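(* Let $N$ be an H-type group whose centre has dimension $m\in\{2,3\}$, with $\dim\mathfrak z^\perp=2n$, and let $f$ be a Schwartz class function on $N$. Suppose that for all $\boldsymbol\lambda\in\mathbb R^m\setminus\{0\}$ and all $(z,w)\in\mathbb C^{2n}$ one has $\mathcal R(\hat f(\boldsymbol\lambda))\subseteq\mathcal D(\pi_{\boldsymbol\lambda}(z,w))$, the operator $\pi_{\boldsymbol\lambda}(z,w)\hat f(\boldsymbol\lambda)$ is of trace class, and $$\int_U\left\|\pi_{\boldsymbol\lambda}(\sigma(z,w))\,\hat f(\boldsymbol\lambda)\right\|_{HS}^2\,d\sigma<\infty .$$ If $$\int_{\mathbb R^{2n}}|f^{\boldsymbol\lambda}(y,v)|\left(\sup_{|(y',v')|\le|(y,v)|}\left\|\pi_{\boldsymbol\lambda}(i(y',v'))\,\hat f(\boldsymbol\lambda)\right\|_1\right)dy\,dv<\infty$$ for almost every $\boldsymbol\lambda\in\mathbb R^m\setminus\{0\}$, then $f=0$.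
   Context: H-type groups. An H-type algebra is a finite-dimensional real Lie algebra $\mathfrak n$ with an inner product such that, $\mathfrak z$ being its centre, $[\mathfrak z^\perp,\mathfrak z^\perp]=\mathfrak z$ and for each unit $z\in\mathfrak z$ the map $J_z:\mathfrak z^\perp\to\mathfrak z^\perp$, $\langle J_z v,w\rangle=\langle z,[v,w]\rangle$, is orthogonal. $N$ is the connected simply connected Lie group of $\mathfrak n$, identified with $\mathfrak n=\mathfrak z^\perp\oplus\mathfrak z\cong\mathbb R^{2n}\times\mathbb R^m$ by the exponential map, with group law $(Z,t)(W,s)=(Z+W,t+s+\tfrac12[Z,W])$ and Haar measure the Lebesgue measure. The group $U$. $U$ is the compact group of automorphisms of $N$ which act as orthogonal transformations on $\mathfrak n$ and act trivially on $\mathfrak z$; it acts linearly on $\mathfrak z^\perp\cong\mathbb R^{2n}$, and this action is extended complex linearly to $\mathbb C^{2n}$, written $\sigma(z,w)$. $d\sigma$ is Haar measure on $U$. Adapted coordinates. For $\boldsymbol\lambda\in\mathbb R^m\setminus\{0\}$ put $\lambda=|\boldsymbol\lambda|$, $\omega=\boldsymbol\lambda/\lambda$. A $\boldsymbol\lambda$-adapted basis is an orthonormal basis $E_1,\dots,E_n,E_1',\dots,E_n'$ of $\mathfrak z^\perp$ with $J_\omega E_j=-E_j'$, $J_\omega E_j'=E_j$. Write $(x,u)\in\mathbb R^n\times\mathbb R^n$ for $\sum_j(x_jE_j+u_jE_j')$. In these coordinates $\boldsymbol\lambda\cdot[(x,u),(x',u')]=\lambda(u\cdot x'-x\cdot u')$.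 All expressions involving a given $\boldsymbol\lambda$ are written in $\boldsymbol\lambda$-adapted coordinates. Representations. $\pi_{\boldsymbol\lambda}(x,u,t)\varphi(\xi)=e^{i\boldsymbol\lambda\cdot t}e^{i\lambda(x\cdot\xi+\frac12x\cdot u)}\varphi(\xi+u)$ for $\varphi\in L^2(\mathbb R^n)$; write $\pi_{\boldsymbol\lambda}(x,u)=\pi_{\boldsymbol\lambda}(x,u,0)$. Complex arguments. For $(z,w)=(x+iy,u+iv)\in\mathbb C^n\times\mathbb C^n$, $\pi_{\boldsymbol\lambda}(z,w)$ is the (generally unbounded) operator formally given by $\varphi(\xi)\mapsto e^{i\lambda(z\cdot\xi+\frac12z\cdot w)}\varphi(\xi+w)$ (bilinear dot product). Precisely, if $A_{y,v}$ is the self-adjoint operator with $\pi_{\boldsymbol\lambda}(ry,rv)=e^{irA_{y,v}}$ for $r\in\mathbb R$, then $\pi_{\boldsymbol\lambda}(iy,iv)=e^{-A_{y,v}}$ (spectral calculus) and $\pi_{\boldsymbol\lambda}(z,w)=e^{\frac{\lambda}{2}(y\cdot u-x\cdot v)}\pi_{\boldsymbol\lambda}(x,u)\,\pi_{\boldsymbol\lambda}(iy,iv)$, with domain that of $e^{-A_{y,v}}$. Fourier transforms. $f^{\boldsymbol\lambda}(x,u)=\int_{\mathbb R^m}f(x,u,t)e^{i\boldsymbol\lambda\cdot t}\,dt$ and $\hat f(\boldsymbol\lambda)=\int_Nf(x,u,t)\,\pi_{\boldsymbol\lambda}(x,u,t)\,dx\,du\,dt$. Other notation. $\mathcal D(T),\mathcal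 R(T)$ are the domain and range of $T$; $\|T\|_{HS}$ is the Hilbert–Schmidt norm and $\|T\|_1=\operatorname{tr}|T|$, $|T|=(T^*T)^{1/2}$, the trace norm. *)

theory Defs
  imports "HOL-Analysis.Analysis"
begin

section \<open>H-type algebras\<close>

definition lie_algebra :: "('g::euclidean_space \<Rightarrow> 'g \<Rightarrow> 'g) \<Rightarrow> bool" where
  "lie_algebra brk \<longleftrightarrow> bilinear brk \<and> (\<forall>x. brk x x = 0) \<and>
     (\<forall>x y z. brk x (brk y z) + brk y (brk z x) + brk z (brk x y) = 0)"

definition lie_centre :: "('g::euclidean_space \<Rightarrow> 'g \<Rightarrow> 'g) \<Rightarrow> 'g set" where
  "lie_centre brk = {x. \<forall>y. brk x y = 0}"

abbreviation horizontal :: "('g::euclidean_space \<Rightarrow> 'g \<Rightarrow> 'g) \<Rightarrow> 'g set" where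
  "horizontal brk \<equiv> (lie_centre brk)\<^sup>\<bottom>"

text \<open>The value \<open>J z v\<close> is meaningful for \<open>z\<close> in the centre and \<open>v\<close> in its orthogonal
  complement.\<close>

definition J_map :: "('g::euclidean_space \<Rightarrow> 'g \<Rightarrow> 'g) \<Rightarrow> 'g \<Rightarrow> 'g \<Rightarrow> 'g" where
  "J_map brk z v =
     (THE u. u \<in> horizontal brk \<and> (\<forall>w\<in>horizontal brk. inner u w = inner z (brk v w)))"

definition h_type_algebra :: "('g::euclidean_space \<Rightarrow> 'g \<Rightarrow> 'g) \<Rightarrow> bool" where
  "h_type_algebra brk \<longleftrightarrow> lie_algebra brk \<and>
     span {brk v w | v w. v \<in> horizontal brk \<and> w \<in> horizontal brk} = lie_centre brk \<and>
     (\<forall>z\<in>lie_centre brk. norm z = 1 \<longrightarrow>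
        (\<forall>v\<in>horizontal brk. \<forall>w\<in>horizontal brk.
           inner (J_map brk z v) (J_map brk z w) = inner v w))"

text \<open>The group \<open>N\<close> is the Lie algebra with the Baker--Campbell--Hausdorff product
  (the algebra is nilpotent of step two). Its Haar measure is Lebesgue measure.\<close>

definition N_mult :: "('g::euclidean_space \<Rightarrow> 'g \<Rightarrow> 'g) \<Rightarrow> 'g \<Rightarrow> 'g \<Rightarrow> 'g" where
  "N_mult brk X Y = X + Y + (1/2) *\<^sub>R brk X Y"

text \<open>The group \<open>U\<close>, as a subset of the normed space of linear maps; this fixes its topology.\<close>

definition U_group :: "('g::euclidean_space \<Rightarrow> 'g \<Rightarrow> 'g) \<Rightarrow> ('g \<Rightarrow>\<^sub>L 'g) set" where
  "U_group brk = {\<sigma>. bij (blinfun_apply \<sigma>) \<and>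
     (\<forall>X Y. \<sigma> (N_mult brk X Y) = N_mult brk (\<sigma> X) (\<sigma> Y)) \<and>
     orthogonal_transformation (blinfun_apply \<sigma>) \<and>
     (\<forall>z\<in>lie_centre brk. \<sigma> z = z)}"

text \<open>Haar measure on a compact group of linear maps; the normalisation is left open.
  Regularity is automatic, the group being compact and metrisable.\<close>

definition haar_measure :: "('g::euclidean_space \<Rightarrow>\<^sub>L 'g) set \<Rightarrow> ('g \<Rightarrow>\<^sub>L 'g) measure \<Rightarrow> bool" where
  "haar_measure G \<mu> \<longleftrightarrow> sets \<mu> = sets (restrict_space borel G) \<and>
     emeasure \<mu> G \<noteq> 0 \<and> emeasure \<mu> G \<noteq> \<infinity> \<and>
     (\<forall>\<tau>\<in>G. \<forall>A\<in>sets \<mu>. emeasure \<mu> ((\<lambda>\<sigma>. \<tau> o\<^sub>L \<sigma>) ` A) = emeasure \<mu> A)"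


section \<open>Adapted coordinates\<close>

definition orthonormal_basis_of :: "('i::finite \<Rightarrow> 'g::euclidean_space) \<Rightarrow> 'g set \<Rightarrow> bool" where
  "orthonormal_basis_of b S \<longleftrightarrow>
     (\<forall>i j. inner (b i) (b j) = (if i = j then 1 else 0)) \<and> span (range b) = S"

definition vec_of :: "('i::finite \<Rightarrow> 'g::euclidean_space) \<Rightarrow> real^'i \<Rightarrow> 'g" where
  "vec_of b x = (\<Sum>i\<in>UNIV. (x $ i) *\<^sub>R b i)"

text \<open>Here \<open>e\<close> is an orthonormal basis of the centre, identifying it with \<open>real^'m\<close>.\<close>

definition adapted_basis ::
  "('g::euclidean_space \<Rightarrow> 'g \<Rightarrow> 'g) \<Rightarrow> ('m::finite \<Rightarrow> 'g) \<Rightarrow> real^'m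
     \<Rightarrow> ('n::finite \<Rightarrow> 'g) \<Rightarrow> ('n \<Rightarrow> 'g) \<Rightarrow> bool" where
  "adapted_basis brk e l E E' \<longleftrightarrow>
     orthonormal_basis_of (case_sum E E') (horizontal brk) \<and>
     (let \<omega> = vec_of e ((1 / norm l) *\<^sub>R l) in
        \<forall>j. J_map brk \<omega> (E j) = - E' j \<and> J_map brk \<omega> (E' j) = E j)"

definition hor_vec :: "('n::finite \<Rightarrow> 'g::euclidean_space) \<Rightarrow> ('n \<Rightarrow> 'g) \<Rightarrow> (real^'n) \<times> (real^'n) \<Rightarrow> 'g" where
  "hor_vec E E' = (\<lambda>(x, u). vec_of E x + vec_of E' u)"

definition N_coords ::
  "('m::finite \<Rightarrow> 'g::euclidean_space) \<Rightarrow> ('n::finite \<Rightarrow> 'g) \<Rightarrow> ('n \<Rightarrow> 'g)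
     \<Rightarrow> (real^'n) \<times> (real^'n) \<times> (real^'m) \<Rightarrow> 'g" where
  "N_coords e E E' = (\<lambda>(x, u, t). hor_vec E E' (x, u) + vec_of e t)"

definition cvec :: "(real^'n) \<times> (real^'n) \<Rightarrow> (real^'n) \<times> (real^'n)
     \<Rightarrow> (complex^'n) \<times> (complex^'n)" where
  "cvec p q = (\<chi> j. Complex (fst p $ j) (fst q $ j), \<chi> j. Complex (snd p $ j) (snd q $ j))"

definition re_vec :: "(complex^'n) \<times> (complex^'n) \<Rightarrow> (real^'n) \<times> (real^'n)" where
  "re_vec p = (\<chi> j. Re (fst p $ j), \<chi> j. Re (snd p $ j))"

definition im_vec :: "(complex^'n) \<times> (complex^'n) \<Rightarrow> (real^'n) \<times> (real^'n)" where
  "im_vec p = (\<chi> j. Im (fst p $ j), \<chi> j. Im (snd p $ j))"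

text \<open>The action of a linear map on the orthogonal complement of the centre, in coordinates,
  and its complex linear extension.\<close>

definition act_real :: "('n::finite \<Rightarrow> 'g::euclidean_space) \<Rightarrow> ('n \<Rightarrow> 'g) \<Rightarrow> ('g \<Rightarrow>\<^sub>L 'g)
     \<Rightarrow> (real^'n) \<times> (real^'n) \<Rightarrow> (real^'n) \<times> (real^'n)" where
  "act_real E E' \<sigma> p =
     (\<chi> j. inner (\<sigma> (hor_vec E E' p)) (E j), \<chi> j. inner (\<sigma> (hor_vec E E' p)) (E' j))"

definition act :: "('n::finite \<Rightarrow> 'g::euclidean_space) \<Rightarrow> ('n \<Rightarrow> 'g) \<Rightarrow> ('g \<Rightarrow>\<^sub>L 'g)
     \<Rightarrow> (complex^'n) \<times> (complex^'n) \<Rightarrow> (complex^'n) \<times> (complex^'n)" where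
  "act E E' \<sigma> p = cvec (act_real E E' \<sigma> (re_vec p)) (act_real E E' \<sigma> (im_vec p))"


section \<open>Schwartz functions\<close>

fun partials :: "'g list \<Rightarrow> ('g::euclidean_space \<Rightarrow> complex) \<Rightarrow> 'g \<Rightarrow> complex" where
  "partials [] f = f"
| "partials (b # bs) f = (\<lambda>x. frechet_derivative (partials bs f) (at x) b)"

text \<open>On \<open>N\<close> the Schwartz class is, by definition, that of the underlying vector space.
  Differentiability of all iterated partial derivatives amounts to smoothness.\<close>

definition schwartz :: "('g::euclidean_space \<Rightarrow> complex) \<Rightarrow> bool" where
  "schwartz f \<longleftrightarrow> (\<forall>bs. set bs \<subseteq> Basis \<longrightarrow>
     (\<forall>x. partials bs f differentiable (at x)) \<and>
     (\<forall>k::nat. bounded (range (\<lambda>x. (1 + norm x) ^ k *\<^sub>R partials bs f x))))"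


section \<open>The Hilbert space of square integrable functions\<close>

definition square_integrable :: "('a::euclidean_space \<Rightarrow> complex) \<Rightarrow> bool" where
  "square_integrable \<phi> \<longleftrightarrow> \<phi> \<in> borel_measurable lborel \<and> integrable lborel (\<lambda>x. (cmod (\<phi> x))\<^sup>2)"

definition L2_rel :: "('a::euclidean_space \<Rightarrow> complex) \<Rightarrow> ('a \<Rightarrow> complex) \<Rightarrow> bool" where
  "L2_rel \<phi> \<psi> \<longleftrightarrow> square_integrable \<phi> \<and> square_integrable \<psi> \<and> (AE x in lborel. \<phi> x = \<psi> x)"

lemma square_integrable_0: "square_integrable (\<lambda>_. 0)"
  by (simp add: square_integrable_def)

lemma part_equivp_L2_rel: "part_equivp (L2_rel :: ('a::euclidean_space \<Rightarrow> complex) \<Rightarrow> _)"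
proof (rule part_equivpI)
  show "\<exists>\<phi>::'a \<Rightarrow> complex. L2_rel \<phi> \<phi>"
    using square_integrable_0 by (auto simp: L2_rel_def)
  show "symp (L2_rel :: ('a \<Rightarrow> complex) \<Rightarrow> _)"
    by (auto simp: L2_rel_def symp_def eq_commute)
  show "transp (L2_rel :: ('a \<Rightarrow> complex) \<Rightarrow> _)"
    by (auto simp: L2_rel_def transp_def)
qed

quotient_type (overloaded) 'a L2 = "'a::euclidean_space \<Rightarrow> complex" / partial: L2_rel
  by (rule part_equivp_L2_rel)

lemma square_integrable_cmult:
  assumes "square_integrable \<phi>" shows "square_integrable (\<lambda>x. c * \<phi> x)"
  using assms by (auto simp: square_integrable_def norm_mult power_mult_distrib)

lemma square_integrable_add:
  assumes "square_integrable \<phi>" "square_integrable \<psi>"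
  shows "square_integrable (\<lambda>x. \<phi> x + \<psi> x)"
proof -
  have [measurable]: "\<phi> \<in> borel_measurable lborel" "\<psi> \<in> borel_measurable lborel"
    using assms by (auto simp: square_integrable_def)
  have le: "(cmod (\<phi> x + \<psi> x))\<^sup>2 \<le> 2 * (cmod (\<phi> x))\<^sup>2 + 2 * (cmod (\<psi> x))\<^sup>2" for x
  proof -
    have "(cmod (\<phi> x + \<psi> x))\<^sup>2 \<le> (cmod (\<phi> x) + cmod (\<psi> x))\<^sup>2"
      by (intro power_mono norm_triangle_ineq) simp
    also have "\<dots> \<le> 2 * (cmod (\<phi> x))\<^sup>2 + 2 * (cmod (\<psi> x))\<^sup>2"
      using zero_le_power2[of "cmod (\<phi> x) - cmod (\<psi> x)"]
      by (simp add: power2_eq_square algebra_simps)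
    finally show ?thesis .
  qed
  have "integrable lborel (\<lambda>x. 2 * (cmod (\<phi> x))\<^sup>2 + 2 * (cmod (\<psi> x))\<^sup>2)"
    using assms by (auto simp: square_integrable_def)
  then have "integrable lborel (\<lambda>x. (cmod (\<phi> x + \<psi> x))\<^sup>2)"
    by (rule Bochner_Integration.integrable_bound) (use le in auto)
  then show ?thesis
    by (simp add: square_integrable_def)
qed

lemma borel_measurable_cnj [measurable (raw)]:
  "g \<in> borel_measurable M \<Longrightarrow> (\<lambda>x. cnj (g x)) \<in> borel_measurable M"
  by (rule measurable_compose[OF _ borel_measurable_continuous_onI])
     (auto intro: continuous_intros)

lemma integrable_mult_cnj:
  assumes "square_integrable \<phi>" "square_integrable \<psi>"
  shows "integrable lborel (\<lambda>x. \<phi> x * cnj (\<psi> x))"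
proof -
  have [measurable]: "\<phi> \<in> borel_measurable lborel" "\<psi> \<in> borel_measurable lborel"
    using assms by (auto simp: square_integrable_def)
  have le: "cmod (\<phi> x * cnj (\<psi> x)) \<le> (cmod (\<phi> x))\<^sup>2 + (cmod (\<psi> x))\<^sup>2" for x
  proof -
    have "2 * (cmod (\<phi> x) * cmod (\<psi> x)) \<le> (cmod (\<phi> x))\<^sup>2 + (cmod (\<psi> x))\<^sup>2"
      using zero_le_power2[of "cmod (\<phi> x) - cmod (\<psi> x)"]
      by (simp add: power2_eq_square algebra_simps)
    moreover have "0 \<le> cmod (\<phi> x) * cmod (\<psi> x)" by simp
    ultimately show ?thesis unfolding norm_mult complex_mod_cnj by linarith
  qed
  have "integrable lborel (\<lambda>x. (cmod (\<phi> x))\<^sup>2 + (cmod (\<psi> x))\<^sup>2)"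
    using assms by (auto simp: square_integrable_def)
  then show ?thesis
    by (rule Bochner_Integration.integrable_bound) (use le in auto)
qed

lift_definition scaleC_L2 :: "complex \<Rightarrow> 'a::euclidean_space L2 \<Rightarrow> 'a L2" (infixr "*\<^sub>C" 75)
  is "\<lambda>c \<phi> x. c * \<phi> x"
  by (auto simp: L2_rel_def intro: square_integrable_cmult)

text \<open>Linear in the first argument.\<close>

lift_definition cinner :: "'a::euclidean_space L2 \<Rightarrow> 'a L2 \<Rightarrow> complex"
  is "\<lambda>\<phi> \<psi>. LINT x|lborel. \<phi> x * cnj (\<psi> x)"
  subgoal for \<phi> \<phi>' \<psi> \<psi>'
  proof -
    assume *: "L2_rel \<phi> \<phi>'" "L2_rel \<psi> \<psi>'"
    then have [measurable]: "\<phi> \<in> borel_measurable lborel" "\<phi>' \<in> borel_measurable lborel"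
      "\<psi> \<in> borel_measurable lborel" "\<psi>' \<in> borel_measurable lborel"
      by (auto simp: L2_rel_def square_integrable_def)
    have "AE x in lborel. \<phi> x = \<phi>' x" "AE x in lborel. \<psi> x = \<psi>' x"
      using * by (auto simp: L2_rel_def)
    then have "AE x in lborel. \<phi> x * cnj (\<psi> x) = \<phi>' x * cnj (\<psi>' x)"
      by eventually_elim simp
    then show "(LINT x|lborel. \<phi> x * cnj (\<psi> x)) = (LINT x|lborel. \<phi>' x * cnj (\<psi>' x))"
      by (intro integral_cong_AE) measurable

  qed
  done

instantiation L2 :: (euclidean_space) real_inner
begin

lift_definition zero_L2 :: "'a L2" is "\<lambda>_. 0"
  by (simp add: L2_rel_def square_integrable_0)

lift_definition plus_L2 :: "'a L2 \<Rightarrow> 'a L2 \<Rightarrow> 'a L2" is "\<lambda>\<phi> \<psi> x. \<phi> x + \<psi> x"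
  by (auto simp: L2_rel_def intro: square_integrable_add)

definition uminus_L2 :: "'a L2 \<Rightarrow> 'a L2" where "uminus_L2 \<phi> = (- 1) *\<^sub>C \<phi>"

definition minus_L2 :: "'a L2 \<Rightarrow> 'a L2 \<Rightarrow> 'a L2" where "minus_L2 \<phi> \<psi> = \<phi> + - \<psi>"

definition scaleR_L2 :: "real \<Rightarrow> 'a L2 \<Rightarrow> 'a L2" where "scaleR_L2 r \<phi> = of_real r *\<^sub>C \<phi>"

definition inner_L2 :: "'a L2 \<Rightarrow> 'a L2 \<Rightarrow> real" where "inner_L2 \<phi> \<psi> = Re (cinner \<phi> \<psi>)"

definition norm_L2 :: "'a L2 \<Rightarrow> real" where "norm_L2 \<phi> = sqrt (inner \<phi> \<phi>)"

definition sgn_L2 :: "'a L2 \<Rightarrow> 'a L2" where "sgn_L2 \<phi> = inverse (norm \<phi>) *\<^sub>R \<phi>"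

definition dist_L2 :: "'a L2 \<Rightarrow> 'a L2 \<Rightarrow> real" where "dist_L2 \<phi> \<psi> = norm (\<phi> - \<psi>)"

definition uniformity_L2 :: "('a L2 \<times> 'a L2) filter" where
  "uniformity_L2 = (INF e\<in>{0 <..}. principal {(x, y). dist x y < e})"

definition open_L2 :: "'a L2 set \<Rightarrow> bool" where
  "open_L2 S = (\<forall>x\<in>S. \<forall>\<^sub>F (x', y) in uniformity. x' = x \<longrightarrow> y \<in> S)"

instance
proof
  fix a b c :: "'a L2" and r s :: real
  show "a + b + c = a + (b + c)"
    by transfer (auto simp: L2_rel_def algebra_simps intro!: square_integrable_add)
  show "a + b = b + a"
    by transfer (auto simp: L2_rel_def algebra_simps intro!: square_integrable_add)
  show "0 + a = a"
    by transfer (auto simp: L2_rel_def algebra_simps intro!: square_integrable_add)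
  show "- a + a = 0"
    unfolding uminus_L2_def
    by transfer (auto simp: L2_rel_def square_integrable_0
          intro!: square_integrable_add square_integrable_cmult)
  show "a - b = a + - b"
    by (rule minus_L2_def)
  show "r *\<^sub>R (a + b) = r *\<^sub>R a + r *\<^sub>R b"
    unfolding scaleR_L2_def
    by transfer (auto simp: L2_rel_def distrib_left
          intro!: square_integrable_add square_integrable_cmult)
  show "(r + s) *\<^sub>R a = r *\<^sub>R a + s *\<^sub>R a"
    unfolding scaleR_L2_def
    by transfer (auto simp: L2_rel_def distrib_right
          intro!: square_integrable_add square_integrable_cmult)
  show "r *\<^sub>R s *\<^sub>R a = (r * s) *\<^sub>R a"
    unfolding scaleR_L2_def
    by transfer (auto simp: L2_rel_def mult.assoc
          intro!: square_integrable_add square_integrable_cmult)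
  show "1 *\<^sub>R a = a"
    unfolding scaleR_L2_def by transfer (auto simp: L2_rel_def)
  show "sgn a = inverse (norm a) *\<^sub>R a"
    by (rule sgn_L2_def)
  show "dist a b = norm (a - b)"
    by (rule dist_L2_def)
  show "uniformity = (INF e\<in>{0 <..}. principal {(x, y::'a L2). dist x y < e})"
    by (rule uniformity_L2_def)
  show "open S = (\<forall>x\<in>S. \<forall>\<^sub>F (x', y) in uniformity. x' = x \<longrightarrow> y \<in> S)" for S :: "'a L2 set"
    by (rule open_L2_def)
  have cnj: "cinner b a = cnj (cinner a b)"
  proof transfer
    fix a b :: "'a \<Rightarrow> complex"
    have "(LINT x|lborel. cnj (a x * cnj (b x))) = cnj (LINT x|lborel. a x * cnj (b x))"
      by (rule Bochner_Integration.integral_cnj)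
    then show "(LINT x|lborel. b x * cnj (a x)) = cnj (LINT x|lborel. a x * cnj (b x))"
      by (simp add: mult.commute)
  qed
  show "inner a b = inner b a"
    unfolding inner_L2_def cnj by simp
  have "cinner (a + b) c = cinner a c + cinner b c"
    by transfer (auto simp: L2_rel_def algebra_simps integrable_mult_cnj
          simp flip: Bochner_Integration.integral_add)
  then show "inner (a + b) c = inner a c + inner b c"
    unfolding inner_L2_def by simp
  have "cinner (of_real r *\<^sub>C a) b = of_real r * cinner a b"
    by transfer (simp add: mult.assoc)
  then show "inner (r *\<^sub>R a) b = r * inner a b"
    unfolding inner_L2_def scaleR_L2_def by simp
  have sq: "\<phi> x * cnj (\<phi> x) = of_real ((cmod (\<phi> x))\<^sup>2)" for \<phi> :: "'a \<Rightarrow> complex" and x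
    using complex_norm_square[of "\<phi> x"] by simp
  show "0 \<le> inner a a"
    unfolding inner_L2_def by transfer (simp add: sq del: of_real_power)
  show "inner a a = 0 \<longleftrightarrow> a = 0"
    unfolding inner_L2_def
  proof transfer
    fix \<phi> :: "'a \<Rightarrow> complex" assume "L2_rel \<phi> \<phi>"
    then have \<phi>: "square_integrable \<phi>" by (simp add: L2_rel_def)
    have "Re (LINT x|lborel. \<phi> x * cnj (\<phi> x)) = (LINT x|lborel. (cmod (\<phi> x))\<^sup>2)"
      by (simp add: sq del: of_real_power)
    also have "\<dots> = 0 \<longleftrightarrow> (AE x in lborel. (cmod (\<phi> x))\<^sup>2 = 0)"
      using \<phi> by (intro integral_nonneg_eq_0_iff_AE) (auto simp: square_integrable_def)
    finally show "Re (LINT x|lborel. \<phi> x * cnj (\<phi> x)) = 0 \<longleftrightarrow> L2_rel \<phi> (\<lambda>_. 0)"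
      using \<phi> by (simp add: L2_rel_def square_integrable_0)
  qed
  show "norm a = sqrt (inner a a)"
    by (rule norm_L2_def)
qed

end


section \<open>Operators\<close>

text \<open>Possibly unbounded operators are represented by their graphs, so that domain and range are
  \<^const>\<open>Domain\<close> and \<^const>\<open>Range\<close>. Everything below is for the Hilbert spaces \<^typ>\<open>'a L2\<close>.\<close>

type_synonym 'a oper = "('a L2 \<times> 'a L2) set"

definition graph_of :: "('a::euclidean_space L2 \<Rightarrow> 'a L2) \<Rightarrow> 'a oper" where
  "graph_of F = {(\<phi>, F \<phi>) | \<phi>. True}"

text \<open>First \<open>T\<close>, then \<open>S\<close>; relational composition is written in the opposite order.\<close>

definition op_comp :: "'a::euclidean_space oper \<Rightarrow> 'a oper \<Rightarrow> 'a oper" where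
  "op_comp S T = T O S"

definition op_scale :: "complex \<Rightarrow> 'a::euclidean_space oper \<Rightarrow> 'a oper" where
  "op_scale c T = {(\<phi>, c *\<^sub>C \<eta>) | \<phi> \<eta>. (\<phi>, \<eta>) \<in> T}"

definition op_apply :: "'a::euclidean_space oper \<Rightarrow> 'a L2 \<Rightarrow> 'a L2" where
  "op_apply T \<phi> = (THE \<eta>. (\<phi>, \<eta>) \<in> T)"

definition linear_oper :: "'a::euclidean_space oper \<Rightarrow> bool" where
  "linear_oper T \<longleftrightarrow> single_valued T \<and> (0, 0) \<in> T \<and>
     (\<forall>\<phi> \<eta> \<phi>' \<eta>'. (\<phi>, \<eta>) \<in> T \<longrightarrow> (\<phi>', \<eta>') \<in> T \<longrightarrow> (\<phi> + \<phi>', \<eta> + \<eta>') \<in> T) \<and>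
     (\<forall>c \<phi> \<eta>. (\<phi>, \<eta>) \<in> T \<longrightarrow> (c *\<^sub>C \<phi>, c *\<^sub>C \<eta>) \<in> T)"

definition bounded_oper :: "'a::euclidean_space oper \<Rightarrow> bool" where
  "bounded_oper T \<longleftrightarrow> linear_oper T \<and> Domain T = UNIV \<and>
     (\<exists>K. \<forall>(\<phi>, \<eta>)\<in>T. norm \<eta> \<le> K * norm \<phi>)"

definition op_adjoint :: "'a::euclidean_space oper \<Rightarrow> 'a oper" where
  "op_adjoint T = {(\<psi>, \<theta>). \<forall>(\<phi>, \<eta>)\<in>T. cinner \<eta> \<psi> = cinner \<phi> \<theta>}"

definition selfadjoint :: "'a::euclidean_space oper \<Rightarrow> bool" where
  "selfadjoint A \<longleftrightarrow> linear_oper A \<and> closure (Domain A) = UNIV \<and> op_adjoint A = A"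

definition positive_oper :: "'a::euclidean_space oper \<Rightarrow> bool" where
  "positive_oper A \<longleftrightarrow> (\<forall>(\<phi>, \<eta>)\<in>A. cinner \<eta> \<phi> \<in> \<real> \<and> 0 \<le> Re (cinner \<eta> \<phi>))"


subsection \<open>Spectral calculus\<close>

definition orthogonal_projection :: "('a::euclidean_space L2 \<Rightarrow> 'a L2) \<Rightarrow> bool" where
  "orthogonal_projection P \<longleftrightarrow> bounded_oper (graph_of P) \<and>
     (\<forall>\<phi>. P (P \<phi>) = P \<phi>) \<and> (\<forall>\<phi> \<psi>. cinner (P \<phi>) \<psi> = cinner \<phi> (P \<psi>))"

definition projection_valued_measure :: "(real set \<Rightarrow> 'a::euclidean_space L2 \<Rightarrow> 'a L2) \<Rightarrow> bool" where
  "projection_valued_measure P \<longleftrightarrow>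
     (\<forall>A\<in>sets borel. orthogonal_projection (P A)) \<and>
     (\<forall>\<phi>. P UNIV \<phi> = \<phi>) \<and>
     (\<forall>(A :: nat \<Rightarrow> real set) \<phi>. range A \<subseteq> sets borel \<longrightarrow> disjoint_family A \<longrightarrow>
        (\<lambda>k. P (A k) \<phi>) sums P (\<Union>k. A k) \<phi>)"

definition spectral_scalar_measure ::
  "(real set \<Rightarrow> 'a::euclidean_space L2 \<Rightarrow> 'a L2) \<Rightarrow> 'a L2 \<Rightarrow> real measure" where
  "spectral_scalar_measure P \<phi> =
     measure_of UNIV (sets borel) (\<lambda>A. ennreal (Re (cinner (P A \<phi>) \<phi>)))"

definition spectral_domain ::
  "(real set \<Rightarrow> 'a::euclidean_space L2 \<Rightarrow> 'a L2) \<Rightarrow> (real \<Rightarrow> complex) \<Rightarrow> 'a L2 set" where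
  "spectral_domain P g = {\<phi>. integrable (spectral_scalar_measure P \<phi>) (\<lambda>s. (cmod (g s))\<^sup>2)}"

text \<open>The operator \<open>\<integral> g dP\<close>. It satisfies \<open>\<langle>(\<integral> g dP) \<phi>, \<psi>\<rangle> = \<integral> g d\<langle>P \<phi>, \<psi>\<rangle>\<close>, and the complex
  measure on the right is expressed by polarisation through the positive ones. For \<open>\<phi>\<close> and \<open>\<psi>\<close>
  in the (dense) domain all integrals converge.\<close>

definition spectral_integral ::
  "(real set \<Rightarrow> 'a::euclidean_space L2 \<Rightarrow> 'a L2) \<Rightarrow> (real \<Rightarrow> complex) \<Rightarrow> 'a oper" where
  "spectral_integral P g = {(\<phi>, \<theta>). \<phi> \<in> spectral_domain P g \<and>
     (\<forall>\<psi>\<in>spectral_domain P g.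
        cinner \<theta> \<psi> = (\<Sum>k<4. \<i> ^ k * (LINT s|spectral_scalar_measure P (\<phi> + (\<i> ^ k) *\<^sub>C \<psi>). g s)) / 4)}"

definition spectral_measure :: "'a::euclidean_space oper \<Rightarrow> real set \<Rightarrow> 'a L2 \<Rightarrow> 'a L2" where
  "spectral_measure A =
     (SOME P. projection_valued_measure P \<and> spectral_integral P complex_of_real = A)"

definition spectral_calculus :: "'a::euclidean_space oper \<Rightarrow> (real \<Rightarrow> complex) \<Rightarrow> 'a oper" where
  "spectral_calculus A g = spectral_integral (spectral_measure A) g"


subsection \<open>Hilbert--Schmidt and trace norms\<close>

text \<open>Orthonormal bases are with respect to the complex inner product.\<close>

definition hilbert_basis :: "'a::euclidean_space L2 set \<Rightarrow> bool" where
  "hilbert_basis B \<longleftrightarrow>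
     (\<forall>b\<in>B. \<forall>c\<in>B. cinner b c = (if b = c then 1 else 0)) \<and>
     (\<forall>\<phi>. (\<forall>b\<in>B. cinner \<phi> b = 0) \<longrightarrow> \<phi> = 0)"

text \<open>The quantities below do not depend on the choice of this basis.\<close>

definition some_basis :: "'a::euclidean_space L2 set" where
  "some_basis = (SOME B. hilbert_basis B)"

definition hs_norm_sq :: "'a::euclidean_space oper \<Rightarrow> ennreal" where
  "hs_norm_sq T = (\<Sum>\<^sub>\<infinity>b\<in>some_basis. ennreal ((norm (op_apply T b))\<^sup>2))"

definition op_abs :: "'a::euclidean_space oper \<Rightarrow> 'a oper" where
  "op_abs T = (THE S. selfadjoint S \<and> positive_oper S \<and> op_comp S S = op_comp (op_adjoint T) T)"

definition trace_norm :: "'a::euclidean_space oper \<Rightarrow> ennreal" where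
  "trace_norm T = (\<Sum>\<^sub>\<infinity>b\<in>some_basis. ennreal (Re (cinner (op_apply (op_abs T) b) b)))"

definition trace_class :: "'a::euclidean_space oper \<Rightarrow> bool" where
  "trace_class T \<longleftrightarrow> bounded_oper T \<and> trace_norm T < \<infinity>"


section \<open>Representations\<close>

lemma square_integrable_shift:
  assumes "square_integrable \<phi>" shows "square_integrable (\<lambda>\<xi>. \<phi> (\<xi> + u))"
proof -
  have [measurable]: "\<phi> \<in> borel_measurable borel"
    using assms by (simp add: square_integrable_def)
  have "integrable lborel (\<lambda>x. (cmod (\<phi> x))\<^sup>2)"
    using assms by (simp add: square_integrable_def)
  then have "integrable (distr lborel borel ((+) u)) (\<lambda>x. (cmod (\<phi> x))\<^sup>2)"
    by (simp add: lborel_distr_plus)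
  then have "integrable lborel (\<lambda>x. (cmod (\<phi> (u + x)))\<^sup>2)"
    by (subst (asm) integrable_distr_eq) auto
  then show ?thesis
    by (simp add: square_integrable_def add.commute)
qed

lemma square_integrable_phase:
  assumes "square_integrable \<phi>" "h \<in> borel_measurable borel"
  shows "square_integrable (\<lambda>\<xi>. cis (h \<xi>) * \<phi> \<xi>)"
proof -
  have [measurable]: "\<phi> \<in> borel_measurable borel" "h \<in> borel_measurable borel"
    using assms by (auto simp: square_integrable_def)
  have "(\<lambda>\<xi>. cis (h \<xi>) * \<phi> \<xi>) \<in> borel_measurable borel"
    unfolding cis_conv_exp by measurable
  then show ?thesis
    using assms by (simp add: square_integrable_def norm_mult)
qed

lemma AE_lborel_shift:
  fixes u :: "'a::euclidean_space"
  assumes "AE x in lborel. P x" shows "AE x in lborel. P (x + u)"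
proof -
  have "AE x in distr lborel borel ((+) u). P x"
    using assms by (simp only: lborel_distr_plus)
  then have "AE x in lborel. P (u + x)"
    by (rule AE_distrD[rotated]) measurable
  then show ?thesis
    by (simp add: add.commute)
qed

text \<open>The operators \<open>\<pi>(x, u, 0)\<close> for the parameter \<open>l\<close>, the norm of the central character.\<close>

lift_definition schroedinger :: "real \<Rightarrow> (real^'n) \<times> (real^'n) \<Rightarrow> (real^'n) L2 \<Rightarrow> (real^'n) L2"
  is "\<lambda>l p \<phi> \<xi>. cis (l * (inner (fst p) \<xi> + inner (fst p) (snd p) / 2)) * \<phi> (\<xi> + snd p)"
  subgoal for l p \<phi> \<psi>
    using AE_lborel_shift[of "\<lambda>x. \<phi> x = \<psi> x" "snd p"]
    by (auto simp: L2_rel_def intro!: square_integrable_phase square_integrable_shift)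
  done

definition rep :: "real^'m \<Rightarrow> (real^'n) \<times> (real^'n) \<times> (real^'m) \<Rightarrow> (real^'n) L2 \<Rightarrow> (real^'n) L2" where
  "rep l = (\<lambda>(x, u, t) \<phi>. cis (inner l t) *\<^sub>C schroedinger (norm l) (x, u) \<phi>)"

text \<open>The self-adjoint operator \<open>A\<close> with \<open>\<pi>(r y, r v) = exp (i r A)\<close>, unique by Stone's
  theorem.\<close>

definition generator :: "real^'m \<Rightarrow> (real^'n) \<times> (real^'n) \<Rightarrow> (real^'n) oper" where
  "generator l q = (THE A. selfadjoint A \<and>
     (\<forall>r. graph_of (schroedinger (norm l) (r *\<^sub>R q)) = spectral_calculus A (\<lambda>s. cis (r * s))))"

definition rep_complex :: "real^'m \<Rightarrow> (complex^'n) \<times> (complex^'n) \<Rightarrow> (real^'n) oper" where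
  "rep_complex l p =
     (let (x, u) = re_vec p; (y, v) = im_vec p in
        op_scale (of_real (exp (norm l / 2 * (inner y u - inner x v))))
          (op_comp (graph_of (schroedinger (norm l) (x, u)))
             (spectral_calculus (generator l (y, v)) (\<lambda>s. of_real (exp (- s))))))"


section \<open>Fourier transforms\<close>

text \<open>The functions \<open>e\<close>, \<open>E\<close>, \<open>E'\<close> are the bases defining the coordinates \<open>(x, u, t)\<close> on \<open>N\<close>.\<close>

definition central_fourier ::
  "('m::finite \<Rightarrow> 'g::euclidean_space) \<Rightarrow> ('n::finite \<Rightarrow> 'g) \<Rightarrow> ('n \<Rightarrow> 'g) \<Rightarrow> ('g \<Rightarrow> complex)
     \<Rightarrow> real^'m \<Rightarrow> (real^'n) \<times> (real^'n) \<Rightarrow> complex" where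
  "central_fourier e E E' f l =
     (\<lambda>(x, u). LINT t|lborel. f (N_coords e E E' (x, u, t)) * cis (inner l t))"

text \<open>The operator-valued integral is taken in the weak sense.\<close>

definition group_fourier ::
  "('m::finite \<Rightarrow> 'g::euclidean_space) \<Rightarrow> ('n::finite \<Rightarrow> 'g) \<Rightarrow> ('n \<Rightarrow> 'g) \<Rightarrow> ('g \<Rightarrow> complex)
     \<Rightarrow> real^'m \<Rightarrow> (real^'n) oper" where
  "group_fourier e E E' f l = graph_of (\<lambda>\<phi>. THE \<theta>. \<forall>\<psi>.
     cinner \<theta> \<psi> = (LINT p|lborel. f (N_coords e E E' p) * cinner (rep l p \<phi>) \<psi>))"

end

theory Submission
  imports Defs "HOL-Probability.Probability" "HOL-Complex_Analysis.Complex_Analysis"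
begin

text \<open>Fix a central frequency, let \<open>F\<close> be the central Fourier transform, \<open>T\<close> the operator transform and
  \<open>A\<close> the generator in the direction \<open>q\<close>. With a Weyl frame in place of an orthonormal basis, the
  trace of \<open>exp (i r A) T\<close> is a multiple of \<open>F (- r q)\<close>, and the trace norm of \<open>exp (- y A) T\<close> bounds
  the trace of \<open>exp (i (x + i y) A) T\<close>. So \<open>F\<close> restricted to the line of \<open>q\<close> extends to an entire
  function \<open>G\<close> bounded on horizontal lines, and in polar coordinates the hypothesis becomes a one
  dimensional Beurling condition on almost every line. Then \<open>w \<mapsto> \<integral> G x (cnj (G (cnj w x))) dx\<close> is bounded
  and holomorphic in the strip \<open>\<bar>Im w\<bar> < 1\<close>; a reflection in \<open>w \<mapsto> 1 / w\<close> extends its square to a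
  bounded entire function vanishing at infinity (Hedenmalm), whence \<open>G = 0\<close>. Fourier uniqueness in the
  centre concludes.\<close>

section \<open>The Hilbert space\<close>

text \<open>The definitions of \<open>generator\<close> and \<open>spectral_measure\<close> use
  \<open>THE\<close> and \<open>SOME\<close>, so the hypotheses say nothing until existence and
  uniqueness are known: hence the spectral theorem and Stone's theorem in full, both through the
  bounded resolvent (A + i)^-1. The bound by trace norms is not assumed locally bounded in
  \<open>y\<close>; holomorphy therefore comes from spectral cut-offs, with bounds on the disc of
  radius \<open>r\<close> that use only the heights \<open>r\<close> and \<open>- r\<close>. The
  frame is preferred to a basis because conjugation by \<open>weyl l a\<close> multiplies
  \<open>weyl l v\<close> by a character: the integral over \<open>a\<close> is a Fourier integral,
  which Gaussian summation inverts, and for the trace norm an upper frame bound suffices. The square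
  in the last step has its origin in the equation cnj (Phi (1 / x)) = |x| Phi x for real x: |x| is
  not the restriction of a holomorphic function near 0, but x^2 is. Polar coordinates take the form
  of dilations: integrating H (r w) over w and r >= 1 costs the integral of r^(-2n), finite since 2n
  >= 2.\<close>

lemma L2_rel_rep: "L2_rel (rep_L2 ph) (rep_L2 ph)"
  by (rule Quotient3_rep_reflp[OF Quotient3_L2])

lemma square_integrable_rep: "square_integrable (rep_L2 ph)"
  using L2_rel_rep[of ph] by (simp add: L2_rel_def)

lemma measurable_rep [measurable]: "rep_L2 ph \<in> borel_measurable borel"
  using square_integrable_rep[of ph] by (simp add: square_integrable_def)

lemma abs_rep_L2: "abs_L2 (rep_L2 ph) = ph"
  by (rule Quotient3_abs_rep[OF Quotient3_L2])

lemma L2_rel_refl: "square_integrable f ==> L2_rel f f"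
  by (simp add: L2_rel_def)

lemma rep_abs_L2: "square_integrable f ==> AE x in lborel. rep_L2 (abs_L2 f) x = f x"
  using Quotient3_rep_abs[OF Quotient3_L2 L2_rel_refl, of f] by (simp add: L2_rel_def)

lemma L2_eqI: "AE x in lborel. rep_L2 ph x = rep_L2 ps x ==> ph = ps"
  using Quotient3_rel_rep[OF Quotient3_L2, of ph ps] square_integrable_rep[of ph] square_integrable_rep[of ps]
  by (simp add: L2_rel_def)

lemma rep_plus: "AE x in lborel. rep_L2 (ph + ps) x = rep_L2 ph x + rep_L2 ps x"
  using plus_L2.abs_eq[OF L2_rel_rep L2_rel_rep, of ph ps]
    rep_abs_L2[OF square_integrable_add[OF square_integrable_rep square_integrable_rep], of ph ps]
  by (simp add: abs_rep_L2)

lemma rep_scaleC: "AE x in lborel. rep_L2 (c *\<^sub>C ph) x = c * rep_L2 ph x"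
  using scaleC_L2.abs_eq[OF L2_rel_rep, of c ph]
    rep_abs_L2[OF square_integrable_cmult[OF square_integrable_rep], of c ph]
  by (simp add: abs_rep_L2)

lemma rep_minus: "AE x in lborel. rep_L2 (ph - ps) x = rep_L2 ph x - rep_L2 ps x"
  using rep_plus[of ph "- ps"] rep_scaleC[of "-1" ps]
  unfolding minus_L2_def uminus_L2_def by eventually_elim simp

section \<open>The complex inner product and the Cauchy-Schwarz inequality\<close>

lemma cinner_rep: "cinner ph ps = (LINT x|lborel. rep_L2 ph x * cnj (rep_L2 ps x))"
  by (rule cinner.rep_eq)

lemma cinner_abs:
  "square_integrable f ==> square_integrable g ==>
     cinner (abs_L2 f) (abs_L2 g) = (LINT x|lborel. f x * cnj (g x))"
  by (rule cinner.abs_eq) (simp_all add: L2_rel_refl)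

lemma cinner_commute: "cinner ps ph = cnj (cinner ph ps)"
  unfolding cinner_rep Bochner_Integration.integral_cnj[symmetric] by (simp add: mult.commute)

lemma cinner_add_left: "cinner (ph + ps) th = cinner ph th + cinner ps th"
  by transfer (auto simp: L2_rel_def algebra_simps integrable_mult_cnj
          simp flip: Bochner_Integration.integral_add)

lemma cinner_scaleC_left: "cinner (c *\<^sub>C ph) th = c * cinner ph th"
  by transfer (simp add: mult.assoc)

lemma cinner_add_right: "cinner th (ph + ps) = cinner th ph + cinner th ps"
  by (metis cinner_add_left cinner_commute complex_cnj_add)

lemma cinner_scaleC_right: "cinner th (c *\<^sub>C ph) = cnj c * cinner th ph"
  by (metis cinner_scaleC_left cinner_commute complex_cnj_mult)

lemma scaleR_eq_scaleC: "r *\<^sub>R ph = of_real r *\<^sub>C (ph :: 'a::euclidean_space L2)"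
  by (rule scaleR_L2_def)

lemma uminus_eq_scaleC: "- ph = (-1) *\<^sub>C (ph :: 'a::euclidean_space L2)"
  by (rule uminus_L2_def)

lemma cinner_minus_left: "cinner (- ph) th = - cinner ph th"
  by (simp add: uminus_eq_scaleC cinner_scaleC_left)

lemma cinner_minus_right: "cinner th (- ph) = - cinner th ph"
  by (simp add: uminus_eq_scaleC cinner_scaleC_right)

lemma cinner_diff_left: "cinner (ph - ps) th = cinner ph th - cinner ps th"
  using cinner_add_left[of ph "- ps" th] by (simp add: cinner_minus_left)

lemma cinner_diff_right: "cinner th (ph - ps) = cinner th ph - cinner th ps"
  using cinner_add_right[of th ph "- ps"] by (simp add: cinner_minus_right)

lemma cinner_scaleR_left: "cinner (r *\<^sub>R ph) th = of_real r * cinner ph th"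
  by (simp add: scaleR_eq_scaleC cinner_scaleC_left)

lemma cinner_scaleR_right: "cinner th (r *\<^sub>R ph) = of_real r * cinner th ph"
  by (simp add: scaleR_eq_scaleC cinner_scaleC_right)

lemma cinner_zero_left [simp]: "cinner 0 th = 0"
  using cinner_scaleR_left[of 0 0 th] by simp

lemma cinner_zero_right [simp]: "cinner th 0 = 0"
  using cinner_scaleR_right[of th 0 0] by simp

lemma scaleC_add_right: "c *\<^sub>C (ph + ps) = c *\<^sub>C ph + c *\<^sub>C ps"
  by transfer (auto simp: L2_rel_def distrib_left
          intro!: square_integrable_add square_integrable_cmult)

lemma scaleC_add_left: "(c + d) *\<^sub>C ph = c *\<^sub>C ph + d *\<^sub>C ph"
  by transfer (auto simp: L2_rel_def distrib_right
          intro!: square_integrable_add square_integrable_cmult)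

lemma scaleC_scaleC [simp]: "c *\<^sub>C d *\<^sub>C ph = (c * d) *\<^sub>C ph"
  by transfer (auto simp: L2_rel_def mult.assoc
          intro!: square_integrable_add square_integrable_cmult)

lemma scaleC_one [simp]: "1 *\<^sub>C ph = ph"
  by transfer (auto simp: L2_rel_def)

lemma scaleC_zero_left [simp]: "0 *\<^sub>C ph = 0"
  using scaleR_eq_scaleC[of 0 ph] by simp

lemma scaleC_zero_right [simp]: "c *\<^sub>C (0 :: 'a::euclidean_space L2) = 0"
  using scaleC_scaleC[of c 0 0] by simp

lemma scaleC_minus_right: "c *\<^sub>C (- ph) = - (c *\<^sub>C ph)"
  by (simp add: uminus_eq_scaleC mult.commute)

lemma scaleC_minus_left: "(- c) *\<^sub>C ph = - (c *\<^sub>C ph)"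
  by (simp add: uminus_eq_scaleC)

lemma scaleC_diff_right: "c *\<^sub>C (ph - ps) = c *\<^sub>C ph - c *\<^sub>C ps"
  using scaleC_add_right[of c ph "- ps"] by (simp add: scaleC_minus_right)

lemma scaleC_scaleR: "c *\<^sub>C (r *\<^sub>R ph) = r *\<^sub>R (c *\<^sub>C ph)"
  by (simp add: scaleR_eq_scaleC mult.commute)

lemmas cinner_simps = cinner_add_left cinner_add_right cinner_diff_left cinner_diff_right
  cinner_scaleC_left cinner_scaleC_right cinner_scaleR_left cinner_scaleR_right
  cinner_minus_left cinner_minus_right

lemma inner_eq_Re_cinner: "inner ph ps = Re (cinner ph (ps :: 'a::euclidean_space L2))"
  by (rule inner_L2_def)

lemma Im_cinner_self: "Im (cinner ph ph) = 0"
  using arg_cong[OF cinner_commute[of ph ph], of Im] by simp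

lemma cinner_self: "cinner ph ph = of_real ((norm ph)\<^sup>2)"
  using power2_norm_eq_inner[of ph] Im_cinner_self[of ph]
  by (simp add: inner_eq_Re_cinner complex_eq_iff)

lemma Re_cinner_self: "Re (cinner ph ph) = (norm ph)\<^sup>2"
  by (simp add: cinner_self del: of_real_power)

lemma norm_scaleC: "norm (c *\<^sub>C ph) = cmod c * norm (ph :: 'a::euclidean_space L2)"
proof -
  have "cinner (c *\<^sub>C ph) (c *\<^sub>C ph) = (c * cnj c) * cinner ph ph"
    unfolding cinner_scaleC_left cinner_scaleC_right by (metis mult.assoc mult.commute)
  also have "\<dots> = of_real ((cmod c * norm ph)\<^sup>2)"
    unfolding cinner_self complex_norm_square[symmetric] by (simp add: power_mult_distrib)
  finally have "(norm (c *\<^sub>C ph))\<^sup>2 = (cmod c * norm ph)\<^sup>2"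
    unfolding cinner_self of_real_eq_iff .
  then show ?thesis by (simp add: power2_eq_iff_nonneg)
qed

text \<open>A unimodular factor makes the pairing real and nonnegative, which reduces the estimate
  to the real Cauchy-Schwarz inequality of \<open>real_inner\<close>.\<close>

lemma cmod_cinner_le: "cmod (cinner ph ps) <= norm ph * norm ps"
proof (cases "cinner ph ps = 0")
  case False
  define c where "c = cnj (cinner ph ps) / cmod (cinner ph ps)"
  have c: "cmod c = 1" using False by (simp add: c_def norm_divide)
  define z where "z = cinner ph ps"
  have z: "z * cnj z = of_real (cmod z) * of_real (cmod z)"
    by (metis complex_norm_square of_real_power power2_eq_square)
  have "cinner (c *\<^sub>C ph) ps = (z * cnj z) / of_real (cmod z)"
    by (simp add: c_def cinner_scaleC_left z_def)
  also have "\<dots> = of_real (cmod z)" unfolding z using False by (simp add: z_def)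
  finally have "cinner (c *\<^sub>C ph) ps = of_real (cmod (cinner ph ps))" by (simp only: z_def)
  then have "cmod (cinner ph ps) = inner (c *\<^sub>C ph) ps"
    by (simp add: inner_eq_Re_cinner)
  also have "\<dots> <= norm (c *\<^sub>C ph) * norm ps" by (rule norm_cauchy_schwarz)
  finally show ?thesis using c by (simp add: norm_scaleC)
qed simp

lemma bounded_bilinear_cinner: "bounded_bilinear cinner"
proof
  show "EX K. ALL a b. norm (cinner a b) <= norm a * norm b * K"
    using cmod_cinner_le by (intro exI[of _ 1]) auto
qed (simp_all add: cinner_simps scaleR_conv_of_real)

lemma bounded_linear_scaleC: "bounded_linear (%ph :: 'a::euclidean_space L2. c *\<^sub>C ph)"
  by (intro bounded_linear_intro[of _ "cmod c"])
     (simp_all add: scaleC_add_right scaleC_scaleR norm_scaleC)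

lemma bounded_bilinear_scaleC: "bounded_bilinear (%c ph :: 'a::euclidean_space L2. c *\<^sub>C ph)"
proof
  show "EX K. ALL a b. norm (a *\<^sub>C b :: 'a L2) <= norm a * norm b * K"
    by (intro exI[of _ 1]) (auto simp: norm_scaleC)
qed (simp_all add: scaleC_add_right scaleC_add_left scaleC_scaleR scaleR_eq_scaleC scaleR_conv_of_real mult.commute)

lemmas tendsto_cinner [tendsto_intros] = bounded_bilinear.tendsto[OF bounded_bilinear_cinner]
lemmas continuous_on_cinner [continuous_intros] = bounded_bilinear.continuous_on[OF bounded_bilinear_cinner]
lemmas tendsto_scaleC [tendsto_intros] = bounded_bilinear.tendsto[OF bounded_bilinear_scaleC]
lemmas continuous_on_scaleC [continuous_intros] = bounded_bilinear.continuous_on[OF bounded_bilinear_scaleC]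

lemma cinner_ext: "(!!ps. cinner ph ps = cinner ph' ps) ==> ph = ph'"
proof -
  assume "!!ps. cinner ph ps = cinner ph' ps"
  then have "cinner (ph - ph') (ph - ph') = 0" by (simp add: cinner_diff_left)
  then show ?thesis by (simp add: cinner_self)
qed

lemma cinner_ext_right: "(!!ps. cinner ps ph = cinner ps ph') ==> ph = ph'"
  by (rule cinner_ext) (metis cinner_commute)

lemma norm_le_cinnerI: "norm ph <= c" if "!!ps. cmod (cinner ph ps) <= c * norm ps" "0 <= c"
proof -
  have "cmod (cinner ph ph) = norm ph * norm ph"
    by (simp add: cinner_self norm_mult power2_eq_square)
  then have "norm ph * norm ph <= c * norm ph" using that(1)[of ph] by simp
  then show ?thesis using that(2) by (cases "norm ph = 0") (auto simp: mult_le_cancel_right)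
qed

lemma norm_rep: "(norm ph)\<^sup>2 = (LINT x|lborel. (cmod (rep_L2 ph x))\<^sup>2)"
proof -
  have "cinner ph ph = (LINT x|lborel. of_real ((cmod (rep_L2 ph x))\<^sup>2))"
    unfolding cinner_rep by (simp add: complex_norm_square del: of_real_power)
  then show ?thesis unfolding cinner_self by (simp del: of_real_power)
qed

lemma nn_integral_rep: "(\<integral>\<^sup>+x. ennreal ((cmod (rep_L2 ph x))\<^sup>2) \<partial>lborel) = ennreal ((norm ph)\<^sup>2)"
  unfolding norm_rep using square_integrable_rep[of ph]
  by (intro nn_integral_eq_integral) (auto simp: square_integrable_def)

lemma norm_abs_L2:
  "square_integrable f ==> (norm (abs_L2 f))\<^sup>2 = (LINT x|lborel. (cmod (f x))\<^sup>2)"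
proof -
  assume f: "square_integrable f"
  then have [measurable]: "f \<in> borel_measurable borel" by (simp add: square_integrable_def)
  show ?thesis
    unfolding norm_rep using rep_abs_L2[OF f] by (intro integral_cong_AE) auto
qed

section \<open>Completeness of the Hilbert space\<close>

text \<open>Riesz-Fischer. With a_n = |f_(n+1) - f_n|, the series of 2^n a_n^2 has finite integral,
  because its n-th term integrates to at most 2^n 4^-n. Where it converges it dominates the
  increments through a <= 2^-n + 2^n a^2, so the representatives converge almost everywhere; Fatou's
  lemma bounds the distance to the limit.\<close>

lemma L2_fast_Cauchy_convergent:
  fixes Y :: "nat => 'a::euclidean_space L2"
  assumes Y: "!!m n. n <= m ==> norm (Y m - Y n) <= (1/2) ^ n"
  shows "EX l. Y \<longlonglongrightarrow> l"
proof -
  define f where "f n = rep_L2 (Y n)" for n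
  have [measurable]: "f n \<in> borel_measurable borel" for n by (simp add: f_def)
  have f: "square_integrable (f n)" for n by (simp add: f_def square_integrable_rep)
  have int: "(\<integral>\<^sup>+x. ennreal ((cmod (f m x - f n x))\<^sup>2) \<partial>lborel) <= ennreal (((1/2) ^ n)\<^sup>2)" if "n <= m" for m n
  proof -
    have "(\<integral>\<^sup>+x. ennreal ((cmod (f m x - f n x))\<^sup>2) \<partial>lborel) =
        (\<integral>\<^sup>+x. ennreal ((cmod (rep_L2 (Y m - Y n) x))\<^sup>2) \<partial>lborel)"
      using rep_minus[of "Y m" "Y n"] by (intro nn_integral_cong_AE) (auto simp: f_def)
    also have "\<dots> <= ennreal (((1/2) ^ n)\<^sup>2)"
      unfolding nn_integral_rep using Y[OF that] by (intro ennreal_leI power_mono) auto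
    finally show ?thesis .
  qed
  define a where "a n x = cmod (f (Suc n) x - f n x)" for n x
  have [measurable]: "a n \<in> borel_measurable borel" for n unfolding a_def by measurable
  have "(\<integral>\<^sup>+x. (\<Sum>n. ennreal (2 ^ n * (a n x)\<^sup>2)) \<partial>lborel) = (\<Sum>n. \<integral>\<^sup>+x. ennreal (2 ^ n * (a n x)\<^sup>2) \<partial>lborel)"
    by (intro nn_integral_suminf) measurable
  also have "\<dots> <= (\<Sum>n. ennreal ((1/2) ^ n))"
  proof (intro suminf_le summableI)
    fix n
    have "(\<integral>\<^sup>+x. ennreal (2 ^ n * (a n x)\<^sup>2) \<partial>lborel) = ennreal (2 ^ n) * (\<integral>\<^sup>+x. ennreal ((a n x)\<^sup>2) \<partial>lborel)"
      by (subst nn_integral_cmult[symmetric]) (auto simp: ennreal_mult)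
    also have "\<dots> <= ennreal (2 ^ n) * ennreal (((1/2) ^ n)\<^sup>2)"
      unfolding a_def by (intro mult_left_mono int) auto
    also have "\<dots> = ennreal ((1/2) ^ n)"
      by (simp add: ennreal_mult[symmetric] power2_eq_square power_divide)
    finally show "(\<integral>\<^sup>+x. ennreal (2 ^ n * (a n x)\<^sup>2) \<partial>lborel) <= ennreal ((1/2) ^ n)" .
  qed
  also have "\<dots> < \<infinity>"
    by (subst suminf_ennreal2) (auto simp: summable_geometric)
  finally have "AE x in lborel. (\<Sum>n. ennreal (2 ^ n * (a n x)\<^sup>2)) ~= \<infinity>"
    by (intro nn_integral_PInf_AE) auto
  then have conv: "AE x in lborel. convergent (%n. f n x)"
  proof eventually_elim
    fix x assume "(\<Sum>n. ennreal (2 ^ n * (a n x)\<^sup>2)) ~= \<infinity>"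
    then have s: "summable (%n. 2 ^ n * (a n x)\<^sup>2)"
      by (intro summable_suminf_not_top) auto
    have "summable (%n. (1/2) ^ n + 2 ^ n * (a n x)\<^sup>2)"
      by (intro summable_add s summable_geometric) simp
    moreover have "norm (f (Suc n) x - f n x) <= (1/2) ^ n + 2 ^ n * (a n x)\<^sup>2" for n
    proof -
      have *: "t <= (1 / c) + c * t\<^sup>2" if "0 < c" "0 <= t" for t c :: real
      proof -
        have "0 <= (c * t - 1)\<^sup>2" by simp
        then have "2 * (c * t) <= 1 + c\<^sup>2 * t\<^sup>2" by (simp add: power2_eq_square algebra_simps)
        then have "c * t <= 1 + c\<^sup>2 * t\<^sup>2" using that mult_nonneg_nonneg[of c t] by linarith
        then show ?thesis using that by (simp add: field_simps power2_eq_square)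
      qed
      show ?thesis using *[of "2 ^ n" "a n x"] by (simp add: a_def power_divide)
    qed
    ultimately have "summable (%n. f (Suc n) x - f n x)"
      by (rule summable_comparison_test'[where N = 0])
    then have "convergent (%n. \<Sum>i<n. f (Suc i) x - f i x)"
      by (rule summable_iff_convergent[THEN iffD1])
    then have "convergent (%n. f n x - f 0 x)" by (simp only: sum_lessThan_telescope[of "%i. f i x"])
    then have "convergent (%n. (f n x - f 0 x) + f 0 x)" by (intro convergent_add convergent_const)
    then show "convergent (%n. f n x)" by simp
  qed
  define g where "g x = lim (%n. f n x)" for x
  have [measurable]: "g \<in> borel_measurable borel" unfolding g_def by measurable
  have gint: "(\<integral>\<^sup>+x. ennreal ((cmod (g x - f n x))\<^sup>2) \<partial>lborel) <= ennreal (((1/2) ^ n)\<^sup>2)" for n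
  proof -
    have "(\<integral>\<^sup>+x. ennreal ((cmod (g x - f n x))\<^sup>2) \<partial>lborel) =
      (\<integral>\<^sup>+x. liminf (%m. ennreal ((cmod (f m x - f n x))\<^sup>2)) \<partial>lborel)"
      using conv
    proof (intro nn_integral_cong_AE, eventually_elim)
      fix x assume "convergent (%n. f n x)"
      then have "(%m. f m x) \<longlonglongrightarrow> g x" by (simp add: convergent_LIMSEQ_iff g_def)
      then have "(%m. ennreal ((cmod (f m x - f n x))\<^sup>2)) \<longlonglongrightarrow> ennreal ((cmod (g x - f n x))\<^sup>2)"
        by (intro tendsto_intros) auto
      then show "ennreal ((cmod (g x - f n x))\<^sup>2) = liminf (%m. ennreal ((cmod (f m x - f n x))\<^sup>2))"
        by (rule lim_imp_Liminf[OF sequentially_bot, symmetric])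
    qed
    also have "\<dots> <= liminf (%m. \<integral>\<^sup>+x. ennreal ((cmod (f m x - f n x))\<^sup>2) \<partial>lborel)"
      by (intro nn_integral_liminf) measurable
    also have "\<dots> <= liminf (%m. ennreal (((1/2) ^ n)\<^sup>2))"
      by (intro Liminf_mono eventually_sequentiallyI[of n]) (rule int)
    also have "\<dots> = ennreal (((1/2) ^ n)\<^sup>2)"
      by (simp add: Liminf_const)
    finally show ?thesis .
  qed
  have gf: "square_integrable (%x. g x - f n x)" for n
    unfolding square_integrable_def using gint[of n]
    by (auto intro!: integrableI_bounded simp: le_less_trans)
  have "square_integrable (%x. (g x - f 0 x) + f 0 x)" by (intro square_integrable_add gf f)
  then have g: "square_integrable g" by simp
  have "norm (abs_L2 g - Y n) <= (1/2) ^ n" for n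
  proof -
    have "ennreal ((norm (abs_L2 g - Y n))\<^sup>2) = (\<integral>\<^sup>+x. ennreal ((cmod (rep_L2 (abs_L2 g - Y n) x))\<^sup>2) \<partial>lborel)"
      by (rule nn_integral_rep[symmetric])
    also have "\<dots> = (\<integral>\<^sup>+x. ennreal ((cmod (g x - f n x))\<^sup>2) \<partial>lborel)"
      using rep_minus[of "abs_L2 g" "Y n"] rep_abs_L2[OF g]
      by (intro nn_integral_cong_AE) (auto simp: f_def elim: eventually_elim2)
    finally have "ennreal ((norm (abs_L2 g - Y n))\<^sup>2) <= ennreal (((1/2) ^ n)\<^sup>2)" using gint[of n] by (simp only:)
    then have "(norm (abs_L2 g - Y n))\<^sup>2 <= ((1/2) ^ n)\<^sup>2" by (rule ennreal_le_iff[THEN iffD1, rotated]) simp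
    then show ?thesis by (rule power2_le_imp_le) simp
  qed
  then have dY: "dist (Y n) (abs_L2 g) <= (1/2) ^ n" for n by (simp only: dist_norm norm_minus_commute)
  have pow: "(%n. (1/2::real) ^ n) \<longlonglongrightarrow> 0" by (rule LIMSEQ_power_zero) simp
  have "(%n. dist (Y n) (abs_L2 g)) \<longlonglongrightarrow> 0"
    by (rule tendsto_sandwich[OF always_eventually always_eventually tendsto_const pow]) (simp_all only: dY zero_le_dist simp_thms)
  then have "Y \<longlonglongrightarrow> abs_L2 g" by (rule tendsto_dist_iff[THEN iffD2])
  then show ?thesis ..
qed

instance L2 :: (euclidean_space) banach
proof
  fix X :: "nat => 'a L2" assume X: "Cauchy X"
  then have "ALL n. EX N. ALL m>=N. ALL k>=N. norm (X m - X k) < (1/2) ^ n"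
    unfolding Cauchy_iff by simp
  then obtain N where N: "!!n m k. N n <= m ==> N n <= k ==> norm (X m - X k) < (1/2) ^ n"
    by metis
  \<comment> \<open>Summing \<open>Suc (N k)\<close> makes \<open>r\<close> strictly increasing and
    keeps \<open>r m\<close> above \<open>N n\<close> whenever \<open>n <= m\<close>.\<close>
  define r where "r n = (\<Sum>k\<le>n. Suc (N k))" for n
  have r: "strict_mono r" by (rule strict_monoI_Suc) (simp add: r_def)
  have rN: "N n <= r m" if "n <= m" for n m
  proof -
    have "Suc (N n) <= r n" unfolding r_def by (rule member_le_sum) auto
    also have "r n <= r m" using r that by (simp add: strict_mono_less_eq)
    finally show ?thesis by simp
  qed
  have "EX l. (X \<circ> r) \<longlonglongrightarrow> l"
    by (rule L2_fast_Cauchy_convergent) (auto intro!: less_imp_le N rN)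
  then obtain l where "(X \<circ> r) \<longlonglongrightarrow> l" ..
  with X r have "X \<longlonglongrightarrow> l" by (rule Cauchy_converges_subseq)
  then show "convergent X" by (rule convergentI)
qed

section \<open>Riesz representation\<close>

text \<open>The representing vector minimises \<open>J ph = norm ph ^ 2 - 2 * L ph\<close> over
  \<open>M\<close>; the parallelogram law makes a minimising sequence Cauchy. Working over a closed
  subspace and over the reals serves twice: \<open>M = UNIV\<close> gives the representation of
  functionals, and \<open>L\<close> an inner product with a fixed vector gives orthogonal
  projections.\<close>

lemma riesz_subspace:
  fixes M :: "'b::{real_inner,complete_space} set" and L :: "'b => real"
  assumes M: "subspace M" "closed M" and L: "bounded_linear L"
  shows "EX th:M. ALL ph:M. L ph = inner ph th"
proof -
  interpret L: bounded_linear L by (rule L)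
  define J where "J ph = (norm ph)\<^sup>2 - 2 * L ph" for ph
  obtain K where K: "!!ph. norm (L ph) <= norm ph * K" "0 < K" using L.pos_bounded by blast
  have lb: "- K\<^sup>2 <= J ph" for ph
  proof -
    have "L ph <= norm ph * K" using K(1)[of ph] by simp
    moreover have "0 <= (norm ph - K)\<^sup>2" by simp
    ultimately show ?thesis unfolding J_def power2_diff by simp
  qed
  define I where "I = Inf (J ` M)"
  have bdd: "bdd_below (J ` M)" by (rule bdd_belowI2[of _ "- K\<^sup>2"]) (rule lb)
  have I: "I <= J ph" if "ph \<in> M" for ph using that bdd by (auto simp: I_def intro: cInf_lower)
  have "0 \<in> M" using M by (simp add: subspace_0)
  then have ne: "J ` M ~= {}" by auto
  have "EX ph:M. J ph < I + 1 / (real n + 1)" for n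
  proof -
    have "Inf (J ` M) < I + 1 / (real n + 1)" by (simp add: I_def)
    then show ?thesis using cInf_less_iff[OF ne bdd] by auto
  qed
  then obtain ph where ph: "!!n. ph n \<in> M" "!!n. J (ph n) < I + 1 / (real n + 1)" by metis
  have par: "(norm (a - b))\<^sup>2 = 2 * J a + 2 * J b - 4 * J ((1/2) *\<^sub>R (a + b))" for a b
    unfolding J_def L.scaleR L.add power2_norm_eq_inner
    by (simp add: inner_simps algebra_simps inner_commute)
  have d: "(norm (ph m - ph n))\<^sup>2 <= 2 / (real m + 1) + 2 / (real n + 1)" for m n
  proof -
    have "I <= J ((1/2) *\<^sub>R (ph m + ph n))" using M ph(1) by (intro I subspace_scale subspace_add)
    then show ?thesis unfolding par using ph(2)[of m] ph(2)[of n] by simp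
  qed
  have "Cauchy ph"
  proof (rule metric_CauchyI)
    fix e :: real assume e: "0 < e"
    obtain N where N: "4 / e\<^sup>2 < real N" using reals_Archimedean2 by blast
    have "dist (ph m) (ph n) < e" if "N <= m" "N <= n" for m n
    proof -
      have *: "2 / (real m + 1) < e\<^sup>2 / 2" if "N <= m" for m
      proof -
        have "4 / e\<^sup>2 < real m + 1" using N that by linarith
        then show ?thesis using e by (simp add: field_simps)
      qed
      have "(norm (ph m - ph n))\<^sup>2 < e\<^sup>2" using d[of m n] *[OF that(1)] *[OF that(2)] by linarith
      then show ?thesis using e by (simp add: dist_norm power_less_imp_less_base)
    qed
    then show "EX N. ALL m>=N. ALL n>=N. dist (ph m) (ph n) < e" by blast
  qed
  then obtain th where lim: "ph \<longlonglongrightarrow> th" using Cauchy_convergent convergent_def by blast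
  have th: "th \<in> M" using M(2) ph(1) lim by (meson closed_sequentially)
  have "(%n. J (ph n)) \<longlonglongrightarrow> J th" unfolding J_def
    by (intro tendsto_intros lim L.tendsto)
  moreover have "(%n. I + 1 / (real n + 1)) \<longlonglongrightarrow> I + 0"
    by (intro tendsto_intros LIMSEQ_inverse_real_of_nat[unfolded inverse_eq_divide of_nat_Suc add.commute[of 1]])
  ultimately have "J th <= I + 0" using ph(2) by (intro LIMSEQ_le) (auto intro!: exI[of _ 0] less_imp_le)
  then have min: "J th <= J ps" if "ps \<in> M" for ps using I[OF that] by simp
  have "L ps = inner ps th" if "ps \<in> M" for ps
  proof -
    define d where "d = inner ps th - L ps"
    have q: "0 <= t\<^sup>2 * (norm ps)\<^sup>2 + 2 * t * d" for t
    proof -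
      have "J th <= J (th + t *\<^sub>R ps)" using M th that by (intro min subspace_add subspace_scale)
      then show ?thesis unfolding J_def L.add L.scaleR power2_norm_eq_inner d_def
        by (simp add: inner_simps algebra_simps inner_commute power2_eq_square)
    qed
    have "d = 0"
    proof (rule ccontr)
      assume "d ~= 0"
      \<comment> \<open>The quadratic \<open>t^2 * norm ps ^ 2 + 2 * t * d\<close> is negative at
        \<open>t = - d / c\<close> unless \<open>d = 0\<close>; the summand 1 keeps \<open>c\<close>
        positive when \<open>ps = 0\<close>.\<close>
      define c where "c = (norm ps)\<^sup>2 + 1"
      have c: "0 < c" by (simp add: c_def add_nonneg_pos)
      have "0 <= (- d / c)\<^sup>2 * (norm ps)\<^sup>2 + 2 * (- d / c) * d" by (rule q)
      also have "\<dots> <= (- d / c)\<^sup>2 * c + 2 * (- d / c) * d"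
        by (intro add_right_mono mult_left_mono) (auto simp: c_def)
      also have "\<dots> = - d\<^sup>2 / c" using c by (simp add: field_simps power2_eq_square)
      also have "\<dots> < 0" using c \<open>d ~= 0\<close> by simp
      finally show False by simp
    qed
    then show ?thesis by (simp add: d_def)
  qed
  then show ?thesis using th by blast
qed

text \<open>The real part of \<open>L\<close> has a real representer, and evaluating it at
  \<open>\<i> *\<^sub>C ph\<close> recovers the imaginary part.\<close>

lemma riesz:
  fixes L :: "'a::euclidean_space L2 => complex"
  assumes add: "!!x y. L (x + y) = L x + L y" and scale: "!!c x. L (c *\<^sub>C x) = c * L x"
    and bdd: "!!x. cmod (L x) <= K * norm x"
  shows "EX th. ALL ph. L ph = cinner ph th"
proof -
  have "bounded_linear (%x. Re (L x))"
  proof (rule bounded_linear_intro[of _ K])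
    show "norm (Re (L x)) <= norm x * K" for x
      using bdd[of x] abs_Re_le_cmod[of "L x"] by (simp add: mult.commute)
  qed (simp_all add: add scale scaleR_eq_scaleC)
  then obtain th where th: "!!ph. Re (L ph) = Re (cinner ph th)"
    using riesz_subspace[of UNIV "%x. Re (L x)"] by (auto simp: inner_eq_Re_cinner)
  have "L ph = cinner ph th" for ph
    using th[of ph] th[of "\<i> *\<^sub>C ph"] by (simp add: scale cinner_simps complex_eq_iff)
  then show ?thesis by blast
qed

section \<open>Bounded operators\<close>

text \<open>The library type of bounded linear maps is real linear; this subtype carries complex
  linearity. As an instance of \<open>real_normed_algebra_1\<close> and \<open>banach\<close> it
  admits geometric series and norm-convergent iterations.\<close>

typedef (overloaded) 'a bop =
  "{T :: 'a::euclidean_space L2 \<Rightarrow>\<^sub>L 'a L2. ALL c x. T (c *\<^sub>C x) = c *\<^sub>C T x}"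
  by (rule exI[of _ 0]) simp

definition app :: "'a::euclidean_space bop => 'a L2 => 'a L2" (infixr "@@" 80)
  where "app T = blinfun_apply (Rep_bop T)"

lemma bop_eqI: "(!!x. S @@ x = T @@ x) ==> S = T"
  by (rule Rep_bop_inject[THEN iffD1], rule blinfun_eqI) (simp add: app_def)

lemma app_scaleC: "T @@ (c *\<^sub>C x) = c *\<^sub>C (T @@ x)"
  using Rep_bop[of T] by (simp add: app_def)

instantiation bop :: (euclidean_space) real_normed_algebra_1
begin

definition zero_bop :: "'a bop" where "0 = Abs_bop 0"
definition one_bop :: "'a bop" where "1 = Abs_bop id_blinfun"
definition plus_bop :: "'a bop => 'a bop => 'a bop" where "S + T = Abs_bop (Rep_bop S + Rep_bop T)"
definition minus_bop :: "'a bop => 'a bop => 'a bop" where "S - T = Abs_bop (Rep_bop S - Rep_bop T)"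
definition uminus_bop :: "'a bop => 'a bop" where "- T = Abs_bop (- Rep_bop T)"
definition times_bop :: "'a bop => 'a bop => 'a bop" where "S * T = Abs_bop (Rep_bop S o\<^sub>L Rep_bop T)"
definition scaleR_bop :: "real => 'a bop => 'a bop" where "r *\<^sub>R T = Abs_bop (r *\<^sub>R Rep_bop T)"
definition norm_bop :: "'a bop => real" where "norm T = norm (Rep_bop T)"
definition sgn_bop :: "'a bop => 'a bop" where "sgn_bop T = inverse (norm T) *\<^sub>R T"
definition dist_bop :: "'a bop => 'a bop => real" where "dist_bop S T = norm (S - T)"
definition uniformity_bop :: "('a bop \<times> 'a bop) filter" where
  "uniformity_bop = (INF e\<in>{0 <..}. principal {(x, y). dist x y < e})"
definition open_bop :: "'a bop set => bool" where
  "open_bop S = (ALL x:S. \<forall>\<^sub>F (x', y) in uniformity. x' = x --> y \<in> S)"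

lemma Rep_scaleC: "blinfun_apply (Rep_bop T) (c *\<^sub>C x) = c *\<^sub>C blinfun_apply (Rep_bop T) x"
  using Rep_bop[of T] by simp

lemma Rep_bop_ops:
  "Rep_bop 0 = 0" "Rep_bop 1 = id_blinfun" "Rep_bop (S + T) = Rep_bop S + Rep_bop T"
  "Rep_bop (S - T) = Rep_bop S - Rep_bop T" "Rep_bop (- T) = - Rep_bop T"
  "Rep_bop (S * T) = Rep_bop S o\<^sub>L Rep_bop T" "Rep_bop (r *\<^sub>R T) = r *\<^sub>R Rep_bop T"
  unfolding zero_bop_def one_bop_def plus_bop_def minus_bop_def uminus_bop_def times_bop_def scaleR_bop_def
  by (subst Abs_bop_inverse;
      simp add: Rep_scaleC blinfun.add_left blinfun.diff_left blinfun.minus_left blinfun.scaleR_left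
        scaleC_add_right scaleC_diff_right scaleC_minus_right scaleC_scaleR)+

lemma app_add_left [simp]: "(S + T) @@ x = S @@ x + T @@ x"
  and app_diff_left [simp]: "(S - T) @@ x = S @@ x - T @@ x"
  and app_minus_left [simp]: "(- T) @@ x = - (T @@ x)"
  and app_scaleR_left [simp]: "(r *\<^sub>R T) @@ x = r *\<^sub>R (T @@ x)"
  and app_zero_left [simp]: "0 @@ x = 0"
  and app_one [simp]: "1 @@ x = x"
  and app_times [simp]: "(S * T) @@ x = S @@ T @@ x"
  by (simp_all add: app_def Rep_bop_ops blinfun.add_left blinfun.diff_left blinfun.minus_left blinfun.scaleR_left)

lemma app_add: "T @@ (x + y) = T @@ x + T @@ y"
  and app_diff: "T @@ (x - y) = T @@ x - T @@ y"
  and app_minus: "T @@ (- x) = - (T @@ x)"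
  and app_scaleR: "T @@ (r *\<^sub>R x) = r *\<^sub>R (T @@ x)"
  and app_zero [simp]: "T @@ 0 = 0"
  by (simp_all add: app_def blinfun.add_right blinfun.diff_right blinfun.minus_right blinfun.scaleR_right)

instance
proof
  fix a b c :: "'a bop" and r s :: real
  show "a + b + c = a + (b + c)" by (rule bop_eqI) (simp add: app_add app_scaleR scaleR_add_right scaleR_add_left)
  show "a + b = b + a" by (rule bop_eqI) (simp add: app_add app_scaleR scaleR_add_right scaleR_add_left)
  show "0 + a = a" by (rule bop_eqI) (simp add: app_add app_scaleR scaleR_add_right scaleR_add_left)
  show "- a + a = 0" by (rule bop_eqI) (simp add: app_add app_scaleR scaleR_add_right scaleR_add_left)
  show "a - b = a + - b" by (rule bop_eqI) (simp add: app_add app_scaleR scaleR_add_right scaleR_add_left)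
  show "r *\<^sub>R (a + b) = r *\<^sub>R a + r *\<^sub>R b" by (rule bop_eqI) (simp add: app_add app_scaleR scaleR_add_right scaleR_add_left)
  show "(r + s) *\<^sub>R a = r *\<^sub>R a + s *\<^sub>R a" by (rule bop_eqI) (simp add: app_add app_scaleR scaleR_add_right scaleR_add_left)
  show "r *\<^sub>R s *\<^sub>R a = (r * s) *\<^sub>R a" by (rule bop_eqI) (simp add: app_add app_scaleR scaleR_add_right scaleR_add_left)
  show "1 *\<^sub>R a = a" by (rule bop_eqI) (simp add: app_add app_scaleR scaleR_add_right scaleR_add_left)
  show "a * b * c = a * (b * c)" by (rule bop_eqI) (simp add: app_add app_scaleR scaleR_add_right scaleR_add_left)
  show "(a + b) * c = a * c + b * c"
    by (rule bop_eqI) (simp add: app_add app_scaleR scaleR_add_right scaleR_add_left)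
  show "a * (b + c) = a * b + a * c"
    by (rule bop_eqI) (simp add: app_add app_scaleR scaleR_add_right scaleR_add_left)
  show "r *\<^sub>R a * b = r *\<^sub>R (a * b)"
    by (rule bop_eqI) (simp add: app_add app_scaleR scaleR_add_right scaleR_add_left)
  show "a * r *\<^sub>R b = r *\<^sub>R (a * b)"
    by (rule bop_eqI) (simp add: app_add app_scaleR scaleR_add_right scaleR_add_left)
  show "1 * a = a" by (rule bop_eqI) (simp add: app_add app_scaleR scaleR_add_right scaleR_add_left)
  show "a * 1 = a" by (rule bop_eqI) (simp add: app_add app_scaleR scaleR_add_right scaleR_add_left)
  \<comment> \<open>The class demands \<open>norm 1 = 1\<close>, hence a nonzero vector; the
    indicator of the unit cube is one.\<close>
  have *: "EX v :: 'a L2. v ~= 0"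
  proof
    have fin: "emeasure lborel (cbox (0::'a) One) = 1"
      by (simp add: emeasure_lborel_cbox_eq)
    have "integrable lborel (indicat_real (cbox (0::'a) One))"
      by (rule integrable_real_indicator) (simp_all add: fin)
    then have sq: "square_integrable (%x::'a. of_real (indicator (cbox 0 One) x))"
    proof -
      have "(%x::'a. (cmod (of_real (indicator (cbox 0 One) x)))\<^sup>2) = indicat_real (cbox 0 One)"
        by (auto simp: fun_eq_iff indicator_def)
      then show ?thesis using \<open>integrable lborel (indicat_real (cbox (0::'a) One))\<close>
        by (simp add: square_integrable_def)
    qed
    have "(norm (abs_L2 (%x::'a. of_real (indicator (cbox 0 One) x))))\<^sup>2 = (LINT x|lborel. indicator (cbox (0::'a) One) x)"
      unfolding norm_abs_L2[OF sq] by (intro Bochner_Integration.integral_cong) (auto simp: indicator_def)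
    also have "\<dots> = 1" using fin by (simp add: measure_def)
    finally show "abs_L2 (%x::'a. of_real (indicator (cbox 0 One) x)) ~= 0" by auto
  qed
  have one: "norm (1 :: 'a bop) = 1"
    unfolding norm_bop_def Rep_bop_ops
  proof (rule antisym)
    show "norm (id_blinfun :: 'a L2 \<Rightarrow>\<^sub>L 'a L2) <= 1" by (rule norm_blinfun_id_le)
    obtain v :: "'a L2" where v: "v ~= 0" using * by blast
    have "norm v <= norm (id_blinfun :: 'a L2 \<Rightarrow>\<^sub>L 'a L2) * norm v"
      using norm_blinfun[of id_blinfun v] by simp
    then show "1 <= norm (id_blinfun :: 'a L2 \<Rightarrow>\<^sub>L 'a L2)" using v by simp
  qed
  show "norm (1 :: 'a bop) = 1" by (rule one)
  show "(0::'a bop) ~= 1"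
  proof
    assume "(0::'a bop) = 1"
    then have "norm (0::'a bop) = 1" using one by simp
    then show False by (simp add: norm_bop_def Rep_bop_ops)
  qed
  show "norm (a * b) <= norm a * norm b" unfolding norm_bop_def Rep_bop_ops by (rule norm_blinfun_compose)
  show "norm (a + b) <= norm a + norm b" unfolding norm_bop_def Rep_bop_ops by (rule norm_triangle_ineq)
  show "norm (r *\<^sub>R a) = \<bar>r\<bar> * norm a" unfolding norm_bop_def Rep_bop_ops by simp
  show "norm a = 0 \<longleftrightarrow> a = 0" by (simp add: norm_bop_def Rep_bop_inject[symmetric] Rep_bop_ops)
  show "sgn a = inverse (norm a) *\<^sub>R a" by (rule sgn_bop_def)
  show "dist a b = norm (a - b)" by (rule dist_bop_def)
  show "uniformity = (INF e\<in>{0 <..}. principal {(x, y::'a bop). dist x y < e})"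
    by (rule uniformity_bop_def)
  show "open S = (ALL x:S. \<forall>\<^sub>F (x', y) in uniformity. x' = x --> y \<in> S)" for S :: "'a bop set"
    by (rule open_bop_def)
qed

end

lemma app_norm: "norm (T @@ x) <= norm T * norm x"
  unfolding app_def norm_bop_def by (rule norm_blinfun)

lemma bounded_linear_app: "bounded_linear (%x. T @@ x)"
  unfolding app_def by (rule blinfun.bounded_linear_right)

lemma bounded_bilinear_app: "bounded_bilinear (@@)"
  by standard (use app_norm in \<open>auto simp: app_add app_scaleR intro!: exI[of _ 1]\<close>)

lemmas tendsto_app [tendsto_intros] = bounded_bilinear.tendsto[OF bounded_bilinear_app]
lemmas continuous_on_app [continuous_intros] = bounded_bilinear.continuous_on[OF bounded_bilinear_app]

lemma norm_bop_le: "0 <= c ==> (!!x. norm (T @@ x) <= c * norm x) ==> norm T <= c"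
  unfolding app_def norm_bop_def by (rule norm_blinfun_bound)

lemma bop_exists:
  assumes "!!x y. f (x + y) = f x + f y" "!!c x. f (c *\<^sub>C x) = c *\<^sub>C f x" "!!x. norm (f x) <= K * norm x"
  shows "EX T. ALL x. T @@ x = f x"
proof -
  have bl: "bounded_linear f"
    by (rule bounded_linear_intro[of _ K]) (use assms in \<open>auto simp: scaleR_eq_scaleC mult.commute\<close>)
  show ?thesis
    by (rule exI[of _ "Abs_bop (Blinfun f)"])
       (simp add: app_def Abs_bop_inverse bounded_linear_Blinfun_apply bl assms)
qed

instance bop :: (euclidean_space) banach
proof
  fix X :: "nat => 'a bop" assume "Cauchy X"
  have d: "dist (Rep_bop S) (Rep_bop T) = dist S T" for S T :: "'a bop"
    unfolding dist_norm by (simp add: norm_bop_def Rep_bop_ops)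
  have "Cauchy (%n. Rep_bop (X n))"
    using \<open>Cauchy X\<close> by (simp add: Cauchy_def d)
  then obtain L where L: "(%n. Rep_bop (X n)) \<longlonglongrightarrow> L"
    using Cauchy_convergent convergent_def by blast
  have lim: "(%n. X n @@ x) \<longlonglongrightarrow> L x" for x
    unfolding app_def by (intro tendsto_intros L)
  have "L (c *\<^sub>C x) = c *\<^sub>C L x" for c x
  proof (rule LIMSEQ_unique[OF lim])
    show "(%n. X n @@ (c *\<^sub>C x)) \<longlonglongrightarrow> c *\<^sub>C L x"
      unfolding app_scaleC by (intro tendsto_intros lim)
  qed
  then have "Rep_bop (Abs_bop L) = L" by (simp add: Abs_bop_inverse)
  then have "(%n. dist (X n) (Abs_bop L)) \<longlonglongrightarrow> 0"
    using tendsto_dist_iff[THEN iffD1, OF L] unfolding d[symmetric] by simp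
  then have "X \<longlonglongrightarrow> Abs_bop L" by (rule tendsto_dist_iff[THEN iffD2])
  then show "convergent X" by (rule convergentI)
qed

text \<open>The algebra has real scalars only, so a complex multiple of an operator is its product
  with the central element \<open>cop c\<close>.\<close>

definition cop :: "complex => 'a::euclidean_space bop" where
  "cop c = Abs_bop (Blinfun (%x. c *\<^sub>C x))"

lemma app_cop [simp]: "cop c @@ x = c *\<^sub>C x"
  by (simp add: cop_def app_def Abs_bop_inverse bounded_linear_Blinfun_apply bounded_linear_scaleC mult.commute)

lemma cop_commute: "T * cop c = cop c * T"
  by (rule bop_eqI) (simp add: app_scaleC)

lemma cop_mult: "cop c * cop d = cop (c * d)"
  by (rule bop_eqI) simp

lemma norm_cop_mult: "norm (cop c * T) = cmod c * norm T"
proof (rule antisym)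
  have le: "norm (cop c * T) <= cmod c * norm T" for c and T :: "'a bop"
    by (rule norm_bop_le) (simp_all add: norm_scaleC mult.assoc mult_left_mono app_norm)
  show "norm (cop c * T) <= cmod c * norm T" by (rule le)
  show "cmod c * norm T <= norm (cop c * T)"
  proof (cases "c = 0")
    case False
    have "T = cop (inverse c) * (cop c * T)"
      using False by (intro bop_eqI) simp
    then have "norm T <= cmod (inverse c) * norm (cop c * T)" by (metis le)
    then have "cmod c * norm T <= cmod c * (cmod (inverse c) * norm (cop c * T))"
      by (intro mult_left_mono) auto
    also have "\<dots> = norm (cop c * T)" using False by (simp add: norm_inverse del: inverse_eq_divide)
    finally show ?thesis .
  qed simp
qed

subsection \<open>Adjoints\<close>

definition adj :: "'a::euclidean_space bop => 'a bop" where
  "adj T = (SOME S. ALL x y. cinner (T @@ x) y = cinner x (S @@ y))"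

lemma adj_right: "cinner (T @@ x) y = cinner x (adj T @@ y)"
proof -
  have bd: "cmod (cinner (T @@ x) y) <= (norm T * norm y) * norm x" for x y
  proof -
    have "cmod (cinner (T @@ x) y) <= norm (T @@ x) * norm y" by (rule cmod_cinner_le)
    also have "\<dots> <= (norm T * norm x) * norm y" by (intro mult_right_mono app_norm) simp
    finally show ?thesis by (simp add: ac_simps)
  qed
  have "EX th. ALL x. cinner (T @@ x) y = cinner x th" for y
    by (rule riesz[of _ "norm T * norm y"]) (simp_all add: app_add app_scaleC cinner_simps bd)
  then obtain f where f: "!!x y. cinner (T @@ x) y = cinner x (f y)" by metis
  have "EX S. ALL y. S @@ y = f y"
  proof (rule bop_exists)
    show "f (x + y) = f x + f y" for x y
      by (rule cinner_ext_right) (simp add: cinner_simps f[symmetric])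
    show "f (c *\<^sub>C x) = c *\<^sub>C f x" for c x
      by (rule cinner_ext_right) (simp add: cinner_simps f[symmetric])
    show "norm (f y) <= norm T * norm y" for y
    proof (rule norm_le_cinnerI)
      show "cmod (cinner (f y) x) <= norm T * norm y * norm x" for x
        using bd[of x y] cinner_commute[of x "f y"] by (simp add: f)
    qed simp
  qed
  then have "EX S. ALL x y. cinner (T @@ x) y = cinner x (S @@ y)" using f by metis
  then show ?thesis unfolding adj_def by (rule someI2_ex) auto
qed

lemma adj_left: "cinner x (T @@ y) = cinner (adj T @@ x) y"
  by (metis adj_right cinner_commute)

lemma adj_unique: "(!!x y. cinner (T @@ x) y = cinner x (S @@ y)) ==> adj T = S"
  by (rule bop_eqI, rule cinner_ext_right) (simp add: adj_right[symmetric])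

lemma adj_adj [simp]: "adj (adj T) = T"
  by (rule adj_unique) (simp add: adj_left)
lemma adj_times [simp]: "adj (S * T) = adj T * adj S"
  by (rule adj_unique) (simp add: adj_right)
lemma adj_plus [simp]: "adj (S + T) = adj S + adj T"
  by (rule adj_unique) (simp add: adj_right cinner_simps)
lemma adj_minus [simp]: "adj (S - T) = adj S - adj T"
  by (rule adj_unique) (simp add: adj_right cinner_simps)
lemma adj_uminus [simp]: "adj (- T) = - adj T"
  by (rule adj_unique) (simp add: adj_right cinner_simps)
lemma adj_scaleR [simp]: "adj (r *\<^sub>R T) = r *\<^sub>R adj T"
  by (rule adj_unique) (simp add: adj_right cinner_simps)
lemma adj_one [simp]: "adj 1 = 1"
  by (rule adj_unique) simp
lemma adj_zero [simp]: "adj 0 = 0"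
  by (rule adj_unique) simp
lemma adj_cop [simp]: "adj (cop c) = cop (cnj c)"
  by (rule adj_unique) (simp add: cinner_simps)

lemma norm_adj [simp]: "norm (adj T) = norm T"
proof -
  have le: "norm (adj T) <= norm T" for T :: "'a bop"
  proof (rule norm_bop_le)
    fix y
    show "norm (adj T @@ y) <= norm T * norm y"
    proof (rule norm_le_cinnerI)
      fix x
      have "cmod (cinner (adj T @@ y) x) = cmod (cinner y (T @@ x))" by (simp add: adj_left)
      also have "\<dots> <= norm y * norm (T @@ x)" by (rule cmod_cinner_le)
      also have "\<dots> <= norm y * (norm T * norm x)" by (intro mult_left_mono app_norm) simp
      finally show "cmod (cinner (adj T @@ y) x) <= norm T * norm y * norm x" by (simp add: ac_simps)
    qed simp
  qed simp
  show ?thesis using le[of T] le[of "adj T"] by simp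
qed

lemma norm_app_sq: "of_real ((norm (T @@ x))\<^sup>2) = cinner ((adj T * T) @@ x) x"
  by (simp add: cinner_self[symmetric] adj_left del: of_real_power)

lemma tendsto_adj [tendsto_intros]: "(f \<longlongrightarrow> T) F ==> ((%x. adj (f x)) \<longlongrightarrow> adj T) F"
  unfolding tendsto_dist_iff[of _ T] tendsto_dist_iff[of _ "adj T"] dist_norm
  by (simp flip: adj_minus)

text \<open>Polarisation in the shape that \<open>spectral_integral\<close> uses. It lets operators
  be identified by their diagonal matrix elements and yields the crude norm bounds of the
  calculus.\<close>

lemma cinner_app_polarization:
  "4 * cinner (T @@ a) b = (\<Sum>k<4. \<i> ^ k * cinner (T @@ (a + \<i> ^ k *\<^sub>C b)) (a + \<i> ^ k *\<^sub>C b))"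
proof -
  have s: "(\<Sum>k<4. F k) = F 0 + F 1 + F 2 + F 3" for F :: "nat => complex"
    by (simp add: eval_nat_numeral)
  have p: "\<i> ^ 0 = 1" "\<i> ^ 1 = \<i>" "\<i> ^ 2 = -1" "\<i> ^ 3 = - \<i>"
    by (simp_all add: power3_eq_cube)
  show ?thesis
    unfolding s p scaleC_one app_add app_scaleC cinner_simps
    by (simp add: complex_eq_iff)
qed

lemma bop_eq_diag: "(!!x. cinner (S @@ x) x = cinner (T @@ x) x) ==> S = T"
proof (rule bop_eqI, rule cinner_ext)
  fix x y assume "!!x. cinner (S @@ x) x = cinner (T @@ x) x"
  then have "4 * cinner (S @@ x) y = 4 * cinner (T @@ x) y"
    unfolding cinner_app_polarization by simp
  then show "cinner (S @@ x) y = cinner (T @@ x) y" by simp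
qed

lemma selfadj_iff: "adj T = T \<longleftrightarrow> (ALL x. cinner (T @@ x) x \<in> \<real>)"
proof
  show "ALL x. cinner (T @@ x) x \<in> \<real>" if "adj T = T"
    using adj_left[of _ T] that by (metis cinner_commute Reals_cnj_iff)
  assume r: "ALL x. cinner (T @@ x) x \<in> \<real>"
  show "adj T = T"
    by (rule bop_eq_diag) (metis r adj_left cinner_commute Reals_cnj_iff)
qed

lemma norm_selfadj_le:
  assumes T: "adj T = T" and c: "!!x. \<bar>Re (cinner (T @@ x) x)\<bar> <= c * (norm x)\<^sup>2" "0 <= c"
  shows "norm T <= c"
proof (rule norm_bop_le[OF c(2)])
  fix x
  show "norm (T @@ x) <= c * norm x"
  proof (cases "T @@ x = 0")
    case True then show ?thesis using c by simp
  next
    case False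
    then have x: "norm x > 0" by auto
    \<comment> \<open>Rescaling the image of \<open>x\<close> to the length of \<open>x\<close>
      makes the squared norms of \<open>x + y\<close> and \<open>x - y\<close> add up to four times
      that of \<open>x\<close>, so the constant \<open>c\<close> comes out without loss.\<close>
    define y where "y = (norm x / norm (T @@ x)) *\<^sub>R (T @@ x)"
    have ny: "norm y = norm x" using False by (simp add: y_def)
    have "Re (cinner (T @@ x) y) = norm x * norm (T @@ x)"
      using False by (simp add: y_def cinner_simps Re_cinner_self cinner_self power2_eq_square)
    moreover have "4 * Re (cinner (T @@ x) y) = Re (cinner (T @@ (x + y)) (x + y)) - Re (cinner (T @@ (x - y)) (x - y))"
    proof -
      have "Re (cinner (T @@ y) x) = Re (cinner (T @@ x) y)"
        using adj_left[of y T x] T cinner_commute[of y "T @@ x"] by (metis cnj.simps(1))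
      then show ?thesis by (simp add: app_add app_diff cinner_simps)
    qed
    moreover have "(norm (x + y))\<^sup>2 + (norm (x - y))\<^sup>2 = 4 * (norm x)\<^sup>2"
      using ny by (simp add: power2_norm_eq_inner inner_simps inner_commute) (simp add: norm_eq)
    ultimately have "4 * (norm x * norm (T @@ x)) <= c * (norm (x + y))\<^sup>2 + c * (norm (x - y))\<^sup>2"
      using c(1)[of "x + y"] c(1)[of "x - y"] by linarith
    also have "\<dots> = c * (4 * (norm x)\<^sup>2)"
      unfolding \<open>(norm (x + y))\<^sup>2 + (norm (x - y))\<^sup>2 = 4 * (norm x)\<^sup>2\<close>[symmetric] by (simp add: distrib_left)
    finally have "norm x * norm (T @@ x) <= norm x * (c * norm x)" by (simp add: power2_eq_square ac_simps)
    then show ?thesis using x by simp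
  qed
qed

subsection \<open>Positive operators and square roots\<close>

definition pos :: "'a::euclidean_space bop => bool" where
  "pos T \<longleftrightarrow> adj T = T & (ALL x. 0 <= Re (cinner (T @@ x) x))"

lemma pos_adj: "pos T ==> adj T = T" and pos_ge: "pos T ==> 0 <= Re (cinner (T @@ x) x)"
  by (auto simp: pos_def)

lemma pos_adj_times: "pos (adj T * T)"
  unfolding pos_def norm_app_sq[symmetric] by simp

lemma pos_square: "adj T = T ==> pos (T * T)"
  using pos_adj_times[of T] by simp

lemma pos_scaleR: "pos T ==> 0 <= r ==> pos (r *\<^sub>R T)"
  by (simp add: pos_def cinner_simps)

lemma Re_cinner_app_le: "\<bar>Re (cinner (T @@ x) x)\<bar> <= norm T * (norm x)\<^sup>2"
proof -
  have "\<bar>Re (cinner (T @@ x) x)\<bar> <= norm (T @@ x) * norm x"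
    using cmod_cinner_le[of "T @@ x" x] abs_Re_le_cmod[of "cinner (T @@ x) x"] by linarith
  also have "\<dots> <= (norm T * norm x) * norm x" by (intro mult_right_mono app_norm) simp
  finally show ?thesis by (simp add: power2_eq_square ac_simps)
qed

section \<open>Square roots by successive approximation\<close>

text \<open>A limit \<open>L\<close> satisfies 2 L = C + L^2, that is (1 - L)^2 = 1 - C, so the
  iteration produces a square root of \<open>1 - C\<close>. The definition is over any real algebra
  because the scalar run with \<open>C = 1\<close> serves as a majorant of the operator run.\<close>

primrec sqrt_iter :: "'b::real_algebra => nat => 'b" where
  "sqrt_iter C 0 = 0"
| "sqrt_iter C (Suc n) = (1/2) *\<^sub>R (C + sqrt_iter C n * sqrt_iter C n)"

lemma sqrt_iter_commute: "B * C = C * B ==> B * sqrt_iter C n = sqrt_iter C n * B"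
  for B C :: "'b::real_algebra"
proof (induction n)
  case (Suc n)
  have "B * (sqrt_iter C n * sqrt_iter C n) = sqrt_iter C n * sqrt_iter C n * B"
    using Suc by (metis mult.assoc)
  then show ?case using Suc(2) by (simp add: distrib_left distrib_right)
qed simp

lemma sqrt_iter_one: "0 <= sqrt_iter (1::real) n" "sqrt_iter (1::real) n <= 1"
  "sqrt_iter (1::real) n <= sqrt_iter 1 (Suc n)"
proof -
  show *: "0 <= sqrt_iter (1::real) n" "sqrt_iter (1::real) n <= 1"
  proof (induction n)
    case (Suc n)
    { case 1 then show ?case by simp }
    { case 2 have "sqrt_iter (1::real) n * sqrt_iter 1 n <= 1 * 1" using Suc by (intro mult_mono) auto
      then show ?case by simp }
  qed auto
  have "0 <= (1 - sqrt_iter (1::real) n)\<^sup>2" by simp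
  then show "sqrt_iter (1::real) n <= sqrt_iter 1 (Suc n)" by (simp add: power2_eq_square algebra_simps)
qed

text \<open>Consecutive iterates are polynomials in \<open>C\<close> and commute, so an increment
  factors as half of (Z + Y)(Z - Y); induction compares this with the same factorisation of the
  scalar increment at \<open>C = 1\<close>.\<close>

lemma sqrt_iter_norm:
  fixes C :: "'b::real_normed_algebra"
  assumes C: "norm C <= 1"
  shows "norm (sqrt_iter C n) <= sqrt_iter 1 n"
    and "norm (sqrt_iter C (Suc n) - sqrt_iter C n) <= sqrt_iter 1 (Suc n) - sqrt_iter 1 n"
proof -
  show A: "norm (sqrt_iter C n) <= sqrt_iter 1 n" for n
  proof (induction n)
    case (Suc n)
    have "norm (C + sqrt_iter C n * sqrt_iter C n) <= norm C + norm (sqrt_iter C n * sqrt_iter C n)"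
      by (rule norm_triangle_ineq)
    also have "\<dots> <= 1 + sqrt_iter 1 n * sqrt_iter 1 n"
      using Suc C by (intro add_mono order.trans[OF norm_mult_ineq] mult_mono) (auto simp: sqrt_iter_one)
    finally show ?case by simp
  qed simp
  show "norm (sqrt_iter C (Suc n) - sqrt_iter C n) <= sqrt_iter 1 (Suc n) - sqrt_iter 1 n"
  proof (induction n)
    case 0 then show ?case using C by simp
  next
    case (Suc n)
    define Y where "Y = sqrt_iter C n"
    define Z where "Z = sqrt_iter C (Suc n)"
    define y where "y = sqrt_iter (1::real) n"
    define z where "z = sqrt_iter (1::real) (Suc n)"
    have com: "Y * Z = Z * Y" unfolding Y_def Z_def
      by (intro sqrt_iter_commute) (metis sqrt_iter_commute)
    have "sqrt_iter C (Suc (Suc n)) - sqrt_iter C (Suc n) = (1/2) *\<^sub>R (C + Z * Z) - (1/2) *\<^sub>R (C + Y * Y)"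
      by (simp add: Z_def Y_def)
    also have "\<dots> = (1/2) *\<^sub>R ((Z + Y) * (Z - Y))"
      using com by (simp add: algebra_simps)
    finally have "norm (sqrt_iter C (Suc (Suc n)) - sqrt_iter C (Suc n)) = (1/2) * norm ((Z + Y) * (Z - Y))"
      by simp
    also have "\<dots> <= (1/2) * ((z + y) * (z - y))"
      using Suc A[of n] A[of "Suc n"] sqrt_iter_one(1)[of n] sqrt_iter_one(1)[of "Suc n"]
      unfolding Y_def[symmetric] Z_def[symmetric] y_def[symmetric] z_def[symmetric]
      by (intro mult_left_mono order.trans[OF norm_mult_ineq] mult_mono order.trans[OF norm_triangle_ineq] add_mono) auto
    also have "\<dots> = sqrt_iter 1 (Suc (Suc n)) - sqrt_iter 1 (Suc n)"
    proof -
      have a: "sqrt_iter 1 (Suc (Suc n)) = (1/2) * (1 + z * z)" and b: "sqrt_iter 1 (Suc n) = (1/2) * (1 + y * y)"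
        by (simp_all only: z_def y_def real_scaleR_def sqrt_iter.simps(2)[of 1 "Suc n"] sqrt_iter.simps(2)[of 1 n])
      show ?thesis unfolding a b by (simp add: algebra_simps)
    qed
    finally show ?case .
  qed
qed

text \<open>The scalar increments are nonnegative and telescope to at most 1, so the operator
  iterates converge in norm even when \<open>norm C = 1\<close>. Self-adjointness and commutation
  relations pass to the limit.\<close>

lemma sqrt_one_minus:
  fixes C :: "'a::euclidean_space bop"
  assumes C: "norm C <= 1" "adj C = C"
  shows "EX D. pos D & D * D = 1 - C & (ALL B. B * C = C * B --> B * D = D * B)"
proof -
  let ?Y = "sqrt_iter C"
  have "summable (%n. sqrt_iter (1::real) (Suc n) - sqrt_iter 1 n)"
  proof (rule bounded_imp_summable)
    show "0 <= sqrt_iter (1::real) (Suc n) - sqrt_iter 1 n" for n using sqrt_iter_one(3)[of n] by simp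
    show "(\<Sum>k\<le>n. sqrt_iter (1::real) (Suc k) - sqrt_iter 1 k) <= 1" for n
      using sqrt_iter_one(2)[of "Suc n"] unfolding lessThan_Suc_atMost[symmetric] sum_lessThan_telescope by simp
  qed
  then have "summable (%n. ?Y (Suc n) - ?Y n)"
    by (rule summable_comparison_test'[where N = 0]) (rule sqrt_iter_norm(2)[OF C(1)])
  then have "convergent (%n. \<Sum>i<n. ?Y (Suc i) - ?Y i)"
    by (rule summable_iff_convergent[THEN iffD1])
  then have "convergent ?Y" unfolding sum_lessThan_telescope by simp
  then obtain L where L: "?Y \<longlonglongrightarrow> L" by (auto simp: convergent_def)
  have "(%n. (1/2) *\<^sub>R (C + ?Y n * ?Y n)) \<longlonglongrightarrow> (1/2) *\<^sub>R (C + L * L)" by (intro tendsto_intros L)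
  moreover have "(%n. (1/2) *\<^sub>R (C + ?Y n * ?Y n)) \<longlonglongrightarrow> L" using LIMSEQ_Suc[OF L] by simp
  ultimately have "(1/2) *\<^sub>R (C + L * L) = L" by (rule LIMSEQ_unique)
  then have "2 *\<^sub>R L = C + L * L" by (metis scaleR_half_double scaleR_2 scaleR_add_right)
  then have sq: "(1 - L) * (1 - L) = 1 - C" by (simp add: algebra_simps scaleR_2)
  have "(%n. norm (?Y n)) \<longlonglongrightarrow> norm L" by (intro tendsto_intros L)
  then have nL: "norm L <= 1"
    by (rule LIMSEQ_le_const2) (meson sqrt_iter_norm(1)[OF C(1)] sqrt_iter_one(2) order.trans)
  have "adj (?Y n) = ?Y n" for n by (induction n) (simp_all add: C(2))
  then have "(%n. ?Y n) \<longlonglongrightarrow> adj L" using tendsto_adj[OF L] by simp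
  then have adjL: "adj L = L" using L LIMSEQ_unique by blast
  have "pos (1 - L)"
    unfolding pos_def
  proof (intro conjI allI)
    show "adj (1 - L) = 1 - L" using adjL by simp
    fix x
    have "Re (cinner (L @@ x) x) <= norm L * (norm x)\<^sup>2" using Re_cinner_app_le[of L x] by simp
    also have "\<dots> <= 1 * (norm x)\<^sup>2" by (intro mult_right_mono nL) simp
    finally show "0 <= Re (cinner ((1 - L) @@ x) x)" by (simp add: cinner_simps Re_cinner_self)
  qed
  moreover have "B * (1 - L) = (1 - L) * B" if B: "B * C = C * B" for B
  proof -
    have "(%n. B * ?Y n) \<longlonglongrightarrow> B * L" "(%n. ?Y n * B) \<longlonglongrightarrow> L * B" by (intro tendsto_intros L)+
    then have "B * L = L * B" unfolding sqrt_iter_commute[OF B] by (rule LIMSEQ_unique)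
    then show ?thesis by (simp add: algebra_simps)
  qed
  ultimately show ?thesis using sq by blast
qed

lemma pos_sqrt_exists:
  fixes S :: "'a::euclidean_space bop"
  assumes S: "pos S"
  shows "EX D. pos D & D * D = S & (ALL B. B * S = S * B --> B * D = D * B)"
proof -
  \<comment> \<open>As quadratic forms 0 <= S <= c, so \<open>1 - (1/c) *\<^sub>R S\<close> is a
    contraction and the iteration applies to it; the summand 1 keeps \<open>c\<close> positive when
    \<open>S = 0\<close>.\<close>
  define c where "c = norm S + 1"
  have c: "0 < c" by (simp add: c_def add_nonneg_pos)
  define C where "C = 1 - (1/c) *\<^sub>R S"
  have adjC: "adj C = C" using pos_adj[OF S] by (simp add: C_def)
  have "norm C <= 1"
  proof (rule norm_selfadj_le[OF adjC])
    fix x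
    have "Re (cinner (S @@ x) x) <= c * (norm x)\<^sup>2"
      using Re_cinner_app_le[of S x] zero_le_power2[of "norm x"] unfolding c_def distrib_right by linarith
    then have "Re (cinner (S @@ x) x) / c <= (norm x)\<^sup>2" using c by (simp add: field_simps)
    moreover have "0 <= Re (cinner (S @@ x) x) / c" using c pos_ge[OF S] by simp
    ultimately have "\<bar>(norm x)\<^sup>2 - Re (cinner (S @@ x) x) / c\<bar> <= (norm x)\<^sup>2" by linarith
    then show "\<bar>Re (cinner (C @@ x) x)\<bar> <= 1 * (norm x)\<^sup>2"
      by (simp add: C_def cinner_simps Re_cinner_self)
  qed simp
  from sqrt_one_minus[OF this adjC] obtain D where D: "pos D" "D * D = 1 - C"
    "!!B. B * C = C * B ==> B * D = D * B" by blast
  have "(sqrt c *\<^sub>R D) * (sqrt c *\<^sub>R D) = S"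
    using c by (simp add: D(2)) (simp add: C_def)
  moreover have "pos (sqrt c *\<^sub>R D)" using c by (intro pos_scaleR D) simp
  moreover have "B * (sqrt c *\<^sub>R D) = (sqrt c *\<^sub>R D) * B" if "B * S = S * B" for B
    using D(3)[of B] that by (simp add: C_def algebra_simps)
  ultimately show ?thesis by blast
qed

definition bsqrt :: "'a::euclidean_space bop => 'a bop" where
  "bsqrt S = (SOME D. pos D & D * D = S & (ALL B. B * S = S * B --> B * D = D * B))"

lemma bsqrt: assumes "pos S"
  shows pos_bsqrt: "pos (bsqrt S)" and bsqrt_square: "bsqrt S * bsqrt S = S"
    and bsqrt_commute: "B * S = S * B ==> B * bsqrt S = bsqrt S * B"
  using someI_ex[OF pos_sqrt_exists[OF assms]] unfolding bsqrt_def by auto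

lemma bsqrt_app_sq: "pos S ==> of_real ((norm (bsqrt S @@ x))\<^sup>2) = cinner (S @@ x) x"
  by (metis bsqrt_square norm_app_sq pos_adj pos_bsqrt)

lemma pos_app_zero: "pos S ==> Re (cinner (S @@ x) x) = 0 ==> S @@ x = 0"
proof -
  assume S: "pos S" and z: "Re (cinner (S @@ x) x) = 0"
  have "bsqrt S @@ x = 0"
    using arg_cong[OF bsqrt_app_sq[OF S, of x], of Re] z by simp
  then show ?thesis by (metis app_times app_zero bsqrt_square[OF S])
qed

text \<open>The root of \<open>S\<close> commutes with \<open>T\<close>, so the form of the product
  is that of \<open>T\<close> evaluated at the image of \<open>x\<close> under the root.\<close>

lemma pos_times: "pos S ==> pos T ==> S * T = T * S ==> pos (S * T)"
proof -
  assume S: "pos S" and T: "pos T" and c: "S * T = T * S"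
  define D where "D = bsqrt S"
  have D: "adj D = D" "D * D = S" "T * D = D * T"
    using pos_adj[OF pos_bsqrt[OF S]] bsqrt_square[OF S] bsqrt_commute[OF S, of T] c by (auto simp: D_def)
  have "S * T = D * T * D" using D by (metis mult.assoc)
  then have "cinner ((S * T) @@ x) x = cinner (T @@ (D @@ x)) (D @@ x)" for x
    using D(1) by (simp add: adj_left)
  then show ?thesis using pos_ge[OF T] pos_adj[OF S] pos_adj[OF T] c by (simp add: pos_def)
qed

text \<open>Two commuting positive roots \<open>C\<close> and \<open>D\<close> satisfy (C + D)(C -
  D) = 0. On a vector E x with E = C - D both forms are nonnegative with sum 0, so \<open>C\<close>
  and \<open>D\<close> annihilate it; hence E E x = 0, and E x = 0 by self-adjointness.\<close>

lemma bsqrt_unique: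
  assumes D: "pos D" and S: "D * D = S"
  shows "D = bsqrt S"
proof -
  define C where "C = bsqrt S"
  have pS: "pos S" using pos_square[OF pos_adj[OF D]] S by simp
  have C: "pos C" "C * C = S" using pos_bsqrt[OF pS] bsqrt_square[OF pS] by (simp_all add: C_def)
  have "D * S = S * D" by (simp add: S[symmetric] mult.assoc)
  then have com: "D * C = C * D" using bsqrt_commute[OF pS] by (simp add: C_def)
  define E where "E = C - D"
  have adjE: "adj E = E" using C D by (simp add: E_def pos_adj)
  have "(C + D) * E = 0" using C(2) S com by (simp add: E_def algebra_simps)
  have "E @@ x = 0" for x
  proof -
    have "cinner (C @@ (E @@ x)) (E @@ x) + cinner (D @@ (E @@ x)) (E @@ x) = cinner (((C + D) * E) @@ x) (E @@ x)"
      by (simp add: cinner_simps)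
    then have "Re (cinner (C @@ (E @@ x)) (E @@ x)) + Re (cinner (D @@ (E @@ x)) (E @@ x)) = 0"
      using \<open>(C + D) * E = 0\<close> by (metis app_zero_left cinner_zero_left plus_complex.simps(1) zero_complex.simps(1))
    then have "Re (cinner (C @@ (E @@ x)) (E @@ x)) = 0" "Re (cinner (D @@ (E @@ x)) (E @@ x)) = 0"
      using pos_ge[OF C(1), of "E @@ x"] pos_ge[OF D, of "E @@ x"] by linarith+
    then have "C @@ (E @@ x) = 0" "D @@ (E @@ x) = 0" using pos_app_zero C(1) D by blast+
    then have "E @@ (E @@ x) = 0" by (simp add: E_def)
    then have "cinner (E @@ x) (E @@ x) = 0" using adjE by (metis adj_right cinner_zero_right)
    then show ?thesis by (simp add: cinner_self)
  qed
  then have "E = 0" by (intro bop_eqI) simp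
  then show ?thesis by (simp add: E_def C_def)
qed

text \<open>A Neumann series: after division by \<open>norm R + e\<close> the operator
  \<open>R + e *\<^sub>R 1\<close> differs from 1 by at most 1 - e / c. It supplies the regularised
  inverse in the trace estimate.\<close>

lemma pos_inverse_exists:
  fixes R :: "'a::euclidean_space bop"
  assumes R: "pos R" and e: "0 < e"
  shows "EX J. (R + e *\<^sub>R 1) * J = 1 & J * (R + e *\<^sub>R 1) = 1"
proof -
  define c where "c = norm R + e"
  have c: "0 < c" using e by (simp add: c_def add_nonneg_pos)
  define x where "x = 1 - (1/c) *\<^sub>R (R + e *\<^sub>R 1)"
  have adjx: "adj x = x" using pos_adj[OF R] by (simp add: x_def)
  have "norm x <= 1 - e / c"
  proof (rule norm_selfadj_le[OF adjx])
    fix v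
    have l: "Re (cinner (x @@ v) v) = (norm v)\<^sup>2 - (Re (cinner (R @@ v) v) + e * (norm v)\<^sup>2) / c"
      by (simp add: x_def cinner_simps Re_cinner_self cinner_self add_divide_distrib algebra_simps)
    have "Re (cinner (R @@ v) v) + e * (norm v)\<^sup>2 <= c * (norm v)\<^sup>2"
      using Re_cinner_app_le[of R v] unfolding c_def distrib_right by linarith
    then have "(Re (cinner (R @@ v) v) + e * (norm v)\<^sup>2) / c <= (norm v)\<^sup>2" using c by (simp add: field_simps)
    moreover have "e * (norm v)\<^sup>2 / c <= (Re (cinner (R @@ v) v) + e * (norm v)\<^sup>2) / c"
      using c pos_ge[OF R, of v] by (intro divide_right_mono) auto
    moreover have "(1 - e / c) * (norm v)\<^sup>2 = (norm v)\<^sup>2 - e * (norm v)\<^sup>2 / c" by (simp add: algebra_simps)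
    ultimately show "\<bar>Re (cinner (x @@ v) v)\<bar> <= (1 - e / c) * (norm v)\<^sup>2" unfolding l by linarith
  next
    have "e <= c" by (simp add: c_def)
    then show "0 <= 1 - e / c" using c by simp
  qed
  also have "\<dots> < 1" using e c by simp
  finally have "summable (%n. x ^ n)" by (rule complete_algebra_summable_geometric)
  then obtain s where s: "(%n. x ^ n) sums s" by (auto simp: summable_def)
  have "(%n. x ^ Suc n) sums (s - x ^ 0)" using s by (subst sums_Suc_iff) simp
  then have s': "(%n. x ^ Suc n) sums (s - 1)" by simp
  have "(%n. x * x ^ n) sums (x * s)" by (rule sums_mult[OF s])
  then have "x * s = s - 1" using s' sums_unique2 by (metis (no_types, lifting) power_Suc sums_cong)
  moreover have "(%n. x ^ n * x) sums (s * x)" by (rule sums_mult2[OF s])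
  then have "s * x = s - 1" using s' sums_unique2 by (metis (no_types, lifting) power_Suc2 sums_cong)
  ultimately have 1: "(1 - x) * s = 1" "s * (1 - x) = 1" by (simp_all add: algebra_simps)
  have "R + e *\<^sub>R 1 = c *\<^sub>R (1 - x)" using c by (simp add: x_def)
  then show ?thesis using 1 c by (intro exI[of _ "(1/c) *\<^sub>R s"]) simp
qed

subsection \<open>Projections\<close>

definition proj :: "'a::euclidean_space bop => bool" where
  "proj P \<longleftrightarrow> adj P = P & P * P = P"

text \<open>The projection sends \<open>x\<close> to the representer of
  \<open>ph \<mapsto> inner ph x\<close> on \<open>M\<close>; stability of \<open>M\<close> under
  complex scalars upgrades the real identity to one for \<open>cinner\<close>.\<close>

lemma proj_exists:
  fixes M :: "'a::euclidean_space L2 set"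
  assumes M: "subspace M" "closed M" and C: "!!c x. x \<in> M ==> c *\<^sub>C x \<in> M"
  shows "EX P. proj P & (ALL x. P @@ x \<in> M) & (ALL x:M. P @@ x = x)"
proof -
  have "EX th:M. ALL ph:M. cinner ph x = cinner ph th" for x
  proof -
    obtain th where th: "th \<in> M" "!!ph. ph \<in> M ==> inner ph x = inner ph th"
      using riesz_subspace[OF M bounded_linear_inner_left[of x]] by blast
    have "cinner ph x = cinner ph th" if "ph \<in> M" for ph
      using th(2)[OF that] th(2)[OF C[OF that, of \<i>]]
      by (simp add: inner_eq_Re_cinner cinner_simps complex_eq_iff)
    then show ?thesis using th(1) by blast
  qed
  then obtain f where f: "!!x. f x \<in> M" "!!x ph. ph \<in> M ==> cinner ph x = cinner ph (f x)" by metis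
  have uniq: "f x = y" if "y \<in> M" "!!ph. ph \<in> M ==> cinner ph x = cinner ph y" for x y
  proof -
    have "f x - y \<in> M" using M f(1) that(1) by (simp add: subspace_diff)
    then have "cinner (f x - y) (f x) = cinner (f x - y) y" using f(2) that(2) by metis
    then have "cinner (f x - y) (f x - y) = 0" by (simp add: cinner_diff_right)
    then show ?thesis by (simp add: cinner_self)
  qed
  have "EX P. ALL x. P @@ x = f x"
  proof (rule bop_exists[of _ 1])
    show "f (x + y) = f x + f y" for x y
      by (rule uniq) (simp_all add: subspace_add[OF M(1)] f(1) cinner_add_right f(2)[symmetric])
    show "f (c *\<^sub>C x) = c *\<^sub>C f x" for c x
      by (rule uniq) (simp_all add: C f(1) cinner_scaleC_right f(2)[symmetric])
    show "norm (f x) <= 1 * norm x" for x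
    proof -
      have "norm (f x) * norm (f x) = cmod (cinner (f x) (f x))"
        by (simp add: cinner_self norm_mult power2_eq_square)
      also have "\<dots> = cmod (cinner (f x) x)" using f by metis
      also have "\<dots> <= norm (f x) * norm x" by (rule cmod_cinner_le)
      finally show ?thesis by (cases "norm (f x) = 0") (auto simp: mult_le_cancel_left)
    qed
  qed
  then obtain P where P: "!!x. P @@ x = f x" by blast
  have fM: "f x = x" if "x \<in> M" for x using that by (intro uniq) auto
  have "adj P = P"
  proof (rule adj_unique)
    fix x y
    have "cinner (f x) y = cinner (f x) (f y)" by (rule f(2)[OF f(1)])
    also have "\<dots> = cinner x (f y)" using f(2)[OF f(1), of y x] by (metis cinner_commute)
    finally show "cinner (P @@ x) y = cinner x (P @@ y)" by (simp add: P)
  qed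
  moreover have "P * P = P" by (rule bop_eqI) (simp add: P fM f)
  ultimately show ?thesis using f fM by (intro exI[of _ P]) (auto simp: proj_def P)
qed

lemma proj_diag: "proj P ==> cinner (P @@ x) x = of_real ((norm (P @@ x))\<^sup>2)"
  using norm_app_sq[of P x] by (simp add: proj_def)

lemma proj_compl: "proj P ==> proj (1 - P)"
  by (simp add: proj_def algebra_simps)

lemma proj_pythagoras: "proj P ==> (norm x)\<^sup>2 = (norm (P @@ x))\<^sup>2 + (norm ((1 - P) @@ x))\<^sup>2"
proof -
  assume P: "proj P"
  have "complex_of_real ((norm x)\<^sup>2) = cinner (P @@ x) x + cinner ((1 - P) @@ x) x"
    by (simp add: cinner_simps cinner_self)
  also have "\<dots> = of_real ((norm (P @@ x))\<^sup>2 + (norm ((1 - P) @@ x))\<^sup>2)"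
    using proj_diag[OF P] proj_diag[OF proj_compl[OF P]] by simp
  finally show ?thesis using of_real_eq_iff by blast
qed

lemma proj_norm_le: "proj P ==> norm (P @@ x) <= norm x"
proof -
  assume "proj P"
  then have "(norm (P @@ x))\<^sup>2 <= (norm x)\<^sup>2" using proj_pythagoras[of P x] by simp
  then show ?thesis by (rule power2_le_imp_le) simp
qed

lemma kernel_proj_exists:
  fixes T :: "'a::euclidean_space bop"
  shows "EX P. proj P & T * P = 0 & (ALL x. T @@ x = 0 --> P @@ x = x)"
proof -
  have "closed {x. T @@ x = 0}"
    by (intro closed_Collect_eq continuous_on_app continuous_intros)
  moreover have "subspace {x. T @@ x = 0}"
    by (auto simp: subspace_def app_add app_scaleR)
  ultimately obtain P where "proj P" "!!x. P @@ x \<in> {x. T @@ x = 0}" "!!x. x \<in> {x. T @@ x = 0} ==> P @@ x = x"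
    using proj_exists[of "{x. T @@ x = 0}"] by (auto simp: app_scaleC)
  then show ?thesis by (intro exI[of _ P]) (auto intro!: bop_eqI)
qed

section \<open>Functional calculus of a projection-valued measure\<close>

definition bounded_borel :: "(real => complex) => bool" where
  "bounded_borel g \<longleftrightarrow> g \<in> borel_measurable borel & (EX K. ALL x. cmod (g x) <= K)"

lemma bounded_borel_measurable [measurable_dest]: "bounded_borel g ==> g \<in> borel_measurable borel"
  by (simp add: bounded_borel_def)

lemma bounded_borelI:
  "g \<in> borel_measurable borel ==> (!!x. cmod (g x) <= K) ==> bounded_borel g"
  by (auto simp: bounded_borel_def)

lemma bounded_borelE:
  assumes "bounded_borel g"
  obtains K where "g \<in> borel_measurable borel" "!!x. cmod (g x) <= K" "0 <= K"
  using assms norm_ge_zero order.trans unfolding bounded_borel_def by metis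

lemma bounded_borel_const: "bounded_borel (%x. c)"
  by (rule bounded_borelI[of _ "cmod c"]) auto

lemma bounded_borel_indicator: "A \<in> sets borel ==> bounded_borel (%x. of_real (indicator A x))"
  by (rule bounded_borelI[of _ 1]) (auto simp: indicator_def)

lemma bounded_borel_add: assumes "bounded_borel f" "bounded_borel g"
  shows "bounded_borel (%x. f x + g x)"
proof -
  obtain K L where K: "f \<in> borel_measurable borel" "!!x. cmod (f x) <= K"
    and L: "g \<in> borel_measurable borel" "!!x. cmod (g x) <= L"
    using assms unfolding bounded_borel_def by metis
  show ?thesis
    by (rule bounded_borelI[of _ "K + L"])
       (use K(1) L(1) order.trans[OF norm_triangle_ineq add_mono[OF K(2) L(2)]] in auto)
qed

lemma bounded_borel_mult: assumes "bounded_borel f" "bounded_borel g"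
  shows "bounded_borel (%x. f x * g x)"
proof -
  obtain K where K: "f \<in> borel_measurable borel" "!!x. cmod (f x) <= K" "0 <= K"
    using bounded_borelE[OF assms(1)] by metis
  obtain L where L: "g \<in> borel_measurable borel" "!!x. cmod (g x) <= L"
    using bounded_borelE[OF assms(2)] by metis
  show ?thesis
    by (rule bounded_borelI[of _ "K * L"])
       (use K L(1) mult_mono[OF K(2) L(2) K(3) norm_ge_zero] in \<open>auto simp: norm_mult\<close>)
qed

lemma bounded_borel_cmult: "bounded_borel f ==> bounded_borel (%x. c * f x)"
  by (rule bounded_borel_mult[OF bounded_borel_const])

lemma bounded_borel_diff: "bounded_borel f ==> bounded_borel g ==> bounded_borel (%x. f x - g x)"
  using bounded_borel_add[of f "%x. (-1) * g x"] bounded_borel_cmult[of g "-1"] by simp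

lemma bounded_borel_cnj: "bounded_borel f ==> bounded_borel (%x. cnj (f x))"
  by (auto simp: bounded_borel_def)

lemma bounded_borel_sum:
  "finite I ==> (!!i. i \<in> I ==> bounded_borel (f i)) ==> bounded_borel (%x. \<Sum>i\<in>I. f i x)"
  by (induction I rule: finite_induct) (auto intro: bounded_borel_const bounded_borel_add)

text \<open>Rounding the real and imaginary parts down to multiples of 1 / (n + 1) gives a uniform
  approximation, and boundedness leaves finitely many levels. The explicit rate in the last case
  matches the operator norm bounds of the calculus, so no almost-everywhere argument is needed
  there.\<close>

lemma bounded_borel_induct [consumes 1, case_names indicator add cmult lim]:
  assumes g: "bounded_borel g"
  assumes ind: "!!A. A \<in> sets borel ==> Q (%x. of_real (indicator A x))"
    and add: "!!f h. bounded_borel f ==> bounded_borel h ==> Q f ==> Q h ==> Q (%x. f x + h x)"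
    and cmult: "!!f c. bounded_borel f ==> Q f ==> Q (%x. c * f x)"
    and lim: "!!f h. (!!n. bounded_borel (f n)) ==> (!!n. Q (f n)) ==> bounded_borel h ==>
      (!!n x. cmod (f n x - h x) <= 1 / (real n + 1)) ==> Q h"
  shows "Q g"
proof -
  have zero: "Q (%x. 0)" using ind[of "{}"] by simp
  have sum: "Q (%x. \<Sum>i\<in>I. f i x)" if "finite I" "!!i. i \<in> I ==> bounded_borel (f i)" "!!i. i \<in> I ==> Q (f i)"
    for I :: "int set" and f
    using that
    by (induction I rule: finite_induct) (auto intro!: zero add bounded_borel_sum)
  have real: "Q (%x. of_real (u x))" if u: "u \<in> borel_measurable borel" "!!x. \<bar>u x\<bar> <= M" for u :: "real => real" and M
  proof -
    \<comment> \<open>The margin 1 on both sides makes room for the rounding of the floor.\<close>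
    define J where "J n = {- \<lceil>(real n + 1) * M\<rceil> - 1 .. \<lceil>(real n + 1) * M\<rceil> + 1}" for n :: nat
    define F where "F n j = (%x. of_real (real_of_int j / (real n + 1)) *
        complex_of_real (indicator {x. \<lfloor>(real n + 1) * u x\<rfloor> = j} x))" for n j
    have meas: "{x. \<lfloor>(real n + 1) * u x\<rfloor> = j} \<in> sets borel" for n :: nat and j
      using u(1) by measurable
    have F: "bounded_borel (F n j)" "Q (F n j)" for n j
      unfolding F_def by (intro bounded_borel_cmult cmult bounded_borel_indicator ind meas)+
    have eq: "(\<Sum>j\<in>J n. F n j x) = of_real (real_of_int \<lfloor>(real n + 1) * u x\<rfloor> / (real n + 1))" for n x
    proof -
      have "\<bar>(real n + 1) * u x\<bar> <= (real n + 1) * M"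
        using u(2)[of x] by (simp add: abs_mult mult_left_mono)
      then have "\<lfloor>(real n + 1) * u x\<rfloor> \<in> J n" unfolding J_def by simp linarith
      moreover have "(\<Sum>j\<in>J n. F n j x) = (\<Sum>j\<in>J n. if j = \<lfloor>(real n + 1) * u x\<rfloor> then of_real (real_of_int j / (real n + 1)) else 0)"
        by (intro sum.cong) (auto simp: F_def)
      moreover have "finite (J n)" by (simp add: J_def)
      ultimately show ?thesis by (simp add: sum.delta')
    qed
    show ?thesis
    proof (rule lim[of "%n x. \<Sum>j\<in>J n. F n j x"])
      show "bounded_borel (%x. \<Sum>j\<in>J n. F n j x)" "Q (%x. \<Sum>j\<in>J n. F n j x)" for n
        by (intro bounded_borel_sum sum F; simp add: J_def)+
      show "bounded_borel (%x. of_real (u x))"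
        by (rule bounded_borelI[of _ M]) (use u in auto)
      show "cmod ((\<Sum>j\<in>J n. F n j x) - of_real (u x)) <= 1 / (real n + 1)" for n x
      proof -
        have "cmod ((\<Sum>j\<in>J n. F n j x) - of_real (u x)) = \<bar>real_of_int \<lfloor>(real n + 1) * u x\<rfloor> / (real n + 1) - u x\<bar>"
          unfolding eq of_real_diff[symmetric] norm_of_real ..
        also have "\<dots> = \<bar>real_of_int \<lfloor>(real n + 1) * u x\<rfloor> - (real n + 1) * u x\<bar> / (real n + 1)"
          by (simp add: field_simps abs_divide[symmetric] del: abs_divide)
        also have "\<dots> <= 1 / (real n + 1)" by (intro divide_right_mono) linarith+
        finally show ?thesis .
      qed
    qed
  qed
  obtain K where K: "g \<in> borel_measurable borel" "!!x. cmod (g x) <= K" using bounded_borelE[OF g] by metis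
  have re: "\<bar>Re (g x)\<bar> <= K" and im: "\<bar>Im (g x)\<bar> <= K" for x
    using K(2)[of x] abs_Re_le_cmod[of "g x"] abs_Im_le_cmod[of "g x"] by linarith+
  have b: "bounded_borel (%x. of_real (Re (g x)))" "bounded_borel (%x. of_real (Im (g x)))"
    by (rule bounded_borelI[of _ K]; use K(1) re im in auto)+
  have "Q (%x. of_real (Re (g x)) + \<i> * of_real (Im (g x)))"
    by (intro add cmult bounded_borel_cmult b real[of _ K]) (use K(1) re im in auto)
  then show ?thesis unfolding complex_eq[symmetric] .
qed

section \<open>Projection-valued measures and their scalar measures\<close>

locale pvm =
  fixes P :: "real set => 'a::euclidean_space L2 => 'a L2"
  assumes pvm: "projection_valued_measure P"
begin

lemma P_ortho: "A \<in> sets borel ==> orthogonal_projection (P A)"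
  using pvm by (simp add: projection_valued_measure_def)

lemma P_bop: "A \<in> sets borel ==> EX T. ALL x. T @@ x = P A x"
proof -
  assume "A \<in> sets borel"
  from P_ortho[OF this] have b: "bounded_oper (graph_of (P A))" by (simp add: orthogonal_projection_def)
  then obtain K where K: "ALL (ph, et):graph_of (P A). norm et <= K * norm ph" by (auto simp: bounded_oper_def)
  show ?thesis
  proof (rule bop_exists)
    show "norm (P A x) <= K * norm x" for x using K by (auto simp: graph_of_def)
    show "P A (x + y) = P A x + P A y" "P A (c *\<^sub>C x) = c *\<^sub>C P A x" for c x y
      using b by (auto simp: bounded_oper_def linear_oper_def graph_of_def)
  qed
qed

definition E :: "real set => 'a bop" where "E A = (SOME T. ALL x. T @@ x = P A x)"

lemma E_app: "A \<in> sets borel ==> E A @@ x = P A x"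
  using someI_ex[OF P_bop[of A]] by (simp add: E_def)

lemma E_proj: "A \<in> sets borel ==> proj (E A)"
proof -
  assume A: "A \<in> sets borel"
  have "adj (E A) = E A"
    using P_ortho[OF A] by (intro adj_unique) (simp add: E_app[OF A] orthogonal_projection_def)
  moreover have "E A * E A = E A"
    using P_ortho[OF A] by (intro bop_eqI) (simp add: E_app[OF A] orthogonal_projection_def)
  ultimately show ?thesis by (simp add: proj_def)
qed

lemma E_UNIV: "E UNIV = 1"
  using pvm by (intro bop_eqI) (simp add: E_app projection_valued_measure_def)

lemma E_sums:
  "range A \<subseteq> sets borel ==> disjoint_family A ==> (%k. E (A k) @@ ph) sums (E (\<Union>k. A k) @@ ph)"
proof -
  assume A: "range A \<subseteq> sets borel" "disjoint_family A"
  then have "(%k. P (A k) ph) sums P (\<Union>k. A k) ph"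
    using pvm by (simp add: projection_valued_measure_def)
  moreover have "A k \<in> sets borel" "(\<Union>k. A k) \<in> sets borel" for k using A(1) by auto
  ultimately show ?thesis by (simp add: E_app)
qed

lemma E_empty: "E {} = 0"
proof (rule bop_eqI)
  fix x
  have "(%k::nat. E {} @@ x) sums (E {} @@ x)"
    using E_sums[of "%k. {}" x] by (simp add: disjoint_family_on_def)
  then have "(%k::nat. E {} @@ x) \<longlonglongrightarrow> 0" by (intro summable_LIMSEQ_zero sums_summable)
  then show "E {} @@ x = 0 @@ x" by (simp add: LIMSEQ_const_iff)
qed

lemma E_Un: "A \<in> sets borel ==> B \<in> sets borel ==> A \<inter> B = {} ==> E (A \<union> B) = E A + E B"
proof (rule bop_eqI)
  fix x assume A: "A \<in> sets borel" "B \<in> sets borel" "A \<inter> B = {}"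
  have "(%k. E (binaryset A B k) @@ x) sums (E (\<Union>k. binaryset A B k) @@ x)"
    using A by (intro E_sums) (auto simp: disjoint_family_on_def binaryset_def)
  moreover have "(%k. E (binaryset A B k) @@ x) sums (E A @@ x + E B @@ x)"
    by (rule binaryset_sums) (simp add: E_empty)
  ultimately show "E (A \<union> B) @@ x = (E A + E B) @@ x"
    unfolding UN_binaryset_eq by (simp add: sums_unique2)
qed

text \<open>Pure algebra: \<open>a\<close>, \<open>b\<close> and \<open>a + b\<close> are
  idempotent, hence a b = - b a; multiplying by \<open>a\<close> turns this into a b = b a, so a b =
  0.\<close>

lemma E_disjoint: assumes A: "A \<in> sets borel" "B \<in> sets borel" "A \<inter> B = {}"
  shows "E A * E B = 0"
proof -
  define a b where "a = E A" and "b = E B"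
  have p: "a * a = a" "b * b = b" "(a + b) * (a + b) = a + b"
    using E_proj[OF A(1)] E_proj[OF A(2)] E_proj[of "A \<union> B"] E_Un[OF A] A by (auto simp: proj_def a_def b_def)
  then have ab: "a * b = - (b * a)" by (simp add: algebra_simps) (metis add.commute add_eq_0_iff)
  have "a * b = a * (a * b)" by (metis mult.assoc p(1))
  also have "\<dots> = a * (- (b * a))" by (simp only: ab)
  also have "\<dots> = - ((a * b) * a)" by (simp add: mult.assoc)
  also have "\<dots> = - ((- (b * a)) * a)" by (simp only: ab)
  also have "\<dots> = b * a" by (simp add: mult.assoc p(1))
  finally have e: "a * b = b * a" .
  have "a * b = - (a * b)" using ab unfolding e .
  then have "2 *\<^sub>R (a * b) = 0" by (simp add: eq_neg_iff_add_eq_0 scaleR_2)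
  then show ?thesis by (simp add: a_def b_def)
qed

lemma E_Int: assumes A: "A \<in> sets borel" "B \<in> sets borel"
  shows "E A * E B = E (A \<inter> B)"
proof -
  have 1: "E A = E (A \<inter> B) + E (A - B)" using E_Un[of "A \<inter> B" "A - B"] A by (simp add: Int_Diff_Un Int_Diff_disjoint)
  have 2: "E B = E (A \<inter> B) + E (B - A)"
    using E_Un[of "A \<inter> B" "B - A"] A by (metis Int_Diff_Un Int_Diff_disjoint Int_commute sets.Diff sets.Int)
  have 3: "E (A \<inter> B) * E (B - A) = 0" "E (A - B) * E (A \<inter> B) = 0" "E (A - B) * E (B - A) = 0"
    using A by (auto intro!: E_disjoint)
  have "E (A \<inter> B) * E (A \<inter> B) = E (A \<inter> B)" using E_proj[of "A \<inter> B"] A by (simp add: proj_def)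
  then show ?thesis by (subst 1, subst 2) (simp add: distrib_left distrib_right 3)
qed

abbreviation \<mu> :: "'a L2 => real measure" where "\<mu> \<equiv> spectral_scalar_measure P"

lemma E_diag: "A \<in> sets borel ==> Re (cinner (P A ph) ph) = (norm (E A @@ ph))\<^sup>2"
  using proj_diag[OF E_proj, of A ph] by (simp add: E_app)

lemma E_diag_cinner: "A \<in> sets borel ==> cinner (P A ph) ph = of_real ((norm (E A @@ ph))\<^sup>2)"
  using proj_diag[OF E_proj, of A ph] by (simp add: E_app)

lemma space_mu [simp]: "space (\<mu> ph) = UNIV" and sets_mu [simp, measurable_cong]: "sets (\<mu> ph) = sets borel"
  by (simp_all add: spectral_scalar_measure_def space_measure_of_conv sets.sigma_sets_eq[of borel, simplified])

lemma emeasure_mu: "A \<in> sets borel ==> emeasure (\<mu> ph) A = ennreal ((norm (E A @@ ph))\<^sup>2)"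
proof -
  assume A: "A \<in> sets borel"
  have "emeasure (\<mu> ph) A = ennreal (Re (cinner (P A ph) ph))"
  proof (rule emeasure_measure_of[OF spectral_scalar_measure_def])
    show "sets borel \<subseteq> Pow (UNIV :: real set)" by simp
    show "A \<in> sets (\<mu> ph)" using A by simp
    show "positive (sets (\<mu> ph)) (%A. ennreal (Re (cinner (P A ph) ph)))"
      using E_app[of "{}" ph] by (simp add: positive_def E_empty)
    show "countably_additive (sets (\<mu> ph)) (%A. ennreal (Re (cinner (P A ph) ph)))"
    proof (rule countably_additiveI)
      fix A :: "nat => real set" assume A: "range A \<subseteq> sets (\<mu> ph)" "disjoint_family A"
      then have "(%k. P (A k) ph) sums P (\<Union>k. A k) ph" using pvm by (simp add: projection_valued_measure_def)
      then have "(%k. Re (cinner (P (A k) ph) ph)) sums Re (cinner (P (\<Union>k. A k) ph) ph)"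
        using bounded_linear.sums[OF bounded_linear_inner_left[of ph]] unfolding inner_eq_Re_cinner by blast
      moreover have "A k \<in> sets borel" for k using A by auto
      then have "0 <= Re (cinner (P (A k) ph) ph)" for k by (simp add: E_diag)
      ultimately show "(\<Sum>i. ennreal (Re (cinner (P (A i) ph) ph))) = ennreal (Re (cinner (P (\<Union>k. A k) ph) ph))"
        by (intro suminf_ennreal_eq)
    qed
  qed
  then show ?thesis using A by (simp add: E_diag)
qed

lemma finite_mu: "finite_measure (\<mu> ph)"
  by (rule finite_measureI) (simp add: emeasure_mu)

lemma measure_mu: "A \<in> sets borel ==> measure (\<mu> ph) A = (norm (E A @@ ph))\<^sup>2"
  by (simp add: measure_def emeasure_mu)

lemma measure_mu_UNIV: "measure (\<mu> ph) UNIV = (norm ph)\<^sup>2"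
  by (simp add: measure_mu E_UNIV)

lemma integrable_bounded_borel: "bounded_borel g ==> integrable (\<mu> ph) g"
proof -
  assume "bounded_borel g"
  then obtain K where K: "g \<in> borel_measurable borel" "!!x. cmod (g x) <= K" using bounded_borelE by metis
  show ?thesis
  proof (rule finite_measure.integrable_const_bound[OF finite_mu, of _ K])
    show "g \<in> borel_measurable (\<mu> ph)" using K(1) unfolding measurable_cong_sets[OF sets_mu refl] .
  qed (use K in auto)
qed

lemma integrable_norm_sq: "bounded_borel g ==> integrable (\<mu> ph) (%x. (cmod (g x))\<^sup>2)"
  using integrable_Re[OF integrable_bounded_borel[OF bounded_borel_mult[OF _ bounded_borel_cnj]], of g g ph]
  by (simp add: complex_norm_square[symmetric] del: of_real_power)

lemma integral_mu_le:
  assumes "bounded_borel g" "!!x. cmod (g x) <= K"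
  shows "cmod (\<integral>x. g x \<partial>\<mu> ph) <= K * (norm ph)\<^sup>2"
proof -
  interpret finite_measure "\<mu> ph" by (rule finite_mu)
  have "cmod (\<integral>x. g x \<partial>\<mu> ph) <= (\<integral>x. cmod (g x) \<partial>\<mu> ph)" by (rule integral_norm_bound)
  also have "\<dots> <= (\<integral>x. K \<partial>\<mu> ph)"
    using assms by (intro integral_mono integrable_norm integrable_bounded_borel) auto
  also have "\<dots> = K * (norm ph)\<^sup>2" using measure_mu_UNIV[of ph] by simp
  finally show ?thesis .
qed

section \<open>The bounded functional calculus\<close>

text \<open>A relation rather than a function, so that existence can be proved by induction over
  bounded Borel functions before an operator is chosen; the diagonal determines it uniquely.\<close>

definition is_fc :: "(real => complex) => 'a bop => bool" where
  "is_fc g X \<longleftrightarrow> (ALL ph. cinner (X @@ ph) ph = (\<integral>x. g x \<partial>\<mu> ph))"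

lemma is_fc_indicator: "A \<in> sets borel ==> is_fc (%x. of_real (indicator A x)) (E A)"
  by (simp add: is_fc_def E_app E_diag_cinner measure_mu)

lemma is_fc_add: "bounded_borel f ==> bounded_borel g ==> is_fc f X ==> is_fc g Y ==> is_fc (%x. f x + g x) (X + Y)"
  by (simp add: is_fc_def cinner_simps integrable_bounded_borel)

lemma is_fc_cmult: "is_fc f X ==> is_fc (%x. c * f x) (cop c * X)"
  by (simp add: is_fc_def cinner_simps)

text \<open>Polarisation with \<open>y\<close> of the same norm as \<open>x\<close> gives four terms
  of size at most \<open>K * (2 * norm x)^2\<close>, which accounts for the factor 4. The crude
  constant is enough for convergence; the sharp bound \<open>fc_norm_le\<close> needs
  multiplicativity.\<close>

lemma is_fc_norm:
  assumes "bounded_borel g" "is_fc g X" and K: "!!x. cmod (g x) <= K"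
  shows "norm X <= 4 * K"
proof -
  have "0 <= K" using K[of 0] norm_ge_zero[of "g 0"] by linarith
  have q: "cmod (cinner (X @@ ph) ph) <= K * (norm ph)\<^sup>2" for ph
    using assms integral_mu_le[of g K ph] by (simp add: is_fc_def)
  show ?thesis
  proof (rule norm_bop_le)
    fix x
    show "norm (X @@ x) <= 4 * K * norm x"
    proof (cases "X @@ x = 0")
      case False
      then have nx: "norm x > 0" by auto
      define y where "y = (norm x / norm (X @@ x)) *\<^sub>R (X @@ x)"
      have ny: "norm y = norm x" using False by (simp add: y_def)
      have "cmod (4 * cinner (X @@ x) y) <= (\<Sum>k<4. cmod (\<i> ^ k * cinner (X @@ (x + \<i> ^ k *\<^sub>C y)) (x + \<i> ^ k *\<^sub>C y)))"
        unfolding cinner_app_polarization by (rule norm_sum)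
      also have "\<dots> <= (\<Sum>k<(4::nat). K * (2 * norm x)\<^sup>2)"
      proof (rule sum_mono)
        fix k :: nat
        have "norm (x + \<i> ^ k *\<^sub>C y) <= 2 * norm x"
          using norm_triangle_ineq[of x "\<i> ^ k *\<^sub>C y"] ny by (simp add: norm_scaleC norm_power)
        then have "(norm (x + \<i> ^ k *\<^sub>C y))\<^sup>2 <= (2 * norm x)\<^sup>2" by (intro power_mono) auto
        then show "cmod (\<i> ^ k * cinner (X @@ (x + \<i> ^ k *\<^sub>C y)) (x + \<i> ^ k *\<^sub>C y)) <= K * (2 * norm x)\<^sup>2"
          using q[of "x + \<i> ^ k *\<^sub>C y"] \<open>0 <= K\<close>
          by (simp add: norm_mult norm_power) (meson mult_left_mono order.trans)
      qed
      finally have "4 * cmod (cinner (X @@ x) y) <= 16 * K * (norm x)\<^sup>2"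
        by (simp add: norm_mult power2_eq_square)
      moreover have "cinner (X @@ x) y = of_real (norm x * norm (X @@ x))"
        using False by (simp add: y_def cinner_simps cinner_self power2_eq_square)
      ultimately have "norm x * norm (X @@ x) <= norm x * (4 * K * norm x)"
        by (simp add: norm_mult power2_eq_square ac_simps)
      then show ?thesis using nx by simp
    qed (use \<open>0 <= K\<close> in simp)
  qed (use \<open>0 <= K\<close> in simp)
qed

lemma is_fc_diff:
  assumes "bounded_borel f" "bounded_borel g" "is_fc f X" "is_fc g Y"
  shows "is_fc (%x. f x - g x) (X - Y)"
  using assms by (simp add: is_fc_def cinner_simps integrable_bounded_borel)

lemma is_fc_exists: "bounded_borel g ==> EX X. is_fc g X"
proof (induct rule: bounded_borel_induct)
  case (indicator A) then show ?case using is_fc_indicator by blast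
next
  case (add f h) then show ?case using is_fc_add by blast
next
  case (cmult f c) then show ?case using is_fc_cmult by blast
next
  case (lim f h)
  then obtain X where X: "!!n. is_fc (f n) (X n)" by metis
  have d: "norm (X m - X n) <= 4 * (1 / (real m + 1) + 1 / (real n + 1))" for m n
  proof (rule is_fc_norm[OF bounded_borel_diff[OF lim(1) lim(1)] is_fc_diff[OF lim(1) lim(1) X X]])
    fix x
    have "cmod (f m x - f n x) = cmod ((f m x - h x) - (f n x - h x))" by simp
    also have "\<dots> <= 1 / (real m + 1) + 1 / (real n + 1)"
      by (rule order.trans[OF norm_triangle_ineq4 add_mono[OF lim(4) lim(4)]])
    finally show "cmod (f m x - f n x) <= 1 / (real m + 1) + 1 / (real n + 1)" .
  qed
  have "Cauchy X"
  proof (rule metric_CauchyI)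
    fix e :: real assume e: "0 < e"
    obtain N where N: "8 / e < real N" using reals_Archimedean2 by blast
    have "dist (X m) (X n) < e" if "N <= m" "N <= n" for m n
    proof -
      have *: "4 * (1 / (real m + 1)) < e / 2" if "N <= m" for m
      proof -
        have "8 / e < real m + 1" using N that by linarith
        then show ?thesis using e by (simp add: field_simps)
      qed
      show ?thesis unfolding dist_norm using d[of m n, unfolded distrib_left] *[OF that(1)] *[OF that(2)] by linarith
    qed
    then show "EX N. ALL m>=N. ALL n>=N. dist (X m) (X n) < e" by blast
  qed
  then obtain L where L: "X \<longlonglongrightarrow> L" using Cauchy_convergent convergent_def by blast
  have "is_fc h L"
    unfolding is_fc_def
  proof
    fix ph
    have 1: "(%n. cinner (X n @@ ph) ph) \<longlonglongrightarrow> cinner (L @@ ph) ph"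
      by (rule tendsto_cinner[OF tendsto_app[OF L tendsto_const] tendsto_const])
    have "(%n. cinner (X n @@ ph) ph - (\<integral>x. h x \<partial>\<mu> ph)) \<longlonglongrightarrow> 0"
    proof (rule Lim_null_comparison[OF always_eventually])
      show "ALL n. norm (cinner (X n @@ ph) ph - (\<integral>x. h x \<partial>\<mu> ph)) <= 1 / (real n + 1) * (norm ph)\<^sup>2"
      proof
        fix n
        have "cinner (X n @@ ph) ph - (\<integral>x. h x \<partial>\<mu> ph) = (\<integral>x. f n x - h x \<partial>\<mu> ph)"
          using X[of n] lim by (simp add: is_fc_def integrable_bounded_borel)
        then show "norm (cinner (X n @@ ph) ph - (\<integral>x. h x \<partial>\<mu> ph)) <= 1 / (real n + 1) * (norm ph)\<^sup>2"
          using integral_mu_le[OF bounded_borel_diff[OF lim(1,3)] lim(4), where ph = ph] by simp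
      qed
      have "(%n. 1 / (real n + 1)) \<longlonglongrightarrow> 0"
        using LIMSEQ_inverse_real_of_nat by (simp add: inverse_eq_divide add.commute)
      from tendsto_mult_left_zero[OF this, of "(norm ph)\<^sup>2"]
      show "(%n. 1 / (real n + 1) * (norm ph)\<^sup>2) \<longlonglongrightarrow> 0" .
    qed
    from this[unfolded LIM_zero_iff] show "cinner (L @@ ph) ph = (\<integral>x. h x \<partial>\<mu> ph)"
      by (rule LIMSEQ_unique[OF 1])
  qed
  then show ?case ..
qed

definition fc :: "(real => complex) => 'a bop" where "fc g = (SOME X. is_fc g X)"

lemma is_fc_fc: "bounded_borel g ==> is_fc g (fc g)"
  using someI_ex[OF is_fc_exists] by (simp add: fc_def)

lemma fc_unique: "bounded_borel g ==> is_fc g X ==> fc g = X"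
  using is_fc_fc[of g] by (intro bop_eq_diag) (simp add: is_fc_def)

lemma fc_diag: "bounded_borel g ==> cinner (fc g @@ ph) ph = (\<integral>x. g x \<partial>\<mu> ph)"
  using is_fc_fc by (simp add: is_fc_def)

lemma fc_indicator: "A \<in> sets borel ==> fc (%x. of_real (indicator A x)) = E A"
  by (intro fc_unique bounded_borel_indicator is_fc_indicator)

lemma fc_add: "bounded_borel f ==> bounded_borel g ==> fc (%x. f x + g x) = fc f + fc g"
  by (intro fc_unique bounded_borel_add is_fc_add is_fc_fc)

lemma fc_diff: "bounded_borel f ==> bounded_borel g ==> fc (%x. f x - g x) = fc f - fc g"
  by (intro fc_unique bounded_borel_diff is_fc_diff is_fc_fc)

lemma fc_cmult: "bounded_borel f ==> fc (%x. c * f x) = cop c * fc f"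
  by (intro fc_unique bounded_borel_cmult is_fc_cmult is_fc_fc)

lemma fc_one: "fc (%x. 1) = 1"
  using fc_indicator[of UNIV] by (simp add: E_UNIV)

lemma fc_cnj: "bounded_borel f ==> fc (%x. cnj (f x)) = adj (fc f)"
proof (rule fc_unique[OF bounded_borel_cnj], assumption)
  assume f: "bounded_borel f"
  show "is_fc (%x. cnj (f x)) (adj (fc f))"
    unfolding is_fc_def Bochner_Integration.integral_cnj fc_diag[OF f, symmetric]
    using adj_left cinner_commute by metis
qed

lemma fc_uniform_lim:
  assumes "!!n. bounded_borel (f n)" "bounded_borel h" "!!n x. cmod (f n x - h x) <= 1 / (real n + 1)"
  shows "(%n. fc (f n)) \<longlonglongrightarrow> fc h"
proof -
  have "(%n. fc (f n) - fc h) \<longlonglongrightarrow> 0"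
  proof (rule Lim_null_comparison[OF always_eventually])
    show "ALL n. norm (fc (f n) - fc h) <= 4 * (1 / (real n + 1))"
      unfolding fc_diff[OF assms(1,2), symmetric]
      by (intro allI is_fc_norm[OF bounded_borel_diff is_fc_fc] bounded_borel_diff assms)
    have "(%n. 1 / (real n + 1)) \<longlonglongrightarrow> 0"
      using LIMSEQ_inverse_real_of_nat by (simp add: inverse_eq_divide add.commute)
    from tendsto_mult_right_zero[OF this, of 4]
    show "(%n. 4 * (1 / (real n + 1))) \<longlonglongrightarrow> 0" .
  qed
  then show ?thesis by (simp add: LIM_zero_iff)
qed

text \<open>For two indicators this is \<open>E_Int\<close>. Induction extends it in the first
  factor with an indicator as second factor, then in the second factor; the limit cases use that
  multiplication by a bounded function preserves uniform convergence.\<close>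

lemma fc_mult: "bounded_borel f ==> bounded_borel g ==> fc (%x. f x * g x) = fc f * fc g"
proof -
  assume f: "bounded_borel f" and g: "bounded_borel g"
  have uni: "cmod (f n x * k x - h x * k x) <= K * (1 / (real n + 1))"
    if "cmod (f n x - h x) <= 1 / (real n + 1)" "cmod (k x) <= K" for f :: "nat => real => complex" and h k K n x
  proof -
    have "cmod (f n x * k x - h x * k x) = cmod (f n x - h x) * cmod (k x)"
      by (simp add: norm_mult[symmetric] left_diff_distrib)
    also have "\<dots> <= 1 / (real n + 1) * K" by (intro mult_mono that) auto
    finally show ?thesis by (simp only: mult.commute)
  qed
  have lim0: "(%n. fc (%x. f n x * k x)) \<longlonglongrightarrow> fc (%x. h x * k x)"
    if "!!n. bounded_borel (f n)" "bounded_borel h" "bounded_borel k" "!!n x. cmod (f n x - h x) <= 1 / (real n + 1)"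
    for f :: "nat => real => complex" and h k
  proof -
    note bk = that(3)
    obtain K where K: "!!x. cmod (k x) <= K" "0 <= K" using bounded_borelE[OF bk] by metis
    have "(%n. fc (%x. f n x * k x) - fc (%x. h x * k x)) \<longlonglongrightarrow> 0"
    proof (rule Lim_null_comparison[OF always_eventually])
      show "ALL n. norm (fc (%x. f n x * k x) - fc (%x. h x * k x)) <= 4 * (K * (1 / (real n + 1)))"
        unfolding fc_diff[OF bounded_borel_mult[OF that(1,3)] bounded_borel_mult[OF that(2,3)], symmetric]
        by (intro allI is_fc_norm[OF _ is_fc_fc] bounded_borel_diff bounded_borel_mult that uni K)
      have "(%n. 1 / (real n + 1)) \<longlonglongrightarrow> 0"
        using LIMSEQ_inverse_real_of_nat by (simp add: inverse_eq_divide add.commute)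
      from tendsto_mult_right_zero[OF tendsto_mult_right_zero[OF this, of K], of 4]
      show "(%n. 4 * (K * (1 / (real n + 1)))) \<longlonglongrightarrow> 0" .
    qed
    then show ?thesis by (simp add: LIM_zero_iff)
  qed
  have ind: "fc (%x. f x * of_real (indicator B x)) = fc f * E B" if B: "B \<in> sets borel" for B
    using f
  proof (induct rule: bounded_borel_induct)
    case (indicator A)
    have "(%x. complex_of_real (indicator A x) * of_real (indicator B x)) = (%x. of_real (indicator (A \<inter> B) x))"
      by (auto simp: indicator_def)
    then show ?case using indicator B by (simp add: fc_indicator E_Int)
  next
    case (add f h)
    then show ?case
      using B by (simp add: distrib_right fc_add bounded_borel_mult bounded_borel_indicator)
  next
    case (cmult f c)
    then show ?case
      using B by (simp add: mult.assoc fc_cmult bounded_borel_mult bounded_borel_indicator)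
  next
    case (lim f h)
    have "(%n. fc (%x. f n x * of_real (indicator B x))) \<longlonglongrightarrow> fc (%x. h x * of_real (indicator B x))"
      by (rule lim0[OF lim(1) lim(3) bounded_borel_indicator[OF B] lim(4)])
    moreover have "(%n. fc (f n) * E B) \<longlonglongrightarrow> fc h * E B"
      by (rule tendsto_mult[OF fc_uniform_lim[OF lim(1) lim(3) lim(4)] tendsto_const])
    ultimately show ?case unfolding lim(2) by (rule LIMSEQ_unique)
  qed
  show ?thesis
    using g
  proof (induct rule: bounded_borel_induct)
    case (indicator A)
    then show ?case by (simp add: ind fc_indicator)
  next
    case (add g h)
    then show ?case using f by (simp add: distrib_left fc_add bounded_borel_mult)
  next
    case (cmult g c)
    have "(%x. f x * (c * g x)) = (%x. c * (f x * g x))" by (simp add: fun_eq_iff mult.left_commute)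
    then have "fc (%x. f x * (c * g x)) = fc (%x. c * (f x * g x))" by (rule arg_cong)
    also have "\<dots> = cop c * (fc f * fc g)" by (simp only: fc_cmult[OF bounded_borel_mult[OF f cmult(1)]] cmult(2))
    also have "\<dots> = fc f * (cop c * fc g)" by (simp only: mult.assoc[symmetric] cop_commute)
    finally show ?case by (simp only: fc_cmult[OF cmult(1)])
  next
    case (lim g h)
    have "(%n. fc (%x. g n x * f x)) \<longlonglongrightarrow> fc (%x. h x * f x)"
      by (rule lim0[OF lim(1) lim(3) f lim(4)])
    moreover have "(%n. fc f * fc (g n)) \<longlonglongrightarrow> fc f * fc h"
      by (rule tendsto_mult[OF tendsto_const fc_uniform_lim[OF lim(1) lim(3) lim(4)]])
    moreover have "fc (%x. g n x * f x) = fc f * fc (g n)" for n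
      unfolding lim(2)[of n, symmetric] by (simp only: mult.commute)
    ultimately have "fc (%x. h x * f x) = fc f * fc h" by (simp only: LIMSEQ_unique)
    then show ?case by (simp only: mult.commute)
  qed
qed

lemma fc_norm_sq: "bounded_borel g ==> (norm (fc g @@ ph))\<^sup>2 = (\<integral>x. (cmod (g x))\<^sup>2 \<partial>\<mu> ph)"
proof -
  assume g: "bounded_borel g"
  have "complex_of_real ((norm (fc g @@ ph))\<^sup>2) = cinner (fc (%x. cnj (g x) * g x) @@ ph) ph"
    unfolding norm_app_sq fc_mult[OF bounded_borel_cnj[OF g] g] fc_cnj[OF g] ..
  also have "\<dots> = (\<integral>x. of_real ((cmod (g x))\<^sup>2) \<partial>\<mu> ph)"
    using g by (subst fc_diag[OF bounded_borel_mult[OF bounded_borel_cnj[OF g] g]])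
      (simp only: complex_norm_square mult.commute)
  also have "\<dots> = of_real (\<integral>x. (cmod (g x))\<^sup>2 \<partial>\<mu> ph)" by (rule integral_complex_of_real)
  finally show ?thesis using of_real_eq_iff by blast
qed

lemma fc_norm_app_le: "bounded_borel g ==> (!!x. cmod (g x) <= K) ==> norm (fc g @@ ph) <= K * norm ph"
proof -
  assume g: "bounded_borel g" and K: "!!x. cmod (g x) <= K"
  interpret finite_measure "\<mu> ph" by (rule finite_mu)
  have "0 <= K" using K[of 0] norm_ge_zero[of "g 0"] by linarith
  have "(norm (fc g @@ ph))\<^sup>2 = (\<integral>x. (cmod (g x))\<^sup>2 \<partial>\<mu> ph)" by (rule fc_norm_sq[OF g])
  also have "\<dots> <= (\<integral>x. K\<^sup>2 \<partial>\<mu> ph)"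
  proof (rule integral_mono)
    show "integrable (\<mu> ph) (%x. (cmod (g x))\<^sup>2)"
      by (rule integrable_norm_sq[OF g])
    show "(cmod (g x))\<^sup>2 <= K\<^sup>2" for x by (intro power_mono K) simp
  qed simp
  also have "\<dots> = (K * norm ph)\<^sup>2" using measure_mu_UNIV[of ph] by (simp add: power_mult_distrib)
  finally show ?thesis by (rule power2_le_imp_le) (use \<open>0 <= K\<close> in simp)
qed

lemma fc_norm_le: "bounded_borel g ==> (!!x. cmod (g x) <= K) ==> norm (fc g) <= K"
  by (rule norm_bop_le[OF order.trans[OF norm_ge_zero]]) (auto intro: fc_norm_app_le)

text \<open>The squared norm of the difference is the integral of |f_n - h|^2 against the finite
  scalar measure of \<open>ph\<close>, to which dominated convergence applies. Convergence is
  strong, not in norm.\<close>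

lemma fc_dominated_convergence:
  assumes f: "!!n. bounded_borel (f n)" "bounded_borel h" "!!n x. cmod (f n x) <= K"
    and lim: "!!x. (%n. f n x) \<longlonglongrightarrow> h x"
  shows "(%n. fc (f n) @@ ph) \<longlonglongrightarrow> fc h @@ ph"
proof -
  interpret finite_measure "\<mu> ph" by (rule finite_mu)
  have [measurable]: "f n \<in> borel_measurable borel" "h \<in> borel_measurable borel" for n
    using f by (auto dest: bounded_borel_measurable)
  have hK: "cmod (h x) <= K" for x
    by (rule Lim_norm_ubound[OF sequentially_bot lim]) (simp add: f)
  have "(%n. \<integral>x. (cmod (f n x - h x))\<^sup>2 \<partial>\<mu> ph) \<longlonglongrightarrow> (\<integral>x. 0 \<partial>\<mu> ph)"
  proof (rule integral_dominated_convergence)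
    show "integrable (\<mu> ph) (%x. (2 * K)\<^sup>2)" by simp
    show "AE x in \<mu> ph. (%n. (cmod (f n x - h x))\<^sup>2) \<longlonglongrightarrow> 0"
    proof (rule AE_I2)
      fix x
      have "(%n. (cmod (f n x - h x))\<^sup>2) \<longlonglongrightarrow> (cmod (h x - h x))\<^sup>2" by (intro tendsto_intros lim)
      then show "(%n. (cmod (f n x - h x))\<^sup>2) \<longlonglongrightarrow> 0" by simp
    qed
    show "AE x in \<mu> ph. norm ((cmod (f n x - h x))\<^sup>2) <= (2 * K)\<^sup>2" for n
    proof (rule AE_I2)
      fix x
      have "cmod (f n x - h x) <= 2 * K" using norm_triangle_ineq4[of "f n x" "h x"] f(3)[of n x] hK[of x] by linarith
      then show "norm ((cmod (f n x - h x))\<^sup>2) <= (2 * K)\<^sup>2"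
        using power_mono[OF _ norm_ge_zero, of "f n x - h x" "2 * K" 2] by simp
    qed
  qed measurable
  then have "(%n. (norm (fc (f n) @@ ph - fc h @@ ph))\<^sup>2) \<longlonglongrightarrow> 0"
    unfolding fc_norm_sq[OF bounded_borel_diff[OF f(1,2)], symmetric] fc_diff[OF f(1,2)] by simp
  from tendsto_real_sqrt[OF this] have "(%n. norm (fc (f n) @@ ph - fc h @@ ph)) \<longlonglongrightarrow> 0" by simp
  then show ?thesis using LIM_zero_iff tendsto_norm_zero_iff by blast
qed

section \<open>Unbounded spectral integrals by truncation\<close>

definition trunc :: "(real => complex) => nat => real => complex" where
  "trunc g N x = (if cmod (g x) <= real N then g x else 0)"

lemma bounded_borel_trunc: "g \<in> borel_measurable borel ==> bounded_borel (trunc g N)"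
proof (rule bounded_borelI[of _ "real N"])
  assume [measurable]: "g \<in> borel_measurable borel"
  show "trunc g N \<in> borel_measurable borel" unfolding trunc_def[abs_def] by measurable
qed (simp add: trunc_def)

lemma trunc_le: "cmod (trunc g N x) <= cmod (g x)"
  by (simp add: trunc_def)

lemma trunc_lim: "(%N. trunc g N x) \<longlonglongrightarrow> g x"
proof (rule tendsto_eventually)
  obtain N0 where "cmod (g x) <= real N0" using real_arch_simple by blast
  then show "\<forall>\<^sub>F N in sequentially. trunc g N x = g x"
    by (intro eventually_sequentiallyI[of N0]) (auto simp: trunc_def)
qed

text \<open>One direction compares integrals, the other is Fatou's lemma. In this form linearity of
  the domain is a statement about bounded operators, with no comparison of the scalar measures of
  different vectors.\<close>

lemma spectral_domain_iff:
  assumes g: "g \<in> borel_measurable borel"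
  shows "ph \<in> spectral_domain P g \<longleftrightarrow> (EX C. ALL N. norm (fc (trunc g N) @@ ph) <= C)"
proof
  note [measurable] = g bounded_borel_measurable[OF bounded_borel_trunc[OF g]]
  { assume "ph \<in> spectral_domain P g"
    then have i: "integrable (\<mu> ph) (%x. (cmod (g x))\<^sup>2)" by (simp add: spectral_domain_def)
    have "norm (fc (trunc g N) @@ ph) <= sqrt (\<integral>x. (cmod (g x))\<^sup>2 \<partial>\<mu> ph)" for N
    proof (rule real_le_rsqrt)
      show "(norm (fc (trunc g N) @@ ph))\<^sup>2 <= (\<integral>x. (cmod (g x))\<^sup>2 \<partial>\<mu> ph)"
        unfolding fc_norm_sq[OF bounded_borel_trunc[OF g]]
        by (rule Bochner_Integration.integral_mono'[OF i]) (simp_all add: trunc_le power_mono)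
    qed
    then show "EX C. ALL N. norm (fc (trunc g N) @@ ph) <= C" by blast }
  { assume "EX C. ALL N. norm (fc (trunc g N) @@ ph) <= C"
    then obtain C where C: "!!N. norm (fc (trunc g N) @@ ph) <= C" by blast
    have le: "(\<integral>\<^sup>+x. ennreal ((cmod (trunc g N x))\<^sup>2) \<partial>\<mu> ph) <= ennreal (C\<^sup>2)" for N
    proof -
      have "(\<integral>\<^sup>+x. ennreal ((cmod (trunc g N x))\<^sup>2) \<partial>\<mu> ph) = ennreal (\<integral>x. (cmod (trunc g N x))\<^sup>2 \<partial>\<mu> ph)"
        by (intro nn_integral_eq_integral integrable_norm_sq bounded_borel_trunc g) simp
      also have "\<dots> = ennreal ((norm (fc (trunc g N) @@ ph))\<^sup>2)"
        by (simp add: fc_norm_sq[OF bounded_borel_trunc[OF g]])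
      also have "\<dots> <= ennreal (C\<^sup>2)" by (intro ennreal_leI power_mono C) simp
      finally show ?thesis .
    qed
    have "(\<integral>\<^sup>+x. ennreal ((cmod (g x))\<^sup>2) \<partial>\<mu> ph) = (\<integral>\<^sup>+x. liminf (%N. ennreal ((cmod (trunc g N x))\<^sup>2)) \<partial>\<mu> ph)"
    proof (rule nn_integral_cong)
      fix x
      have "(%N. ennreal ((cmod (trunc g N x))\<^sup>2)) \<longlonglongrightarrow> ennreal ((cmod (g x))\<^sup>2)"
        by (intro tendsto_ennrealI tendsto_power tendsto_norm trunc_lim)
      then show "ennreal ((cmod (g x))\<^sup>2) = liminf (%N. ennreal ((cmod (trunc g N x))\<^sup>2))"
        by (rule lim_imp_Liminf[OF sequentially_bot, symmetric])
    qed
    also have "\<dots> <= liminf (%N. \<integral>\<^sup>+x. ennreal ((cmod (trunc g N x))\<^sup>2) \<partial>\<mu> ph)"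
      by (intro nn_integral_liminf) measurable
    also have "\<dots> <= liminf (%N::nat. ennreal (C\<^sup>2))" by (intro Liminf_mono always_eventually allI le)
    also have "\<dots> < \<infinity>" by (simp add: Liminf_const)
    finally show "ph \<in> spectral_domain P g"
      unfolding spectral_domain_def by (auto intro!: integrableI_bounded) }
qed

lemma spectral_domain_bounded: "bounded_borel g ==> spectral_domain P g = UNIV"
proof -
  assume g: "bounded_borel g"
  obtain K where K: "g \<in> borel_measurable borel" "!!x. cmod (g x) <= K" using bounded_borelE[OF g] by metis
  have "norm (fc (trunc g N) @@ ph) <= K * norm ph" for N ph
    by (rule fc_norm_app_le[OF bounded_borel_trunc[OF K(1)]]) (rule order.trans[OF trunc_le K(2)])
  then show ?thesis using spectral_domain_iff[OF K(1)] by blast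
qed

lemma spectral_domain_add:
  assumes g: "g \<in> borel_measurable borel" and "ph \<in> spectral_domain P g" "ps \<in> spectral_domain P g"
  shows "ph + c *\<^sub>C ps \<in> spectral_domain P g"
proof -
  obtain C D where C: "!!N. norm (fc (trunc g N) @@ ph) <= C" and D: "!!N. norm (fc (trunc g N) @@ ps) <= D"
    using assms by (auto simp: spectral_domain_iff)
  have "norm (fc (trunc g N) @@ (ph + c *\<^sub>C ps)) <= C + cmod c * D" for N
  proof -
    have "norm (fc (trunc g N) @@ (ph + c *\<^sub>C ps)) <= norm (fc (trunc g N) @@ ph) + cmod c * norm (fc (trunc g N) @@ ps)"
      unfolding app_add app_scaleC using norm_triangle_ineq by (metis norm_scaleC)
    also have "\<dots> <= C + cmod c * D" by (intro add_mono mult_left_mono C D) simp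
    finally show ?thesis .
  qed
  then show ?thesis using g by (auto simp: spectral_domain_iff)
qed

lemma fc_cinner:
  assumes g: "bounded_borel g"
  shows "cinner (fc g @@ ph) ps = (\<Sum>k<4. \<i> ^ k * (\<integral>s. g s \<partial>\<mu> (ph + (\<i> ^ k) *\<^sub>C ps))) / 4"
  using cinner_app_polarization[of "fc g" ph ps] unfolding fc_diag[OF g] by (simp add: mult.commute)

text \<open>Each vector in the polarised sum lies in the domain, so 1 + |g|^2 is an integrable
  majorant of the truncations. This links the definition of \<open>spectral_integral\<close> with
  the bounded calculus.\<close>

lemma spectral_integral_form_lim:
  assumes g: "g \<in> borel_measurable borel" and dom: "ph \<in> spectral_domain P g" "ps \<in> spectral_domain P g"
  shows "(%N. cinner (fc (trunc g N) @@ ph) ps) \<longlonglongrightarrow>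
     (\<Sum>k<4. \<i> ^ k * (\<integral>s. g s \<partial>\<mu> (ph + (\<i> ^ k) *\<^sub>C ps))) / 4"
  unfolding fc_cinner[OF bounded_borel_trunc[OF g]]
proof (intro tendsto_divide tendsto_sum tendsto_mult tendsto_const)
  fix k :: nat
  define th where "th = ph + (\<i> ^ k) *\<^sub>C ps"
  interpret finite_measure "\<mu> th" by (rule finite_mu)
  note [measurable] = g bounded_borel_measurable[OF bounded_borel_trunc[OF g]]
  have i: "integrable (\<mu> th) (%x. (cmod (g x))\<^sup>2)"
    using spectral_domain_add[OF g dom, of "\<i> ^ k"] by (simp add: th_def spectral_domain_def)
  show "(%N. \<integral>s. trunc g N s \<partial>\<mu> th) \<longlonglongrightarrow> (\<integral>s. g s \<partial>\<mu> th)"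
  proof (rule integral_dominated_convergence)
    show "integrable (\<mu> th) (%x. 1 + (cmod (g x))\<^sup>2)" using i by simp
    show "AE x in \<mu> th. (%N. trunc g N x) \<longlonglongrightarrow> g x" by (intro AE_I2 trunc_lim)
    show "AE x in \<mu> th. norm (trunc g N x) <= 1 + (cmod (g x))\<^sup>2" for N
    proof (rule AE_I2)
      fix x
      have "0 <= (cmod (g x) - 1)\<^sup>2" by simp
      then have "2 * cmod (g x) <= 1 + (cmod (g x))\<^sup>2" by (simp add: power2_diff)
      then show "norm (trunc g N x) <= 1 + (cmod (g x))\<^sup>2"
        using trunc_le[of g N x] norm_ge_zero[of "g x"] by linarith
    qed
  qed measurable
qed simp

lemma spectral_integral_bounded: "bounded_borel g ==> spectral_integral P g = graph_of (%ph. fc g @@ ph)"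
  unfolding spectral_integral_def graph_of_def
  by (auto simp: spectral_domain_bounded fc_cinner[symmetric] intro: cinner_ext)

text \<open>The transfer from unbounded to bounded operators: wherever the factor \<open>k\<close>
  tames \<open>g\<close>, membership in the graph becomes an identity of bounded operators. Later
  arguments meet unbounded integrals mostly through it.\<close>

lemma spectral_integral_fc:
  assumes g: "g \<in> borel_measurable borel" and m: "(ze, th) \<in> spectral_integral P g"
    and k: "bounded_borel k" and kg: "bounded_borel (%x. k x * g x)"
  shows "fc k @@ th = fc (%x. k x * g x) @@ ze"
proof (rule cinner_ext)
  fix et
  obtain K where K: "!!x. cmod (k x * g x) <= K" using bounded_borelE[OF kg] by metis
  \<comment> \<open>These test vectors lie in the domain of the unbounded integral because the
    product of \<open>g\<close> with the conjugate of \<open>k\<close> is bounded by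
    \<open>K\<close>.\<close>
  define ps where "ps = fc (%x. cnj (k x)) @@ et"
  have bk: "bounded_borel (%x. cnj (k x))" by (rule bounded_borel_cnj[OF k])
  have "norm (fc (trunc g N) @@ ps) <= K * norm et" for N
  proof -
    have "fc (trunc g N) @@ ps = fc (%x. trunc g N x * cnj (k x)) @@ et"
      unfolding ps_def fc_mult[OF bounded_borel_trunc[OF g] bk] by simp
    also have "norm \<dots> <= K * norm et"
    proof (rule fc_norm_app_le[OF bounded_borel_mult[OF bounded_borel_trunc[OF g] bk]])
      fix x
      have "cmod (trunc g N x * cnj (k x)) <= cmod (g x) * cmod (k x)"
        unfolding norm_mult complex_mod_cnj by (intro mult_right_mono trunc_le) simp
      then show "cmod (trunc g N x * cnj (k x)) <= K" using K[of x] by (simp add: norm_mult mult.commute)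
    qed
    finally show ?thesis .
  qed
  then have ps: "ps \<in> spectral_domain P g" using spectral_domain_iff[OF g] by blast
  have ze: "ze \<in> spectral_domain P g" using m by (simp add: spectral_integral_def)
  have eq: "cinner th ps = (\<Sum>k<4. \<i> ^ k * (\<integral>s. g s \<partial>\<mu> (ze + (\<i> ^ k) *\<^sub>C ps))) / 4"
    using m ps unfolding spectral_integral_def by blast
  have "(%N. cinner (fc (trunc g N) @@ ze) ps) \<longlonglongrightarrow> cinner th ps"
    unfolding eq by (rule spectral_integral_form_lim[OF g ze ps])
  moreover have "cinner (fc (trunc g N) @@ ze) ps = cinner (fc (%x. k x * trunc g N x) @@ ze) et" for N
    unfolding ps_def fc_cnj[OF k] fc_mult[OF k bounded_borel_trunc[OF g]] by (simp add: adj_left)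
  moreover have "(%N. fc (%x. k x * trunc g N x) @@ ze) \<longlonglongrightarrow> fc (%x. k x * g x) @@ ze"
  proof (rule fc_dominated_convergence[OF bounded_borel_mult[OF k bounded_borel_trunc[OF g]] kg])
    show "cmod (k x * trunc g N x) <= K" for N x
    proof -
      have "cmod (k x * trunc g N x) <= cmod (k x * g x)" unfolding norm_mult by (intro mult_left_mono trunc_le) simp
      also have "\<dots> <= K" by (rule K)
      finally show ?thesis .
    qed
    show "(%N. k x * trunc g N x) \<longlonglongrightarrow> k x * g x" for x by (intro tendsto_mult tendsto_const trunc_lim)
  qed
  then have "(%N. cinner (fc (%x. k x * trunc g N x) @@ ze) et) \<longlonglongrightarrow> cinner (fc (%x. k x * g x) @@ ze) et"
    by (rule tendsto_cinner[OF _ tendsto_const])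
  ultimately have "cinner th ps = cinner (fc (%x. k x * g x) @@ ze) et" by (simp add: LIMSEQ_unique)
  moreover have "cinner th ps = cinner (fc k @@ th) et" unfolding ps_def fc_cnj[OF k] by (simp add: adj_left)
  ultimately show "cinner (fc k @@ th) et = cinner (fc (%x. k x * g x) @@ ze) et" by simp
qed

end

section \<open>Encoding a self-adjoint operator by its resolvent\<close>

definition resolvent_fun :: "real => complex" where "resolvent_fun t = inverse (of_real t + \<i>)"

lemma resolvent_fun_nz: "of_real t + \<i> ~= 0"
  by (simp add: complex_eq_iff)

lemma cmod_plus_i_ge: "1 <= cmod (of_real t + \<i>)" "\<bar>t\<bar> <= cmod (of_real t + \<i>)"
  using abs_Im_le_cmod[of "of_real t + \<i>"] abs_Re_le_cmod[of "of_real t + \<i>"] by auto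

lemma bounded_borel_resolvent_fun: "bounded_borel resolvent_fun"
  and resolvent_fun_le: "cmod (resolvent_fun t) <= 1"
proof -
  show le: "cmod (resolvent_fun t) <= 1" for t
    using cmod_plus_i_ge(1)[of t] by (simp add: resolvent_fun_def norm_inverse inverse_le_1_iff)
  show "bounded_borel resolvent_fun"
    by (rule bounded_borelI[of _ 1]) (simp_all add: le, simp add: resolvent_fun_def[abs_def])
qed

lemma resolvent_fun_times_id: "resolvent_fun t * of_real t = 1 - \<i> * resolvent_fun t"
  using resolvent_fun_nz[of t] by (simp add: resolvent_fun_def field_simps)

text \<open>The graph of R^-1 - i, that is of the operator \<open>A\<close> with (A + i)^-1 = R,
  written without inverting \<open>R\<close>: the pair of \<open>z = R ph\<close> and A z = ph - i
  z.\<close>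

definition resolvent_graph :: "'a::euclidean_space bop => 'a oper" where
  "resolvent_graph R = {(R @@ ph, ph - \<i> *\<^sub>C (R @@ ph)) | ph. True}"

text \<open>One inclusion is the transfer lemma with \<open>k = resolvent_fun\<close>. For the
  other, |t / (t + i)| <= 1 puts the range of \<open>fc resolvent_fun\<close> into the domain of the
  identity function, with truncations converging to the second component.\<close>

lemma (in pvm) spectral_integral_id:
  "spectral_integral P complex_of_real = resolvent_graph (fc resolvent_fun)"
proof (intro set_eqI iffI; clarify)
  let ?r = resolvent_fun
  have m: "complex_of_real \<in> borel_measurable borel" by simp
  have bg: "bounded_borel (%x. ?r x * of_real x)"
    unfolding resolvent_fun_times_id
    by (intro bounded_borel_diff bounded_borel_const bounded_borel_cmult bounded_borel_resolvent_fun)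
  have fg: "fc (%x. ?r x * of_real x) = 1 - cop \<i> * fc ?r"
    unfolding resolvent_fun_times_id
    by (simp add: fc_diff fc_cmult fc_one bounded_borel_const bounded_borel_cmult bounded_borel_resolvent_fun)
  note br = bounded_borel_resolvent_fun
  { fix ze th assume a: "(ze, th) \<in> spectral_integral P complex_of_real"
    have "fc ?r @@ th = ze - \<i> *\<^sub>C (fc ?r @@ ze)"
      using spectral_integral_fc[OF m a br bg] by (simp add: fg)
    then have "fc ?r @@ (th + \<i> *\<^sub>C ze) = ze" by (simp add: app_add app_scaleC)
    then have "(ze, th) = (fc ?r @@ (th + \<i> *\<^sub>C ze), (th + \<i> *\<^sub>C ze) - \<i> *\<^sub>C (fc ?r @@ (th + \<i> *\<^sub>C ze)))" by simp
    then show "(ze, th) \<in> resolvent_graph (fc ?r)" unfolding resolvent_graph_def by blast }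
  fix ze th assume "(ze, th) \<in> resolvent_graph (fc ?r)"
  then obtain ph where ph: "ze = fc ?r @@ ph" "th = ph - \<i> *\<^sub>C (fc ?r @@ ph)" by (auto simp: resolvent_graph_def)
  have eq: "fc (trunc of_real N) @@ ze = fc (%x. ?r x * trunc of_real N x) @@ ph" for N
    unfolding ph by (subst mult.commute) (simp add: fc_mult[OF bounded_borel_trunc[OF m] br])
  have le: "cmod (?r x * trunc of_real N x) <= 1" for N x
  proof -
    have "cmod (?r x * trunc of_real N x) <= cmod (?r x) * cmod (of_real x)"
      unfolding norm_mult by (intro mult_left_mono trunc_le) simp
    also have "\<dots> = \<bar>x\<bar> / cmod (of_real x + \<i>)"
      unfolding resolvent_fun_def norm_inverse norm_of_real by (simp add: field_simps)
    also have "\<dots> <= 1" using cmod_plus_i_ge[of x] by (simp add: divide_le_eq)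
    finally show ?thesis .
  qed
  have "norm (fc (trunc of_real N) @@ ze) <= 1 * norm ph" for N
    unfolding eq by (intro fc_norm_app_le bounded_borel_mult br bounded_borel_trunc m le)
  then have ze: "ze \<in> spectral_domain P of_real" unfolding spectral_domain_iff[OF m] by blast
  have lim: "(%N. fc (trunc of_real N) @@ ze) \<longlonglongrightarrow> th"
  proof -
    have "(%N. fc (%x. ?r x * trunc of_real N x) @@ ph) \<longlonglongrightarrow> fc (%x. ?r x * of_real x) @@ ph"
      by (rule fc_dominated_convergence[OF bounded_borel_mult[OF br bounded_borel_trunc[OF m]] bg le])
         (intro tendsto_mult tendsto_const trunc_lim)
    then show ?thesis unfolding eq by (simp add: fg ph(2))
  qed
  have "cinner th ps = (\<Sum>k<4. \<i> ^ k * (\<integral>s. of_real s \<partial>\<mu> (ze + (\<i> ^ k) *\<^sub>C ps))) / 4"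
    if "ps \<in> spectral_domain P of_real" for ps
    by (rule LIMSEQ_unique[OF tendsto_cinner[OF lim tendsto_const] spectral_integral_form_lim[OF m ze that]])
  then show "(ze, th) \<in> spectral_integral P complex_of_real"
    using ze by (simp add: spectral_integral_def)
qed

section \<open>The spectral theorem\<close>

lemma scaleC_2i: "(2 * \<i>) *\<^sub>C x = \<i> *\<^sub>C x + \<i> *\<^sub>C x"
  using scaleC_add_left[of \<i> \<i> x] by (simp only: mult_2)

lemma subspace_closure:
  fixes S :: "'b::real_normed_vector set"
  assumes S: "subspace S" shows "subspace (closure S)"
  unfolding subspace_def
proof (intro conjI ballI allI)
  show "0 \<in> closure S" using closure_subset subspace_0[OF S] by blast
  have 1: "x + y \<in> closure S" if "x \<in> S" "y \<in> closure S" for x y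
  proof -
    have "(%y. x + y) ` closure S \<subseteq> closure S"
      by (rule image_closure_subset) (use that(1) closure_subset subspace_add[OF S] in \<open>auto intro!: continuous_intros\<close>)
    then show ?thesis using that by blast
  qed
  show "x + y \<in> closure S" if "x \<in> closure S" "y \<in> closure S" for x y
  proof -
    have "(%x. x + y) ` closure S \<subseteq> closure S"
      by (rule image_closure_subset) (use 1 that(2) in \<open>auto intro!: continuous_intros\<close>)
    then show ?thesis using that by blast
  qed
  show "c *\<^sub>R x \<in> closure S" if "x \<in> closure S" for c x
  proof -
    have "(%x. c *\<^sub>R x) ` closure S \<subseteq> closure S"
      by (rule image_closure_subset) (use closure_subset subspace_scale[OF S] in \<open>auto intro!: continuous_intros\<close>)
    then show ?thesis using that by blast
  qed
qed

text \<open>The component of a vector orthogonal to the closure of the range lies in the kernel of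
  \<open>adj T\<close>.\<close>

lemma dense_range:
  assumes "!!x. adj T @@ x = 0 ==> x = 0"
  shows "closure (range (%x. T @@ x)) = UNIV"
proof -
  let ?M = "closure (range (%x. T @@ x))"
  have r: "subspace (range (%x. T @@ x))"
    by (intro linear_subspace_image subspace_UNIV bounded_linear.linear bounded_linear_app)
  have C: "c *\<^sub>C x \<in> ?M" if "x \<in> ?M" for c x
  proof -
    have "(%x. c *\<^sub>C x) ` ?M \<subseteq> ?M"
    proof (rule image_closure_subset)
      have "c *\<^sub>C (T @@ u) \<in> range (%x. T @@ x)" for u by (metis app_scaleC rangeI)
      then show "(%x. c *\<^sub>C x) ` range (%x. T @@ x) \<subseteq> ?M" using closure_subset by blast
    qed (auto intro: linear_continuous_on bounded_linear_scaleC)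
    then show ?thesis using that by blast
  qed
  obtain Q where Q: "proj Q" "!!x. Q @@ x \<in> ?M" "!!x. x \<in> ?M ==> Q @@ x = x"
    using proj_exists[OF subspace_closure[OF r] closed_closure C] by blast
  have "x \<in> ?M" for x
  proof -
    have "cinner y (adj T @@ (x - Q @@ x)) = 0" for y
    proof -
      have "Q @@ T @@ y = T @@ y" by (rule Q(3)[OF subsetD[OF closure_subset rangeI]])
      then have "cinner (T @@ y) (Q @@ x) = cinner (T @@ y) x"
        using Q(1) by (metis adj_right proj_def)
      then show ?thesis unfolding adj_left[of y "adj T"] adj_adj cinner_diff_right by simp
    qed
    then have "adj T @@ (x - Q @@ x) = 0" by (intro cinner_ext_right) simp
    then have "x - Q @@ x = 0" by (rule assms)
    then show ?thesis using Q(2)[of x] by simp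
  qed
  then show ?thesis by blast
qed

text \<open>With A = sqrt (Z^2) in the role of |Z|, \<open>E\<close> projects onto the kernel of |Z|
  + Z: it is the spectral projection of \<open>Z\<close> for the half line up to 0. That kernel is
  invariant under everything commuting with \<open>Z\<close>, and this commutant is closed under
  adjoints, so \<open>E\<close> commutes with it. The last clause puts the kernel of
  \<open>Z\<close> into the range of \<open>E\<close>; it is the convention that yields right
  continuity of the spectral family.\<close>

lemma negative_part_proj:
  fixes Z :: "'a::euclidean_space bop"
  assumes Z: "adj Z = Z"
  shows "EX E. proj E & (ALL B. B * Z = Z * B --> B * E = E * B) & (ALL v. E @@ v = v --> Re (cinner (Z @@ v) v) <= 0) &
     (ALL v. E @@ v = 0 --> 0 <= Re (cinner (Z @@ v) v) & (Re (cinner (Z @@ v) v) = 0 --> Z @@ v = 0)) &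
     (ALL v. Z @@ v = 0 --> E @@ v = v)"
proof -
  define A where "A = bsqrt (Z * Z)"
  note pZ = pos_square[OF Z]
  have A: "pos A" "A * A = Z * Z" using pos_bsqrt[OF pZ] bsqrt_square[OF pZ] by (simp_all add: A_def)
  have comA: "B * A = A * B" if "B * Z = Z * B" for B
    unfolding A_def by (rule bsqrt_commute[OF pZ]) (metis that mult.assoc)
  have AZ: "A * Z = Z * A" using comA[of Z] by simp
  obtain E where E: "proj E" "(A + Z) * E = 0" "!!x. (A + Z) @@ x = 0 ==> E @@ x = x"
    using kernel_proj_exists[of "A + Z"] by blast
  have half: "E * B * E = B * E" if "B * Z = Z * B" for B
  proof (rule bop_eqI)
    fix x
    have "(A + Z) * B = B * (A + Z)" using that comA[OF that] by (simp add: distrib_left distrib_right)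
    then have "(A + Z) * (B * E) = B * ((A + Z) * E)" by (metis mult.assoc)
    then have "(A + Z) @@ (B * E) @@ x = 0" using E(2) by (metis app_times app_zero_left mult_zero_right)
    then show "(E * B * E) @@ x = (B * E) @@ x" using E(3) by simp
  qed
  have com: "B * E = E * B" if B: "B * Z = Z * B" for B
  proof -
    have "adj B * Z = Z * adj B" using arg_cong[OF B, of adj] Z by simp
    from arg_cong[OF half[OF this], of adj] have "E * B * E = E * B"
      using E(1) by (simp add: proj_def mult.assoc)
    then show ?thesis using half[OF B] by simp
  qed
  have neg: "Re (cinner (Z @@ v) v) <= 0" if "E @@ v = v" for v
  proof -
    have "(A + Z) @@ v = 0" using arg_cong[OF E(2), of "%T. T @@ v"] that by (metis app_times app_zero_left)
    then have "Z @@ v = - (A @@ v)" by (simp add: eq_neg_iff_add_eq_0 add.commute)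
    then show ?thesis using pos_ge[OF A(1), of v] by (simp add: cinner_minus_left)
  qed
  \<comment> \<open>Since (|Z| + Z)(|Z| - Z) = 0, the range of |Z| - Z is contained in that of
    \<open>E\<close>, hence orthogonal to \<open>v\<close>.\<close>
  have AZv: "A @@ v = Z @@ v" if v: "E @@ v = 0" for v
  proof -
    have "(A + Z) * (A - Z) = 0" using A(2) AZ by (simp add: algebra_simps)
    then have Em: "E @@ (A - Z) @@ x = (A - Z) @@ x" for x
      using E(3) by (metis app_times app_zero_left)
    have "adj (A - Z) = A - Z" using Z pos_adj[OF A(1)] by simp
    then have "cinner ((A - Z) @@ v) ((A - Z) @@ v) = cinner v ((A - Z) @@ ((A - Z) @@ v))"
      by (metis adj_right)
    also have "\<dots> = cinner v (E @@ (A - Z) @@ (A - Z) @@ v)" by (simp only: Em)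
    also have "\<dots> = cinner (E @@ v) ((A - Z) @@ (A - Z) @@ v)" using E(1) by (metis adj_right proj_def)
    finally show ?thesis using v by (simp add: cinner_self)
  qed
  have pos: "0 <= Re (cinner (Z @@ v) v) & (Re (cinner (Z @@ v) v) = 0 --> Z @@ v = 0)" if "E @@ v = 0" for v
    using pos_ge[OF A(1), of v] pos_app_zero[OF A(1), of v] by (simp add: AZv[OF that])
  have ker: "E @@ v = v" if "Z @@ v = 0" for v
  proof (rule E(3))
    have "cinner ((A * A) @@ v) v = 0" unfolding A(2) using that by simp
    then have "cinner (A @@ v) (A @@ v) = 0" using pos_adj[OF A(1)] by (simp add: adj_left)
    then show "(A + Z) @@ v = 0" using that by (simp add: cinner_self)
  qed
  show ?thesis using E(1) com neg pos ker by blast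
qed

lemma proj_mult_norm_sq_diff:
  assumes P: "proj P" "proj Q" "Q * P = Q" "P * Q = Q"
  shows "(norm (P @@ x - Q @@ x))\<^sup>2 = (norm (P @@ x))\<^sup>2 - (norm (Q @@ x))\<^sup>2"
proof -
  have "proj (P - Q)" using P by (simp add: proj_def algebra_simps)
  then have "complex_of_real ((norm ((P - Q) @@ x))\<^sup>2) = cinner ((P - Q) @@ x) x" by (rule proj_diag[symmetric])
  also have "\<dots> = of_real ((norm (P @@ x))\<^sup>2 - (norm (Q @@ x))\<^sup>2)"
    using proj_diag[OF P(1)] proj_diag[OF P(2)] by (simp add: cinner_diff_left)
  finally show ?thesis using of_real_eq_iff by (metis app_diff_left)
qed

text \<open>For nested projections the squared norm of a difference is the difference of the squared
  norms, so monotone convergence of real numbers makes the vectors Cauchy.\<close>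

lemma decreasing_proj_lim:
  fixes Q :: "nat => 'a::euclidean_space bop"
  assumes Q: "!!n. proj (Q n)" "!!m n. n <= m ==> Q m * Q n = Q m"
  shows "EX ps. (%n. Q n @@ ph) \<longlonglongrightarrow> ps & (ALL n. Q n @@ ps = ps)"
proof -
  have Q': "Q n * Q m = Q m" if "n <= m" for m n
    using arg_cong[OF Q(2)[OF that], of adj] Q(1)[of n] Q(1)[of m] by (simp add: proj_def)
  define a where "a n = (norm (Q n @@ ph))\<^sup>2" for n
  have d: "(norm (Q n @@ ph - Q m @@ ph))\<^sup>2 = a n - a m" if "n <= m" for m n
    unfolding a_def by (intro proj_mult_norm_sq_diff Q Q' that)
  have "decseq a" unfolding decseq_def using d zero_le_power2 by (metis diff_ge_0_iff_ge)
  then obtain L where "a \<longlonglongrightarrow> L" using decseq_convergent[of a 0] by (auto simp: a_def)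
  then have "Cauchy a" by (rule LIMSEQ_imp_Cauchy)
  have "Cauchy (%n. Q n @@ ph)"
  proof (rule metric_CauchyI)
    fix e :: real assume e: "0 < e"
    then obtain N where N: "!!m n. N <= m ==> N <= n ==> dist (a m) (a n) < e\<^sup>2"
      using \<open>Cauchy a\<close> metric_CauchyD[of a "e\<^sup>2"] by auto
    have *: "dist (Q n @@ ph) (Q m @@ ph) < e" if "N <= n" "n <= m" for m n
    proof -
      have "(norm (Q n @@ ph - Q m @@ ph))\<^sup>2 < e\<^sup>2" using N[of n m] that d[OF that(2)] by (simp add: dist_real_def)
      then show ?thesis using e by (simp add: dist_norm power_less_imp_less_base)
    qed
    have "dist (Q m @@ ph) (Q n @@ ph) < e" if "N <= m" "N <= n" for m n
      using *[of m n] *[of n m] that by (cases "m <= n") (auto simp: dist_commute)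
    then show "EX N. ALL m>=N. ALL n>=N. dist (Q m @@ ph) (Q n @@ ph) < e" by blast
  qed
  then obtain ps where ps: "(%n. Q n @@ ph) \<longlonglongrightarrow> ps" using Cauchy_convergent convergent_def by blast
  have "Q n @@ ps = ps" for n
  proof (rule LIMSEQ_unique[OF _ ps])
    have "(%m. Q n @@ (Q m @@ ph)) \<longlonglongrightarrow> Q n @@ ps" by (intro tendsto_app tendsto_const ps)
    then show "(%m. Q m @@ ph) \<longlonglongrightarrow> Q n @@ ps"
    proof (rule Lim_transform_eventually)
      show "\<forall>\<^sub>F m in sequentially. Q n @@ Q m @@ ph = Q m @@ ph"
        by (intro eventually_sequentiallyI[of n]) (metis Q' app_times)
    qed
  qed
  then show ?thesis using ps by blast
qed

lemma bounded_oper_graph_app: "bounded_oper (graph_of (%x. T @@ x))"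
  unfolding bounded_oper_def linear_oper_def graph_of_def single_valued_def
  using app_norm by (auto simp: app_add app_scaleC)

lemma orthogonal_projection_app: "proj T ==> orthogonal_projection (%x. T @@ x)"
  unfolding orthogonal_projection_def proj_def by (metis bounded_oper_graph_app app_times adj_left)

section \<open>From a resolvent to a spectral family\<close>

text \<open>The properties of (A + i)^-1 for self-adjoint \<open>A\<close>. The adjoint is (A -
  i)^-1, and \<open>res\<close> is the resolvent identity between the points i and -i.\<close>

locale resolvent_op =
  fixes R :: "'a::euclidean_space bop"
  assumes res: "adj R - R = cop (2 * \<i>) * (adj R * R)"
    and normal: "adj R * R = R * adj R"
    and inj: "R @@ x = 0 ==> x = 0"
begin

lemma adj_inj: "adj R @@ x = 0 ==> x = 0"
  using normal inj by (metis app_times app_zero adj_adj adj_right cinner_zero_left norm_eq_zero cinner_self of_real_eq_0_iff power_eq_0_iff)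

text \<open>For R = (A + i)^-1 these are X = A (A^2 + 1)^-1, Y = (A^2 + 1)^-1 and Z t = (A - t)(A^2
  + 1)^-1. Thus \<open>Z t\<close> is bounded and has the sign of A - t, so its nonpositive part
  gives the spectral projection \<open>EE t\<close> of \<open>A\<close> for the half line up to and
  including \<open>t\<close>.\<close>

definition "X = (1/2) *\<^sub>R (R + adj R)"
definition "Y = adj R * R"
definition "Z t = X - t *\<^sub>R Y"

lemma adj_X: "adj X = X" and adj_Y: "adj Y = Y" and adj_Z: "adj (Z t) = Z t"
  by (simp_all add: X_def Y_def Z_def add.commute)

lemma R_eq: "R = X - cop \<i> * Y" "adj R = X + cop \<i> * Y"
proof -
  have "cop \<i> * Y = (1/2) *\<^sub>R (adj R - R)"
    unfolding res Y_def by (rule bop_eqI) (simp add: scaleR_eq_scaleC)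
  moreover have "R = (1/2) *\<^sub>R (R + adj R) - (1/2) *\<^sub>R (adj R - R)" "adj R = (1/2) *\<^sub>R (R + adj R) + (1/2) *\<^sub>R (adj R - R)"
    by (simp_all add: algebra_simps scaleR_2[symmetric])
  ultimately show "R = X - cop \<i> * Y" "adj R = X + cop \<i> * Y" by (simp_all add: X_def)
qed

lemma com_Z: "B * R = R * B ==> B * adj R = adj R * B ==> B * Z t = Z t * B"
proof -
  assume a: "B * R = R * B" "B * adj R = adj R * B"
  have "B * (adj R * R) = adj R * R * B" by (metis a mult.assoc)
  then show ?thesis using a by (simp add: Z_def X_def Y_def algebra_simps)
qed

definition "EE t = (SOME E. proj E & (ALL B. B * Z t = Z t * B --> B * E = E * B) & (ALL v. E @@ v = v --> Re (cinner (Z t @@ v) v) <= 0) &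
     (ALL v. E @@ v = 0 --> 0 <= Re (cinner (Z t @@ v) v) & (Re (cinner (Z t @@ v) v) = 0 --> Z t @@ v = 0)) &
     (ALL v. Z t @@ v = 0 --> E @@ v = v))"

lemmas EE_some = someI_ex[OF negative_part_proj[OF adj_Z], folded EE_def]

definition "x v = Re (cinner (X @@ v) v)"
definition "y v = Re (cinner (Y @@ v) v)"

lemma Re_Z: "Re (cinner (Z t @@ v) v) = x v - t * y v"
  by (simp add: Z_def x_def y_def cinner_simps)

lemma y_eq: "y v = (norm (R @@ v))\<^sup>2"
  by (simp add: y_def Y_def adj_left[symmetric] Re_cinner_self)

lemma y_ge: "0 <= y v" by (simp add: y_eq)

lemma y_0: "y v <= 0 ==> v = 0"
  using inj by (simp add: y_eq)

lemma EE_proj: "proj (EE t)" using EE_some by blast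
lemma EE_com: "B * Z t = Z t * B ==> B * EE t = EE t * B" using EE_some by blast
lemma EE_le: "EE t @@ v = v ==> x v <= t * y v" using EE_some[of t] Re_Z[of t v] by auto
lemma EE_ge: "EE t @@ v = 0 ==> t * y v <= x v" using EE_some[of t] Re_Z[of t v] by auto
lemma EE_ker: "EE t @@ v = 0 ==> x v = t * y v ==> v = 0" using EE_some[of t] Re_Z[of t v] by (metis diff_self)

lemma EE_R: "EE t * R = R * EE t" "EE t * adj R = adj R * EE t"
  using EE_com[OF com_Z[of R]] EE_com[OF com_Z[of "adj R"]] normal by auto

lemma EE_EE: "EE s * EE t = EE t * EE s"
  by (intro EE_com com_Z EE_R)

text \<open>A vector in the range of \<open>EE s\<close> and in the kernel of \<open>EE t\<close>
  satisfies t y <= x <= s y for its two forms; as s < t this forces y = 0, and y is definite because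
  \<open>R\<close> is injective.\<close>

lemma EE_mono: assumes "s <= t" shows "EE s * EE t = EE s"
proof (cases "s = t")
  case True then show ?thesis using EE_proj[of t] by (simp add: proj_def)
next
  case False
  have "EE s @@ (1 - EE t) @@ w = 0" for w
  proof -
    define v where "v = EE s @@ (1 - EE t) @@ w"
    have 1: "EE s @@ v = v" using EE_proj[of s] by (simp add: v_def proj_def) (metis app_times app_diff)
    have "EE t * (EE s * (1 - EE t)) = EE s * (EE t * (1 - EE t))" by (metis EE_EE mult.assoc)
    then have "EE t * (EE s * (1 - EE t)) = 0" using EE_proj[of t] by (simp add: proj_def algebra_simps)
    then have 2: "EE t @@ v = 0" unfolding v_def by (metis app_times app_zero_left)
    have "t * y v <= s * y v" using EE_le[OF 1] EE_ge[OF 2] by linarith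
    then have "y v <= 0" using False assms y_ge[of v] by (simp add: mult_le_cancel_right)
    then show ?thesis using y_0 by (simp add: v_def)
  qed
  then have "EE s * (1 - EE t) = 0" by (intro bop_eqI) (metis app_times app_zero_left)
  then show ?thesis by (simp add: algebra_simps)
qed

lemma EE_mono': "s <= t ==> EE t * EE s = EE s"
  by (metis EE_mono EE_EE)

definition "F ph t = (norm (EE t @@ ph))\<^sup>2"

lemma F_mono: "s <= t ==> F ph s <= F ph t"
  unfolding F_def by (metis EE_mono proj_norm_le[OF EE_proj] app_times power_mono norm_ge_zero)

text \<open>The jump vector of the decreasing limit at \<open>a\<close> lies in the range of every
  \<open>EE (a + 1 / (n + 1))\<close> and in the kernel of \<open>EE a\<close>; hence x = a y for
  it, and \<open>EE_ker\<close> annihilates it because \<open>EE a\<close> contains the kernel of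
  \<open>Z a\<close>.\<close>

lemma F_right: "continuous (at_right a) (F ph)"
proof (rule continuous_at_right_real_increasing[of "F ph", THEN iffD2], rule F_mono, assumption, intro allI impI)
  fix e :: real assume e: "0 < e"
  define s where "s n = a + 1 / (real n + 1)" for n :: nat
  have dec: "s m <= s n" if "n <= m" for m n using that by (simp add: s_def frac_le)
  obtain ps where ps: "(%n. EE (s n) @@ ph) \<longlonglongrightarrow> ps" "!!n. EE (s n) @@ ps = ps"
    using decreasing_proj_lim[of "%n. EE (s n)" ph] EE_proj EE_mono dec by blast
  have as: "a <= s n" for n by (simp add: s_def)
  define \<delta> where "\<delta> = ps - EE a @@ ph"
  have E1: "EE (s n) @@ \<delta> = \<delta>" for n
    using ps(2)[of n] EE_mono'[OF as[of n]] unfolding \<delta>_def app_diff by (metis app_times)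
  have "(%n. EE a @@ (EE (s n) @@ ph)) \<longlonglongrightarrow> EE a @@ ps" by (intro tendsto_app tendsto_const ps)
  moreover have "EE a @@ (EE (s n) @@ ph) = EE a @@ ph" for n by (metis EE_mono as app_times)
  ultimately have "EE a @@ ps = EE a @@ ph" by (simp add: LIMSEQ_const_iff)
  then have E0: "EE a @@ \<delta> = 0" using EE_proj[of a] unfolding \<delta>_def app_diff proj_def by (metis app_times diff_self)
  have "x \<delta> <= a * y \<delta>"
  proof (rule LIMSEQ_le_const)
    have "(%n. 1 / (real n + 1)) \<longlonglongrightarrow> 0"
      using LIMSEQ_inverse_real_of_nat by (simp add: inverse_eq_divide add.commute)
    then have "(%n. (a + 1 / (real n + 1)) * y \<delta>) \<longlonglongrightarrow> (a + 0) * y \<delta>" by (intro tendsto_intros)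
    then show "(%n. s n * y \<delta>) \<longlonglongrightarrow> a * y \<delta>" by (simp add: s_def)
    show "EX N. ALL n>=N. x \<delta> <= s n * y \<delta>" using EE_le[OF E1] by blast
  qed
  then have "\<delta> = 0" using EE_ge[OF E0] by (intro EE_ker[OF E0]) simp
  then have "ps = EE a @@ ph" by (simp add: \<delta>_def)
  then have Flim: "(%n. F ph (s n)) \<longlonglongrightarrow> F ph a" unfolding F_def using ps(1) by (intro tendsto_power tendsto_norm) simp
  have "F ph a < F ph a + e" using e by simp
  from order_tendstoD(2)[OF Flim this] have "\<forall>\<^sub>F n in sequentially. F ph (s n) < F ph a + e" .
  then obtain n where "F ph (s n) < F ph a + e" by (auto simp: eventually_sequentially)
  then show "EX \<delta>>0. F ph (a + \<delta>) - F ph a < e"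
    by (intro exI[of _ "1 / (real n + 1)"]) (auto simp: s_def)
qed

text \<open>The strong limit \<open>ps\<close> satisfies x ps <= - n y ps for every n, which
  excludes y ps > 0.\<close>

lemma F_bot: "(%n. F ph (- real n)) \<longlonglongrightarrow> 0"
proof -
  obtain ps where ps: "(%n. EE (- real n) @@ ph) \<longlonglongrightarrow> ps" "!!n. EE (- real n) @@ ps = ps"
    using decreasing_proj_lim[of "%n. EE (- real n)" ph] EE_proj EE_mono by auto
  have "y ps <= 0"
  proof (rule ccontr)
    assume "\<not> y ps <= 0"
    then obtain n :: nat where "- x ps / y ps < real n" using reals_Archimedean2 by blast
    then show False using EE_le[OF ps(2), of n] \<open>\<not> y ps <= 0\<close> by (simp add: field_simps)
  qed
  then have "ps = 0" by (rule y_0)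
  then have "(%n. (norm (EE (- real n) @@ ph))\<^sup>2) \<longlonglongrightarrow> (norm (0 :: 'a L2))\<^sup>2" using ps(1) by (intro tendsto_intros) simp
  then show ?thesis by (simp add: F_def)
qed

lemma F_top: "(%n. F ph (real n)) \<longlonglongrightarrow> (norm ph)\<^sup>2"
proof -
  have "(1 - EE (real m)) * (1 - EE (real n)) = 1 - EE (real m)" if "n <= m" for m n
    using EE_mono'[of "real n" "real m"] that by (simp add: algebra_simps)
  then obtain ps where ps: "(%n. (1 - EE (real n)) @@ ph) \<longlonglongrightarrow> ps" "!!n. (1 - EE (real n)) @@ ps = ps"
    using decreasing_proj_lim[of "%n. 1 - EE (real n)" ph] proj_compl[OF EE_proj] by blast
  have E0: "EE (real n) @@ ps = 0" for n using ps(2)[of n] by simp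
  have "y ps <= 0"
  proof (rule ccontr)
    assume "\<not> y ps <= 0"
    then obtain n :: nat where "x ps / y ps < real n" using reals_Archimedean2 by blast
    then show False using EE_ge[OF E0, of n] \<open>\<not> y ps <= 0\<close> by (simp add: field_simps)
  qed
  then have "ps = 0" by (rule y_0)
  then have "(%n. ph - (1 - EE (real n)) @@ ph) \<longlonglongrightarrow> ph - 0" using ps(1) by (intro tendsto_intros) simp
  then have "(%n. EE (real n) @@ ph) \<longlonglongrightarrow> ph" by simp
  then show ?thesis unfolding F_def by (intro tendsto_intros)
qed

section \<open>From the spectral family to a projection-valued measure\<close>

definition "m ph = interval_measure (F ph)"

lemma sets_m [simp]: "sets (m ph) = sets borel" and space_m [simp]: "space (m ph) = UNIV"
  by (simp_all add: m_def)

lemma m_Ioc: "a <= b ==> emeasure (m ph) {a<..b} = ennreal ((norm ((EE b - EE a) @@ ph))\<^sup>2)"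
  using proj_mult_norm_sq_diff[OF EE_proj EE_proj EE_mono EE_mono', of a b ph]
  by (simp add: m_def emeasure_interval_measure_Ioc[OF _ F_mono F_right]) (simp add: F_def)

lemma m_UNIV: "emeasure (m ph) UNIV = ennreal ((norm ph)\<^sup>2)"
proof -
  have "(%n. emeasure (m ph) {- real n<..real n}) \<longlonglongrightarrow> emeasure (m ph) (\<Union>n. {- real n<..real n})"
    by (intro Lim_emeasure_incseq) (auto simp: incseq_def)
  moreover have "(\<Union>n. {- real n<..real n}) = UNIV"
  proof -
    have "EX n::nat. - real n < t & t <= real n" for t
      using reals_Archimedean2[of "\<bar>t\<bar>"] by (auto simp: abs_less_iff intro: less_imp_le) (metis less_imp_le minus_less_iff)
    then show ?thesis by auto
  qed
  moreover have "emeasure (m ph) {- real n<..real n} = ennreal (F ph (real n) - F ph (- real n))" for n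
    by (simp add: m_def emeasure_interval_measure_Ioc[OF _ F_mono F_right])
  moreover have "(%n. ennreal (F ph (real n) - F ph (- real n))) \<longlonglongrightarrow> ennreal ((norm ph)\<^sup>2 - 0)"
    by (intro tendsto_ennrealI tendsto_diff F_top F_bot)
  ultimately show ?thesis using LIMSEQ_unique by fastforce
qed

text \<open>The sets represented by a projection contain the half-open intervals and are closed
  under complements and disjoint unions. This replaces a proof that the measure of a fixed Borel set
  is a quadratic form in \<open>ph\<close>.\<close>

definition rep_proj :: "real set => 'a bop => bool" where
  "rep_proj B Q \<longleftrightarrow> proj Q & (ALL ph. emeasure (m ph) B = ennreal ((norm (Q @@ ph))\<^sup>2))"

lemma rep_proj_unique: "rep_proj B Q ==> rep_proj B Q' ==> Q = Q'"
  by (rule bop_eq_diag) (auto simp: rep_proj_def proj_diag)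

text \<open>Orthogonality comes from counting mass: the measure of the vector Q_j ps has total mass
  equal to its squared norm, all of which sits on B_j, so nothing is left for B_i. The partial sums
  are then increasing projections and converge strongly.\<close>

lemma rep_proj_union:
  fixes B :: "nat => real set"
  assumes B: "disjoint_family B" "!!i. B i \<in> sets borel" and Q: "!!i. rep_proj (B i) (Q i)"
  shows "EX S. rep_proj (\<Union>i. B i) S & (ALL ph. (%i. Q i @@ ph) sums (S @@ ph))"
proof -
  have P: "proj (Q i)" for i using Q by (simp add: rep_proj_def)
  have ort: "Q i * Q j = 0" if "i ~= j" for i j
  proof (rule bop_eqI)
    fix ps
    have "emeasure (m (Q j @@ ps)) (B i) + emeasure (m (Q j @@ ps)) (B j) = emeasure (m (Q j @@ ps)) (B i \<union> B j)"
      using B that by (intro plus_emeasure) (auto simp: disjoint_family_on_def)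
    also have "\<dots> <= emeasure (m (Q j @@ ps)) UNIV" by (intro emeasure_mono) auto
    finally have "ennreal ((norm (Q i @@ Q j @@ ps))\<^sup>2 + (norm (Q j @@ Q j @@ ps))\<^sup>2) <= ennreal ((norm (Q j @@ ps))\<^sup>2)"
      using Q[of i] Q[of j] by (simp add: rep_proj_def m_UNIV)
    then have "(norm (Q i @@ Q j @@ ps))\<^sup>2 + (norm (Q j @@ Q j @@ ps))\<^sup>2 <= (norm (Q j @@ ps))\<^sup>2"
      by (rule ennreal_le_iff[THEN iffD1, rotated]) simp
    moreover have "Q j @@ Q j @@ ps = Q j @@ ps" using P[of j] by (metis app_times proj_def)
    ultimately have "(norm (Q i @@ Q j @@ ps))\<^sup>2 <= 0" by simp
    then show "(Q i * Q j) @@ ps = 0 @@ ps" by simp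
  qed
  define S where "S n = (\<Sum>i<n. Q i)" for n
  have QS: "Q i * S n = (if i < n then Q i else 0)" "S n * Q i = (if i < n then Q i else 0)" for i n
  proof -
    have "Q i * S n = (\<Sum>j<n. if i = j then Q i else 0)" "S n * Q i = (\<Sum>j<n. if j = i then Q i else 0)"
      unfolding S_def sum_distrib_left sum_distrib_right
      by (rule sum.cong; use ort P in \<open>auto simp: proj_def\<close>)+
    then show "Q i * S n = (if i < n then Q i else 0)" "S n * Q i = (if i < n then Q i else 0)" by simp_all
  qed
  have adjS: "adj (S n) = S n" for n
    unfolding S_def by (induction n) (use P in \<open>auto simp: proj_def\<close>)
  have SS: "S k * S n = S k" if "k <= n" for k n
  proof -
    have "S k * S n = (\<Sum>i<k. Q i * S n)" by (simp add: S_def sum_distrib_right)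
    also have "\<dots> = S k" unfolding QS(1) using that by (simp add: S_def)
    finally show ?thesis .
  qed
  have SS': "S n * S k = S k" if "k <= n" for k n
    using arg_cong[OF SS[OF that], of adj] by (simp add: adjS)
  have PS: "proj (S n)" for n using SS[of n n] adjS by (simp add: proj_def)
  have "EX ps. (%n. (1 - S n) @@ ph) \<longlonglongrightarrow> ps & (ALL n. (1 - S n) @@ ps = ps)" for ph
    by (rule decreasing_proj_lim[OF proj_compl[OF PS]]) (simp add: algebra_simps SS')
  then obtain f where f: "!!ph. (%n. (1 - S n) @@ ph) \<longlonglongrightarrow> f ph" "!!ph n. (1 - S n) @@ f ph = f ph" by metis
  have lim: "(%n. S n @@ ph) \<longlonglongrightarrow> ph - f ph" for ph
    using tendsto_diff[OF tendsto_const f(1)[of ph], of ph] by simp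
  have "EX T. ALL ph. T @@ ph = ph - f ph"
  proof (rule bop_exists[of _ 1])
    show "x + y - f (x + y) = x - f x + (y - f y)" for x y
      by (rule LIMSEQ_unique[OF lim]) (unfold app_add, intro tendsto_add lim)
    show "c *\<^sub>C x - f (c *\<^sub>C x) = c *\<^sub>C (x - f x)" for c x
      by (rule LIMSEQ_unique[OF lim]) (unfold app_scaleC, intro tendsto_scaleC tendsto_const lim)
    show "norm (x - f x) <= 1 * norm x" for x
      by (rule LIMSEQ_le_const2[OF tendsto_norm[OF lim]]) (simp add: proj_norm_le[OF PS])
  qed
  then obtain T where T: "!!ph. T @@ ph = ph - f ph" by blast
  have "adj T = T"
  proof (rule adj_unique, rule LIMSEQ_unique)
    fix x y
    show "(%n. cinner (S n @@ x) y) \<longlonglongrightarrow> cinner (T @@ x) y" unfolding T by (intro tendsto_cinner tendsto_const lim)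
    have "(%n. cinner x (S n @@ y)) \<longlonglongrightarrow> cinner x (T @@ y)" unfolding T by (intro tendsto_cinner tendsto_const lim)
    then show "(%n. cinner (S n @@ x) y) \<longlonglongrightarrow> cinner x (T @@ y)" by (simp add: adj_left adjS)
  qed
  moreover have "T * T = T"
  proof (rule bop_eqI)
    fix ph
    have "S n @@ f ph = 0" for n using f(2)[of n ph] by simp
    then have "(%n. S n @@ f ph) \<longlonglongrightarrow> 0" by simp
    then have "T @@ f ph = 0" unfolding T by (rule LIMSEQ_unique[OF lim])
    then show "(T * T) @@ ph = T @@ ph" using T[of ph] by (simp add: app_diff)
  qed
  ultimately have PT: "proj T" by (simp add: proj_def)
  have sums: "(%i. Q i @@ ph) sums (T @@ ph)" for ph
  proof -
    have "(\<Sum>i<n. Q i @@ ph) = S n @@ ph" for n by (induction n) (simp_all add: S_def)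
    then show ?thesis using lim[of ph] by (simp add: sums_def T)
  qed
  have "emeasure (m ph) (\<Union>i. B i) = ennreal ((norm (T @@ ph))\<^sup>2)" for ph
  proof -
    have "(%i. inner (Q i @@ ph) ph) sums inner (T @@ ph) ph"
      by (rule bounded_linear.sums[OF bounded_linear_inner_left sums])
    then have s: "(%i. (norm (Q i @@ ph))\<^sup>2) sums (norm (T @@ ph))\<^sup>2"
      unfolding inner_eq_Re_cinner proj_diag[OF P] proj_diag[OF PT] by (simp del: of_real_power)
    have "emeasure (m ph) (\<Union>i. B i) = (\<Sum>i. emeasure (m ph) (B i))"
      using B by (intro suminf_emeasure[symmetric]) auto
    also have "\<dots> = (\<Sum>i. ennreal ((norm (Q i @@ ph))\<^sup>2))" using Q by (simp add: rep_proj_def)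
    also have "\<dots> = ennreal ((norm (T @@ ph))\<^sup>2)" by (intro suminf_ennreal_eq s) simp
    finally show ?thesis .
  qed
  then show ?thesis using PT sums by (auto simp: rep_proj_def)
qed

text \<open>Dynkin's argument over the intersection-stable family of half-open intervals; a
  complement is represented by 1 - Q because the total mass is the squared norm of
  \<open>ph\<close>.\<close>

lemma rep_proj_exists: assumes "B \<in> sets borel" shows "EX Q. rep_proj B Q"
proof -
  let ?G = "range (%(a, b). {a<..b::real})"
  have borel: "sets borel = sigma_sets UNIV ?G"
    unfolding borel_sigma_sets_Ioc by (rule sets_measure_of) auto
  have I: "Int_stable ?G"
  proof (rule Int_stableI)
    fix a b assume "a \<in> ?G" "b \<in> ?G"
    then obtain p q r s where "a = {p<..q}" "b = {r<..s}" by auto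
    then have "a \<inter> b = {max p r<..min q s}" by auto
    then show "a \<inter> b \<in> ?G" by (auto intro!: image_eqI[of _ _ "(max p r, min q s)"])
  qed
  have "B \<in> sigma_sets UNIV ?G" using assms borel by simp
  have G: "?G \<subseteq> Pow UNIV" by simp
  from I G \<open>B \<in> sigma_sets UNIV ?G\<close> show ?thesis
  proof (induct rule: sigma_sets_induct_disjoint)
    case (basic A)
    then obtain a b where A: "A = {a<..b}" by auto
    show ?case
    proof (cases "a <= b")
      case True
      have "proj (EE b - EE a)" using EE_proj[of a] EE_proj[of b] EE_mono[OF True] EE_mono'[OF True]
        by (simp add: proj_def algebra_simps)
      then show ?thesis using m_Ioc[OF True] unfolding rep_proj_def A by blast
    next
      case False
      then show ?thesis by (intro exI[of _ 0]) (simp add: rep_proj_def proj_def A)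
    qed
  next
    case empty then show ?case by (intro exI[of _ 0]) (simp add: rep_proj_def proj_def)
  next
    case (compl A)
    then obtain Q where Q: "rep_proj A Q" by blast
    have "emeasure (m ph) (UNIV - A) = ennreal ((norm ((1 - Q) @@ ph))\<^sup>2)" for ph
    proof -
      have "emeasure (m ph) (UNIV - A) = emeasure (m ph) UNIV - emeasure (m ph) A"
        using compl(1) Q borel by (intro emeasure_Diff) (auto simp: rep_proj_def)
      also have "\<dots> = ennreal ((norm ph)\<^sup>2 - (norm (Q @@ ph))\<^sup>2)"
        using Q by (simp add: m_UNIV rep_proj_def ennreal_minus)
      also have "(norm ph)\<^sup>2 - (norm (Q @@ ph))\<^sup>2 = (norm ((1 - Q) @@ ph))\<^sup>2"
        using proj_pythagoras[of Q ph] Q by (simp add: rep_proj_def)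
      finally show ?thesis .
    qed
    then show ?case using Q proj_compl unfolding rep_proj_def by blast
  next
    case (union A)
    then obtain Q where "!!i. rep_proj (A i) (Q i)" by metis
    then show ?case using rep_proj_union[of A Q] union(1,2) borel by blast
  qed
qed

definition "PP B = (%ph. (SOME Q. rep_proj B Q) @@ ph)"

lemma PP_app: "rep_proj B Q ==> PP B ph = Q @@ ph"
  unfolding PP_def using someI[of "rep_proj B" Q] rep_proj_unique by metis

lemma PP_pvm: "projection_valued_measure PP"
  unfolding projection_valued_measure_def
proof (intro conjI allI impI ballI)
  fix B :: "real set" assume "B \<in> sets borel"
  then obtain Q where "rep_proj B Q" using rep_proj_exists by blast
  moreover from this have "PP B = (%x. Q @@ x)" using PP_app by blast
  ultimately show "orthogonal_projection (PP B)" by (simp add: rep_proj_def orthogonal_projection_app)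
next
  have "rep_proj UNIV 1" by (simp add: rep_proj_def proj_def m_UNIV)
  then show "PP UNIV ph = ph" for ph using PP_app by simp
next
  fix A :: "nat => real set" and ph assume A: "range A \<subseteq> sets borel" "disjoint_family A"
  then have "ALL i. EX Q. rep_proj (A i) Q" using rep_proj_exists by blast
  then obtain Q where Q: "!!i. rep_proj (A i) (Q i)" by metis
  then obtain S where S: "rep_proj (\<Union>i. A i) S" "ALL ph. (%i. Q i @@ ph) sums (S @@ ph)"
    using rep_proj_union[OF A(2) _ Q] A(1) by blast
  show "(%k. PP (A k) ph) sums PP (\<Union>k. A k) ph"
    unfolding PP_app[OF Q] PP_app[OF S(1)] using S(2) by blast
qed

sublocale PP: pvm PP by standard (rule PP_pvm)

lemma PP_E: "rep_proj B Q ==> B \<in> sets borel ==> PP.E B = Q"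
  by (rule bop_eqI) (simp add: PP.E_app PP_app)

section \<open>The constructed measure reproduces the resolvent\<close>

text \<open>On the range of EE b - EE a the operator \<open>A\<close> lies between a and b, so (A -
  b) R is bounded by (b - a) R there. In bounded terms, (b - a) Y - Z b and (b - a) Y + Z b are
  positive and commute on that range; positivity of their product compares the norms of
  \<open>Z b\<close> and \<open>Y\<close>.\<close>

lemma R_small_interval:
  assumes ab: "a <= b" and v: "EE b @@ v = v" "EE a @@ v = 0"
  shows "norm (R @@ v - inverse (of_real b + \<i>) *\<^sub>C v) <= (b - a) * norm v"
proof -
  define Q where "Q = EE b - EE a"
  \<comment> \<open>This is (A - b) R, so that \<open>Z b\<close> equals
    \<open>adj R * D\<close>.\<close>
  define D where "D = 1 - cop (of_real b + \<i>) * R"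
  have Q: "proj Q" using EE_proj[of a] EE_proj[of b] EE_mono[OF ab] EE_mono'[OF ab]
    by (simp add: proj_def algebra_simps Q_def)
  have QR: "Q * R = R * Q" "Q * adj R = adj R * Q" using EE_R by (simp_all add: Q_def algebra_simps)
  have QH: "Q * Z b = Z b * Q" by (rule com_Z[OF QR])
  have QY: "Q * Y = Y * Q" unfolding Y_def by (metis QR mult.assoc)
  have range: "a * y w <= x w & x w <= b * y w" if "Q @@ w = w" for w
  proof -
    have "EE b * Q = Q" "EE a * Q = 0"
      using EE_proj[of a] EE_proj[of b] EE_mono[OF ab] EE_mono'[OF ab] by (simp_all add: Q_def proj_def algebra_simps)
    then have "EE b @@ w = w" "EE a @@ w = 0" using that by (metis app_times app_zero_left)+
    then show ?thesis using EE_le EE_ge by blast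
  qed
  have comYZ: "Y * Z b = Z b * Y" by (rule com_Z; simp add: Y_def; metis normal mult.assoc)
  let ?d = "b - a"
  have pos: "pos (T * Q)" if "adj T = T" "Q * T = T * Q" "!!w. Q @@ w = w ==> 0 <= Re (cinner (T @@ w) w)" for T
    unfolding pos_def
  proof (intro conjI allI)
    show "adj (T * Q) = T * Q" using that Q by (simp add: proj_def)
    fix w
    have "(T * Q) = Q * (T * Q)" using that(2) Q by (metis mult.assoc proj_def)
    then have "cinner ((T * Q) @@ w) w = cinner (T @@ (Q @@ w)) (Q @@ w)"
      using Q by (metis adj_right app_times proj_def)
    moreover have "Q @@ Q @@ w = Q @@ w" using Q by (metis app_times proj_def)
    ultimately show "0 <= Re (cinner ((T * Q) @@ w) w)" using that(3)[of "Q @@ w"] by simp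
  qed
  have RxZ: "Re (cinner ((?d *\<^sub>R Y - Z b) @@ w) w) = ?d * y w - (x w - b * y w)"
    "Re (cinner ((?d *\<^sub>R Y + Z b) @@ w) w) = ?d * y w + (x w - b * y w)" for w
    using Re_Z[of b w] by (simp_all add: cinner_simps y_def)
  have p1: "pos ((?d *\<^sub>R Y - Z b) * Q)"
  proof (rule pos)
    show "0 <= Re (cinner ((?d *\<^sub>R Y - Z b) @@ w) w)" if "Q @@ w = w" for w
      unfolding RxZ using range[OF that] mult_nonneg_nonneg[of ?d "y w"] ab y_ge[of w] by linarith
  qed (simp_all add: adj_Y adj_Z algebra_simps QY QH)
  have p2: "pos ((?d *\<^sub>R Y + Z b) * Q)"
  proof (rule pos)
    show "0 <= Re (cinner ((?d *\<^sub>R Y + Z b) @@ w) w)" if "Q @@ w = w" for w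
      unfolding RxZ using range[OF that] by (simp add: algebra_simps)
  qed (simp_all add: adj_Y adj_Z algebra_simps QY QH)
  have QQ: "Q * Q = Q" using Q by (simp add: proj_def)
  have mQ: "(S * Q) * (T * Q) = S * T * Q" if "Q * T = T * Q" for S T
  proof -
    have "(S * Q) * (T * Q) = S * (Q * T) * Q" by (simp only: mult.assoc)
    then show ?thesis by (simp only: that mult.assoc QQ)
  qed
  have m1: "((?d *\<^sub>R Y - Z b) * Q) * ((?d *\<^sub>R Y + Z b) * Q) = (?d *\<^sub>R Y - Z b) * (?d *\<^sub>R Y + Z b) * Q"
    by (rule mQ) (simp add: algebra_simps QY QH)
  have m2: "((?d *\<^sub>R Y + Z b) * Q) * ((?d *\<^sub>R Y - Z b) * Q) = (?d *\<^sub>R Y + Z b) * (?d *\<^sub>R Y - Z b) * Q"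
    by (rule mQ) (simp add: algebra_simps QY QH)
  have prod: "(d *\<^sub>R Y - Z b) * (d *\<^sub>R Y + Z b) = (d * d) *\<^sub>R (Y * Y) - Z b * Z b"
    "(d *\<^sub>R Y + Z b) * (d *\<^sub>R Y - Z b) = (d * d) *\<^sub>R (Y * Y) - Z b * Z b" for d
    by (simp_all add: distrib_left distrib_right left_diff_distrib right_diff_distrib scaleR_diff_right scaleR_add_right comYZ)
  have "pos (((?d * ?d) *\<^sub>R (Y * Y) - Z b * Z b) * Q)"
    using pos_times[OF p1 p2] unfolding m1 m2 prod by blast
  then have HY: "(norm (Z b @@ w))\<^sup>2 <= (?d * norm (Y @@ w))\<^sup>2" if "Q @@ w = w" for w
  proof -
    assume "pos (((?d * ?d) *\<^sub>R (Y * Y) - Z b * Z b) * Q)"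
    from pos_ge[OF this, of w] have "0 <= (?d * ?d) * Re (cinner (Y @@ Y @@ w) w) - Re (cinner (Z b @@ Z b @@ w) w)"
      using that by (simp add: cinner_simps)
    moreover have "Re (cinner (T @@ T @@ w) w) = (norm (T @@ w))\<^sup>2" if "adj T = T" for T :: "'a bop"
      using adj_right[of T "T @@ w" w] that by (simp add: Re_cinner_self)
    ultimately show ?thesis using adj_Y adj_Z[of b] by (simp add: power2_eq_square ac_simps)
  qed
  have HD: "Z b = adj R * D" "adj R * D = D * adj R"
  proof -
    have "adj R * D = adj R - cop (of_real b + \<i>) * Y"
      unfolding D_def Y_def right_diff_distrib mult_1_right by (metis cop_commute mult.assoc)
    also have "\<dots> = X + cop \<i> * Y - cop (of_real b + \<i>) * Y" using R_eq(2) by simp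
    also have "\<dots> = Z b" by (rule bop_eqI) (simp add: Z_def scaleC_add_left scaleR_eq_scaleC)
    finally show "Z b = adj R * D" ..
    show "adj R * D = D * adj R"
      unfolding D_def right_diff_distrib left_diff_distrib mult_1_right mult_1_left
      by (metis cop_commute mult.assoc normal)
  qed
  \<comment> \<open>The inequality between \<open>Z b\<close> and \<open>Y\<close> is the desired
    one evaluated at vectors in the range of \<open>adj R\<close>; that range is dense and both
    sides are continuous.\<close>
  have DQ: "norm (D @@ Q @@ w) <= ?d * norm (R @@ Q @@ w)" for w
  proof -
    have "range (%x. adj R @@ x) \<subseteq> {w. norm (D @@ Q @@ w) <= ?d * norm (R @@ Q @@ w)}"
    proof clarify
      fix u
      have w: "Q @@ Q @@ u = Q @@ u" using QQ by (metis app_times)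
      have "D * (Q * adj R) = Z b * Q" unfolding HD(1) QR(2) HD(2) by (metis HD(2) mult.assoc)
      then have 1: "D @@ Q @@ adj R @@ u = Z b @@ Q @@ u" by (metis app_times)
      have "R * (Q * adj R) = Y * Q" unfolding QR(2) Y_def normal by (simp only: mult.assoc)
      then have 2: "R @@ Q @@ adj R @@ u = Y @@ Q @@ u" by (metis app_times)
      show "norm (D @@ Q @@ adj R @@ u) <= ?d * norm (R @@ Q @@ adj R @@ u)"
        unfolding 1 2 by (rule power2_le_imp_le[OF HY[OF w]]) (use ab in simp)
    qed
    moreover have "closed {w. norm (D @@ Q @@ w) <= ?d * norm (R @@ Q @@ w)}"
      by (intro closed_Collect_le continuous_intros)
    ultimately have "closure (range (%x. adj R @@ x)) \<subseteq> {w. norm (D @@ Q @@ w) <= ?d * norm (R @@ Q @@ w)}"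
      by (rule closure_minimal)
    moreover have "closure (range (%x. adj R @@ x)) = UNIV" by (rule dense_range) (simp add: inj)
    ultimately show ?thesis by blast
  qed
  \<comment> \<open>By \<open>res\<close>, the squared norm of R w is the imaginary part of the
    pairing of w with R w.\<close>
  have nR: "norm (R @@ w) <= norm w" for w
  proof -
    have "y w = Im (cinner w (R @@ w))"
    proof -
      have "Re (cinner ((adj R - R) @@ w) w) = 0 & Im (cinner ((adj R - R) @@ w) w) = 2 * y w"
        unfolding res Y_def[symmetric] using adj_Y selfadj_iff[of Y] by (simp add: cinner_simps y_def complex_is_Real_iff)
      moreover have "cinner ((adj R - R) @@ w) w = cinner w (R @@ w) - cnj (cinner w (R @@ w))"
        unfolding app_diff_left cinner_diff_left adj_left[of w R w, symmetric] cinner_commute[of "R @@ w" w] ..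
      ultimately show ?thesis by simp
    qed
    also have "\<dots> <= norm w * norm (R @@ w)" using cmod_cinner_le[of w "R @@ w"] abs_Im_le_cmod[of "cinner w (R @@ w)"] by linarith
    finally show ?thesis unfolding y_eq power2_eq_square
      by (cases "norm (R @@ w) = 0") (auto simp: mult_le_cancel_right)
  qed
  have Qv: "Q @@ v = v" using v by (simp add: Q_def)
  have nz: "of_real b + \<i> ~= 0" by (rule resolvent_fun_nz)
  have "R @@ v - inverse (of_real b + \<i>) *\<^sub>C v = (- inverse (of_real b + \<i>)) *\<^sub>C (D @@ v)"
    using nz by (simp add: D_def scaleC_diff_right scaleC_minus_left)
  then have "norm (R @@ v - inverse (of_real b + \<i>) *\<^sub>C v) = cmod (resolvent_fun b) * norm (D @@ v)"
    by (simp only: norm_scaleC norm_minus_cancel resolvent_fun_def)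
  also have "\<dots> <= 1 * (?d * norm (R @@ v))"
    using DQ[of v] Qv by (intro mult_mono resolvent_fun_le) auto
  also have "\<dots> <= ?d * norm v" using nR[of v] ab by (simp add: mult_left_mono)
  finally show ?thesis .
qed

text \<open>The difference \<open>V\<close> commutes with the projections of a partition of the line
  into intervals of length \<open>d\<close>, and on each range it is at most 2 d: one d from
  \<open>R_small_interval\<close>, one because \<open>resolvent_fun\<close> has Lipschitz constant
  1. Orthogonality of the ranges gives the same bound on the whole space, and d is
  arbitrary.\<close>

theorem fc_resolvent: "PP.fc resolvent_fun = R"
proof (rule bop_eqI)
  fix ph
  define V where "V = PP.fc resolvent_fun - R"
  have key: "norm (V @@ ph) <= 2 * d * norm ph" if d: "0 < d" for d
  proof -
    define I where "I j = {real_of_int j * d<..(real_of_int j + 1) * d}" for j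
    have Ib: "I j \<in> sets borel" for j by (simp add: I_def)
    have le: "real_of_int j * d <= (real_of_int j + 1) * d" for j using d by (simp add: distrib_right)
    define Q where "Q j = EE ((real_of_int j + 1) * d) - EE (real_of_int j * d)" for j
    have Qproj: "proj (Q j)" for j
      using EE_proj[of "real_of_int j * d"] EE_proj[of "(real_of_int j + 1) * d"] EE_mono[OF le[of j]] EE_mono'[OF le[of j]]
      by (simp add: proj_def algebra_simps Q_def)
    have rp: "rep_proj (I j) (Q j)" for j
      using m_Ioc[OF le] Qproj unfolding rep_proj_def I_def Q_def by blast
    have EQ: "PP.E (I j) = Q j" for j by (rule PP_E[OF rp Ib])
    have QV: "Q j * V = V * Q j" for j
    proof -
      have "Q j * PP.fc resolvent_fun = PP.fc resolvent_fun * Q j"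
        unfolding EQ[symmetric] PP.fc_indicator[OF Ib, symmetric]
          PP.fc_mult[OF bounded_borel_indicator[OF Ib] bounded_borel_resolvent_fun, symmetric]
          PP.fc_mult[OF bounded_borel_resolvent_fun bounded_borel_indicator[OF Ib], symmetric]
        by (simp only: mult.commute)
      moreover have "Q j * R = R * Q j" using EE_R by (simp add: Q_def algebra_simps)
      ultimately show ?thesis by (simp add: V_def algebra_simps)
    qed
    have small: "norm (V @@ v) <= 2 * d * norm v" if v: "Q j @@ v = v" for j v
    proof -
      define b where "b = (real_of_int j + 1) * d"
      define a where "a = real_of_int j * d"
      have ab: "a <= b" "b - a = d" using le by (auto simp: a_def b_def distrib_right)
      have "EE b * Q j = Q j" "EE a * Q j = 0"
        using EE_proj[of a] EE_proj[of b] EE_mono[OF ab(1)] EE_mono'[OF ab(1)]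
        by (simp_all add: Q_def proj_def algebra_simps flip: a_def b_def[unfolded distrib_right])
           (simp_all add: Q_def proj_def algebra_simps a_def b_def)
      then have Ev: "EE b @@ v = v" "EE a @@ v = 0" using v by (metis app_times app_zero_left)+
      have 1: "norm (R @@ v - resolvent_fun b *\<^sub>C v) <= d * norm v"
        using R_small_interval[OF ab(1) Ev] ab(2) by (simp add: resolvent_fun_def)
      let ?g = "%t. (resolvent_fun t - resolvent_fun b) * of_real (indicator (I j) t)"
      have bb: "bounded_borel (%t. resolvent_fun t - resolvent_fun b)"
        by (intro bounded_borel_diff bounded_borel_resolvent_fun bounded_borel_const)
      have bg: "bounded_borel ?g" by (intro bounded_borel_mult bb bounded_borel_indicator Ib)
      have "PP.fc ?g = (PP.fc resolvent_fun - cop (resolvent_fun b)) * Q j"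
      proof -
        have "PP.fc (%t. resolvent_fun b) = cop (resolvent_fun b)"
          using PP.fc_cmult[OF bounded_borel_const[of 1], of "resolvent_fun b"] by (simp add: PP.fc_one)
        then show ?thesis
          unfolding PP.fc_mult[OF bb bounded_borel_indicator[OF Ib]] PP.fc_indicator[OF Ib] EQ
            PP.fc_diff[OF bounded_borel_resolvent_fun bounded_borel_const] by simp
      qed
      then have eq: "PP.fc resolvent_fun @@ v - resolvent_fun b *\<^sub>C v = PP.fc ?g @@ v" using v by simp
      have "cmod (?g t) <= d" for t
      proof (cases "t \<in> I j")
        case True
        then have "\<bar>b - t\<bar> <= d" by (auto simp: I_def b_def distrib_right)
        have "resolvent_fun t - resolvent_fun b = of_real (b - t) * (resolvent_fun t * resolvent_fun b)"
          using resolvent_fun_nz[of t] resolvent_fun_nz[of b] by (simp add: resolvent_fun_def field_simps)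
        then have "cmod (resolvent_fun t - resolvent_fun b) = \<bar>b - t\<bar> * (cmod (resolvent_fun t) * cmod (resolvent_fun b))"
          by (simp only: norm_mult norm_of_real)
        also have "\<dots> <= d * (1 * 1)"
          by (intro mult_mono resolvent_fun_le \<open>\<bar>b - t\<bar> <= d\<close>) (use d in auto)
        finally show ?thesis using True by simp
      qed (use d in simp)
      then have "norm (PP.fc ?g @@ v) <= d * norm v" by (rule PP.fc_norm_app_le[OF bg])
      then have "norm (PP.fc resolvent_fun @@ v - resolvent_fun b *\<^sub>C v) <= d * norm v" unfolding eq .
      moreover have Vv: "V @@ v = (PP.fc resolvent_fun @@ v - resolvent_fun b *\<^sub>C v) - (R @@ v - resolvent_fun b *\<^sub>C v)"
        by (simp add: V_def)
      ultimately show ?thesis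
        unfolding Vv using 1 norm_triangle_ineq4[of "PP.fc resolvent_fun @@ v - resolvent_fun b *\<^sub>C v" "R @@ v - resolvent_fun b *\<^sub>C v"]
        by linarith
    qed
    have "(\<Union>j. I j) = UNIV"
    proof -
      have "t \<in> I (\<lceil>t / d\<rceil> - 1)" for t
      proof -
        have "real_of_int (\<lceil>t / d\<rceil> - 1) * d < t / d * d" "t / d * d <= (real_of_int (\<lceil>t / d\<rceil> - 1) + 1) * d"
          by (intro mult_strict_right_mono mult_right_mono d less_imp_le[OF d]; linarith)+
        then show ?thesis using d by (simp add: I_def)
      qed
      then show ?thesis by blast
    qed
    moreover have "disjoint_family I"
      unfolding disjoint_family_on_def
    proof (intro ballI impI)
      have *: "I j \<inter> I k = {}" if "j < k" for j k
      proof -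
        have "real_of_int j + 1 <= real_of_int k" using that by linarith
        then have "(real_of_int j + 1) * d <= real_of_int k * d" using d by (simp add: mult_right_mono)
        then show ?thesis by (auto simp: I_def)
      qed
      fix j k :: int assume "j ~= k"
      then show "I j \<inter> I k = {}" using *[of j k] *[of k j] by (cases "j < k") auto
    qed
    ultimately have sum: "ennreal ((norm ps)\<^sup>2) = (\<integral>\<^sup>+j. ennreal ((norm (Q j @@ ps))\<^sup>2) \<partial>count_space UNIV)" for ps
      using emeasure_UN_countable[where X = I and I = UNIV and M = "PP.\<mu> ps"] Ib
      by (simp add: PP.emeasure_mu PP.E_UNIV EQ image_subset_iff)
    have "ennreal ((norm (V @@ ph))\<^sup>2) <= (\<integral>\<^sup>+j. ennreal ((2 * d)\<^sup>2) * ennreal ((norm (Q j @@ ph))\<^sup>2) \<partial>count_space UNIV)"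
      unfolding sum[of "V @@ ph"]
    proof (rule nn_integral_mono)
      fix j
      have "Q j @@ V @@ ph = V @@ Q j @@ ph" using QV by (metis app_times)
      moreover have "Q j @@ Q j @@ ph = Q j @@ ph" using Qproj[of j] by (metis app_times proj_def)
      ultimately have "norm (Q j @@ V @@ ph) <= 2 * d * norm (Q j @@ ph)" using small by simp
      then have "(norm (Q j @@ V @@ ph))\<^sup>2 <= (2 * d)\<^sup>2 * (norm (Q j @@ ph))\<^sup>2"
        unfolding power_mult_distrib[symmetric] by (rule power_mono) simp
      then show "ennreal ((norm (Q j @@ V @@ ph))\<^sup>2) <= ennreal ((2 * d)\<^sup>2) * ennreal ((norm (Q j @@ ph))\<^sup>2)"
        by (simp add: ennreal_mult[symmetric] del: power_mult_distrib)
    qed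
    also have "\<dots> = ennreal ((2 * d)\<^sup>2) * ennreal ((norm ph)\<^sup>2)"
      unfolding sum[of ph] by (rule nn_integral_cmult) simp
    also have "\<dots> = ennreal ((2 * d * norm ph)\<^sup>2)" unfolding power_mult_distrib by (simp add: ennreal_mult)
    finally have "ennreal ((norm (V @@ ph))\<^sup>2) <= ennreal ((2 * d * norm ph)\<^sup>2)" .
    then have "(norm (V @@ ph))\<^sup>2 <= (2 * d * norm ph)\<^sup>2" by (rule ennreal_le_iff[THEN iffD1, rotated]) simp
    then show ?thesis by (rule power2_le_imp_le) (use d in simp)
  qed
  have "norm (V @@ ph) <= 0"
  proof (rule field_le_epsilon)
    fix e :: real assume e: "0 < e"
    define a where "a = norm ph + 1"
    have a: "0 < a" "norm ph <= a" by (simp_all add: a_def add_nonneg_pos)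
    have "norm (V @@ ph) <= 2 * (e / 2 / a) * norm ph" by (rule key) (use e a in simp)
    also have "\<dots> = e * (norm ph / a)" by simp
    also have "\<dots> <= e * 1" using e a by (intro mult_left_mono) (auto simp: divide_le_eq)
    finally show "norm (V @@ ph) <= 0 + e" by simp
  qed
  then show "PP.fc resolvent_fun @@ ph = R @@ ph" by (simp add: V_def)
qed

lemma R_graph_sym: "cinner (x' - \<i> *\<^sub>C (R @@ x')) (R @@ y') = cinner (R @@ x') (y' - \<i> *\<^sub>C (R @@ y'))"
proof -
  have "cinner x' (R @@ y') - cinner (R @@ x') y' = cinner ((adj R - R) @@ x') y'"
    by (simp add: cinner_simps adj_left)
  also have "\<dots> = 2 * \<i> * cinner (R @@ x') (R @@ y')"
    unfolding res by (simp add: cinner_simps adj_right)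
  finally have "cinner x' (R @@ y') = cinner (R @@ x') y' + 2 * \<i> * cinner (R @@ x') (R @@ y')" by (simp add: diff_eq_eq)
  then show ?thesis by (simp add: cinner_simps)
qed

lemma selfadjoint_resolvent_graph: "selfadjoint (resolvent_graph R)"
  unfolding selfadjoint_def
proof (intro conjI)
  have in_graph: "(R @@ ph, ph - \<i> *\<^sub>C (R @@ ph)) \<in> resolvent_graph R" for ph unfolding resolvent_graph_def by blast
  show "linear_oper (resolvent_graph R)"
    unfolding linear_oper_def
  proof (intro conjI allI impI)
    show "single_valued (resolvent_graph R)"
    proof (rule single_valuedI)
      fix a b c assume "(a, b) \<in> resolvent_graph R" "(a, c) \<in> resolvent_graph R"
      then obtain u v where u: "a = R @@ u" "b = u - \<i> *\<^sub>C (R @@ u)" "a = R @@ v" "c = v - \<i> *\<^sub>C (R @@ v)"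
        unfolding resolvent_graph_def by blast
      have "R @@ (u - v) = 0" using u by (simp add: app_diff)
      then have "u = v" using inj by fastforce
      then show "b = c" using u by simp
    qed
    show "(0, 0) \<in> resolvent_graph R" using in_graph[of 0] by simp
    fix ph et ph' et' assume "(ph, et) \<in> resolvent_graph R"
    then obtain u where u: "ph = R @@ u" "et = u - \<i> *\<^sub>C (R @@ u)" unfolding resolvent_graph_def by blast
    { assume "(ph', et') \<in> resolvent_graph R"
      then obtain v where v: "ph' = R @@ v" "et' = v - \<i> *\<^sub>C (R @@ v)" unfolding resolvent_graph_def by blast
      show "(ph + ph', et + et') \<in> resolvent_graph R"
        using in_graph[of "u + v"] by (simp add: u v app_add scaleC_add_right algebra_simps) }
    fix c
    show "(c *\<^sub>C ph, c *\<^sub>C et) \<in> resolvent_graph R"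
      using in_graph[of "c *\<^sub>C u"] by (simp add: u app_scaleC scaleC_diff_right mult.commute)
  qed
  have "Domain (resolvent_graph R) = range (%x. R @@ x)" by (auto simp: resolvent_graph_def)
  then show "closure (Domain (resolvent_graph R)) = UNIV" using dense_range[of R] adj_inj by simp
  show "op_adjoint (resolvent_graph R) = resolvent_graph R"
  proof (intro set_eqI iffI; clarify)
    fix ps th
    { assume "(ps, th) \<in> op_adjoint (resolvent_graph R)"
      then have a: "cinner (u - \<i> *\<^sub>C (R @@ u)) ps = cinner (R @@ u) th" for u
        using in_graph[of u] unfolding op_adjoint_def by blast
      have "ps + \<i> *\<^sub>C (adj R @@ ps) = adj R @@ th"
        by (rule cinner_ext_right) (use a in \<open>simp add: cinner_simps adj_right\<close>)
      then have psi: "ps = adj R @@ (th - \<i> *\<^sub>C ps)" by (simp add: app_diff app_scaleC algebra_simps)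
      \<comment> \<open>With y = th - i ps, the equation already obtained says ps =
        \<open>adj R\<close> y; normality and \<open>res\<close> then turn 2 i R ps into (adj R - R)
        y, which cancels the term R y.\<close>
      have "R @@ (th + \<i> *\<^sub>C ps) = R @@ (th - \<i> *\<^sub>C ps) + (2 * \<i>) *\<^sub>C (R @@ ps)"
        by (simp add: app_add app_diff app_scaleC scaleC_2i)
      also have "(2 * \<i>) *\<^sub>C (R @@ ps) = (2 * \<i>) *\<^sub>C (R @@ adj R @@ (th - \<i> *\<^sub>C ps))"
        by (rule arg_cong[OF psi, of "%x. (2 * \<i>) *\<^sub>C (R @@ x)"])
      also have "\<dots> = (adj R - R) @@ (th - \<i> *\<^sub>C ps)" unfolding res normal by simp
      finally have 1: "R @@ (th + \<i> *\<^sub>C ps) = ps" by (simp add: psi[symmetric])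
      have "(ps, th) = (R @@ (th + \<i> *\<^sub>C ps), (th + \<i> *\<^sub>C ps) - \<i> *\<^sub>C (R @@ (th + \<i> *\<^sub>C ps)))" by (simp add: 1)
      then show "(ps, th) \<in> resolvent_graph R" using in_graph by metis }
    assume "(ps, th) \<in> resolvent_graph R"
    then obtain v where v: "ps = R @@ v" "th = v - \<i> *\<^sub>C (R @@ v)" unfolding resolvent_graph_def by blast
    show "(ps, th) \<in> op_adjoint (resolvent_graph R)"
      unfolding op_adjoint_def v by (auto simp: resolvent_graph_def intro: R_graph_sym)
  qed
qed

end

lemma resolvent_graph_inject: "resolvent_graph R = resolvent_graph R' ==> R = R'"
proof (rule bop_eqI)
  fix x assume "resolvent_graph R = resolvent_graph R'"
  then have "(R @@ x, x - \<i> *\<^sub>C (R @@ x)) \<in> resolvent_graph R'" unfolding resolvent_graph_def by blast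
  then obtain y where y: "R @@ x = R' @@ y" "x - \<i> *\<^sub>C (R @@ x) = y - \<i> *\<^sub>C (R' @@ y)" unfolding resolvent_graph_def by blast
  then have "x = y" by simp
  then show "R @@ x = R' @@ x" using y by simp
qed

section \<open>The resolvent of a self-adjoint operator\<close>

text \<open>Symmetry gives |A ph + c ph|^2 = |A ph|^2 + |ph|^2 for c = i and c = -i. Hence A + c is
  injective with closed range, since \<open>A\<close> is closed as an adjoint; a vector orthogonal
  to the range would be an eigenvector with imaginary eigenvalue, so it vanishes. \<open>R\<close>
  is the inverse for c = i.\<close>

lemma selfadjoint_resolvent:
  fixes A :: "'a::euclidean_space oper"
  assumes A: "selfadjoint A"
  shows "EX R. resolvent_op R & A = resolvent_graph R"
proof -
  have lin: "linear_oper A" and adjA: "op_adjoint A = A" using A by (auto simp: selfadjoint_def)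
  have sv: "(ph, et) \<in> A ==> (ph, et') \<in> A ==> et = et'" for ph et et'
    using lin by (auto simp: linear_oper_def single_valued_def)
  have zero: "(0, 0) \<in> A" and add: "(ph, et) \<in> A ==> (ph', et') \<in> A ==> (ph + ph', et + et') \<in> A"
    and scale: "(ph, et) \<in> A ==> (c *\<^sub>C ph, c *\<^sub>C et) \<in> A" for ph et ph' et' c
    using lin by (auto simp: linear_oper_def)
  have diff: "(ph, et) \<in> A ==> (ph', et') \<in> A ==> (ph - ph', et - et') \<in> A" for ph et ph' et'
    using add scale[of ph' et' "-1"] unfolding uminus_eq_scaleC[symmetric] by (metis diff_conv_add_uminus)
  have sym: "(ph, et) \<in> A ==> (ps, th) \<in> A ==> cinner et ps = cinner ph th" for ph et ps th
    using adjA unfolding op_adjoint_def by blast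
  have adjI: "(ps, th) \<in> A" if "!!ph et. (ph, et) \<in> A ==> cinner et ps = cinner ph th" for ps th
    using that adjA unfolding op_adjoint_def by blast
  have closed: "(ph, et) \<in> A" if "!!n. (f n, g n) \<in> A" "f \<longlonglongrightarrow> ph" "g \<longlonglongrightarrow> et" for f g ph et
  proof (rule adjI)
    fix ps th assume "(ps, th) \<in> A"
    then have "cinner th (f n) = cinner ps (g n)" for n using sym that(1) by blast
    moreover have "(%n. cinner th (f n)) \<longlonglongrightarrow> cinner th ph" "(%n. cinner ps (g n)) \<longlonglongrightarrow> cinner ps et"
      by (intro tendsto_cinner tendsto_const that)+
    ultimately show "cinner th ph = cinner ps et" using LIMSEQ_unique by fastforce
  qed
  have nrm: "(norm (et + c *\<^sub>C ph))\<^sup>2 = (norm et)\<^sup>2 + (norm ph)\<^sup>2" if m: "(ph, et) \<in> A" and c: "c = \<i> | c = - \<i>" for ph et c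
  proof -
    have r: "cinner et ph = cinner ph et" by (rule sym[OF m m])
    have "complex_of_real ((norm (et + c *\<^sub>C ph))\<^sup>2) = of_real ((norm et)\<^sup>2 + (norm ph)\<^sup>2)"
      using c unfolding cinner_self[symmetric] of_real_add by (auto simp: cinner_simps r complex_eq_iff)
    then show ?thesis using of_real_eq_iff by blast
  qed
  have surj: "EX ph et. (ph, et) \<in> A & et + c *\<^sub>C ph = x" if c: "c = \<i> | c = - \<i>" for c x
  proof -
    let ?M = "{et + c *\<^sub>C ph | ph et. (ph, et) \<in> A}"
    have memI: "(ph, et) \<in> A ==> u = et + c *\<^sub>C ph ==> u \<in> ?M" for ph et u by blast
    have Msc: "d *\<^sub>C u \<in> ?M" if "u \<in> ?M" for d u
    proof -
      obtain ph et where "(ph, et) \<in> A" "u = et + c *\<^sub>C ph" using \<open>u \<in> ?M\<close> by blast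
      then show ?thesis by (intro memI[OF scale[of ph et d]]) (simp_all add: scaleC_add_right mult.commute)
    qed
    have sub: "subspace ?M"
      unfolding subspace_def
    proof (intro conjI ballI allI)
      show "0 \<in> ?M" by (rule memI[OF zero]) simp
      show "u + v \<in> ?M" if "u \<in> ?M" "v \<in> ?M" for u v
      proof -
        obtain ph et ph' et' where "(ph, et) \<in> A" "u = et + c *\<^sub>C ph" "(ph', et') \<in> A" "v = et' + c *\<^sub>C ph'"
          using \<open>u \<in> ?M\<close> \<open>v \<in> ?M\<close> by blast
        then show ?thesis by (intro memI[OF add[of ph et ph' et']]) (simp_all add: scaleC_add_right)
      qed
      show "r *\<^sub>R u \<in> ?M" if "u \<in> ?M" for r u unfolding scaleR_eq_scaleC by (rule Msc[OF that])
    qed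
    have "closed ?M"
      unfolding closed_sequential_limits
    proof (intro allI impI, elim conjE)
      fix u l assume u: "ALL n. u n \<in> ?M" and l: "u \<longlonglongrightarrow> l"
      then obtain f g where fg: "!!n. (f n, g n) \<in> A" "!!n. u n = g n + c *\<^sub>C f n" by simp metis
      have d: "(norm (u k - u n))\<^sup>2 = (norm (g k - g n))\<^sup>2 + (norm (f k - f n))\<^sup>2" for k n
        using nrm[OF diff[OF fg(1) fg(1)] c, of k n] by (simp add: fg(2) scaleC_diff_right algebra_simps)
      have le: "dist (f k) (f n) <= dist (u k) (u n)" "dist (g k) (g n) <= dist (u k) (u n)" for k n
        unfolding dist_norm by (rule power2_le_imp_le; simp add: d)+
      have "Cauchy u" using l by (rule LIMSEQ_imp_Cauchy)
      then have "Cauchy f" "Cauchy g" unfolding Cauchy_def using le by (meson le_less_trans)+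
      then obtain ph et where lim: "f \<longlonglongrightarrow> ph" "g \<longlonglongrightarrow> et" using Cauchy_convergent convergent_def by metis
      have "u \<longlonglongrightarrow> et + c *\<^sub>C ph"
        using tendsto_add[OF lim(2) tendsto_scaleC[OF tendsto_const[of c] lim(1)]] unfolding fg(2)[symmetric] .
      then have "l = et + c *\<^sub>C ph" using l LIMSEQ_unique by blast
      then show "l \<in> ?M" using closed[OF fg(1) lim] by blast
    qed
    then obtain Q where Q: "proj Q" "!!x. Q @@ x \<in> ?M" "!!x. x \<in> ?M ==> Q @@ x = x"
      using proj_exists[OF sub _ Msc] by blast
    define ps where "ps = x - Q @@ x"
    have ort: "cinner u ps = 0" if "u \<in> ?M" for u
      using Q(3)[OF that] Q(1) by (simp add: ps_def cinner_diff_right adj_left proj_def)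
    have "(ps, cnj (- c) *\<^sub>C ps) \<in> A"
    proof (rule adjI)
      fix ph et assume "(ph, et) \<in> A"
      then have "cinner (et + c *\<^sub>C ph) ps = 0" by (intro ort memI) auto
      then show "cinner et ps = cinner ph (cnj (- c) *\<^sub>C ps)" by (simp add: cinner_simps eq_neg_iff_add_eq_0)
    qed
    then have "cinner (cnj (- c) *\<^sub>C ps) ps = cinner ps (cnj (- c) *\<^sub>C ps)" using sym by blast
    then have "ps = 0" using c by (auto simp: cinner_simps cinner_self)
    then have "x = Q @@ x" by (simp add: ps_def)
    then have "x \<in> ?M" using Q(2)[of x] by simp
    then show ?thesis by blast
  qed
  obtain r where r: "!!x. (r x, x - \<i> *\<^sub>C r x) \<in> A"
  proof -
    have "EX ph. (ph, x - \<i> *\<^sub>C ph) \<in> A" for x using surj[of \<i> x] by (metis add_diff_cancel_right')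
    then show ?thesis using that by metis
  qed
  have runiq: "ph = r x" if "(ph, x - \<i> *\<^sub>C ph) \<in> A" for ph x
  proof -
    have "(ph - r x, (x - \<i> *\<^sub>C ph) - (x - \<i> *\<^sub>C r x)) \<in> A" by (rule diff[OF that r])
    from nrm[OF this, of \<i>] have "(norm (ph - r x))\<^sup>2 <= 0"
      by (simp add: scaleC_diff_right)
    then show ?thesis by simp
  qed
  have "EX R. ALL x. R @@ x = r x"
  proof (rule bop_exists[of _ 1])
    show "r (x + y) = r x + r y" for x y
      by (rule runiq[symmetric]) (use add[OF r[of x] r[of y]] in \<open>simp add: scaleC_add_right algebra_simps\<close>)
    show "r (c *\<^sub>C x) = c *\<^sub>C r x" for c x
      by (rule runiq[symmetric]) (use scale[OF r[of x], of c] in \<open>simp add: scaleC_diff_right mult.commute\<close>)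
    show "norm (r x) <= 1 * norm x" for x
    proof (rule power2_le_imp_le)
      have "(norm x)\<^sup>2 = (norm (x - \<i> *\<^sub>C r x))\<^sup>2 + (norm (r x))\<^sup>2"
        using nrm[OF r[of x] disjI1[OF refl]] by (simp only: diff_add_cancel)
      then show "(norm (r x))\<^sup>2 <= (1 * norm x)\<^sup>2" by (simp only: mult_1 le_add_same_cancel2 zero_le_power2)
    qed simp
  qed
  then obtain R where R: "!!x. R @@ x = r x" by blast
  have AR: "A = resolvent_graph R"
  proof (intro set_eqI iffI; clarify)
    fix ph et
    { assume m: "(ph, et) \<in> A"
      have "ph = R @@ (et + \<i> *\<^sub>C ph)" unfolding R by (rule runiq) (use m in simp)
      then have "(ph, et) = (R @@ (et + \<i> *\<^sub>C ph), (et + \<i> *\<^sub>C ph) - \<i> *\<^sub>C (R @@ (et + \<i> *\<^sub>C ph)))" by simp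
      then show "(ph, et) \<in> resolvent_graph R" unfolding resolvent_graph_def by blast }
    assume "(ph, et) \<in> resolvent_graph R"
    then show "(ph, et) \<in> A" using r by (auto simp: resolvent_graph_def R)
  qed
  have res: "adj R - R = cop (2 * \<i>) * (adj R * R)"
  proof (rule bop_eqI, rule cinner_ext)
    fix x y
    have "cinner (x - \<i> *\<^sub>C (R @@ x)) (R @@ y) = cinner (R @@ x) (y - \<i> *\<^sub>C (R @@ y))"
      unfolding R by (rule sym[OF r r])
    then have "cinner (adj R @@ x) y - \<i> * cinner (adj R @@ R @@ x) y = cinner (R @@ x) y + \<i> * cinner (adj R @@ R @@ x) y"
      by (simp add: cinner_simps adj_left app_diff app_scaleC)
    then have "cinner (adj R @@ x) y - cinner (R @@ x) y = 2 * \<i> * cinner (adj R @@ R @@ x) y" by algebra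
    then show "cinner ((adj R - R) @@ x) y = cinner ((cop (2 * \<i>) * (adj R * R)) @@ x) y"
      by (simp add: cinner_simps)
  qed
  \<comment> \<open>The Cayley transform (A - i)(A + i)^-1, used to obtain normality of
    \<open>R\<close>.\<close>
  define V where "V = 1 - cop (2 * \<i>) * R"
  have adjV: "adj V = 1 + cop (2 * \<i>) * adj R"
  proof -
    have "adj R * cop (- 2 * \<i>) = - (cop (2 * \<i>) * adj R)" by (rule bop_eqI) (simp add: app_scaleC scaleC_minus_left app_minus)
    then show ?thesis by (simp add: V_def)
  qed
  have four: "cop (2 * \<i>) * (cop (2 * \<i>) * T) = - (4 *\<^sub>R T)" for T :: "'a bop"
    by (rule bop_eqI) (simp add: scaleC_minus_left scaleR_eq_scaleC)
  have VV: "adj V * V = 1"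
  proof -
    have "adj V * V = 1 + cop (2 * \<i>) * (adj R - R) + 4 *\<^sub>R (adj R * R)"
    proof (rule bop_eqI)
      fix x show "(adj V * V) @@ x = (1 + cop (2 * \<i>) * (adj R - R) + 4 *\<^sub>R (adj R * R)) @@ x"
        unfolding adjV by (simp add: V_def app_diff app_scaleC scaleC_diff_right scaleC_add_right scaleC_minus_left scaleR_eq_scaleC)
    qed
    also have "\<dots> = 1" unfolding res four by simp
    finally show ?thesis .
  qed
  have surjV: "EX x. V @@ x = z" for z
  proof -
    obtain ph et where m: "(ph, et) \<in> A" "et + (- \<i>) *\<^sub>C ph = z" using surj[of "- \<i>" z] by blast
    have p: "R @@ (et + \<i> *\<^sub>C ph) = ph" unfolding R by (rule runiq[symmetric]) (use m in simp)
    have "et + \<i> *\<^sub>C ph - (2 * \<i>) *\<^sub>C ph = z"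
      unfolding m(2)[symmetric] by (simp add: scaleC_minus_left scaleC_2i)
    then have "V @@ (et + \<i> *\<^sub>C ph) = z" by (simp add: V_def p)
    then show ?thesis by blast
  qed
  \<comment> \<open>Surjectivity of A - i makes the isometry \<open>V\<close> unitary; expanding
    both products in terms of \<open>R\<close> shows that \<open>adj R * R\<close> and
    \<open>R * adj R\<close> agree.\<close>
  have VV': "V * adj V = 1"
  proof (rule bop_eqI)
    fix z obtain x where "V @@ x = z" using surjV by blast
    then show "(V * adj V) @@ z = 1 @@ z" using VV by (metis app_one app_times)
  qed
  have res': "cop (2 * \<i>) * (adj R - R) = - (4 *\<^sub>R (R * adj R))"
  proof -
    have "V * adj V = 1 + cop (2 * \<i>) * (adj R - R) + 4 *\<^sub>R (R * adj R)"
    proof (rule bop_eqI)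
      fix x show "(V * adj V) @@ x = (1 + cop (2 * \<i>) * (adj R - R) + 4 *\<^sub>R (R * adj R)) @@ x"
        unfolding adjV by (simp add: V_def app_add app_diff app_scaleC scaleC_diff_right scaleC_add_right scaleC_minus_left scaleR_eq_scaleC)
    qed
    then show ?thesis unfolding VV' by (simp add: eq_neg_iff_add_eq_0 add.assoc)
  qed
  have normal: "adj R * R = R * adj R"
    using res' unfolding res four by simp
  have inj: "x = 0" if "R @@ x = 0" for x
  proof -
    have "(0, x) \<in> A" using r[of x] that by (simp add: R)
    then show ?thesis using sv zero by blast
  qed
  show ?thesis using res normal inj AR unfolding resolvent_op_def by blast
qed

text \<open>\<open>spectral_measure A\<close> is a choice, so one witness transfers its properties
  to it. The witness integrates the identity to the graph encoded by its resolvent, and that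
  resolvent is \<open>R\<close> by \<open>fc_resolvent\<close>.\<close>

theorem spectral_theorem:
  assumes "selfadjoint A"
  shows "pvm (spectral_measure A)" and "spectral_integral (spectral_measure A) complex_of_real = A"
proof -
  obtain R where R: "resolvent_op R" "A = resolvent_graph R" using selfadjoint_resolvent[OF assms] by blast
  interpret resolvent_op R by (rule R)
  have "projection_valued_measure PP & spectral_integral PP complex_of_real = A"
    using PP_pvm PP.spectral_integral_id by (simp add: fc_resolvent R)
  then have "projection_valued_measure (spectral_measure A) & spectral_integral (spectral_measure A) complex_of_real = A"
    unfolding spectral_measure_def by (rule someI[of "%P. projection_valued_measure P & spectral_integral P complex_of_real = A"])
  then show "pvm (spectral_measure A)" "spectral_integral (spectral_measure A) complex_of_real = A"
    by (auto simp: pvm_def)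
qed

section \<open>Stone's theorem\<close>

lemma sesquilinear_bop_exists:
  assumes "!!x x' y. B (x + x') y = B x y + B x' y" "!!c x y. B (c *\<^sub>C x) y = c * B x y"
    "!!x y y'. B x (y + y') = B x y + B x y'" "!!c x y. B x (c *\<^sub>C y) = cnj c * B x y"
    and bd: "!!x y. cmod (B x y) <= K * norm x * norm y" and K: "0 <= K"
  shows "EX T. ALL x y. cinner (T @@ x) y = B x y"
proof -
  have "EX th. ALL y. cnj (B x y) = cinner y th" for x
    by (rule riesz[of _ "K * norm x"]) (use assms in simp_all)
  then obtain f where "!!x y. cnj (B x y) = cinner y (f x)" by metis
  then have f: "!!x y. cinner (f x) y = B x y" by (metis cinner_commute complex_cnj_cnj)
  have "EX T. ALL x. T @@ x = f x"
  proof (rule bop_exists[of _ K])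
    show "f (x + y) = f x + f y" "f (c *\<^sub>C x) = c *\<^sub>C f x" for c x y
      by (rule cinner_ext; simp add: f assms cinner_simps)+
    show "norm (f x) <= K * norm x" for x
      by (rule norm_le_cinnerI) (use bd K in \<open>auto simp: f\<close>)
  qed
  then show ?thesis using f by metis
qed

lemma weak_integral_exists:
  fixes S :: "'t => 'a::euclidean_space bop"
  assumes m: "!!x y. (%t. cinner (S t @@ x) y) \<in> borel_measurable M"
    and w: "integrable M w" "!!t. norm (S t) <= w t"
  shows "EX T. ALL x y. cinner (T @@ x) y = (\<integral>t. cinner (S t @@ x) y \<partial>M)"
proof -
  have le: "cmod (cinner (S t @@ x) y) <= w t * (norm x * norm y)" for t x y
  proof -
    have "cmod (cinner (S t @@ x) y) <= norm (S t @@ x) * norm y" by (rule cmod_cinner_le)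
    also have "\<dots> <= (w t * norm x) * norm y"
    proof (rule mult_right_mono)
      show "norm (S t @@ x) <= w t * norm x"
        using app_norm[of "S t" x] mult_right_mono[OF w(2)[of t] norm_ge_zero[of x]] by linarith
    qed simp
    finally show ?thesis by (simp add: mult.assoc)
  qed
  have i: "integrable M (%t. cinner (S t @@ x) y)" for x y
    by (rule Bochner_Integration.integrable_bound[OF integrable_mult_left[OF w(1), of "norm x * norm y"] m])
       (use le in \<open>auto intro!: AE_I2 order.trans[OF _ abs_ge_self]\<close>)
  show ?thesis
  proof (rule sesquilinear_bop_exists[of "%x y. \<integral>t. cinner (S t @@ x) y \<partial>M" "\<integral>t. w t \<partial>M"])
    show "cmod (\<integral>t. cinner (S t @@ x) y \<partial>M) <= (\<integral>t. w t \<partial>M) * norm x * norm y" for x y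
    proof -
      have "cmod (\<integral>t. cinner (S t @@ x) y \<partial>M) <= (\<integral>t. w t * (norm x * norm y) \<partial>M)"
        by (rule order.trans[OF integral_norm_bound integral_mono]) (use i w(1) le in auto)
      then show ?thesis by (simp add: mult.assoc)
    qed
    show "0 <= (\<integral>t. w t \<partial>M)"
      by (rule integral_nonneg_AE) (use w(2) norm_ge_zero order.trans in \<open>blast intro: AE_I2\<close>)
  qed (simp_all add: app_add app_scaleC cinner_simps i)
qed

section \<open>The Laplace transform at 1\<close>

definition laplace_weight :: "real => real" where
  "laplace_weight t = indicator {0..} t * exp (- t)"

lemma laplace_weight_nonneg: "0 <= laplace_weight t"
  by (simp add: laplace_weight_def)

lemma laplace_weight_measurable [measurable]: "laplace_weight \<in> borel_measurable borel"
  unfolding laplace_weight_def[abs_def] by measurable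

lemma has_laplace_weight_integral: "has_bochner_integral lborel laplace_weight 1"
proof -
  have "((%x::real. - exp (- x)) \<longlongrightarrow> 0) at_top" by real_asymp
  then have "(\<integral>\<^sup>+x. ennreal (exp (- x)) * indicator {0..} x \<partial>lborel) = ennreal (0 - (- exp (- 0 :: real)))"
    by (intro nn_integral_FTC_atLeast) (auto intro!: derivative_eq_intros)
  then have "(\<integral>\<^sup>+x. ennreal (laplace_weight x) \<partial>lborel) = ennreal 1"
    by (simp add: laplace_weight_def ennreal_mult' mult.commute ennreal_indicator)
  then show ?thesis
    by (intro has_bochner_integral_nn_integral) (auto simp: laplace_weight_nonneg)
qed

lemmas integrable_laplace_weight = integrable.intros[OF has_laplace_weight_integral]

text \<open>The integral is -1 / (i s - 1), and i s - 1 = i (s + i). So the transform of the group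
  exp (i t A) is i times (A + i)^-1.\<close>

lemma laplace_cis: "(\<integral>t. laplace_weight t *\<^sub>R cis (t * s) \<partial>lborel) = \<i> * resolvent_fun s"
proof -
  define c where "c = \<i> * of_real s - 1"
  have c: "c ~= 0" "- inverse c = \<i> * resolvent_fun s"
  proof -
    show "c ~= 0" by (simp add: c_def complex_eq_iff)
    have "c = \<i> * (of_real s + \<i>)" by (simp add: c_def algebra_simps)
    then show "- inverse c = \<i> * resolvent_fun s" by (simp add: resolvent_fun_def)
  qed
  have ex: "exp (- t) *\<^sub>R cis (t * s) = exp (of_real t * c)" for t
    by (simp add: cis_conv_exp exp_of_real[symmetric] scaleR_conv_of_real exp_add[symmetric] c_def algebra_simps del: exp_of_real)
  have part: "(\<integral>t. indicator {0..real n} t *\<^sub>R exp (of_real t * c) \<partial>lborel) = (exp (of_real (real n) * c) - 1) / c" for n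
  proof -
    have "has_bochner_integral lborel (%t. indicator {0..real n} t *\<^sub>R exp (of_real t * c))
        (exp (of_real (real n) * c) / c - exp (of_real 0 * c) / c)"
    proof (rule has_bochner_integral_FTC_Icc[of 0 "real n" "%t. exp (of_real t * c) / c"])
      fix x :: real
      have "((%z. exp (z * c) / c) has_field_derivative exp (of_real x * c)) (at (of_real x))"
        using c by (auto intro!: derivative_eq_intros)
      from has_vector_derivative_real_field[OF this] show
        "((%t. exp (of_real t * c) / c) has_vector_derivative exp (of_real x * c)) (at x within {0..real n})" .
    qed (auto intro!: continuous_intros)
    then show ?thesis by (simp add: has_bochner_integral_integral_eq diff_divide_distrib)
  qed
  have "(%n. \<integral>t. indicator {0..real n} t *\<^sub>R exp (of_real t * c) \<partial>lborel) \<longlonglongrightarrow> (\<integral>t. laplace_weight t *\<^sub>R cis (t * s) \<partial>lborel)"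
  proof (rule integral_dominated_convergence[OF _ _ integrable_laplace_weight])
    show "(%t. laplace_weight t *\<^sub>R cis (t * s)) \<in> borel_measurable lborel" by (simp add: cis_conv_exp)
    show "AE t in lborel. (%n. indicator {0..real n} t *\<^sub>R exp (of_real t * c)) \<longlonglongrightarrow> laplace_weight t *\<^sub>R cis (t * s)"
    proof (rule AE_I2)
      fix t :: real
      obtain N :: nat where N: "t <= real N" using real_arch_simple by blast
      have "indicator {0..real n} t *\<^sub>R exp (of_real t * c) = laplace_weight t *\<^sub>R cis (t * s)" if "N <= n" for n
        using N that unfolding ex[symmetric] by (auto simp: laplace_weight_def indicator_def)
      then show "(%n. indicator {0..real n} t *\<^sub>R exp (of_real t * c)) \<longlonglongrightarrow> laplace_weight t *\<^sub>R cis (t * s)"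
        by (intro tendsto_eventually eventually_sequentiallyI[of N])
    qed
    show "AE t in lborel. norm (indicator {0..real n} t *\<^sub>R exp (of_real t * c)) <= laplace_weight t" for n
      unfolding ex[symmetric] by (intro AE_I2) (auto simp: laplace_weight_def indicator_def)
  qed simp
  moreover have "(%n. (exp (of_real (real n) * c) - 1) / c) \<longlonglongrightarrow> (0 - 1) / c"
  proof (intro tendsto_divide tendsto_diff tendsto_const)
    have l: "(%n. exp (- real n)) \<longlonglongrightarrow> 0" by real_asymp
    show "(%n. exp (of_real (real n) * c)) \<longlonglongrightarrow> 0"
      unfolding ex[symmetric] by (rule Lim_null_comparison[OF always_eventually l]) simp
  qed (rule c)
  ultimately have "(\<integral>t. laplace_weight t *\<^sub>R cis (t * s) \<partial>lborel) = (0 - 1) / c"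
    unfolding part by (rule LIMSEQ_unique)
  then show ?thesis using c(2) by (simp add: divide_inverse)
qed

section \<open>Strongly continuous unitary groups\<close>

locale ugroup =
  fixes U :: "real => 'a::euclidean_space bop"
  assumes U_0: "U 0 = 1" and U_add: "U (s + t) = U s * U t" and U_adj: "adj (U t) = U (- t)"
    and U_cont: "continuous_on UNIV (%t. U t @@ x)"
begin

lemma U_norm: "norm (U t @@ x) = norm x"
proof -
  have "adj (U t) * U t = 1" unfolding U_adj U_add[symmetric] by (simp add: U_0)
  then have "complex_of_real ((norm (U t @@ x))\<^sup>2) = of_real ((norm x)\<^sup>2)" unfolding norm_app_sq by (simp add: cinner_self)
  then show ?thesis unfolding of_real_eq_iff by (simp add: power2_eq_iff_nonneg)
qed

lemma U_norm_le: "norm (U t) <= 1"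
  by (rule norm_bop_le) (simp_all add: U_norm)

lemma U_meas [measurable]: "(%t. cinner (U t @@ x) y) \<in> borel_measurable borel"
  by (intro borel_measurable_continuous_onI continuous_on_cinner U_cont continuous_on_const)

definition "lap = (SOME T. ALL x y. cinner (T @@ x) y = (\<integral>t. laplace_weight t *\<^sub>R cinner (U t @@ x) y \<partial>lborel))"

lemma lap: "cinner (lap @@ x) y = (\<integral>t. laplace_weight t *\<^sub>R cinner (U t @@ x) y \<partial>lborel)"
proof -
  have "EX T. ALL x y. cinner (T @@ x) y = (\<integral>t. cinner ((laplace_weight t *\<^sub>R U t) @@ x) y \<partial>lborel)"
  proof (rule weak_integral_exists[OF _ integrable_laplace_weight])
    show "norm (laplace_weight t *\<^sub>R U t) <= laplace_weight t" for t
      using mult_left_mono[OF U_norm_le laplace_weight_nonneg, of t t] laplace_weight_nonneg[of t] by simp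
    show "(%t. cinner ((laplace_weight t *\<^sub>R U t) @@ x) y) \<in> borel_measurable lborel" for x y
      by (simp add: cinner_simps)
  qed
  then have "EX T. ALL x y. cinner (T @@ x) y = (\<integral>t. laplace_weight t *\<^sub>R cinner (U t @@ x) y \<partial>lborel)"
    by (simp only: app_scaleR_left cinner_scaleR_left scaleR_conv_of_real[where 'a = complex])
  then show ?thesis unfolding lap_def by (rule someI2_ex) blast
qed

lemma lap_commute: "U s * lap = lap * U s"
proof (rule bop_eqI, rule cinner_ext)
  fix x y
  have "U (- s) @@ y = adj (U s) @@ y" by (simp add: U_adj)
  then have "cinner ((U s * lap) @@ x) y = cinner (lap @@ x) (U (- s) @@ y)" by (simp add: adj_right)
  also have "\<dots> = (\<integral>t. laplace_weight t *\<^sub>R cinner (U t @@ U s @@ x) y \<partial>lborel)"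
    unfolding lap
  proof (rule Bochner_Integration.integral_cong[OF refl])
    fix t
    have "cinner (U t @@ x) (U (- s) @@ y) = cinner (U s @@ U t @@ x) y" by (simp add: adj_right U_adj)
    moreover have "U s @@ U t @@ x = U t @@ U s @@ x" by (metis U_add add.commute app_times)
    ultimately show "laplace_weight t *\<^sub>R cinner (U t @@ x) (U (- s) @@ y) = laplace_weight t *\<^sub>R cinner (U t @@ U s @@ x) y" by simp
  qed
  also have "\<dots> = cinner ((lap * U s) @@ x) y" by (simp add: lap)
  finally show "cinner ((U s * lap) @@ x) y = cinner ((lap * U s) @@ x) y" .
qed

text \<open>Translation in the Laplace integral gives e^s times the integral over t >= s. Once the
  first-order term is subtracted, two remainders are left: one carries e^s - 1 - s, the other is an
  integral over [0, s) of an integrand that tends to 0.\<close>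

lemma lap_shift:
  assumes s: "0 <= s"
  shows "cinner (U s @@ lap @@ x - lap @@ x - s *\<^sub>R (lap @@ x - x)) y =
    of_real (exp s - 1 - s) * cinner (lap @@ x) y -
    (\<integral>t. indicator {0..<s} t *\<^sub>R (exp (s - t) *\<^sub>R cinner (U t @@ x) y - cinner x y) \<partial>lborel)"
proof -
  define k where "k t = cinner (U t @@ x) y" for t
  have [measurable]: "k \<in> borel_measurable borel" unfolding k_def by measurable
  have kb: "cmod (k t) <= norm x * norm y" for t unfolding k_def using cmod_cinner_le[of "U t @@ x" y] by (simp add: U_norm)
  have i1: "integrable lborel (%t. laplace_weight t *\<^sub>R k t)"
    by (rule Bochner_Integration.integrable_bound[OF integrable_mult_left[OF integrable_laplace_weight, of "norm x * norm y"]])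
       (use kb in \<open>auto intro!: AE_I2 mult_left_mono simp: laplace_weight_nonneg\<close>)
  have iI: "integrable lborel (indicat_real {0..<s})" using s by (intro integrable_real_indicator) auto
  then have i0: "integrable lborel (%t. indicator {0..<s} t *\<^sub>R (c :: complex))" for c
    by (rule integrable_scaleR_left)
  have i2: "integrable lborel (%t. indicator {0..<s} t *\<^sub>R exp (s - t) *\<^sub>R k t)"
  proof (rule Bochner_Integration.integrable_bound[OF integrable_mult_left[where c = "exp s * (norm x * norm y)"]])
    show "integrable lborel (indicat_real {0..<s})" by (rule iI)
    show "AE t in lborel. norm (indicator {0..<s} t *\<^sub>R exp (s - t) *\<^sub>R k t) <= norm (indicator {0..<s} t * (exp s * (norm x * norm y)))"
      using kb by (intro AE_I2) (auto simp: indicator_def intro!: mult_mono)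
  qed simp
  have "cinner (U s @@ lap @@ x) y = cinner (lap @@ U s @@ x) y" using lap_commute by (metis app_times)
  also have "\<dots> = (\<integral>t. laplace_weight t *\<^sub>R k (s + 1 * t) \<partial>lborel)"
  proof -
    have "U t @@ U s @@ x = U (s + 1 * t) @@ x" for t by (metis U_add add.commute app_times mult_1)
    then show ?thesis by (simp add: lap k_def)
  qed
  also have "\<dots> = (\<integral>t. laplace_weight (t - s) *\<^sub>R k t \<partial>lborel)"
    using lborel_integral_real_affine[of 1 "%t. laplace_weight (t - s) *\<^sub>R k t" s] by simp
  also have "\<dots> = (\<integral>t. exp s *\<^sub>R laplace_weight t *\<^sub>R k t - indicator {0..<s} t *\<^sub>R exp (s - t) *\<^sub>R k t \<partial>lborel)"
    using s by (intro Bochner_Integration.integral_cong) (auto simp: laplace_weight_def indicator_def exp_add[symmetric] simp del: exp_add)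
  also have "\<dots> = exp s *\<^sub>R cinner (lap @@ x) y - (\<integral>t. indicator {0..<s} t *\<^sub>R exp (s - t) *\<^sub>R k t \<partial>lborel)"
    unfolding Bochner_Integration.integral_diff[OF integrable_scaleR_right[OF i1] i2] integral_scaleR_right
    by (simp only: lap k_def)
  also have "(\<integral>t. indicator {0..<s} t *\<^sub>R exp (s - t) *\<^sub>R k t \<partial>lborel) =
      (\<integral>t. indicator {0..<s} t *\<^sub>R (exp (s - t) *\<^sub>R k t - cinner x y) \<partial>lborel) + s *\<^sub>R cinner x y"
  proof -
    have "(\<integral>t. indicator {0..<s} t *\<^sub>R (exp (s - t) *\<^sub>R k t - cinner x y) \<partial>lborel) =
        (\<integral>t. indicator {0..<s} t *\<^sub>R exp (s - t) *\<^sub>R k t - indicator {0..<s} t *\<^sub>R cinner x y \<partial>lborel)"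
      by (simp only: scaleR_diff_right)
    also have "\<dots> = (\<integral>t. indicator {0..<s} t *\<^sub>R exp (s - t) *\<^sub>R k t \<partial>lborel) - s *\<^sub>R cinner x y"
      unfolding Bochner_Integration.integral_diff[OF i2 i0] using s iI by simp
    finally show ?thesis by simp
  qed
  finally show ?thesis by (simp add: cinner_simps k_def scaleR_conv_of_real algebra_simps)
qed

text \<open>The vectors in the range of \<open>lap\<close> are thus smooth for the group, with
  derivative \<open>lap @@ x - x\<close> at 0. The estimate is tested against arbitrary
  \<open>y\<close> because \<open>lap\<close> is a weak integral.\<close>

lemma lap_deriv:
  assumes e: "0 < e"
  shows "EX d>0. ALL s. 0 < s & s < d --> norm (U s @@ lap @@ x - lap @@ x - s *\<^sub>R (lap @@ x - x)) <= e * s"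
proof -
  have "((%t. U t @@ x) \<longlongrightarrow> U 0 @@ x) (at 0)"
    using U_cont[of x] by (simp add: continuous_on_def)
  from tendstoD[OF this divide_pos_pos[OF e zero_less_numeral]]
  have "\<forall>\<^sub>F t in at 0. dist (U t @@ x) x < e / 3" unfolding U_0 app_one .
  then obtain d1 where d1: "0 < d1" "!!t. t ~= 0 ==> \<bar>t\<bar> < d1 ==> norm (U t @@ x - x) < e / 3"
    unfolding eventually_at by (auto simp: dist_norm)
  define K where "K = norm (lap @@ x) + 2 * norm x + 1"
  have K: "0 < K" by (simp add: K_def add_nonneg_pos)
  define d where "d = min (min d1 1) (e / (3 * K))"
  have "norm (U s @@ lap @@ x - lap @@ x - s *\<^sub>R (lap @@ x - x)) <= e * s" if s: "0 < s" "s < d" for s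
  proof (rule norm_le_cinnerI)
    fix y
    have s1: "s < d1" "s < 1" "s * K <= e / 3" using s K by (auto simp: d_def field_simps)
    have ex: "exp s <= 1 + s + s\<^sup>2" using s s1 by (intro exp_bound) auto
    have ab: "\<bar>exp s - 1 - s\<bar> <= s\<^sup>2" using ex exp_ge_add_one_self[of s] by linarith
    have s2: "s\<^sup>2 <= s" using s s1 by (simp add: power2_eq_square)
    let ?I = "\<integral>t. indicator {0..<s} t *\<^sub>R (exp (s - t) *\<^sub>R cinner (U t @@ x) y - cinner x y) \<partial>lborel"
    have "cmod ?I <= (\<integral>t. indicator {0..<s} t * ((2 * s * norm x + e / 3) * norm y) \<partial>lborel)"
    proof (rule Bochner_Integration.integral_norm_bound_integral)
      show bd: "cmod (indicator {0..<s} t *\<^sub>R (exp (s - t) *\<^sub>R cinner (U t @@ x) y - cinner x y)) <=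
          indicator {0..<s} t * ((2 * s * norm x + e / 3) * norm y)" for t
      proof (cases "t \<in> {0..<s}")
        case True
        have "exp (s - t) *\<^sub>R cinner (U t @@ x) y - cinner x y = cinner ((exp (s - t) - 1) *\<^sub>R U t @@ x + (U t @@ x - x)) y"
          by (simp add: cinner_simps scaleR_conv_of_real algebra_simps)
        also have "cmod \<dots> <= norm ((exp (s - t) - 1) *\<^sub>R U t @@ x + (U t @@ x - x)) * norm y" by (rule cmod_cinner_le)
        also have "\<dots> <= (2 * s * norm x + e / 3) * norm y"
        proof (intro mult_right_mono order.trans[OF norm_triangle_ineq] add_mono)
          have "1 <= exp (s - t)" "exp (s - t) <= exp s" using True by auto
          then have "\<bar>exp (s - t) - 1\<bar> <= 2 * s" using ex s2 by linarith
          then show "norm ((exp (s - t) - 1) *\<^sub>R U t @@ x) <= 2 * s * norm x" by (simp add: U_norm mult_right_mono)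
          show "norm (U t @@ x - x) <= e / 3"
            using d1(2)[of t] True s1 e by (cases "t = 0") (auto simp: U_0 intro: less_imp_le)
        qed simp
        finally show ?thesis using True by simp
      qed simp
      have "integrable lborel (indicat_real {0..<s})" using s by (intro integrable_real_indicator) auto
      then show "integrable lborel (%t. indicator {0..<s} t * ((2 * s * norm x + e / 3) * norm y))" by simp
      from this show "integrable lborel (%t. indicator {0..<s} t *\<^sub>R (exp (s - t) *\<^sub>R cinner (U t @@ x) y - cinner x y))"
        by (rule Bochner_Integration.integrable_bound) (use bd in \<open>auto intro!: AE_I2 order.trans[OF _ abs_ge_self]\<close>)
    qed
    then have I: "cmod ?I <= s * (2 * s * norm x + e / 3) * norm y" using s by simp
    have "cmod (of_real (exp s - 1 - s) * cinner (lap @@ x) y) <= s\<^sup>2 * (norm (lap @@ x) * norm y)"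
      unfolding norm_mult norm_of_real by (intro mult_mono cmod_cinner_le ab) auto
    then have "cmod (cinner (U s @@ lap @@ x - lap @@ x - s *\<^sub>R (lap @@ x - x)) y) <=
        s\<^sup>2 * (norm (lap @@ x) * norm y) + s * (2 * s * norm x + e / 3) * norm y"
      unfolding lap_shift[OF less_imp_le[OF s(1)]] using I norm_triangle_ineq4 add_mono order.trans by blast
    also have "\<dots> = s * ((s * (norm (lap @@ x) + 2 * norm x) + e / 3) * norm y)"
      by (simp add: power2_eq_square algebra_simps)
    also have "\<dots> <= s * ((s * K + e / 3) * norm y)"
      using s by (intro mult_left_mono mult_right_mono add_right_mono) (auto simp: K_def)
    also have "\<dots> <= s * (e * norm y)" using s s1 e by (intro mult_left_mono mult_right_mono) auto
    finally show "cmod (cinner (U s @@ lap @@ x - lap @@ x - s *\<^sub>R (lap @@ x - x)) y) <= e * s * norm y"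
      by (simp add: ac_simps)
  qed (use s e in simp)
  moreover have "0 < d" using d1 e K by (simp add: d_def)
  ultimately show ?thesis by blast
qed

lemma lap_inj: "lap @@ x = 0 ==> x = 0"
proof (rule ccontr)
  assume z: "lap @@ x = 0" and x: "x ~= 0"
  then obtain d where "0 < d" "ALL s. 0 < s & s < d --> norm (U s @@ lap @@ x - lap @@ x - s *\<^sub>R (lap @@ x - x)) <= norm x / 2 * s"
    using lap_deriv[of "norm x / 2" x] by auto
  then have "norm ((d / 2) *\<^sub>R x) <= norm x / 2 * (d / 2)" by (auto simp: z dest!: spec[of _ "d / 2"])
  then show False using x \<open>0 < d\<close> by simp
qed

end

section \<open>A unitary group is determined by its Laplace transform\<close>

text \<open>The product rule for a pairing of two orbits. Because the groups act by isometries,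
  \<open>d\<close> does not depend on \<open>t\<close>; this uniformity lets a one-sided estimate
  yield a two-sided derivative.\<close>

lemma ugroup_deriv_product:
  assumes U: "ugroup U" and V: "ugroup V" and e: "0 < e"
  shows "EX d>0. ALL t s. 0 < s & s < d -->
    cmod (cinner (U (t + s) @@ ugroup.lap U @@ x) (V (t + s) @@ ugroup.lap V @@ y)
      - cinner (U t @@ ugroup.lap U @@ x) (V t @@ ugroup.lap V @@ y)
      - of_real s * (cinner (U t @@ (ugroup.lap U @@ x - x)) (V t @@ ugroup.lap V @@ y)
        + cinner (U t @@ ugroup.lap U @@ x) (V t @@ (ugroup.lap V @@ y - y)))) <= e * s"
proof -
  interpret U: ugroup U by (rule U)
  interpret V: ugroup V by (rule V)
  define a b a' b' where "a = U.lap @@ x" and "b = V.lap @@ y" and "a' = U.lap @@ x - x" and "b' = V.lap @@ y - y"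
  define K where "K = norm a' * (norm b' + 1) + norm b + norm a + 1"
  have K: "0 < K" by (simp add: K_def add_nonneg_pos)
  define f where "f = min 1 (e / K)"
  have f: "0 < f" "f <= 1" "f * K <= e" using K e by (auto simp: f_def min_def field_simps)
  obtain d1 where d1: "0 < d1" "!!s. 0 < s ==> s < d1 ==> norm (U s @@ a - a - s *\<^sub>R a') <= f * s"
    using U.lap_deriv[OF f(1), of x] by (auto simp: a_def a'_def)
  obtain d2 where d2: "0 < d2" "!!s. 0 < s ==> s < d2 ==> norm (V s @@ b - b - s *\<^sub>R b') <= f * s"
    using V.lap_deriv[OF f(1), of y] by (auto simp: b_def b'_def)
  define d where "d = min (min d1 d2) f"
  have main: "cmod (cinner (U (t + s) @@ a) (V (t + s) @@ b) - cinner (U t @@ a) (V t @@ b)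
      - of_real s * (cinner (U t @@ a') (V t @@ b) + cinner (U t @@ a) (V t @@ b'))) <= e * s"
    if s: "0 < s" "s < d" for t s
  proof -
    define p q where "p = U s @@ a - a - s *\<^sub>R a'" and "q = V s @@ b - b - s *\<^sub>R b'"
    have pq: "norm p <= f * s" "norm q <= f * s" and sf: "s <= f" "s <= 1"
      using d1(2)[of s] d2(2)[of s] s f by (auto simp: d_def p_def q_def)
    define u v where "u = U t @@ a" and "v = V t @@ b"
    have eq: "U (t + s) @@ a = U t @@ (a + s *\<^sub>R a' + p)" "V (t + s) @@ b = V t @@ (b + s *\<^sub>R b' + q)"
      by (simp_all add: U.U_add V.U_add p_def q_def)
    have "cinner (U (t + s) @@ a) (V (t + s) @@ b) - cinner u v
      - of_real s * (cinner (U t @@ a') v + cinner u (V t @@ b')) =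
      of_real s * cinner (U t @@ a') (V t @@ (s *\<^sub>R b' + q)) + cinner (U t @@ p) (V (t + s) @@ b) + cinner u (V t @@ q)"
      unfolding eq u_def v_def by (simp add: app_add app_scaleR cinner_simps algebra_simps)
    also have "cmod \<dots> <= s * (norm a' * (s * norm b' + f * s)) + f * s * norm b + norm a * (f * s)"
    proof (intro order.trans[OF norm_triangle_ineq] add_mono)
      have "norm (V t @@ (s *\<^sub>R b' + q)) <= s * norm b' + f * s"
        unfolding V.U_norm using norm_triangle_ineq[of "s *\<^sub>R b'" q] pq(2) s by simp
      then show "cmod (of_real s * cinner (U t @@ a') (V t @@ (s *\<^sub>R b' + q))) <= s * (norm a' * (s * norm b' + f * s))"
        using s cmod_cinner_le[of "U t @@ a'" "V t @@ (s *\<^sub>R b' + q)"]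
        by (auto simp: norm_mult U.U_norm intro!: mult_left_mono elim!: order.trans)
      show "cmod (cinner (U t @@ p) (V (t + s) @@ b)) <= f * s * norm b"
        using cmod_cinner_le[of "U t @@ p" "V (t + s) @@ b"] mult_right_mono[OF pq(1), of "norm b"]
        by (simp add: U.U_norm V.U_norm)
      show "cmod (cinner u (V t @@ q)) <= norm a * (f * s)"
        using cmod_cinner_le[of u "V t @@ q"] mult_left_mono[OF pq(2), of "norm a"] by (simp add: u_def U.U_norm V.U_norm)
    qed
    also have "\<dots> <= s * (norm a' * (f * norm b' + f * 1)) + f * s * norm b + norm a * (f * s)"
      using s sf f by (intro add_right_mono mult_left_mono add_mono mult_right_mono) auto
    also have "\<dots> = (f * (norm a' * (norm b' + 1) + norm b + norm a)) * s" by (simp add: algebra_simps)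
    also have "\<dots> <= (f * K) * s" using s f by (intro mult_right_mono mult_left_mono) (auto simp: K_def)
    also have "\<dots> <= e * s" using f(3) s by (intro mult_right_mono) auto
    finally show ?thesis by (simp add: u_def v_def)
  qed
  have "0 < d" using d1 d2 f by (simp add: d_def)
  then show ?thesis
    by (intro exI[of _ d] conjI allI impI main[unfolded a_def b_def a'_def b'_def]) auto
qed

text \<open>A pairing of two vectors moved by the same group is constant, so its derivative along
  smooth vectors vanishes. The outcome is the resolvent identity for \<open>lap\<close>.\<close>

lemma (in ugroup) lap_identity: "2 *\<^sub>R (adj lap * lap) = adj lap + lap"
proof (rule bop_eqI, rule cinner_ext)
  fix x y
  have UU: "cinner (U t @@ u) (U t @@ v) = cinner u v" for t u v
    using U_add[of "- t" t] by (simp add: adj_left U_adj U_0) (metis app_one app_times)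
  define D where "D = cinner (lap @@ x - x) (lap @@ y) + cinner (lap @@ x) (lap @@ y - y)"
  have small: "cmod D <= e" if e: "0 < e" for e
  proof -
    obtain d where "0 < d" and d: "!!s. 0 < s ==> s < d ==> cmod (of_real s * D) <= e * s"
      using ugroup_deriv_product[OF ugroup_axioms ugroup_axioms e, of x y] unfolding UU D_def by auto
    then have "cmod (of_real (d / 2) * D) <= e * (d / 2)" by (intro d) auto
    then show ?thesis using \<open>0 < d\<close> by (simp add: norm_mult)
  qed
  have "cmod D <= 0" by (rule field_le_epsilon) (simp add: small)
  then show "cinner ((2 *\<^sub>R (adj lap * lap)) @@ x) y = cinner ((adj lap + lap) @@ x) y"
    by (simp add: D_def cinner_simps adj_left[symmetric] adj_right algebra_simps)
qed

text \<open>The pairing of the U-orbit and the V-orbit of smooth vectors has derivative 0, since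
  \<open>lap_identity\<close> involves only the common transform. It is therefore constant, and as
  the range of the transform is dense, the adjoint of \<open>V t\<close> inverts
  \<open>U t\<close>.\<close>

lemma ugroup_unique:
  assumes U: "ugroup U" and V: "ugroup V" and eq: "ugroup.lap U = ugroup.lap V"
  shows "U t = V t"
proof -
  interpret U: ugroup U by (rule U)
  interpret V: ugroup V by (rule V)
  have key: "cinner (U t @@ U.lap @@ x) (V t @@ U.lap @@ y) = cinner (U.lap @@ x) (U.lap @@ y)" for x y t
  proof -
    define f where "f t = cinner (U t @@ U.lap @@ x) (V t @@ U.lap @@ y)" for t
    have zero: "cinner (U t @@ (U.lap @@ x - x)) (V t @@ U.lap @@ y) + cinner (U t @@ U.lap @@ x) (V t @@ (U.lap @@ y - y)) = 0" for t
    proof -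
      define u v where "u = U t @@ x" and "v = V t @@ y"
      have "U t @@ U.lap @@ x = U.lap @@ u" "V t @@ U.lap @@ y = U.lap @@ v"
        using U.lap_commute V.lap_commute by (simp_all add: u_def v_def eq app_times[symmetric] del: app_times)
      moreover have "cinner ((2 *\<^sub>R (adj U.lap * U.lap)) @@ u) v = cinner ((adj U.lap + U.lap) @@ u) v"
        by (simp only: U.lap_identity)
      ultimately show ?thesis
        by (simp add: app_diff u_def[symmetric] v_def[symmetric] cinner_simps adj_left[symmetric] algebra_simps)

    qed
    have step: "EX d>0. ALL t s. 0 < s & s < d --> cmod (f (t + s) - f t) <= e * s" if "0 < e" for e
      using ugroup_deriv_product[OF U V that, of x y] unfolding eq[symmetric] f_def[symmetric] zero by simp
    have "(f has_vector_derivative 0) (at t within UNIV)" for t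
      unfolding has_vector_derivative_def has_derivative_at2
    proof (intro conjI bounded_linear_zero)
      show "bounded_linear (%h::real. h *\<^sub>R (0::complex))" by simp
      show "(%y. (1 / norm (y - t)) *\<^sub>R (f y - (f t + (y - t) *\<^sub>R 0))) \<midarrow>t\<rightarrow> 0"
      proof (rule tendstoI)
        fix e :: real assume "0 < e"
        then obtain d where d: "0 < d" "!!t s. 0 < s ==> s < d ==> cmod (f (t + s) - f t) <= e / 2 * s"
          using step[of "e / 2"] by auto
        have "dist ((1 / norm (y - t)) *\<^sub>R (f y - (f t + (y - t) *\<^sub>R 0))) 0 < e" if y: "y ~= t" "dist y t < d" for y
        proof -
          have "cmod (f y - f t) <= e / 2 * \<bar>y - t\<bar>"
            using d(2)[of "y - t" t] d(2)[of "t - y" y] y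
            by (cases "t < y") (auto simp: dist_real_def norm_minus_commute)
          then have "cmod (f y - f t) / \<bar>y - t\<bar> <= e / 2" using y by (simp add: divide_le_eq)
          then have "cmod (f y - f t) / \<bar>y - t\<bar> < e" using \<open>0 < e\<close> by linarith
          then show ?thesis by (simp add: dist_norm)
        qed
        then show "\<forall>\<^sub>F y in at t. dist ((1 / norm (y - t)) *\<^sub>R (f y - (f t + (y - t) *\<^sub>R 0))) 0 < e"
          unfolding eventually_at using d(1) by blast
      qed
    qed
    then obtain c where "!!t. f t = c"
      using has_vector_derivative_zero_constant[of UNIV f] by (metis UNIV_I convex_UNIV)
    then have "f t = f 0" by simp
    then show ?thesis by (simp add: f_def U.U_0 V.U_0)
  qed
  have adjlap: "x = 0" if "adj U.lap @@ x = 0" for x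
  proof -
    have "adj U.lap @@ x + U.lap @@ x = 2 *\<^sub>R (adj U.lap @@ U.lap @@ x)"
      using arg_cong[OF U.lap_identity, of "%T. T @@ x"] by simp
    then have "cinner (U.lap @@ x) x = cinner (2 *\<^sub>R (adj U.lap @@ U.lap @@ x)) x" using that by simp
    moreover have "cinner (U.lap @@ x) x = 0" using that by (simp add: adj_right)
    ultimately have "cinner (U.lap @@ x) (U.lap @@ x) = 0" by (simp add: cinner_simps adj_left[symmetric])
    then show ?thesis using U.lap_inj by (simp add: cinner_self)
  qed
  have dense: "closure (range (%x. U.lap @@ x)) = UNIV" by (rule dense_range) (rule adjlap)
  have "adj (V t) * U t = 1"
  proof (rule bop_eqI)
    fix x
    have "cinner (adj (V t) @@ U t @@ x - x) y = 0" if "x \<in> range (%x. U.lap @@ x)" "y \<in> range (%x. U.lap @@ x)" for x y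
      using that key by (auto simp: cinner_diff_left adj_left[symmetric])
    then have A: "ALL z:range (%x. U.lap @@ x) \<times> range (%x. U.lap @@ x). cinner (adj (V t) @@ U t @@ fst z - fst z) (snd z) = 0" by auto
    have "closed {z. cinner (adj (V t) @@ U t @@ fst z - fst z) (snd z) = 0}"
      by (intro closed_Collect_eq continuous_on_cinner continuous_on_app continuous_intros)
    then have "closure (range (%x. U.lap @@ x) \<times> range (%x. U.lap @@ x)) \<subseteq> {z. cinner (adj (V t) @@ U t @@ fst z - fst z) (snd z) = 0}"
      using A by (intro closure_minimal) auto
    then have "(x, y) \<in> {z. cinner (adj (V t) @@ U t @@ fst z - fst z) (snd z) = 0}" for y
      unfolding closure_Times dense by (rule subsetD) simp
    then have "cinner (adj (V t) @@ U t @@ x - x) y = 0" for y by simp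
    from this[of "adj (V t) @@ U t @@ x - x"] show "(adj (V t) * U t) @@ x = 1 @@ x" by (simp add: cinner_self)
  qed
  then have "V t * adj (V t) * U t = V t" by (simp add: mult.assoc)
  moreover have "V t * adj (V t) = 1" unfolding V.U_adj V.U_add[symmetric] by (simp add: V.U_0)
  ultimately show ?thesis by simp
qed

lemma bounded_borel_cis: "bounded_borel (%s. cis (t * s))"
  by (rule bounded_borelI[of _ 1]) (auto simp: cis_conv_exp)

context pvm
begin

lemma fc_ugroup: "ugroup (%t. fc (%s. cis (t * s)))"
proof
  show "fc (%s. cis (0 * s)) = 1" by (simp add: fc_one)
  show "fc (%u. cis ((s + t) * u)) = fc (%u. cis (s * u)) * fc (%u. cis (t * u))" for s t
    unfolding fc_mult[OF bounded_borel_cis bounded_borel_cis, symmetric] by (simp add: cis_mult distrib_right)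
  show "adj (fc (%s. cis (t * s))) = fc (%s. cis (- t * s))" for t
    unfolding fc_cnj[OF bounded_borel_cis, symmetric] by (simp add: cis_cnj)
  show "continuous_on UNIV (%t. fc (%s. cis (t * s)) @@ x)" for x
    unfolding continuous_on_sequentially comp_def
  proof clarify
    fix f :: "nat => real" and a assume "f \<longlonglongrightarrow> a"
    then have "(%n. cis (f n * s)) \<longlonglongrightarrow> cis (a * s)" for s
      unfolding cis_conv_exp by (intro tendsto_intros)
    then show "(%n. fc (%s. cis (f n * s)) @@ x) \<longlonglongrightarrow> fc (%s. cis (a * s)) @@ x"
      by (intro fc_dominated_convergence[where K = 1] bounded_borel_cis) auto
  qed
qed

text \<open>On the diagonal, Fubini interchanges the Laplace integral and the scalar spectral
  measure, and \<open>laplace_cis\<close> evaluates the inner integral.\<close>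

lemma fc_lap: "ugroup.lap (%t. fc (%s. cis (t * s))) = cop \<i> * fc resolvent_fun"
proof (rule bop_eq_diag)
  fix x
  interpret U: ugroup "%t. fc (%s. cis (t * s))" by (rule fc_ugroup)
  interpret M: finite_measure "\<mu> x" by (rule finite_mu)
  interpret pair_sigma_finite lborel "\<mu> x" by standard
  have [measurable]: "(%(t, s). laplace_weight t *\<^sub>R cis (t * s)) \<in> borel_measurable (lborel \<Otimes>\<^sub>M \<mu> x)"
    by (simp add: cis_conv_exp split_beta' sets_pair_measure_cong[OF sets_lborel sets_mu] cong: measurable_cong_sets)
  have int: "integrable (lborel \<Otimes>\<^sub>M \<mu> x) (%(t, s). laplace_weight t *\<^sub>R cis (t * s))"
  proof (rule Fubini_integrable)
    show "integrable lborel (%t. \<integral>s. norm (case (t, s) of (t, s) => laplace_weight t *\<^sub>R cis (t * s)) \<partial>\<mu> x)"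
      using integrable_laplace_weight by (simp add: laplace_weight_nonneg)
    have "integrable (\<mu> x) (%s. laplace_weight t *\<^sub>R cis (t * s))" for t
      by (intro integrable_scaleR_right integrable_bounded_borel bounded_borel_cis)
    then show "AE t in lborel. integrable (\<mu> x) (%s. case (t, s) of (t, s) => laplace_weight t *\<^sub>R cis (t * s))" by simp
  qed measurable
  have "cinner (U.lap @@ x) x = (\<integral>t. (\<integral>s. laplace_weight t *\<^sub>R cis (t * s) \<partial>\<mu> x) \<partial>lborel)"
    unfolding U.lap fc_diag[OF bounded_borel_cis] by simp
  also have "\<dots> = (\<integral>s. (\<integral>t. laplace_weight t *\<^sub>R cis (t * s) \<partial>lborel) \<partial>\<mu> x)"
    by (rule Fubini_integral[OF int, symmetric])
  also have "\<dots> = cinner ((cop \<i> * fc resolvent_fun) @@ x) x"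
    unfolding laplace_cis by (simp add: cinner_simps fc_diag bounded_borel_resolvent_fun)
  finally show "cinner (U.lap @@ x) x = cinner ((cop \<i> * fc resolvent_fun) @@ x) x" .
qed

end

text \<open>The reversed group has the adjoint transform; applying \<open>lap_identity\<close> to it
  gives the product in the other order, hence normality of the resolvent.\<close>

lemma (in ugroup) ugroup_reverse: "ugroup (%t. U (- t))"
proof
  show "U (- (s + t)) = U (- s) * U (- t)" for s t using U_add[of "- s" "- t"] by simp
  show "continuous_on UNIV (%t. U (- t) @@ x)" for x
    by (rule continuous_on_compose2[OF U_cont continuous_on_minus[OF continuous_on_id]]) simp
qed (simp_all add: U_0 U_adj)

lemma (in ugroup) lap_reverse: "ugroup.lap (%t. U (- t)) = adj lap"
proof (rule bop_eqI, rule cinner_ext)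
  fix x y
  interpret V: ugroup "%t. U (- t)" by (rule ugroup_reverse)
  have "cinner (V.lap @@ x) y = cnj (\<integral>t. laplace_weight t *\<^sub>R cinner (U t @@ y) x \<partial>lborel)"
    unfolding V.lap Bochner_Integration.integral_cnj[symmetric]
    by (intro Bochner_Integration.integral_cong) (simp_all add: U_adj[symmetric] adj_left[symmetric] cinner_commute[of _ "U _ @@ y"])
  also have "\<dots> = cinner (adj lap @@ x) y" unfolding lap[symmetric] by (simp add: adj_left[symmetric] cinner_commute[of _ "lap @@ y"])
  finally show "cinner (V.lap @@ x) y = cinner (adj lap @@ x) y" .
qed

lemma (in ugroup) resolvent_op_lap: "resolvent_op (cop (- \<i>) * lap)"
proof -
  interpret V: ugroup "%t. U (- t)" by (rule ugroup_reverse)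
  have id1: "2 *\<^sub>R (adj lap * lap) = adj lap + lap" by (rule lap_identity)
  have id2: "2 *\<^sub>R (lap * adj lap) = adj lap + lap" using V.lap_identity by (simp add: lap_reverse add.commute)
  have adjR: "adj (cop (- \<i>) * lap) = cop \<i> * adj lap" by (simp add: cop_commute)
  have 1: "adj (cop (- \<i>) * lap) * (cop (- \<i>) * lap) = adj lap * lap" "(cop (- \<i>) * lap) * adj (cop (- \<i>) * lap) = lap * adj lap"
    unfolding adjR by (rule bop_eqI; simp add: app_scaleC)+
  have 2: "adj lap * lap = lap * adj lap" using id1 id2 by (metis scaleR_left_imp_eq zero_neq_numeral)
  show ?thesis
  proof
    have "cop (2 * \<i>) * (adj lap * lap) = cop \<i> * (2 *\<^sub>R (adj lap * lap))"
      by (rule bop_eqI) (simp add: scaleR_eq_scaleC mult.commute)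
    then show "adj (cop (- \<i>) * lap) - cop (- \<i>) * lap = cop (2 * \<i>) * (adj (cop (- \<i>) * lap) * (cop (- \<i>) * lap))"
      unfolding 1(1) id1 unfolding adjR by (intro bop_eqI) (simp add: scaleC_add_right scaleC_minus_left)
    show "adj (cop (- \<i>) * lap) * (cop (- \<i>) * lap) = cop (- \<i>) * lap * adj (cop (- \<i>) * lap)" unfolding 1 2 ..
    fix x assume "(cop (- \<i>) * lap) @@ x = 0"
    then have "\<i> *\<^sub>C (- \<i>) *\<^sub>C (lap @@ x) = 0" by simp
    then show "x = 0" using lap_inj by simp
  qed
qed

text \<open>The generator of a unitary group is read off from its Laplace transform at \<open>1\<close>, which
  determines both the group and the resolvent of the generator.\<close>

theorem (in ugroup) stone:
  "(selfadjoint A & (ALL r. graph_of (%x. U r @@ x) = spectral_calculus A (%s. cis (r * s))))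
     \<longleftrightarrow> A = resolvent_graph (cop (- \<i>) * lap)"
proof
  have inv: "cop (- \<i>) * (cop \<i> * T) = T" "cop \<i> * (cop (- \<i>) * T) = T" for T :: "'a bop" by (rule bop_eqI; simp)+
  { assume A: "selfadjoint A & (ALL r. graph_of (%x. U r @@ x) = spectral_calculus A (%s. cis (r * s)))"
    interpret P: pvm "spectral_measure A" using spectral_theorem A by blast
    have "graph_of (%x. U r @@ x) = graph_of (%x. P.fc (%s. cis (r * s)) @@ x)" for r
      using A by (simp add: spectral_calculus_def P.spectral_integral_bounded[OF bounded_borel_cis])
    then have "U r @@ x = P.fc (%s. cis (r * s)) @@ x" for r x unfolding graph_of_def by blast
    then have "U r = P.fc (%s. cis (r * s))" for r by (intro bop_eqI)
    then have "U = (%t. P.fc (%s. cis (t * s)))" by (rule ext)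
    then have "lap = cop \<i> * P.fc resolvent_fun" using P.fc_lap by simp
    then show "A = resolvent_graph (cop (- \<i>) * lap)"
      using P.spectral_integral_id spectral_theorem(2)[of A] A inv by simp }
  assume A: "A = resolvent_graph (cop (- \<i>) * lap)"
  interpret R: resolvent_op "cop (- \<i>) * lap" by (rule resolvent_op_lap)
  have sa: "selfadjoint A" unfolding A by (rule R.selfadjoint_resolvent_graph)
  interpret P: pvm "spectral_measure A" using spectral_theorem sa by blast
  have "P.fc resolvent_fun = cop (- \<i>) * lap"
    using P.spectral_integral_id spectral_theorem(2)[OF sa] A by (intro resolvent_graph_inject) simp
  then have "ugroup.lap (%t. P.fc (%s. cis (t * s))) = lap" using P.fc_lap inv by simp
  from ugroup_unique[OF P.fc_ugroup ugroup_axioms this]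
  show "selfadjoint A & (ALL r. graph_of (%x. U r @@ x) = spectral_calculus A (%s. cis (r * s)))"
    using sa by (simp add: spectral_calculus_def P.spectral_integral_bounded[OF bounded_borel_cis])
qed

section \<open>Trace norms\<close>

definition orthonormal :: "'a::euclidean_space L2 set => bool" where
  "orthonormal B \<longleftrightarrow> (ALL b:B. ALL c:B. cinner b c = (if b = c then 1 else 0))"

lemma orthonormalD: "orthonormal B ==> b \<in> B ==> c \<in> B ==> cinner b c = (if b = c then 1 else 0)"
  by (simp add: orthonormal_def)

lemma hilbert_basis_exists: "EX B :: 'a::euclidean_space L2 set. hilbert_basis B"
proof -
  obtain B :: "'a L2 set" where B: "orthonormal B" "!!C. orthonormal C ==> B \<subseteq> C ==> C = B"
  proof -
    have "EX M:Collect orthonormal. ALL X:Collect orthonormal. M \<subseteq> X --> X = (M :: 'a L2 set)"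
    proof (rule subset_Zorn')
      fix \<C> :: "'a L2 set set" assume c: "subset.chain (Collect orthonormal) \<C>"
      have "orthonormal (\<Union>\<C>)"
        unfolding orthonormal_def
      proof (intro ballI)
        fix b d assume "b \<in> \<Union>\<C>" "d \<in> \<Union>\<C>"
        then obtain X Y where "X \<in> \<C>" "Y \<in> \<C>" "b \<in> X" "d \<in> Y" by blast
        moreover have "X \<subseteq> Y | Y \<subseteq> X" "orthonormal X" "orthonormal Y"
          using c \<open>X \<in> \<C>\<close> \<open>Y \<in> \<C>\<close> by (auto simp: subset.chain_def)
        ultimately show "cinner b d = (if b = d then 1 else 0)" using orthonormalD by blast
      qed
      then show "\<Union>\<C> \<in> Collect orthonormal" by simp
    qed
    then show ?thesis using that by auto
  qed
  have "ph = 0" if ph: "ALL b:B. cinner ph b = 0" for ph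
  proof (rule ccontr)
    assume nz: "ph ~= 0"
    define e where "e = (1 / norm ph) *\<^sub>R ph"
    have e1: "cinner e e = 1" using nz by (simp add: e_def cinner_simps cinner_self power2_eq_square)
    have e0: "cinner e b = 0 & cinner b e = 0" if "b \<in> B" for b
      using ph that cinner_commute[of b ph] by (simp add: e_def cinner_simps)
    have "orthonormal (insert e B)"
      using B(1) e1 e0 unfolding orthonormal_def by (metis insert_iff)
    then have "insert e B = B" by (rule B(2)) blast
    then show False using e0[of e] e1 by auto
  qed
  then have "hilbert_basis B" using B(1) by (auto simp: hilbert_basis_def orthonormal_def)
  then show ?thesis ..
qed

lemma some_basis: "hilbert_basis some_basis"
  unfolding some_basis_def using hilbert_basis_exists by (rule someI_ex)

text \<open>No countability of \<open>B\<close> is assumed: the expansion runs along finite sets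
  exhausting the basis vectors that are not orthogonal to \<open>ps\<close>. Projections onto their
  spans form a Cauchy sequence, and the limit differs from \<open>ps\<close> by a vector orthogonal
  to all of \<open>B\<close>.\<close>

lemma parseval:
  assumes B: "hilbert_basis B" and F: "incseq F" "!!n. finite (F n)" "!!n. F n \<subseteq> B"
    and zero: "!!b. b \<in> B ==> b \<notin> (\<Union>n. F n) ==> cinner ps b = 0"
  shows "(%n. \<Sum>b\<in>F n. (cmod (cinner ps b))\<^sup>2) \<longlonglongrightarrow> (norm ps)\<^sup>2"
proof -
  define p where "p n = (\<Sum>b\<in>F n. cinner ps b *\<^sub>C b)" for n
  define c where "c n = (\<Sum>b\<in>F n. (cmod (cinner ps b))\<^sup>2)" for n
  have ob: "cinner b d = (if b = d then 1 else 0)" if "b \<in> B" "d \<in> B" for b d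
    using B that by (simp add: hilbert_basis_def)
  have sum_left: "cinner (\<Sum>b\<in>S. f b) x = (\<Sum>b\<in>S. cinner (f b) x)" if "finite S" for S :: "'a L2 set" and f x
    using that by (induction S rule: finite_induct) (auto simp: cinner_add_left)
  have pb: "cinner (p n) d = (if d \<in> F n then cinner ps d else 0)" if "d \<in> B" for n d
  proof -
    have "cinner (p n) d = (\<Sum>b\<in>F n. if b = d then cinner ps d else 0)"
      unfolding p_def sum_left[OF F(2)] using F(3) that
      by (intro sum.cong refl) (auto simp: cinner_scaleC_left ob subset_iff)
    then show ?thesis using F(2) by simp
  qed
  have pp: "cinner (p m) x = (\<Sum>b\<in>F m. cinner ps b * cinner b x)" for m x
    unfolding p_def sum_left[OF F(2)] by (simp add: cinner_scaleC_left)
  have psi_p: "cinner (p m) ps = of_real (c m)" for m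
    unfolding pp c_def of_real_sum
    by (intro sum.cong refl) (metis cinner_commute complex_norm_square of_real_power)
  have p_p: "cinner (p m) (p n) = of_real (c m)" if "m <= n" for m n
  proof -
    have "cinner b (p n) = cinner b ps" if "b \<in> F m" for b
    proof -
      have "b \<in> F n" "b \<in> B" using that F(1) F(3)[of m] \<open>m <= n\<close> unfolding incseq_def by blast+
      then show ?thesis using pb[of b n] by (metis cinner_commute)
    qed
    then show ?thesis unfolding psi_p[symmetric] pp by simp
  qed
  have p_p': "cinner (p n) (p m) = of_real (c m)" if "m <= n" for m n
    using p_p[OF that] by (metis cinner_commute complex_cnj_complex_of_real)
  have d: "(norm (p n - p m))\<^sup>2 = c n - c m" if "m <= n" for m n
  proof -
    have "complex_of_real ((norm (p n - p m))\<^sup>2) = of_real (c n - c m)"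
      unfolding cinner_self[symmetric] by (simp add: cinner_simps p_p[OF that] p_p'[OF that] p_p)
    then show ?thesis unfolding of_real_eq_iff .
  qed
  have "(norm (ps - p n))\<^sup>2 = (norm ps)\<^sup>2 - c n" for n
  proof -
    have "cinner ps (p n) = of_real (c n)" using psi_p[of n] by (metis cinner_commute complex_cnj_complex_of_real)
    then have "complex_of_real ((norm (ps - p n))\<^sup>2) = of_real ((norm ps)\<^sup>2 - c n)"
      unfolding cinner_self[symmetric] by (simp add: cinner_simps psi_p p_p) (simp add: cinner_self)
    then show ?thesis unfolding of_real_eq_iff .
  qed
  then have bd: "c n <= (norm ps)\<^sup>2" for n by (metis diff_ge_0_iff_ge zero_le_power2)
  have inc: "incseq c" unfolding incseq_def using d by (metis diff_ge_0_iff_ge zero_le_power2)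
  then obtain L where L: "c \<longlonglongrightarrow> L" using incseq_convergent[OF inc, of "(norm ps)\<^sup>2"] bd by blast
  then have "Cauchy c" by (rule LIMSEQ_imp_Cauchy)
  have "Cauchy p"
  proof (rule metric_CauchyI)
    fix e :: real assume e: "0 < e"
    then obtain N where N: "!!m n. N <= m ==> N <= n ==> dist (c m) (c n) < e\<^sup>2"
      using \<open>Cauchy c\<close> metric_CauchyD[of c "e\<^sup>2"] by auto
    have *: "dist (p n) (p m) < e" if "N <= m" "m <= n" for m n
    proof -
      have "(norm (p n - p m))\<^sup>2 < e\<^sup>2" using N[of n m] that d[OF that(2)] by (simp add: dist_real_def)
      then show ?thesis using e by (simp add: dist_norm power_less_imp_less_base)
    qed
    have "dist (p m) (p n) < e" if "N <= m" "N <= n" for m n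
      using *[of m n] *[of n m] that by (cases "m <= n") (auto simp: dist_commute)
    then show "EX N. ALL m>=N. ALL n>=N. dist (p m) (p n) < e" by blast
  qed
  then obtain q where q: "p \<longlonglongrightarrow> q" using Cauchy_convergent convergent_def by blast
  have "cinner (ps - q) b = 0" if b: "b \<in> B" for b
  proof -
    have "(%n. cinner (p n) b) \<longlonglongrightarrow> cinner q b" by (intro tendsto_cinner q tendsto_const)
    moreover have "(%n. cinner (p n) b) \<longlonglongrightarrow> cinner ps b"
    proof (cases "b \<in> (\<Union>n. F n)")
      case True
      then obtain N where "b \<in> F N" by blast
      then have "cinner (p n) b = cinner ps b" if "N <= n" for n
        using pb[OF b, of n] F(1) that by (auto simp: incseq_def)
      then show ?thesis by (intro tendsto_eventually eventually_sequentiallyI)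
    qed (use pb[OF b] zero[OF b] in simp)
    ultimately have "cinner q b = cinner ps b" by (rule LIMSEQ_unique)
    then show ?thesis by (simp add: cinner_diff_left)
  qed
  then have "ps = q" using B unfolding hilbert_basis_def by force
  then have "(%n. cinner (p n) ps) \<longlonglongrightarrow> cinner ps ps" using q by (intro tendsto_cinner tendsto_const) simp
  then have "(%n. Re (cinner (p n) ps)) \<longlonglongrightarrow> Re (cinner ps ps)" by (rule tendsto_Re)
  then show ?thesis by (simp add: psi_p Re_cinner_self c_def)
qed

lemma sum_le_infsum_ennreal:
  fixes f :: "'b => ennreal"
  shows "finite F ==> F \<subseteq> B ==> sum f F <= (\<Sum>\<^sub>\<infinity>b\<in>B. f b)"
  unfolding nonneg_infsum_complete[OF zero_le] by (intro SUP_upper) auto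

text \<open>Here \<open>g\<close> is a continuous frame with upper bound \<open>c\<close>; the coherent states of the
  Schroedinger representation form such a frame.\<close>

lemma frame_hilbert_schmidt_bound:
  fixes g :: "'i => 'a::euclidean_space L2"
  assumes frame: "!!ph. (\<integral>\<^sup>+a. ennreal ((cmod (cinner ph (g a)))\<^sup>2) \<partial>M) <= ennreal (c * (norm ph)\<^sup>2)"
    and meas: "!!ph. (%a. cinner ph (g a)) \<in> borel_measurable M" and c: "0 <= c"
    and fin: "(\<Sum>\<^sub>\<infinity>b\<in>some_basis. ennreal ((norm (W @@ b))\<^sup>2)) <= ennreal N" and N: "0 <= N"
  shows "(\<integral>\<^sup>+a. ennreal ((norm (adj W @@ g a))\<^sup>2) \<partial>M) <= ennreal (c * N)"
proof -
  let ?B = "some_basis :: 'a L2 set"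
  have finsum: "(\<Sum>b\<in>F. (norm (W @@ b))\<^sup>2) <= N" if "finite F" "F \<subseteq> ?B" for F
  proof -
    have "ennreal (\<Sum>b\<in>F. (norm (W @@ b))\<^sup>2) <= ennreal N"
      using order.trans[OF sum_le_infsum_ennreal[OF that, of "%b. ennreal ((norm (W @@ b))\<^sup>2)"] fin] by (simp add: sum_ennreal)
    then show ?thesis using ennreal_le_iff[OF N] by blast
  qed
  \<comment> \<open>Finiteness of the Hilbert-Schmidt sum makes each of these sets finite, and
    together they contain every basis vector not annihilated by \<open>W\<close>. They serve as one
    sequence of finite sets for all vectors in the range of \<open>adj W\<close>.\<close>
  define A where "A n = {b \<in> ?B. 1 / (real n + 1) <= (norm (W @@ b))\<^sup>2}" for n :: nat
  have fA: "finite (A n)" for n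
  proof (rule ccontr)
    assume "infinite (A n)"
    obtain k :: nat where k: "N * (real n + 1) < real k" using reals_Archimedean2 by blast
    obtain F where F: "F \<subseteq> A n" "finite F" "card F = k" using infinite_arbitrarily_large[OF \<open>infinite (A n)\<close>] by metis
    have "real k * (1 / (real n + 1)) = (\<Sum>b\<in>F. 1 / (real n + 1))" using F by simp
    also have "\<dots> <= (\<Sum>b\<in>F. (norm (W @@ b))\<^sup>2)" using F by (intro sum_mono) (auto simp: A_def)
    also have "\<dots> <= N" using F by (intro finsum) (auto simp: A_def)
    finally show False using k by (simp add: field_simps)
  qed
  have iA: "incseq A" unfolding incseq_def A_def by (auto elim!: order.trans[rotated] simp: frac_le)
  have Z: "W @@ b = 0" if "b \<in> ?B" "b \<notin> (\<Union>n. A n)" for b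
  proof (rule ccontr)
    assume "W @@ b ~= 0"
    then obtain n :: nat where "inverse ((norm (W @@ b))\<^sup>2) < real n" using reals_Archimedean2 by blast
    then have "inverse ((norm (W @@ b))\<^sup>2) <= real n + 1" by simp
    then have "1 / (real n + 1) <= (norm (W @@ b))\<^sup>2"
      using \<open>W @@ b ~= 0\<close> by (simp add: field_simps)
    then show False using that by (auto simp: A_def)
  qed
  have lim: "(%n. \<Sum>b\<in>A n. (cmod (cinner (adj W @@ x) b))\<^sup>2) \<longlonglongrightarrow> (norm (adj W @@ x))\<^sup>2" for x
  proof (rule parseval[OF some_basis iA fA])
    show "A n \<subseteq> ?B" for n by (auto simp: A_def)
    show "cinner (adj W @@ x) b = 0" if "b \<in> ?B" "b \<notin> (\<Union>n. A n)" for b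
      using Z[OF that] by (simp add: adj_left[symmetric])
  qed
  have "(\<integral>\<^sup>+a. ennreal ((norm (adj W @@ g a))\<^sup>2) \<partial>M) =
      (\<integral>\<^sup>+a. liminf (%n. ennreal (\<Sum>b\<in>A n. (cmod (cinner (adj W @@ g a) b))\<^sup>2)) \<partial>M)"
    by (intro nn_integral_cong lim_imp_Liminf[OF sequentially_bot tendsto_ennrealI, symmetric] lim)
  also have "\<dots> <= liminf (%n. \<integral>\<^sup>+a. ennreal (\<Sum>b\<in>A n. (cmod (cinner (adj W @@ g a) b))\<^sup>2) \<partial>M)"
  proof (rule nn_integral_liminf)
    have "cinner (adj W @@ g a) b = cnj (cinner (W @@ b) (g a))" for a b
      by (metis adj_left cinner_commute)
    then show "(%a. ennreal (\<Sum>b\<in>A n. (cmod (cinner (adj W @@ g a) b))\<^sup>2)) \<in> borel_measurable M" for n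
      using meas by simp
  qed
  also have "\<dots> <= liminf (%n::nat. ennreal (c * N))"
  proof (intro Liminf_mono always_eventually allI)
    fix n
    have "(\<integral>\<^sup>+a. ennreal (\<Sum>b\<in>A n. (cmod (cinner (adj W @@ g a) b))\<^sup>2) \<partial>M) =
        (\<integral>\<^sup>+a. (\<Sum>b\<in>A n. ennreal ((cmod (cinner (W @@ b) (g a)))\<^sup>2)) \<partial>M)"
    proof (rule nn_integral_cong)
      fix a
      have "cmod (cinner (adj W @@ g a) b) = cmod (cinner (W @@ b) (g a))" for b
        by (metis adj_left cinner_commute complex_mod_cnj)
      then show "ennreal (\<Sum>b\<in>A n. (cmod (cinner (adj W @@ g a) b))\<^sup>2) = (\<Sum>b\<in>A n. ennreal ((cmod (cinner (W @@ b) (g a)))\<^sup>2))"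
        by (simp add: sum_ennreal)
    qed
    also have "\<dots> = (\<Sum>b\<in>A n. \<integral>\<^sup>+a. ennreal ((cmod (cinner (W @@ b) (g a)))\<^sup>2) \<partial>M)"
      using meas by (intro nn_integral_sum) simp
    also have "\<dots> <= (\<Sum>b\<in>A n. ennreal (c * (norm (W @@ b))\<^sup>2))" by (intro sum_mono frame)
    also have "\<dots> = ennreal (c * (\<Sum>b\<in>A n. (norm (W @@ b))\<^sup>2))" using c by (simp add: sum_ennreal sum_distrib_left)
    also have "\<dots> <= ennreal (c * N)"
      using fA by (intro ennreal_leI mult_left_mono finsum c) (auto simp: A_def)
    finally show "(\<integral>\<^sup>+a. ennreal (\<Sum>b\<in>A n. (cmod (cinner (adj W @@ g a) b))\<^sup>2) \<partial>M) <= ennreal (c * N)" .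
  qed
  also have "\<dots> = ennreal (c * N)" by (simp add: Liminf_const)
  finally show ?thesis .
qed

section \<open>Adjoint, absolute value and trace norm of bounded operators given as graphs\<close>

lemma op_adjoint_graph: "op_adjoint (graph_of (%x. S @@ x)) = graph_of (%x. adj S @@ x)"
  unfolding op_adjoint_def graph_of_def by (auto simp: adj_right) (metis cinner_ext_right)

lemma op_comp_graph: "op_comp (graph_of F) (graph_of G) = graph_of (%x. F (G x))"
  unfolding op_comp_def graph_of_def by auto

lemma graph_of_inject: "graph_of F = graph_of G \<longleftrightarrow> F = G"
  unfolding graph_of_def by (auto simp: fun_eq_iff set_eq_iff)

lemma op_apply_graph: "op_apply (graph_of F) x = F x"
  by (simp add: op_apply_def graph_of_def)

lemma bounded_oper_bop: "bounded_oper T ==> EX S. T = graph_of (%x. S @@ x)"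
proof -
  assume T: "bounded_oper T"
  then obtain K where "ALL (ph, et):T. norm et <= K * norm ph" unfolding bounded_oper_def by blast
  then have K: "!!ph et. (ph, et) \<in> T ==> norm et <= K * norm ph" by auto
  have lin: "linear_oper T" and "Domain T = UNIV" using T by (auto simp: bounded_oper_def)
  then have "ALL x. EX y. (x, y) \<in> T" by blast
  then obtain f where f: "!!x. (x, f x) \<in> T" by metis
  have u: "(x, y) \<in> T ==> y = f x" for x y using lin f[of x] by (auto simp: linear_oper_def single_valued_def)
  have "EX S. ALL x. S @@ x = f x"
    using lin f by (intro bop_exists[of f K]) (auto simp: linear_oper_def intro!: u[symmetric] K)
  then obtain S where "!!x. S @@ x = f x" by blast
  then show ?thesis using f u by (intro exI[of _ S]) (auto simp: graph_of_def)
qed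

text \<open>The competitors in \<open>op_abs\<close> may be unbounded. But a square that is
  everywhere defined forces full domain, and symmetry then gives the image of \<open>x\<close> the
  norm of S x, so every competitor is bounded and \<open>bsqrt_unique\<close> applies.\<close>

lemma op_abs_graph: "op_abs (graph_of (%x. S @@ x)) = graph_of (%x. bsqrt (adj S * S) @@ x)"
proof -
  define K where "K = bsqrt (adj S * S)"
  have K: "pos K" "K * K = adj S * S" unfolding K_def using pos_bsqrt bsqrt_square pos_adj_times by blast+
  have comp: "op_comp (op_adjoint (graph_of (%x. S @@ x))) (graph_of (%x. S @@ x)) = graph_of (%x. (adj S * S) @@ x)"
    by (simp add: op_adjoint_graph op_comp_graph)
  show ?thesis
    unfolding op_abs_def comp K_def[symmetric]
  proof (rule the_equality)
    have "linear_oper (graph_of (%x. K @@ x))" using bounded_oper_graph_app[of K] by (simp add: bounded_oper_def)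
    moreover have "Domain (graph_of (%x. K @@ x)) = UNIV" by (auto simp: graph_of_def)
    moreover have "cinner (K @@ x) x \<in> \<real>" for x using selfadj_iff[of K] pos_adj[OF K(1)] by blast
    ultimately show "selfadjoint (graph_of (%x. K @@ x)) & positive_oper (graph_of (%x. K @@ x)) &
        op_comp (graph_of (%x. K @@ x)) (graph_of (%x. K @@ x)) = graph_of (%x. (adj S * S) @@ x)"
      unfolding selfadjoint_def positive_oper_def op_adjoint_graph op_comp_graph K(2)[symmetric]
      using pos_adj[OF K(1)] pos_ge[OF K(1)] by (auto simp: graph_of_def)
  next
    fix A assume A: "selfadjoint A & positive_oper A & op_comp A A = graph_of (%x. (adj S * S) @@ x)"
    then have AA: "A O A = graph_of (%x. (adj S * S) @@ x)" by (simp add: op_comp_def)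
    have sym: "cinner et ps = cinner ph th" if "(ph, et) \<in> A" "(ps, th) \<in> A" for ph et ps th
      using A that unfolding selfadjoint_def op_adjoint_def by blast
    have lin: "linear_oper A" using A by (simp add: selfadjoint_def)
    have "EX y. (x, y) \<in> A" for x
    proof -
      have "(x, (adj S * S) @@ x) \<in> A O A" unfolding AA graph_of_def by blast
      then show ?thesis by blast
    qed
    moreover have bd: "norm y <= norm S * norm x" if xy: "(x, y) \<in> A" for x y
    proof -
      obtain z where z: "(y, z) \<in> A" using \<open>!!x. EX y. (x, y) \<in> A\<close> by blast
      then have "(x, z) \<in> A O A" using xy by blast
      then have "z = (adj S * S) @@ x" unfolding AA graph_of_def by blast
      then have "cinner y y = of_real ((norm (S @@ x))\<^sup>2)" using sym[OF z xy] sym[OF xy z] unfolding norm_app_sq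
        by (metis adj_adj adj_right adj_times sym xy z)
      then have "(norm y)\<^sup>2 = (norm (S @@ x))\<^sup>2" unfolding cinner_self of_real_eq_iff .
      then have "norm y = norm (S @@ x)" by (simp add: power2_eq_iff_nonneg)
      then show ?thesis using app_norm by simp
    qed
    ultimately have "bounded_oper A" using lin unfolding bounded_oper_def by blast
    then obtain D where D: "A = graph_of (%x. D @@ x)" using bounded_oper_bop by blast
    have "graph_of (%x. adj D @@ x) = graph_of (%x. D @@ x)" using A by (simp add: D op_adjoint_graph selfadjoint_def)
    then have "adj D = D" unfolding graph_of_inject by (intro bop_eqI) (rule fun_cong)
    then have "pos D" using A unfolding pos_def D positive_oper_def graph_of_def by blast
    moreover have "(%x. (D * D) @@ x) = (%x. (adj S * S) @@ x)"
      using A unfolding D op_comp_graph graph_of_inject app_times by blast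
    then have "D * D = adj S * S" by (intro bop_eqI) (rule fun_cong)
    ultimately show "A = graph_of (%x. K @@ x)" unfolding D K_def using bsqrt_unique by metis
  qed
qed

text \<open>The trace of |S| is the Hilbert-Schmidt sum of its square root, the form in which the
  frame bound can be used.\<close>

lemma trace_norm_graph:
  "trace_norm (graph_of (%x. S @@ x)) = (\<Sum>\<^sub>\<infinity>b\<in>some_basis. ennreal ((norm (bsqrt (bsqrt (adj S * S)) @@ b))\<^sup>2))"
proof -
  have "Re (cinner (bsqrt (adj S * S) @@ b) b) = (norm (bsqrt (bsqrt (adj S * S)) @@ b))\<^sup>2" for b
    using arg_cong[OF bsqrt_app_sq[OF pos_bsqrt[OF pos_adj_times[of S]], of b], of Re] by simp
  then show ?thesis by (simp add: trace_norm_def op_abs_graph op_apply_graph)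
qed

text \<open>With R the root of |S|, formally S = (S R^-1) R is a product of two Hilbert-Schmidt
  operators and Cauchy-Schwarz over the frame gives the bound. As R need not be invertible, S R^-1
  is replaced by C = S (R + e)^-1: the estimate is uniform in e, C R tends to S, and Fatou's lemma
  concludes.\<close>

theorem frame_trace_bound:
  fixes g :: "'i => 'a::euclidean_space L2"
  assumes frame: "!!ph. (\<integral>\<^sup>+a. ennreal ((cmod (cinner ph (g a)))\<^sup>2) \<partial>M) <= ennreal (c * (norm ph)\<^sup>2)"
    and meas: "!!ph. (%a. cinner ph (g a)) \<in> borel_measurable M"
    and meas2: "!!T. (%a. cinner (T @@ g a) (g a)) \<in> borel_measurable M" and c: "0 <= c"
    and N: "trace_norm (graph_of (%x. S @@ x)) <= ennreal N" "0 <= N"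
  shows "(\<integral>\<^sup>+a. ennreal (cmod (cinner (X @@ S @@ g a) (g a))) \<partial>M) <= ennreal (c * norm X * N)"
proof (cases "X = 0")
  case False
  define K where "K = bsqrt (adj S * S)"
  define R where "R = bsqrt K"
  have K: "pos K" "K * K = adj S * S" unfolding K_def using pos_bsqrt bsqrt_square pos_adj_times by blast+
  have R: "pos R" "R * R = K" unfolding R_def using pos_bsqrt bsqrt_square K(1) by blast+
  have SK: "norm (S @@ v) = norm (K @@ v)" for v
  proof -
    have "complex_of_real ((norm (S @@ v))\<^sup>2) = of_real ((norm (K @@ v))\<^sup>2)"
      unfolding norm_app_sq pos_adj[OF K(1)] K(2) ..
    then show ?thesis unfolding of_real_eq_iff by (simp add: power2_eq_iff_nonneg)
  qed
  have sumR: "(\<Sum>\<^sub>\<infinity>b\<in>some_basis. ennreal ((norm (R @@ b))\<^sup>2)) <= ennreal N"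
    using N(1) unfolding trace_norm_graph R_def K_def .
  define t where "t = norm X"
  have t: "0 < t" using False by (simp add: t_def)
  have nsq: "(norm (T @@ g a))\<^sup>2 = Re (cinner ((adj T * T) @@ g a) (g a))" for T a
    using arg_cong[OF norm_app_sq[of T "g a"], of Re] by simp
  have meas_sq: "(%a. (norm (T @@ g a))\<^sup>2) \<in> borel_measurable M" for T
    unfolding nsq using meas2 by measurable
  have approx: "EX C. (\<integral>\<^sup>+a. ennreal (cmod (cinner (X @@ C @@ R @@ g a) (g a))) \<partial>M) <= ennreal (c * t * N) &
      (ALL x. norm (C @@ R @@ x - S @@ x) <= e * norm R * norm x)" if e: "0 < e" for e
  proof -
    obtain J where J: "(R + e *\<^sub>R 1) * J = 1" "J * (R + e *\<^sub>R 1) = 1" using pos_inverse_exists[OF R(1) e] by blast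
    have RJ: "R * J = 1 - e *\<^sub>R J" "J * R = 1 - e *\<^sub>R J" using J by (simp_all add: distrib_left distrib_right algebra_simps)
    have contr: "norm (R @@ J @@ x) <= norm x" for x
    proof -
      define y where "y = J @@ x"
      have x: "x = R @@ y + e *\<^sub>R y" using arg_cong[OF J(1), of "%T. T @@ x"] by (simp add: y_def)
      have "(norm (R @@ y))\<^sup>2 <= Re (cinner x (R @@ y))"
      proof -
        have "cinner y (R @@ y) = cinner (R @@ y) y" using adj_left[of y R y] pos_adj[OF R(1)] by simp
        then have "Re (cinner (R @@ y + e *\<^sub>R y) (R @@ y)) = (norm (R @@ y))\<^sup>2 + e * Re (cinner (R @@ y) y)"
          by (simp add: cinner_simps Re_cinner_self)
        then show ?thesis using e pos_ge[OF R(1), of y] x by simp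
      qed
      also have "\<dots> <= norm x * norm (R @@ y)" using cmod_cinner_le[of x "R @@ y"] complex_Re_le_cmod order.trans by blast
      finally show ?thesis unfolding y_def[symmetric] power2_eq_square
        by (cases "norm (R @@ y) = 0") (auto simp: mult_le_cancel_right)
    qed
    define C where "C = S * J"
    \<comment> \<open>S and K = |S| give vectors of equal norm, K J = R J R since \<open>J\<close>
      commutes with R, and R J is a contraction.\<close>
    have Cb: "norm (C @@ b) <= norm (R @@ b)" for b
    proof -
      have "R * R * J = R * J * R" using RJ by (metis mult.assoc)
      then have "K @@ J @@ b = R @@ J @@ R @@ b" unfolding R(2)[symmetric] by (metis app_times)
      then show ?thesis unfolding C_def app_times SK using contr by simp
    qed
    have "(\<Sum>\<^sub>\<infinity>b\<in>some_basis. ennreal ((norm ((X * C) @@ b))\<^sup>2)) <= (\<Sum>\<^sub>\<infinity>b\<in>some_basis. ennreal (t\<^sup>2) * ennreal ((norm (R @@ b))\<^sup>2))"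
    proof (rule infsum_mono_neutral)
      fix b
      have "norm ((X * C) @@ b) <= t * norm (R @@ b)"
        using app_norm[of X "C @@ b"] mult_left_mono[OF Cb[of b] norm_ge_zero[of X]] unfolding t_def app_times by linarith
      then have "(norm ((X * C) @@ b))\<^sup>2 <= t\<^sup>2 * (norm (R @@ b))\<^sup>2" unfolding power_mult_distrib[symmetric] by (rule power_mono) simp
      then show "ennreal ((norm ((X * C) @@ b))\<^sup>2) <= ennreal (t\<^sup>2) * ennreal ((norm (R @@ b))\<^sup>2)"
        by (simp add: ennreal_mult[symmetric])
    qed (auto intro: nonneg_summable_on_complete)
    also have "\<dots> = ennreal (t\<^sup>2) * (\<Sum>\<^sub>\<infinity>b\<in>some_basis. ennreal ((norm (R @@ b))\<^sup>2))"
      unfolding nonneg_infsum_complete[OF zero_le] sum_distrib_left[symmetric] by (rule SUP_mult_left_ennreal[symmetric])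
    also have "\<dots> <= ennreal (t\<^sup>2 * N)" using mult_left_mono[OF sumR] by (simp add: ennreal_mult N(2))
    finally have I1: "(\<integral>\<^sup>+a. ennreal ((norm (adj (X * C) @@ g a))\<^sup>2) \<partial>M) <= ennreal (c * (t\<^sup>2 * N))"
      by (rule frame_hilbert_schmidt_bound[OF frame meas c]) (use N in simp)
    have I2: "(\<integral>\<^sup>+a. ennreal ((norm (R @@ g a))\<^sup>2) \<partial>M) <= ennreal (c * N)"
      using frame_hilbert_schmidt_bound[OF frame meas c sumR N(2)] pos_adj[OF R(1)] by simp
    have "(\<integral>\<^sup>+a. ennreal (cmod (cinner (X @@ C @@ R @@ g a) (g a))) \<partial>M) <=
      (\<integral>\<^sup>+a. ennreal (t / 2) * ennreal ((norm (R @@ g a))\<^sup>2) + ennreal (1 / (2 * t)) * ennreal ((norm (adj (X * C) @@ g a))\<^sup>2) \<partial>M)"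
    proof (rule nn_integral_mono)
      fix a
      define p q where "p = norm (R @@ g a)" and "q = norm (adj (X * C) @@ g a)"
      have "cmod (cinner (X @@ C @@ R @@ g a) (g a)) = cmod (cinner (R @@ g a) (adj (X * C) @@ g a))"
        by (simp only: adj_right[symmetric] app_times)
      also have "\<dots> <= p * q" unfolding p_def q_def by (rule cmod_cinner_le)
      \<comment> \<open>The two squares integrate to at most c N and c t^2 N; these weights balance
        them so that the sum is c t N.\<close>
      also have "\<dots> <= t / 2 * p\<^sup>2 + 1 / (2 * t) * q\<^sup>2"
      proof -
        have "0 <= (t * p - q)\<^sup>2" by simp
        then have "2 * t * (p * q) <= t\<^sup>2 * p\<^sup>2 + q\<^sup>2" by (simp add: power2_eq_square algebra_simps)
        then have "(2 * t * (p * q)) / (2 * t) <= (t\<^sup>2 * p\<^sup>2 + q\<^sup>2) / (2 * t)" using t by (intro divide_right_mono) auto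
        then show ?thesis using t by (simp add: add_divide_distrib power2_eq_square)
      qed
      finally show "ennreal (cmod (cinner (X @@ C @@ R @@ g a) (g a))) <= ennreal (t / 2) * ennreal ((norm (R @@ g a))\<^sup>2) +
          ennreal (1 / (2 * t)) * ennreal ((norm (adj (X * C) @@ g a))\<^sup>2)"
        using t unfolding p_def[symmetric] q_def[symmetric]
        by (simp add: ennreal_mult[symmetric] ennreal_plus[symmetric] del: ennreal_plus)
    qed
    also have "\<dots> = ennreal (t / 2) * (\<integral>\<^sup>+a. ennreal ((norm (R @@ g a))\<^sup>2) \<partial>M) +
        ennreal (1 / (2 * t)) * (\<integral>\<^sup>+a. ennreal ((norm (adj (X * C) @@ g a))\<^sup>2) \<partial>M)"
      using meas_sq[of R] meas_sq[of "adj (X * C)"] by (subst nn_integral_add) (auto simp: nn_integral_cmult)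
    also have "\<dots> <= ennreal (t / 2) * ennreal (c * N) + ennreal (1 / (2 * t)) * ennreal (c * (t\<^sup>2 * N))"
      by (intro add_mono mult_left_mono I1 I2) auto
    also have "\<dots> = ennreal (t / 2 * (c * N) + 1 / (2 * t) * (c * (t\<^sup>2 * N)))"
    proof -
      have nn: "0 <= t / 2" "0 <= c * N" "0 <= 1 / (2 * t)" "0 <= c * (t\<^sup>2 * N)" using t c N(2) by auto
      show ?thesis
        unfolding ennreal_mult[OF nn(1,2), symmetric] ennreal_mult[OF nn(3,4), symmetric]
        by (rule ennreal_plus[OF mult_nonneg_nonneg[OF nn(1,2)] mult_nonneg_nonneg[OF nn(3,4)], symmetric])
    qed
    also have "t / 2 * (c * N) + 1 / (2 * t) * (c * (t\<^sup>2 * N)) = c * t * N"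
      using t by (simp add: power2_eq_square field_simps)
    finally have A: "(\<integral>\<^sup>+a. ennreal (cmod (cinner (X @@ C @@ R @@ g a) (g a))) \<partial>M) <= ennreal (c * t * N)" .
    have "norm (C @@ R @@ x - S @@ x) <= e * norm R * norm x" for x
    proof -
      have "C * R - S = - (e *\<^sub>R (S * J))" unfolding C_def mult.assoc RJ(2) by (simp add: algebra_simps)
      then have "norm (C @@ R @@ x - S @@ x) = norm (- (e *\<^sub>R (S @@ J @@ x)))"
        by (metis app_diff_left app_minus_left app_scaleR_left app_times)
      also have "\<dots> = e * norm (R @@ R @@ J @@ x)" using e SK[of "J @@ x"] by (simp add: R(2)[symmetric])
      also have "\<dots> <= e * (norm R * norm x)"
        using e by (intro mult_left_mono order.trans[OF app_norm] contr) auto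
      finally show ?thesis by simp
    qed
    then show ?thesis using A by blast
  qed
  have "EX C. ALL n. (\<integral>\<^sup>+a. ennreal (cmod (cinner (X @@ C n @@ R @@ g a) (g a))) \<partial>M) <= ennreal (c * t * N) &
      (ALL x. norm (C n @@ R @@ x - S @@ x) <= (1 / (real n + 1)) * norm R * norm x)"
    by (rule choice) (intro allI approx, simp)
  then obtain C where C: "!!n. (\<integral>\<^sup>+a. ennreal (cmod (cinner (X @@ C n @@ R @@ g a) (g a))) \<partial>M) <= ennreal (c * t * N)"
    "!!n x. norm (C n @@ R @@ x - S @@ x) <= (1 / (real n + 1)) * norm R * norm x" by blast
  have lim: "(%n. C n @@ R @@ x) \<longlonglongrightarrow> S @@ x" for x
  proof -
    have "(%n. 1 / (real n + 1)) \<longlonglongrightarrow> 0"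
      using LIMSEQ_inverse_real_of_nat by (simp add: inverse_eq_divide add.commute)
    from tendsto_mult_left_zero[OF tendsto_mult_left_zero[OF this, of "norm R"], of "norm x"]
    have "(%n. C n @@ R @@ x - S @@ x) \<longlonglongrightarrow> 0"
      by (rule Lim_null_comparison[OF always_eventually, rotated]) (use C(2) in blast)
    then show ?thesis by (simp add: LIM_zero_iff)
  qed
  have "(\<integral>\<^sup>+a. ennreal (cmod (cinner (X @@ S @@ g a) (g a))) \<partial>M) =
      (\<integral>\<^sup>+a. liminf (%n. ennreal (cmod (cinner (X @@ C n @@ R @@ g a) (g a)))) \<partial>M)"
    by (intro nn_integral_cong lim_imp_Liminf[OF sequentially_bot, symmetric] tendsto_ennrealI tendsto_norm
        tendsto_cinner tendsto_const tendsto_app lim)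
  also have "\<dots> <= liminf (%n. \<integral>\<^sup>+a. ennreal (cmod (cinner (X @@ C n @@ R @@ g a) (g a))) \<partial>M)"
    using meas2[of "X * C _ * R"] by (intro nn_integral_liminf) (simp add: mult.assoc)
  also have "\<dots> <= liminf (%n::nat. ennreal (c * t * N))" by (intro Liminf_mono always_eventually allI C(1))
  also have "\<dots> = ennreal (c * norm X * N)" by (simp add: Liminf_const t_def)
  finally show ?thesis .
qed simp

section \<open>Gaussian integrals\<close>

lemma lborel_prod_integral:
  fixes F :: "'a::euclidean_space => real => complex"
  assumes F: "!!b. b \<in> Basis ==> integrable lborel (F b)"
  shows "integrable lborel (%x::'a. \<Prod>b\<in>Basis. F b (x \<bullet> b))"
    and "(\<integral>x. (\<Prod>b\<in>Basis. F b (x \<bullet> b)) \<partial>lborel) = (\<Prod>b\<in>Basis. \<integral>x. F b x \<partial>lborel)"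
proof -
  interpret product_sigma_finite "%_::'a. lborel :: real measure" by standard
  have eq: "(lborel :: 'a measure) = distr (\<Pi>\<^sub>M b\<in>Basis. lborel) borel (%f. \<Sum>b\<in>Basis. f b *\<^sub>R b)"
    unfolding lborel_eq_real by (rule lborel_def)
  have m: "(%f. \<Sum>b\<in>Basis. f b *\<^sub>R b :: 'a) \<in> (\<Pi>\<^sub>M b\<in>Basis. lborel :: real measure) \<rightarrow>\<^sub>M borel" by measurable
  have [measurable]: "b \<in> Basis ==> F b \<in> borel_measurable borel" for b
    using borel_measurable_integrable[OF F, of b] by simp
  have m2: "(%x::'a. \<Prod>b\<in>Basis. F b (x \<bullet> b)) \<in> borel_measurable borel" by measurable
  have P: "(\<Prod>b\<in>Basis. F b ((\<Sum>b\<in>Basis. f b *\<^sub>R b :: 'a) \<bullet> b)) = (\<Prod>b\<in>Basis. F b (f b))" for f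
    by (intro prod.cong) auto
  show "integrable lborel (%x::'a. \<Prod>b\<in>Basis. F b (x \<bullet> b))"
    unfolding eq integrable_distr_eq[OF m m2] P by (intro product_integrable_prod F) auto
  show "(\<integral>x. (\<Prod>b\<in>Basis. F b (x \<bullet> b)) \<partial>lborel) = (\<Prod>b\<in>Basis. \<integral>x. F b x \<partial>lborel)"
    by (subst eq, unfold integral_distr[OF m m2] P) (intro product_integral_prod F finite_Basis)
qed

text \<open>The characteristic function of the standard normal distribution, rescaled by sqrt
  e.\<close>

lemma gauss_real:
  assumes e: "0 < e"
  shows "integrable lborel (%x::real. exp (- (e / 2) * x\<^sup>2) *\<^sub>R cis (x * t))"
    and "(\<integral>x. exp (- (e / 2) * x\<^sup>2) *\<^sub>R cis (x * t) \<partial>lborel) = of_real (sqrt (2 * pi / e) * exp (- t\<^sup>2 / (2 * e)))"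
proof -
  have m [measurable]: "(%x. cis (x * u)) \<in> borel_measurable borel" for u by (simp add: cis_conv_exp)
  let ?f = "%u x. exp (- x\<^sup>2 / 2) *\<^sub>R cis (x * u)"
  have f: "?f u x = sqrt (2 * pi) *\<^sub>R (std_normal_density x *\<^sub>R cis (x * u))" for u x
    by (simp add: std_normal_density_def)
  have nd: "integrable lborel (%x. std_normal_density x *\<^sub>R cis (x * u))" for u
    by (rule Bochner_Integration.integrable_bound[OF integrable_normal_density[of 1 0]]) auto
  have i1: "integrable lborel (?f u)" for u unfolding f by (intro integrable_scaleR_right nd)
  have "char std_normal_distribution u = (\<integral>x. std_normal_density x *\<^sub>R cis (x * u) \<partial>lborel)" for u
    unfolding char_def by (subst integral_density) (auto simp: cis_conv_exp mult.commute)
  then have v1: "(\<integral>x. ?f u x \<partial>lborel) = sqrt (2 * pi) *\<^sub>R of_real (exp (- (u\<^sup>2) / 2))" for u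
    unfolding f integral_scaleR_right by (simp add: char_std_normal_distribution)
  define s where "s = sqrt e"
  have s: "0 < s" "s\<^sup>2 = e" using e by (auto simp: s_def)
  have fs: "?f (t / s) (0 + s * x) = exp (- (e / 2) * x\<^sup>2) *\<^sub>R cis (x * t)" for x
    using s by (simp add: power_mult_distrib mult.commute)
  show i: "integrable lborel (%x::real. exp (- (e / 2) * x\<^sup>2) *\<^sub>R cis (x * t))"
    using lborel_integrable_real_affine[OF i1[of "t / s"], of s 0] s(1) unfolding fs by simp
  have "(\<integral>x. ?f (t / s) x \<partial>lborel) = s *\<^sub>R (\<integral>x. exp (- (e / 2) * x\<^sup>2) *\<^sub>R cis (x * t) \<partial>lborel)"
    using lborel_integral_real_affine[of s "?f (t / s)" 0] s(1) unfolding fs by simp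
  then have "(\<integral>x. exp (- (e / 2) * x\<^sup>2) *\<^sub>R cis (x * t) \<partial>lborel) = (1 / s) *\<^sub>R sqrt (2 * pi) *\<^sub>R of_real (exp (- ((t / s)\<^sup>2) / 2))"
    unfolding v1 using s by (simp add: divide_simps)
  also have "\<dots> = of_real (sqrt (2 * pi / e) * exp (- t\<^sup>2 / (2 * e)))"
    using s by (simp add: scaleR_conv_of_real real_sqrt_divide s_def power_divide)
  finally show "(\<integral>x. exp (- (e / 2) * x\<^sup>2) *\<^sub>R cis (x * t) \<partial>lborel) = of_real (sqrt (2 * pi / e) * exp (- t\<^sup>2 / (2 * e)))" .
qed

lemma norm_sq_Basis: "(norm (x::'a::euclidean_space))\<^sup>2 = (\<Sum>b\<in>Basis. (x \<bullet> b)\<^sup>2)"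
  unfolding power2_norm_eq_inner by (subst euclidean_inner) (simp add: power2_eq_square)

lemma gauss_fourier:
  fixes y :: "'a::euclidean_space"
  assumes e: "0 < e"
  shows "integrable lborel (%x::'a. exp (- (e / 2) * (norm x)\<^sup>2) *\<^sub>R cis (x \<bullet> y))"
    and "(\<integral>x. exp (- (e / 2) * (norm x)\<^sup>2) *\<^sub>R cis (x \<bullet> y) \<partial>lborel) =
      of_real (sqrt (2 * pi / e) ^ DIM('a) * exp (- (norm y)\<^sup>2 / (2 * e)))"
proof -
  have "exp (- (e / 2) * (norm x)\<^sup>2) *\<^sub>R cis (x \<bullet> y) = (\<Prod>b\<in>Basis. exp (- (e / 2) * (x \<bullet> b)\<^sup>2) *\<^sub>R cis ((x \<bullet> b) * (y \<bullet> b)))" for x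
  proof -
    have c: "exp r *\<^sub>R cis u = exp (of_real r + \<i> * of_real u)" for r u
      by (simp add: exp_add cis_conv_exp scaleR_conv_of_real exp_of_real)
    have "of_real (- (e / 2) * (norm x)\<^sup>2) + \<i> * of_real (x \<bullet> y) =
        (\<Sum>b\<in>Basis. of_real (- (e / 2) * (x \<bullet> b)\<^sup>2) + \<i> * of_real ((x \<bullet> b) * (y \<bullet> b)))"
      unfolding norm_sq_Basis euclidean_inner[of x y] by (simp add: sum.distrib sum_distrib_left sum_subtractf sum_negf)
    then show ?thesis unfolding c by (simp only: exp_sum[OF finite_Basis])
  qed
  note eq = this
  show "integrable lborel (%x::'a. exp (- (e / 2) * (norm x)\<^sup>2) *\<^sub>R cis (x \<bullet> y))"
    unfolding eq by (intro lborel_prod_integral gauss_real e)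
  have "(\<integral>x. exp (- (e / 2) * (norm x)\<^sup>2) *\<^sub>R cis (x \<bullet> y) \<partial>lborel) =
      (\<Prod>b\<in>Basis. of_real (sqrt (2 * pi / e) * exp (- (y \<bullet> b)\<^sup>2 / (2 * e))))"
    unfolding eq by (subst lborel_prod_integral) (simp_all only: gauss_real[OF e])
  also have "\<dots> = of_real (\<Prod>b\<in>(Basis :: 'a set). sqrt (2 * pi / e) * exp (- (y \<bullet> b)\<^sup>2 / (2 * e)))" by simp
  also have "(\<Prod>b\<in>(Basis :: 'a set). sqrt (2 * pi / e) * exp (- (y \<bullet> b)\<^sup>2 / (2 * e))) =
      sqrt (2 * pi / e) ^ DIM('a) * exp (- (norm y)\<^sup>2 / (2 * e))"
    unfolding prod.distrib prod_constant exp_sum[OF finite_Basis, symmetric] norm_sq_Basis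
    by (simp add: sum_negf sum_divide_distrib)
  finally show "(\<integral>x. exp (- (e / 2) * (norm x)\<^sup>2) *\<^sub>R cis (x \<bullet> y) \<partial>lborel) =
      of_real (sqrt (2 * pi / e) ^ DIM('a) * exp (- (norm y)\<^sup>2 / (2 * e)))" .
qed

lemma gauss_integral:
  assumes e: "0 < e"
  shows "integrable lborel (%x::'a::euclidean_space. exp (- (e / 2) * (norm x)\<^sup>2))"
    and "(\<integral>x. exp (- (e / 2) * (norm (x::'a))\<^sup>2) \<partial>lborel) = sqrt (2 * pi / e) ^ DIM('a)"
proof -
  have i: "integrable lborel (%x::'a. complex_of_real (exp (- (e / 2) * (norm x)\<^sup>2)))"
    and v: "(\<integral>x. complex_of_real (exp (- (e / 2) * (norm (x::'a))\<^sup>2)) \<partial>lborel) = of_real (sqrt (2 * pi / e) ^ DIM('a))"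
    using gauss_fourier[OF e, of "0 :: 'a"] by (simp_all add: scaleR_conv_of_real)
  show "integrable lborel (%x::'a. exp (- (e / 2) * (norm x)\<^sup>2))" using i unfolding complex_of_real_integrable_eq .
  show "(\<integral>x. exp (- (e / 2) * (norm (x::'a))\<^sup>2) \<partial>lborel) = sqrt (2 * pi / e) ^ DIM('a)"
    using v unfolding integral_complex_of_real of_real_eq_iff .
qed

lemma nn_integral_lborel_affine:
  fixes f :: "'a::euclidean_space => ennreal"
  assumes [measurable]: "f \<in> borel_measurable borel" and c: "c ~= 0"
  shows "(\<integral>\<^sup>+x. f x \<partial>lborel) = ennreal (\<bar>c\<bar> ^ DIM('a)) * (\<integral>\<^sup>+x. f (t + c *\<^sub>R x) \<partial>lborel)"
  by (subst lborel_affine[OF c, of t]) (simp add: nn_integral_density nn_integral_distr nn_integral_cmult)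

lemma integral_lborel_affine:
  fixes f :: "'a::euclidean_space => 'b::{banach,second_countable_topology}"
  assumes [measurable]: "f \<in> borel_measurable borel" and c: "c ~= 0"
  shows "(\<integral>x. f x \<partial>lborel) = \<bar>c\<bar> ^ DIM('a) *\<^sub>R (\<integral>x. f (t + c *\<^sub>R x) \<partial>lborel)"
  by (subst lborel_affine[OF c, of t]) (simp add: integral_density integral_distr)

lemma integral_norm_bound_ennreal':
  fixes f :: "'a => 'b::{banach,second_countable_topology}"
  shows "ennreal (norm (\<integral>x. f x \<partial>M)) <= (\<integral>\<^sup>+x. ennreal (norm (f x)) \<partial>M)"
  by (cases "integrable M f") (simp_all add: integral_norm_bound_ennreal not_integrable_integral_eq)

text \<open>The substitution v = sqrt (d k) v' turns the kernel into a fixed integrable Gaussian, so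
  only boundedness of \<open>h\<close> and continuity at 0 are used. The kernel is not normalised;
  its mass is the power of sqrt (2 pi) in the limit.\<close>

lemma gauss_approximate_identity:
  fixes h :: "'a::euclidean_space => complex"
  assumes h [measurable]: "h \<in> borel_measurable borel" and K: "!!x. cmod (h x) <= K" and cont: "isCont h 0"
    and d: "!!k. 0 < d k" "d \<longlonglongrightarrow> (0::real)"
  shows "(%k::nat. (1 / sqrt (d k)) ^ DIM('a) *\<^sub>R (\<integral>v. exp (- (norm v)\<^sup>2 / (2 * d k)) *\<^sub>R h v \<partial>lborel))
    \<longlonglongrightarrow> of_real (sqrt (2 * pi) ^ DIM('a)) * h 0"
proof -
  have eq: "(1 / sqrt (d k)) ^ DIM('a) *\<^sub>R (\<integral>v. exp (- (norm v)\<^sup>2 / (2 * d k)) *\<^sub>R h v \<partial>lborel) =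
      (\<integral>v. exp (- (1 / 2) * (norm v)\<^sup>2) *\<^sub>R h (sqrt (d k) *\<^sub>R v) \<partial>lborel)" for k
  proof -
    have "(\<integral>v. exp (- (norm v)\<^sup>2 / (2 * d k)) *\<^sub>R h v \<partial>lborel) =
        \<bar>sqrt (d k)\<bar> ^ DIM('a) *\<^sub>R (\<integral>v. exp (- (norm (0 + sqrt (d k) *\<^sub>R v))\<^sup>2 / (2 * d k)) *\<^sub>R h (0 + sqrt (d k) *\<^sub>R v) \<partial>lborel)"
      using d(1)[of k] by (intro integral_lborel_affine) auto
    moreover have "exp (- (norm (0 + sqrt (d k) *\<^sub>R v))\<^sup>2 / (2 * d k)) = exp (- (1 / 2) * (norm v)\<^sup>2)" for v :: 'a
      using d(1)[of k] by (simp add: power_mult_distrib)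
    ultimately show ?thesis using d(1)[of k] by (simp only: add_0) (simp add: power_divide)
  qed
  have "(%k. \<integral>v. exp (- (1 / 2) * (norm v)\<^sup>2) *\<^sub>R h (sqrt (d k) *\<^sub>R v) \<partial>lborel) \<longlonglongrightarrow> (\<integral>v. exp (- (1 / 2) * (norm (v::'a))\<^sup>2) *\<^sub>R h 0 \<partial>lborel)"
  proof (rule integral_dominated_convergence)
    show "integrable lborel (%v::'a. exp (- (1 / 2) * (norm v)\<^sup>2) * K)"
      using gauss_integral(1)[of 1, where 'a = 'a] by simp
    show "AE v in lborel. (%k. exp (- (1 / 2) * (norm v)\<^sup>2) *\<^sub>R h (sqrt (d k) *\<^sub>R v)) \<longlonglongrightarrow> exp (- (1 / 2) * (norm v)\<^sup>2) *\<^sub>R h 0"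
    proof (rule AE_I2, rule tendsto_scaleR[OF tendsto_const])
      fix v :: 'a
      have "(%k. sqrt (d k) *\<^sub>R v) \<longlonglongrightarrow> sqrt 0 *\<^sub>R v" by (intro tendsto_intros d(2))
      then show "(%k. h (sqrt (d k) *\<^sub>R v)) \<longlonglongrightarrow> h 0" by (intro isCont_tendsto_compose[OF cont]) simp
    qed
    show "AE v in lborel. norm (exp (- (1 / 2) * (norm v)\<^sup>2) *\<^sub>R h (sqrt (d k) *\<^sub>R v)) <= exp (- (1 / 2) * (norm v)\<^sup>2) * K" for k
      using K by (intro AE_I2) simp
  qed measurable
  also have "(\<integral>v. exp (- (1 / 2) * (norm (v::'a))\<^sup>2) *\<^sub>R h 0 \<partial>lborel) = of_real (sqrt (2 * pi) ^ DIM('a)) * h 0"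
    using gauss_integral[of 1, where 'a = 'a] by (simp add: scaleR_conv_of_real)
  finally show ?thesis unfolding eq .
qed

lemma borel_measurable_cis [measurable (raw)]: "f \<in> borel_measurable M ==> (%x. cis (f x)) \<in> borel_measurable M"
  by (simp add: cis_conv_exp)

lemma continuous_on_cis' [continuous_intros]: "continuous_on S f ==> continuous_on S (%x. cis (f x))"
  by (simp add: cis_conv_exp continuous_intros)

text \<open>The map \<open>k\<close> in the phase is arbitrary so that one computation serves both
  pairings: the Euclidean one, with k t = c (t - y), and the symplectic one of the Weyl
  operators.\<close>

lemma gauss_fourier_pairing:
  fixes h :: "'b::euclidean_space => complex" and k :: "'b => 'a::euclidean_space"
  assumes h: "integrable lborel h" and k [measurable]: "k \<in> borel_measurable borel" and e: "0 < e"
  shows "(\<integral>x. exp (- (e / 2) * (norm x)\<^sup>2) *\<^sub>R (\<integral>t. h t * cis (x \<bullet> k t) \<partial>lborel) \<partial>lborel) =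
    of_real (sqrt (2 * pi / e) ^ DIM('a)) * (\<integral>t. exp (- (norm (k t))\<^sup>2 / (2 * e)) *\<^sub>R h t \<partial>lborel)"
proof -
  have [measurable]: "h \<in> borel_measurable borel" using borel_measurable_integrable[OF h] by simp
  let ?w = "%x::'a. exp (- (e / 2) * (norm x)\<^sup>2)"
  let ?k = "%x t. ?w x *\<^sub>R (h t * cis (x \<bullet> k t))"
  have int: "integrable (lborel \<Otimes>\<^sub>M lborel) (%(x, t). ?k x t)"
  proof (rule lborel_pair.Fubini_integrable)
    show "(%(x, t). ?k x t) \<in> borel_measurable (lborel \<Otimes>\<^sub>M lborel)" by measurable
    show "integrable lborel (%x. \<integral>t. norm (case (x, t) of (x, t) => ?k x t) \<partial>lborel)"
      using gauss_integral(1)[OF e, where 'a = 'a] by (simp add: norm_mult)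
    show "AE x in lborel. integrable lborel (%t. case (x, t) of (x, t) => ?k x t)"
      by (intro AE_I2) (simp only: prod.case, intro integrable_scaleR_right Bochner_Integration.integrable_bound[OF h], auto simp: norm_mult)
  qed
  have "(\<integral>x. ?w x *\<^sub>R (\<integral>t. h t * cis (x \<bullet> k t) \<partial>lborel) \<partial>lborel) = (\<integral>x. (\<integral>t. ?k x t \<partial>lborel) \<partial>lborel)"
    by (simp only: integral_scaleR_right)
  also have "\<dots> = (\<integral>t. (\<integral>x. ?k x t \<partial>lborel) \<partial>lborel)" by (rule lborel_pair.Fubini_integral[OF int, symmetric])
  also have "\<dots> = (\<integral>t. of_real (sqrt (2 * pi / e) ^ DIM('a)) * (exp (- (norm (k t))\<^sup>2 / (2 * e)) *\<^sub>R h t) \<partial>lborel)"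
  proof (rule Bochner_Integration.integral_cong[OF refl])
    fix t
    have "(\<integral>x. ?k x t \<partial>lborel) = (\<integral>x. h t * (?w x *\<^sub>R cis (x \<bullet> k t)) \<partial>lborel)" by (simp only: mult_scaleR_right)
    also have "\<dots> = h t * of_real (sqrt (2 * pi / e) ^ DIM('a) * exp (- (norm (k t))\<^sup>2 / (2 * e)))"
      unfolding integral_mult_right_zero gauss_fourier(2)[OF e] ..
    finally show "(\<integral>x. ?k x t \<partial>lborel) = of_real (sqrt (2 * pi / e) ^ DIM('a)) * (exp (- (norm (k t))\<^sup>2 / (2 * e)) *\<^sub>R h t)"
      by (simp add: scaleR_conv_of_real ac_simps)
  qed
  finally show ?thesis by (simp only: integral_mult_right_zero)
qed

lemma gauss_fourier_inversion:
  fixes h :: "'a::euclidean_space => complex"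
  assumes h: "integrable lborel h" and e: "0 < e"
  shows "(\<integral>x. exp (- (e / 2) * (norm x)\<^sup>2) *\<^sub>R (cis (- (c * (x \<bullet> y))) * (\<integral>t. h t * cis (c * (x \<bullet> t)) \<partial>lborel)) \<partial>lborel) =
    of_real (sqrt (2 * pi / e) ^ DIM('a)) * (\<integral>t. exp (- (norm (c *\<^sub>R (t - y)))\<^sup>2 / (2 * e)) *\<^sub>R h t \<partial>lborel)"
proof -
  have "cis (- (c * (x \<bullet> y))) * (\<integral>t. h t * cis (c * (x \<bullet> t)) \<partial>lborel) = (\<integral>t. h t * cis (x \<bullet> (c *\<^sub>R (t - y))) \<partial>lborel)" for x
  proof -
    have "h t * cis (x \<bullet> (c *\<^sub>R (t - y))) = cis (- (c * (x \<bullet> y))) * (h t * cis (c * (x \<bullet> t)))" for t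
      by (simp add: cis_mult inner_diff_right right_diff_distrib ac_simps)
    then show ?thesis by (simp only: integral_mult_right_zero)
  qed
  moreover have "(%t. c *\<^sub>R (t - y)) \<in> borel_measurable borel" by measurable
  ultimately show ?thesis by (simp only: gauss_fourier_pairing[OF h _ e])
qed

text \<open>Gaussian means of the vanishing transform equal multiples of Gaussian averages of
  \<open>h\<close> around \<open>y\<close>; the averages tend to a multiple of
  \<open>h y\<close>.\<close>

lemma fourier_uniqueness:
  fixes h :: "'a::euclidean_space => complex"
  assumes h: "integrable lborel h" and K: "!!x. cmod (h x) <= K" and cont: "continuous_on UNIV h"
    and z: "AE l in lborel. (\<integral>t. h t * cis (l \<bullet> t) \<partial>lborel) = 0"
  shows "h y = 0"
proof -
  have [measurable]: "h \<in> borel_measurable borel" using cont by (rule borel_measurable_continuous_onI)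
  define e :: "nat => real" where "e k = 1 / (real k + 1)" for k
  have e: "0 < e k" for k by (simp add: e_def)
  have el: "e \<longlonglongrightarrow> 0" unfolding e_def using LIMSEQ_inverse_real_of_nat by (simp add: inverse_eq_divide add.commute)
  have "(\<integral>v. exp (- (norm v)\<^sup>2 / (2 * e k)) *\<^sub>R h (y + v) \<partial>lborel) = 0" for k
  proof -
    have "(\<integral>x. exp (- (e k / 2) * (norm x)\<^sup>2) *\<^sub>R (cis (- (1 * (x \<bullet> y))) * (\<integral>t. h t * cis (1 * (x \<bullet> t)) \<partial>lborel)) \<partial>lborel) = (\<integral>x. 0 \<partial>(lborel :: 'a measure))"
      using z by (intro integral_cong_AE) auto
    then have "(\<integral>t. exp (- (norm (t - y))\<^sup>2 / (2 * e k)) *\<^sub>R h t \<partial>lborel) = 0"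
      unfolding gauss_fourier_inversion[OF h e] using e[of k] by simp
    moreover have "(\<integral>t. exp (- (norm (t - y))\<^sup>2 / (2 * e k)) *\<^sub>R h t \<partial>lborel) = (\<integral>v. exp (- (norm v)\<^sup>2 / (2 * e k)) *\<^sub>R h (y + v) \<partial>lborel)"
      using integral_lborel_affine[of "%t. exp (- (norm (t - y))\<^sup>2 / (2 * e k)) *\<^sub>R h t" 1 y] by simp
    ultimately show ?thesis by simp
  qed
  moreover have "isCont (%v. h (y + v)) 0"
    using continuous_on_compose2[OF cont, of UNIV "%v. y + v"] by (simp add: continuous_on_eq_continuous_at continuous_intros)
  then have "(%k. (1 / sqrt (e k)) ^ DIM('a) *\<^sub>R (\<integral>v. exp (- (norm v)\<^sup>2 / (2 * e k)) *\<^sub>R h (y + v) \<partial>lborel))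
    \<longlonglongrightarrow> of_real (sqrt (2 * pi) ^ DIM('a)) * h (y + 0)"
    by (rule gauss_approximate_identity[where K = K, OF _ K _ e el, rotated]) measurable
  ultimately have "(%k::nat. 0) \<longlonglongrightarrow> of_real (sqrt (2 * pi) ^ DIM('a)) * h y" by simp
  then show ?thesis by (simp add: LIMSEQ_const_iff)
qed

text \<open>The right side may be infinite, so \<open>h\<close> is only assumed integrable. With
  Gaussian damping the left side unfolds into a double integral of products of \<open>h\<close> at
  two points against a Gaussian kernel; 2 a b <= a^2 + b^2 and the mass of the kernel bound it by
  the same constant for every damping, and Fatou's lemma removes the damping.\<close>

lemma plancherel_le:
  fixes h :: "'a::euclidean_space => complex"
  assumes h: "integrable lborel h" and c: "0 < c"
  shows "(\<integral>\<^sup>+x. ennreal ((cmod (\<integral>t. h t * cis (c * (x \<bullet> t)) \<partial>lborel))\<^sup>2) \<partial>lborel) <=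
    ennreal ((2 * pi / c) ^ DIM('a)) * (\<integral>\<^sup>+t. ennreal ((cmod (h t))\<^sup>2) \<partial>lborel)"
proof -
  have [measurable]: "h \<in> borel_measurable borel" using borel_measurable_integrable[OF h] by simp
  let ?d = "DIM('a)"
  define H where "H x = (\<integral>t. h t * cis (c * (x \<bullet> t)) \<partial>lborel)" for x
  have [measurable]: "H \<in> borel_measurable borel" unfolding H_def by measurable
  define L where "L = (\<integral>t. cmod (h t) \<partial>lborel)"
  have HL: "cmod (H x) <= L" for x
    unfolding H_def L_def using integral_norm_bound[of lborel "%t. h t * cis (c * (x \<bullet> t))"] by (simp add: norm_mult)
  have L0: "0 <= L" using HL[of 0] norm_ge_zero order.trans by blast
  let ?w = "%e (x::'a). exp (- (e / 2) * (norm x)\<^sup>2)"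
  let ?K = "%e (v::'a). exp (- (norm (c *\<^sub>R v))\<^sup>2 / (2 * e))"
  have Kint: "(\<integral>\<^sup>+v. ennreal (?K e v) \<partial>lborel) = ennreal (sqrt (2 * pi * e / c\<^sup>2) ^ ?d)" if e: "0 < e" for e
  proof -
    have eq: "?K e v = exp (- ((c\<^sup>2 / e) / 2) * (norm v)\<^sup>2)" for v by (simp add: power_mult_distrib)
    have "(\<integral>\<^sup>+v. ennreal (?K e v) \<partial>lborel) = ennreal (\<integral>v. ?K e v \<partial>lborel)"
      unfolding eq using c e by (intro nn_integral_eq_integral gauss_integral) auto
    also have "(\<integral>v. ?K e v \<partial>lborel) = sqrt (2 * pi / (c\<^sup>2 / e)) ^ ?d"
      unfolding eq using c e by (intro gauss_integral) auto
    finally show ?thesis by (simp add: mult.commute)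
  qed
  let ?S = "\<integral>\<^sup>+t. ennreal ((cmod (h t))\<^sup>2) \<partial>lborel"
  have main: "(\<integral>\<^sup>+x. ennreal (?w e x * (cmod (H x))\<^sup>2) \<partial>lborel) <= ennreal ((2 * pi / c) ^ ?d) * ?S" if e: "0 < e" for e
  proof -
    have wi: "integrable lborel (?w e)" by (rule gauss_integral[OF e])
    have iwH: "integrable lborel (%x. ?w e x *\<^sub>R (H x * cnj (H x)))"
      by (rule Bochner_Integration.integrable_bound[OF integrable_mult_left[OF wi, of "L * L"]])
         (use mult_mono[OF HL HL L0 norm_ge_zero] L0 in \<open>auto simp: norm_mult\<close>)
    have int: "integrable (lborel \<Otimes>\<^sub>M lborel) (%(x, t). ?w e x *\<^sub>R (cnj (H x) * (h t * cis (c * (x \<bullet> t)))))"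
    proof (rule lborel_pair.Fubini_integrable)
      show "(%(x, t). ?w e x *\<^sub>R (cnj (H x) * (h t * cis (c * (x \<bullet> t))))) \<in> borel_measurable (lborel \<Otimes>\<^sub>M lborel)" by measurable
      have "integrable lborel (%x. ?w e x * (cmod (H x) * L))"
        by (rule Bochner_Integration.integrable_bound[OF integrable_mult_left[OF wi, of "L * L"]])
           (use mult_right_mono[OF HL L0] L0 in auto)
      then show "integrable lborel (%x. \<integral>t. norm (case (x, t) of (x, t) => ?w e x *\<^sub>R (cnj (H x) * (h t * cis (c * (x \<bullet> t))))) \<partial>lborel)"
        by (simp add: norm_mult L_def)
      show "AE x in lborel. integrable lborel (%t. case (x, t) of (x, t) => ?w e x *\<^sub>R (cnj (H x) * (h t * cis (c * (x \<bullet> t)))))"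
        by (intro AE_I2) (simp only: prod.case, intro integrable_scaleR_right integrable_mult_right Bochner_Integration.integrable_bound[OF h], auto simp: norm_mult)
    qed
    have sq: "?w e x * (cmod (H x))\<^sup>2 = Re (?w e x *\<^sub>R (H x * cnj (H x)))" for x
      unfolding cmod_power2 by (simp add: power2_eq_square)
    have "(\<integral>x. ?w e x * (cmod (H x))\<^sup>2 \<partial>lborel) = Re (\<integral>x. ?w e x *\<^sub>R (H x * cnj (H x)) \<partial>lborel)"
      unfolding sq by (rule integral_Re[OF iwH])
    also have "(\<integral>x. ?w e x *\<^sub>R (H x * cnj (H x)) \<partial>lborel) =
        (\<integral>x. (\<integral>t. ?w e x *\<^sub>R (cnj (H x) * (h t * cis (c * (x \<bullet> t)))) \<partial>lborel) \<partial>lborel)"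
      by (simp add: H_def mult.commute)
    also have "\<dots> = (\<integral>t. (\<integral>x. ?w e x *\<^sub>R (cnj (H x) * (h t * cis (c * (x \<bullet> t)))) \<partial>lborel) \<partial>lborel)"
      by (rule lborel_pair.Fubini_integral[OF int, symmetric])
    also have "\<dots> = (\<integral>t. h t * cnj (of_real (sqrt (2 * pi / e) ^ ?d) * (\<integral>s. ?K e (s - t) *\<^sub>R h s \<partial>lborel)) \<partial>lborel)"
    proof (rule Bochner_Integration.integral_cong[OF refl])
      fix t :: 'a
      have "(\<integral>x. ?w e x *\<^sub>R (cnj (H x) * (h t * cis (c * (x \<bullet> t)))) \<partial>lborel) =
          h t * (\<integral>x. cnj (?w e x *\<^sub>R (cis (- (c * (x \<bullet> t))) * H x)) \<partial>lborel)"
        unfolding integral_mult_right_zero[symmetric] by (intro Bochner_Integration.integral_cong refl) (simp add: cis_cnj ac_simps)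
      then show "(\<integral>x. ?w e x *\<^sub>R (cnj (H x) * (h t * cis (c * (x \<bullet> t)))) \<partial>lborel) =
          h t * cnj (of_real (sqrt (2 * pi / e) ^ ?d) * (\<integral>s. ?K e (s - t) *\<^sub>R h s \<partial>lborel))"
        unfolding Bochner_Integration.integral_cnj H_def gauss_fourier_inversion[OF h e] .
    qed
    finally have "ennreal (\<integral>x. ?w e x * (cmod (H x))\<^sup>2 \<partial>lborel) <=
        ennreal (cmod (\<integral>t. h t * cnj (of_real (sqrt (2 * pi / e) ^ ?d) * (\<integral>s. ?K e (s - t) *\<^sub>R h s \<partial>lborel)) \<partial>lborel))"
      using complex_Re_le_cmod ennreal_leI by presburger
    also have "\<dots> <= (\<integral>\<^sup>+t. ennreal (cmod (h t * cnj (of_real (sqrt (2 * pi / e) ^ ?d) * (\<integral>s. ?K e (s - t) *\<^sub>R h s \<partial>lborel)))) \<partial>lborel)"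
      by (rule integral_norm_bound_ennreal')
    also have "\<dots> <= (\<integral>\<^sup>+t. (\<integral>\<^sup>+s. ennreal (sqrt (2 * pi / e) ^ ?d / 2) * (ennreal ((cmod (h t))\<^sup>2) * ennreal (?K e (s - t))
        + ennreal ((cmod (h s))\<^sup>2) * ennreal (?K e (s - t))) \<partial>lborel) \<partial>lborel)"
    proof (rule nn_integral_mono)
      fix t
      define q where "q = sqrt (2 * pi / e) ^ ?d"
      have q: "0 <= q" using e by (simp add: q_def)
      have "ennreal (cmod (h t * cnj (of_real q * (\<integral>s. ?K e (s - t) *\<^sub>R h s \<partial>lborel)))) =
          ennreal (cmod (h t) * q) * ennreal (cmod (\<integral>s. ?K e (s - t) *\<^sub>R h s \<partial>lborel))"
        using q by (simp add: norm_mult ennreal_mult[symmetric] mult.assoc)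
      also have "\<dots> <= ennreal (cmod (h t) * q) * (\<integral>\<^sup>+s. ennreal (cmod (?K e (s - t) *\<^sub>R h s)) \<partial>lborel)"
        by (intro mult_left_mono integral_norm_bound_ennreal') simp
      also have "\<dots> = (\<integral>\<^sup>+s. ennreal (cmod (h t) * q) * ennreal (cmod (?K e (s - t) *\<^sub>R h s)) \<partial>lborel)"
        by (rule nn_integral_cmult[symmetric]) simp
      also have "\<dots> <= (\<integral>\<^sup>+s. ennreal (q / 2) * (ennreal ((cmod (h t))\<^sup>2) * ennreal (?K e (s - t))
        + ennreal ((cmod (h s))\<^sup>2) * ennreal (?K e (s - t))) \<partial>lborel)"
      proof (rule nn_integral_mono)
        fix s
        have "0 <= (cmod (h t) - cmod (h s))\<^sup>2" by simp
        then have "cmod (h t) * cmod (h s) <= ((cmod (h t))\<^sup>2 + (cmod (h s))\<^sup>2) / 2"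
          by (simp add: power2_eq_square algebra_simps)
        from mult_left_mono[OF this, of "q * ?K e (s - t)"] q
        have "(cmod (h t) * q) * cmod (?K e (s - t) *\<^sub>R h s) <= q / 2 * ((cmod (h t))\<^sup>2 * ?K e (s - t) + (cmod (h s))\<^sup>2 * ?K e (s - t))"
          by (simp add: algebra_simps add_divide_distrib)
        then show "ennreal (cmod (h t) * q) * ennreal (cmod (?K e (s - t) *\<^sub>R h s)) <= ennreal (q / 2) * (ennreal ((cmod (h t))\<^sup>2) * ennreal (?K e (s - t))
            + ennreal ((cmod (h s))\<^sup>2) * ennreal (?K e (s - t)))"
          using q by (simp add: ennreal_mult[symmetric] ennreal_plus[symmetric] del: ennreal_plus)
      qed
      finally show "ennreal (cmod (h t * cnj (of_real (sqrt (2 * pi / e) ^ ?d) * (\<integral>s. ?K e (s - t) *\<^sub>R h s \<partial>lborel)))) <=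
        (\<integral>\<^sup>+s. ennreal (sqrt (2 * pi / e) ^ ?d / 2) * (ennreal ((cmod (h t))\<^sup>2) * ennreal (?K e (s - t))
        + ennreal ((cmod (h s))\<^sup>2) * ennreal (?K e (s - t))) \<partial>lborel)" unfolding q_def .
    qed
    also have "\<dots> = ennreal (sqrt (2 * pi / e) ^ ?d / 2) *
        ((\<integral>\<^sup>+t. (\<integral>\<^sup>+s. ennreal ((cmod (h t))\<^sup>2) * ennreal (?K e (s - t)) \<partial>lborel) \<partial>lborel) +
         (\<integral>\<^sup>+t. (\<integral>\<^sup>+s. ennreal ((cmod (h s))\<^sup>2) * ennreal (?K e (s - t)) \<partial>lborel) \<partial>lborel))"
      by (simp add: nn_integral_cmult nn_integral_add)
    finally have A0: "ennreal (\<integral>x. ?w e x * (cmod (H x))\<^sup>2 \<partial>lborel) <= \<dots>" .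
    have f1: "(\<integral>\<^sup>+t. (\<integral>\<^sup>+s. ennreal ((cmod (h s))\<^sup>2) * ennreal (?K e (s - t)) \<partial>lborel) \<partial>lborel) =
        (\<integral>\<^sup>+s. (\<integral>\<^sup>+t. ennreal ((cmod (h s))\<^sup>2) * ennreal (?K e (s - t)) \<partial>lborel) \<partial>lborel)"
      by (rule lborel_pair.Fubini') measurable
    have f2: "(\<integral>\<^sup>+t. ennreal ((cmod (h s))\<^sup>2) * ennreal (?K e (s - t)) \<partial>lborel) = ennreal ((cmod (h s))\<^sup>2) * ennreal (sqrt (2 * pi * e / c\<^sup>2) ^ ?d)" for s
      using nn_integral_lborel_affine[of "%v. ennreal (?K e v)" "-1" s] Kint[OF e] by (simp add: nn_integral_cmult)
    have f3: "(\<integral>\<^sup>+s. ennreal ((cmod (h t))\<^sup>2) * ennreal (?K e (s - t)) \<partial>lborel) = ennreal ((cmod (h t))\<^sup>2) * ennreal (sqrt (2 * pi * e / c\<^sup>2) ^ ?d)" for t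
      using nn_integral_lborel_affine[of "%v. ennreal (?K e v)" 1 "- t"] Kint[OF e] by (simp add: nn_integral_cmult)
    have f4: "ennreal (sqrt (2 * pi / e) ^ ?d / 2) * ((\<integral>\<^sup>+t. ennreal ((cmod (h t))\<^sup>2) * ennreal (sqrt (2 * pi * e / c\<^sup>2) ^ ?d) \<partial>lborel) +
         (\<integral>\<^sup>+t. ennreal ((cmod (h t))\<^sup>2) * ennreal (sqrt (2 * pi * e / c\<^sup>2) ^ ?d) \<partial>lborel)) =
        ennreal (sqrt (2 * pi / e) ^ ?d / 2 * (2 * sqrt (2 * pi * e / c\<^sup>2) ^ ?d)) * ?S"
    proof -
      have gen: "ennreal (a / 2) * (S * ennreal b + S * ennreal b) = ennreal (a / 2 * (2 * b)) * S"
        if "0 <= a" "0 <= b" for a b :: real and S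
      proof -
        have "ennreal (a / 2 * (2 * b)) * S = ennreal (a / 2) * (S * (ennreal (b + b)))"
          using \<open>0 <= a\<close> \<open>0 <= b\<close> ennreal_mult[of "a / 2" "2 * b"] by (simp only: mult.commute[of S] mult.assoc mult_2)
        then show ?thesis using \<open>0 <= b\<close> by (simp only: ennreal_plus distrib_left)
      qed
      have m: "(%t. ennreal ((cmod (h t))\<^sup>2)) \<in> borel_measurable lborel" by measurable
      show ?thesis unfolding nn_integral_multc[OF m]
        by (rule gen) (use e in simp_all)
    qed
    have f5: "sqrt (2 * pi / e) ^ ?d / 2 * (2 * sqrt (2 * pi * e / c\<^sup>2) ^ ?d) = (sqrt (2 * pi / e) * sqrt (2 * pi * e / c\<^sup>2)) ^ ?d"
      by (simp only: power_mult_distrib)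
    have f6: "sqrt (2 * pi / e) * sqrt (2 * pi * e / c\<^sup>2) = 2 * pi / c"
    proof -
      have "(2 * pi / e) * (2 * pi * e / c\<^sup>2) = (2 * pi / c)\<^sup>2" using e c by (simp add: power2_eq_square field_simps)
      then show ?thesis using c by (simp only: real_sqrt_mult[symmetric] real_sqrt_abs) simp
    qed
    have A: "ennreal (\<integral>x. ?w e x * (cmod (H x))\<^sup>2 \<partial>lborel) <= ennreal ((2 * pi / c) ^ ?d) * ?S"
      using A0 unfolding f1 f2 f3 f4 f5 f6 .
    have "integrable lborel (%x. ?w e x * (cmod (H x))\<^sup>2)"
      unfolding sq by (rule integrable_Re[OF iwH])
    then have "(\<integral>\<^sup>+x. ennreal (?w e x * (cmod (H x))\<^sup>2) \<partial>lborel) = ennreal (\<integral>x. ?w e x * (cmod (H x))\<^sup>2 \<partial>lborel)"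
      by (intro nn_integral_eq_integral) auto
    then show ?thesis using A by simp
  qed
  define e :: "nat => real" where "e k = 1 / (real k + 1)" for k
  have e: "0 < e k" for k by (simp add: e_def)
  have el: "e \<longlonglongrightarrow> 0" unfolding e_def using LIMSEQ_inverse_real_of_nat by (simp add: inverse_eq_divide add.commute)
  have "(\<integral>\<^sup>+x. ennreal ((cmod (H x))\<^sup>2) \<partial>lborel) = (\<integral>\<^sup>+x. liminf (%k. ennreal (?w (e k) x * (cmod (H x))\<^sup>2)) \<partial>lborel)"
  proof (rule nn_integral_cong)
    fix x
    have "(%k. ennreal (?w (e k) x * (cmod (H x))\<^sup>2)) \<longlonglongrightarrow> ennreal (exp (- (0 / 2) * (norm x)\<^sup>2) * (cmod (H x))\<^sup>2)"
      by (intro tendsto_ennrealI tendsto_intros el) simp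
    then show "ennreal ((cmod (H x))\<^sup>2) = liminf (%k. ennreal (?w (e k) x * (cmod (H x))\<^sup>2))"
      using lim_imp_Liminf[OF sequentially_bot] by fastforce
  qed
  also have "\<dots> <= liminf (%k. \<integral>\<^sup>+x. ennreal (?w (e k) x * (cmod (H x))\<^sup>2) \<partial>lborel)"
    by (intro nn_integral_liminf) measurable
  also have "\<dots> <= liminf (%k::nat. ennreal ((2 * pi / c) ^ ?d) * ?S)" by (intro Liminf_mono always_eventually allI main e)
  also have "\<dots> = ennreal ((2 * pi / c) ^ ?d) * ?S" by (simp add: Liminf_const)
  finally show ?thesis unfolding H_def .
qed

section \<open>The Schroedinger representation\<close>

lemma AE_not_in_negligible: "negligible N ==> AE x in lborel. x \<notin> N"
  unfolding negligible_iff_null_sets using AE_not_in[of N lebesgue] by (simp add: AE_completion_iff)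

lemma square_integrable_indicator_cbox:
  "square_integrable (%x::'a::euclidean_space. complex_of_real (indicator (cbox a b) x))"
proof -
  have "(%x. (cmod (complex_of_real (indicator (cbox a b) x)))\<^sup>2) = (indicator (cbox a b) :: 'a => real)"
    by (auto simp: indicator_def)
  then show ?thesis unfolding square_integrable_def
    using integrable_real_indicator[of "cbox a b" lborel] emeasure_lborel_cbox_finite[of a b] by simp
qed

text \<open>A vector orthogonal to \<open>W\<close> has integral 0 over every box, hence vanishes
  almost everywhere by Lebesgue's differentiation theorem.\<close>

lemma box_functions_dense:
  fixes W :: "'a::euclidean_space L2 set"
  assumes W: "subspace W" "closed W" "!!c x. x \<in> W ==> c *\<^sub>C x \<in> W"
    and box: "!!a b. abs_L2 (%x. of_real (indicator (cbox a b) x)) \<in> W"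
  shows "ph \<in> W"
proof -
  obtain P where P: "proj P" "!!x. P @@ x \<in> W" "!!x. x \<in> W ==> P @@ x = x"
    using proj_exists[OF W] by metis
  define th where "th = ph - P @@ ph"
  have PP: "adj P = P" "P @@ P @@ x = P @@ x" for x using P(1) app_times[of P P x] by (auto simp: proj_def)
  have orth: "cinner th w = 0" if "w \<in> W" for w
  proof -
    have "cinner th w = cinner th (P @@ w)" using P(3)[OF that] by simp
    also have "\<dots> = cinner (P @@ th) w" using adj_left[of th P w] PP by simp
    also have "P @@ th = 0" unfolding th_def app_diff PP by simp
    finally show ?thesis by simp
  qed
  define f where "f = rep_L2 th"
  have [measurable]: "f \<in> borel_measurable borel" by (simp add: f_def)
  note si = square_integrable_indicator_cbox
  have eq: "f x * cnj (complex_of_real (indicator (cbox a b) x)) = indicator (cbox a b) x *\<^sub>R f x" for a b x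
    by (simp add: scaleR_conv_of_real)
  have int: "set_integrable lborel (cbox a b) f" for a b
    using integrable_mult_cnj[OF square_integrable_rep[of th] si[of a b]] unfolding set_integrable_def f_def[symmetric] eq .
  have "(LINT x : cbox a b | lborel. f x) = 0" for a b
  proof -
    have "cinner (abs_L2 (rep_L2 th)) (abs_L2 (%x. of_real (indicator (cbox a b) x))) = 0"
      using orth[OF box[of a b]] unfolding abs_rep_L2 .
    then show ?thesis unfolding cinner_abs[OF square_integrable_rep si] set_lebesgue_integral_def unfolding f_def[symmetric] eq .
  qed
  then have z: "integral (cbox a b) f = 0" for a b using set_borel_integral_eq_integral(2)[OF int[of a b]] by simp
  obtain N where N: "negligible N" "!!x e. [|x \<notin> N; 0 < e|] ==>
      EX d>0. ALL h. 0 < h & h < d --> norm (integral (cbox x (x + h *\<^sub>R One)) f /\<^sub>R h ^ DIM('a) - f x) < e"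
    using integrable_ccontinuous_explicit[of f] set_borel_integral_eq_integral(1)[OF int] by metis
  have fz: "f x = 0" if x: "x \<notin> N" for x
  proof (rule ccontr)
    assume "f x ~= 0"
    then obtain d where "d > 0" "!!h. 0 < h & h < d ==> norm (integral (cbox x (x + h *\<^sub>R One)) f /\<^sub>R h ^ DIM('a) - f x) < cmod (f x)"
      using N(2)[OF x, of "cmod (f x)"] by auto
    from this(2)[of "d / 2"] \<open>d > 0\<close> show False unfolding z by simp
  qed
  from AE_not_in_negligible[OF N(1)] have "AE x in lborel. f x = 0" by eventually_elim (rule fz)
  then have "AE x in lborel. rep_L2 th x = 0 * rep_L2 th x" by (simp add: f_def)
  then have "AE x in lborel. rep_L2 th x = rep_L2 (0 *\<^sub>C th) x" using rep_scaleC[of 0 th] by eventually_elim simp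
  then have "th = 0" using L2_eqI by fastforce
  then show ?thesis using P(2)[of ph] by (simp add: th_def)
qed

section \<open>Weyl operators and their commutation relations\<close>

definition phase :: "real => (real^'n) \<times> (real^'n) => real^'n => real" where
  "phase l p xi = l * (inner (fst p) xi + inner (fst p) (snd p) / 2)"

lemma phase_measurable [measurable]: "phase l p \<in> borel_measurable borel"
  unfolding phase_def by measurable

lemma schroedinger_abs:
  "square_integrable f ==> schroedinger l p (abs_L2 f) = abs_L2 (%xi. cis (phase l p xi) * f (xi + snd p))"
  unfolding phase_def by (rule schroedinger.abs_eq) (rule L2_rel_refl)

lemma square_integrable_schroedinger:
  "square_integrable f ==> square_integrable (%xi. cis (phase l p xi) * f (xi + snd p))"
  by (intro square_integrable_phase square_integrable_shift) simp_all

lemma schroedinger_rep: "schroedinger l p ph = abs_L2 (%xi. cis (phase l p xi) * rep_L2 ph (xi + snd p))"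
  using schroedinger_abs[OF square_integrable_rep, of l p ph] by (simp add: abs_rep_L2)

lemma rep_schroedinger:
  "AE xi in lborel. rep_L2 (schroedinger l p ph) xi = cis (phase l p xi) * rep_L2 ph (xi + snd p)"
  unfolding schroedinger_rep by (rule rep_abs_L2) (rule square_integrable_schroedinger[OF square_integrable_rep])

lemma schroedinger_add: "schroedinger l p (ph + ps) = schroedinger l p ph + schroedinger l p ps"
  by (rule L2_eqI)
     (use rep_schroedinger[of l p "ph + ps"] rep_schroedinger[of l p ph] rep_schroedinger[of l p ps]
        AE_lborel_shift[OF rep_plus[of ph ps], of "snd p"] rep_plus[of "schroedinger l p ph" "schroedinger l p ps"]
      in \<open>eventually_elim, simp add: distrib_left\<close>)

lemma schroedinger_scaleC: "schroedinger l p (c *\<^sub>C ph) = c *\<^sub>C schroedinger l p ph"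
  by (rule L2_eqI)
     (use rep_schroedinger[of l p "c *\<^sub>C ph"] rep_schroedinger[of l p ph]
        AE_lborel_shift[OF rep_scaleC[of c ph], of "snd p"] rep_scaleC[of c "schroedinger l p ph"]
      in \<open>eventually_elim, simp\<close>)

lemma schroedinger_zero: "schroedinger l 0 ph = ph"
  by (rule L2_eqI) (use rep_schroedinger[of l 0 ph] in \<open>eventually_elim, simp add: phase_def\<close>)

text \<open>The symplectic form of the bracket in adapted coordinates: multiplied by the norm of the
  frequency, it is the central character of the bracket of \<open>p\<close> and
  \<open>q\<close>.\<close>

definition omega :: "(real^'n) \<times> (real^'n) => (real^'n) \<times> (real^'n) => real" where
  "omega p q = inner (snd p) (fst q) - inner (fst p) (snd q)"

lemma schroedinger_comp:
  "schroedinger l p (schroedinger l q ph) = cis (l / 2 * omega p q) *\<^sub>C schroedinger l (p + q) ph"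
proof (rule L2_eqI)
  have ph: "phase l p xi + phase l q (xi + snd p) = l / 2 * omega p q + phase l (p + q) xi" for xi
    by (simp add: phase_def omega_def inner_add_left inner_add_right algebra_simps inner_commute add_divide_distrib)
  show "AE xi in lborel. rep_L2 (schroedinger l p (schroedinger l q ph)) xi =
      rep_L2 (cis (l / 2 * omega p q) *\<^sub>C schroedinger l (p + q) ph) xi"
    using rep_schroedinger[of l p "schroedinger l q ph"] AE_lborel_shift[OF rep_schroedinger[of l q ph], of "snd p"]
      rep_schroedinger[of l "p + q" ph] rep_scaleC[of "cis (l / 2 * omega p q)" "schroedinger l (p + q) ph"]
  proof eventually_elim
    case (elim xi)
    then show ?case
      by (simp only: mult.assoc[symmetric] cis_mult ph) (simp add: add.commute add.left_commute)
  qed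
qed

lemma cinner_schroedinger: "cinner (schroedinger l p ph) ps = cinner ph (schroedinger l (- p) ps)"
proof -
  let ?f = "rep_L2 ph" and ?g = "rep_L2 ps"
  have ph: "phase l (- p) (snd p + xi) = - phase l p xi" for xi
    by (simp add: phase_def inner_add_right algebra_simps)
  have "cinner ph (schroedinger l (- p) ps) = cinner (abs_L2 ?f) (abs_L2 (%xi. cis (phase l (- p) xi) * ?g (xi + snd (- p))))"
    unfolding abs_rep_L2 schroedinger_rep ..
  also have "\<dots> = (LINT xi|lborel. ?f xi * cnj (cis (phase l (- p) xi) * ?g (xi + snd (- p))))"
    by (rule cinner_abs[OF square_integrable_rep square_integrable_schroedinger[OF square_integrable_rep]])
  also have "\<dots> = (LINT xi|lborel. ?f (snd p + xi) * cnj (cis (phase l (- p) (snd p + xi)) * ?g (snd p + xi + snd (- p))))"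
    by (subst integral_lborel_affine[where c = 1 and t = "snd p"]) simp_all
  also have "\<dots> = (LINT xi|lborel. (cis (phase l p xi) * ?f (xi + snd p)) * cnj (?g xi))"
    unfolding ph by (intro Bochner_Integration.integral_cong refl) (simp add: cis_cnj add.commute)
  also have "\<dots> = cinner (abs_L2 (%xi. cis (phase l p xi) * ?f (xi + snd p))) (abs_L2 ?g)"
    by (rule cinner_abs[symmetric, OF square_integrable_schroedinger[OF square_integrable_rep] square_integrable_rep])
  finally show ?thesis unfolding abs_rep_L2 schroedinger_rep[symmetric] by simp
qed

lemma omega_self: "omega p p = 0" "omega (- p) p = 0" "omega p (- p) = 0"
  by (simp_all add: omega_def inner_commute)

lemma norm_schroedinger: "norm (schroedinger l p ph) = norm ph"
proof -
  have "(norm (schroedinger l p ph))\<^sup>2 = (norm ph)\<^sup>2"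
    unfolding Re_cinner_self[symmetric] cinner_schroedinger[of l p ph] schroedinger_comp by (simp add: omega_self schroedinger_zero)
  then show ?thesis by (simp add: power2_eq_iff_nonneg)
qed

definition weyl :: "real => (real^'n) \<times> (real^'n) => (real^'n) bop" where
  "weyl l p = (SOME T. ALL ph. T @@ ph = schroedinger l p ph)"

lemma weyl_app: "weyl l p @@ ph = schroedinger l p ph"
proof -
  have "EX T. ALL ph. T @@ ph = schroedinger l p ph"
    by (rule bop_exists[of _ 1]) (simp_all add: schroedinger_add schroedinger_scaleC norm_schroedinger)
  from someI_ex[OF this] show ?thesis unfolding weyl_def by blast
qed

lemma weyl_times: "weyl l p * weyl l q = cop (cis (l / 2 * omega p q)) * weyl l (p + q)"
  and weyl_zero: "weyl l 0 = 1" and adj_weyl: "adj (weyl l p) = weyl l (- p)"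
  by (auto intro!: bop_eqI adj_unique simp: weyl_app schroedinger_comp schroedinger_zero cinner_schroedinger)

lemma norm_weyl: "norm (weyl l p @@ ph) = norm ph" by (simp add: weyl_app norm_schroedinger)

lemma norm_weyl_le: "norm (weyl l p) <= 1" by (rule norm_bop_le) (simp_all add: norm_weyl)

text \<open>The operators are isometric, so the vectors for which the limit holds form a closed
  subspace. It is enough to treat indicators of boxes, where pointwise convergence holds off the
  boundary.\<close>

lemma weyl_tendsto:
  fixes ph :: "(real^'n) L2"
  assumes p: "p \<longlonglongrightarrow> p0"
  shows "(%k. weyl l (p k) @@ ph) \<longlonglongrightarrow> weyl l p0 @@ ph"
proof -
  define W :: "(real^'n) L2 set" where "W = {ph. (%k. weyl l (p k) @@ ph) \<longlonglongrightarrow> weyl l p0 @@ ph}"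
  have "ph \<in> W"
  proof (rule box_functions_dense)
    show "subspace W" unfolding subspace_def W_def by (auto simp: app_add app_scaleR intro: tendsto_intros)
    show "c *\<^sub>C x \<in> W" if "x \<in> W" for c x using that by (auto simp: W_def app_scaleC intro: tendsto_intros)
    show "closed W" unfolding closed_sequential_limits
    proof (intro allI impI, elim conjE)
      fix x L assume x: "ALL n. x n \<in> W" and L: "x \<longlonglongrightarrow> L"
      show "L \<in> W" unfolding W_def mem_Collect_eq
      proof (rule metric_LIMSEQ_I)
        fix e :: real assume e: "0 < e"
        obtain m where m: "norm (x m - L) < e / 3" using metric_LIMSEQ_D[OF L, of "e / 3"] e by (auto simp: dist_norm)
        have "(%k. weyl l (p k) @@ x m) \<longlonglongrightarrow> weyl l p0 @@ x m" using x by (simp add: W_def)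
        then obtain k0 where k0: "!!k. k >= k0 ==> norm (weyl l (p k) @@ x m - weyl l p0 @@ x m) < e / 3"
          using metric_LIMSEQ_D[of _ "weyl l p0 @@ x m" "e / 3"] e by (metis dist_norm divide_pos_pos zero_less_numeral)
        have "dist (weyl l (p k) @@ L) (weyl l p0 @@ L) < e" if k: "k >= k0" for k
        proof -
          have eq: "weyl l (p k) @@ L - weyl l p0 @@ L =
              (weyl l (p k) @@ x m - weyl l p0 @@ x m) + (weyl l p0 @@ (x m - L) - weyl l (p k) @@ (x m - L))"
            by (simp add: app_diff)
          have "norm (weyl l (p k) @@ L - weyl l p0 @@ L) <= norm (weyl l (p k) @@ x m - weyl l p0 @@ x m) +
              (norm (weyl l p0 @@ (x m - L)) + norm (weyl l (p k) @@ (x m - L)))"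
            unfolding eq by (intro order.trans[OF norm_triangle_ineq] add_left_mono norm_triangle_ineq4)
          then show ?thesis using k0[OF k] m unfolding norm_weyl dist_norm by linarith
        qed
        then show "EX k0. ALL k>=k0. dist (weyl l (p k) @@ L) (weyl l p0 @@ L) < e" by blast
      qed
    qed
    fix a b :: "real^'n"
    let ?B = "%x. complex_of_real (indicator (cbox a b) x)"
    note si = square_integrable_indicator_cbox[of a b]
    let ?f = "%p xi. cis (phase l p xi) * ?B (xi + snd p)"
    have sif: "square_integrable (?f p)" for p by (rule square_integrable_schroedinger[OF si])
    \<comment> \<open>Pairing with the limit function supplies a majorant that does not depend on k.
      As all norms are equal, convergence of this pairing to the squared norm is norm
      convergence.\<close>
    have "(%k. LINT xi|lborel. ?f (p k) xi * cnj (?f p0 xi)) \<longlonglongrightarrow> (LINT xi|lborel. ?f p0 xi * cnj (?f p0 xi))"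
    proof (rule integral_dominated_convergence)
      show "(%xi. ?f p0 xi * cnj (?f p0 xi)) \<in> borel_measurable lborel"
        and "(%xi. ?f (p k) xi * cnj (?f p0 xi)) \<in> borel_measurable lborel" for k by measurable
      show "integrable lborel (%xi. cmod (?f p0 xi * cnj (?f p0 xi)))"
        by (intro integrable_norm integrable_mult_cnj sif)
      show "AE xi in lborel. norm (?f (p k) xi * cnj (?f p0 xi)) <= cmod (?f p0 xi * cnj (?f p0 xi))" for k
        by (rule AE_I2) (auto simp: norm_mult indicator_def)
      have "AE xi in lborel. xi + snd p0 \<notin> cbox a b - box a b"
        using AE_lborel_shift[OF AE_not_in_negligible[OF negligible_frontier_interval]] .
      then show "AE xi in lborel. (%k. ?f (p k) xi * cnj (?f p0 xi)) \<longlonglongrightarrow> ?f p0 xi * cnj (?f p0 xi)"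
      proof eventually_elim
        case (elim xi)
        have cis: "(%k. cis (phase l (p k) xi)) \<longlonglongrightarrow> cis (phase l p0 xi)"
          unfolding phase_def cis_conv_exp by (intro tendsto_intros p) simp_all
        show ?case
        proof (cases "xi + snd p0 \<in> cbox a b")
          case True
          then have "xi + snd p0 \<in> box a b" using elim by blast
          moreover have "(%k. xi + snd (p k)) \<longlonglongrightarrow> xi + snd p0" by (intro tendsto_intros p)
          ultimately have "\<forall>\<^sub>F k in sequentially. xi + snd (p k) \<in> box a b" by (metis topological_tendstoD open_box)
          then have "\<forall>\<^sub>F k in sequentially. cis (phase l (p k) xi) = ?f (p k) xi"
            by (rule eventually_mono) (use box_subset_cbox[of a b] in \<open>auto simp: indicator_def\<close>)
          from tendsto_cong[OF this] cis have "(%k. ?f (p k) xi) \<longlonglongrightarrow> cis (phase l p0 xi)" by simp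
          from tendsto_mult[OF this tendsto_const[of "cnj (?f p0 xi)"]] show ?thesis using True by simp
        qed simp
      qed
    qed
    then have "(%k. cinner (weyl l (p k) @@ abs_L2 ?B) (weyl l p0 @@ abs_L2 ?B)) \<longlonglongrightarrow> cinner (weyl l p0 @@ abs_L2 ?B) (weyl l p0 @@ abs_L2 ?B)"
      unfolding weyl_app schroedinger_abs[OF si] cinner_abs[OF sif sif] .
    note clim = this
    have lim: "(%k. 2 * (norm (abs_L2 ?B))\<^sup>2 - 2 * Re (cinner (weyl l (p k) @@ abs_L2 ?B) (weyl l p0 @@ abs_L2 ?B)))
        \<longlonglongrightarrow> 2 * (norm (abs_L2 ?B))\<^sup>2 - 2 * Re (cinner (weyl l p0 @@ abs_L2 ?B) (weyl l p0 @@ abs_L2 ?B))"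
      by (intro tendsto_diff tendsto_const tendsto_mult tendsto_Re clim)
    have sq: "(norm (u - v))\<^sup>2 = (norm u)\<^sup>2 + (norm v)\<^sup>2 - 2 * Re (cinner u v)" for u v :: "(real^'n) L2"
      using cinner_commute[of u v] unfolding Re_cinner_self[symmetric] cinner_simps by simp
    have "(%k. (norm (weyl l (p k) @@ abs_L2 ?B - weyl l p0 @@ abs_L2 ?B))\<^sup>2) \<longlonglongrightarrow> 0"
      using lim unfolding sq Re_cinner_self norm_weyl by simp
    then have "(%k. sqrt ((norm (weyl l (p k) @@ abs_L2 ?B - weyl l p0 @@ abs_L2 ?B))\<^sup>2)) \<longlonglongrightarrow> sqrt 0" by (rule tendsto_real_sqrt)
    then have "(%k. norm (weyl l (p k) @@ abs_L2 ?B - weyl l p0 @@ abs_L2 ?B)) \<longlonglongrightarrow> 0" by simp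
    then show "abs_L2 ?B \<in> W" unfolding W_def mem_Collect_eq by (rule LIM_zero_cancel[OF tendsto_norm_zero_cancel])
  qed
  then show ?thesis by (simp add: W_def)
qed

lemma continuous_on_weyl: "continuous_on UNIV (%p. weyl l p @@ ph)"
  unfolding continuous_on_sequentially comp_def using weyl_tendsto by blast

lemma continuous_on_weyl_compose [continuous_intros]:
  "continuous_on S f ==> continuous_on S (%x. weyl l (f x) @@ ph)"
  by (rule continuous_on_compose2[OF continuous_on_weyl]) auto

lemma weyl_measurable [measurable]: "(%p. cinner (weyl l p @@ ph) ps) \<in> borel_measurable borel"
  "(%p. cinner ps (weyl l p @@ ph)) \<in> borel_measurable borel"
  "(%p. cinner (T @@ weyl l p @@ ph) (weyl l p @@ ph)) \<in> borel_measurable borel"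
  by (intro borel_measurable_continuous_onI continuous_intros continuous_on_weyl)+

lemma weyl_ugroup: "ugroup (%r. weyl l (r *\<^sub>R q))"
proof
  show "weyl l (0 *\<^sub>R q) = 1" by (simp add: weyl_zero)
  have "omega (s *\<^sub>R q) (t *\<^sub>R q) = 0" for s t by (simp add: omega_def inner_commute)
  then show "weyl l ((s + t) *\<^sub>R q) = weyl l (s *\<^sub>R q) * weyl l (t *\<^sub>R q)" for s t
    unfolding weyl_times by (intro bop_eqI) (simp add: scaleR_add_left)
  show "adj (weyl l (t *\<^sub>R q)) = weyl l ((- t) *\<^sub>R q)" for t by (simp add: adj_weyl)
  show "continuous_on UNIV (%t. weyl l (t *\<^sub>R q) @@ x)" for x by (intro continuous_intros)
qed

text \<open>Stone's theorem is an equivalence with an explicit graph, so the \<open>THE\<close> in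
  the definition evaluates to that graph.\<close>

lemma generator:
  shows "selfadjoint (generator l q)"
    and "graph_of (schroedinger (norm l) (r *\<^sub>R q)) = spectral_calculus (generator l q) (%s. cis (r * s))"
proof -
  have g: "graph_of (%x. weyl (norm l) (r *\<^sub>R q) @@ x) = graph_of (schroedinger (norm l) (r *\<^sub>R q))" for r
    by (simp add: weyl_app)
  note stone = ugroup.stone[OF weyl_ugroup[of "norm l" q], unfolded g]
  have "generator l q = resolvent_graph (cop (- \<i>) * ugroup.lap (%r. weyl (norm l) (r *\<^sub>R q)))"
    unfolding generator_def stone by simp
  from this[folded stone] show "selfadjoint (generator l q)"
    "graph_of (schroedinger (norm l) (r *\<^sub>R q)) = spectral_calculus (generator l q) (%s. cis (r * s))" by auto
qed

text \<open>An upper bound in the orthogonality relations for the matrix coefficients of the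
  representation: the vectors \<open>weyl l a @@ g\<close> form a Bessel family.\<close>

lemma weyl_frame:
  fixes g ph :: "(real^'n) L2"
  assumes l: "0 < l"
  shows "(\<integral>\<^sup>+a. ennreal ((cmod (cinner ph (weyl l a @@ g)))\<^sup>2) \<partial>lborel) <=
    ennreal (((2 * pi / l) ^ CARD('n) * (norm g)\<^sup>2) * (norm ph)\<^sup>2)"
proof -
  let ?f = "rep_L2 ph" and ?g = "rep_L2 g" and ?C = "(2 * pi / l) ^ CARD('n)"
  have C: "0 <= ?C" using l by simp
  \<comment> \<open>For fixed u the matrix coefficient has the modulus of the Fourier transform in x
    of \<open>h u\<close>. Plancherel's inequality in x and Tonelli in u and xi separate the norms
    of \<open>ph\<close> and \<open>g\<close>.\<close>
  define h where "h u xi = ?g (xi + u) * cnj (?f xi)" for u xi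
  have hi: "integrable lborel (h u)" for u
    unfolding h_def by (intro integrable_mult_cnj square_integrable_shift square_integrable_rep)
  have cm: "cmod (cinner ph (weyl l (x, u) @@ g)) = cmod (\<integral>xi. h u xi * cis (l * (x \<bullet> xi)) \<partial>lborel)" for x u
  proof -
    have "cinner (weyl l (x, u) @@ g) ph = cinner (abs_L2 (%xi. cis (phase l (x, u) xi) * ?g (xi + snd (x, u)))) (abs_L2 ?f)"
      unfolding weyl_app schroedinger_rep[symmetric] abs_rep_L2 ..
    also have "\<dots> = (\<integral>xi. (cis (phase l (x, u) xi) * ?g (xi + snd (x, u))) * cnj (?f xi) \<partial>lborel)"
      by (rule cinner_abs[OF square_integrable_schroedinger[OF square_integrable_rep] square_integrable_rep])
    also have "\<dots> = (\<integral>xi. cis (l * (x \<bullet> u) / 2) * (h u xi * cis (l * (x \<bullet> xi))) \<partial>lborel)"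
      by (intro Bochner_Integration.integral_cong refl)
         (simp add: h_def phase_def distrib_left cis_mult[symmetric] ac_simps)
    finally have "cmod (cinner (weyl l (x, u) @@ g) ph) = cmod (\<integral>xi. h u xi * cis (l * (x \<bullet> xi)) \<partial>lborel)"
      by (simp add: norm_mult)
    then show ?thesis using cinner_commute[of ph "weyl l (x, u) @@ g"] by simp
  qed
  have "(\<integral>\<^sup>+a. ennreal ((cmod (cinner ph (weyl l a @@ g)))\<^sup>2) \<partial>lborel) =
      (\<integral>\<^sup>+u. (\<integral>\<^sup>+x. ennreal ((cmod (cinner ph (weyl l (x, u) @@ g)))\<^sup>2) \<partial>lborel) \<partial>lborel)"
    unfolding lborel_prod[symmetric] by (rule lborel_pair.nn_integral_snd[symmetric]) (simp add: lborel_prod)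
  also have "\<dots> <= (\<integral>\<^sup>+u. ennreal ?C * (\<integral>\<^sup>+xi. ennreal ((cmod (h u xi))\<^sup>2) \<partial>lborel) \<partial>lborel)"
    unfolding cm using plancherel_le[OF hi l] by (intro nn_integral_mono) simp
  also have "\<dots> = ennreal ?C * (\<integral>\<^sup>+u. (\<integral>\<^sup>+xi. ennreal ((cmod (h u xi))\<^sup>2) \<partial>lborel) \<partial>lborel)"
    unfolding h_def by (rule nn_integral_cmult) measurable
  also have "(\<integral>\<^sup>+u. (\<integral>\<^sup>+xi. ennreal ((cmod (h u xi))\<^sup>2) \<partial>lborel) \<partial>lborel) =
      (\<integral>\<^sup>+xi. (\<integral>\<^sup>+u. ennreal ((cmod (h u xi))\<^sup>2) \<partial>lborel) \<partial>lborel)"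
    unfolding h_def by (rule lborel_pair.Fubini'[symmetric]) measurable
  also have "\<dots> = (\<integral>\<^sup>+xi. ennreal ((cmod (?f xi))\<^sup>2) * ennreal ((norm g)\<^sup>2) \<partial>lborel)"
  proof (rule nn_integral_cong)
    fix xi
    have "(\<integral>\<^sup>+u. ennreal ((cmod (h u xi))\<^sup>2) \<partial>lborel) = (\<integral>\<^sup>+u. ennreal ((cmod (?f xi))\<^sup>2) * ennreal ((cmod (?g (xi + 1 *\<^sub>R u)))\<^sup>2) \<partial>lborel)"
      by (intro nn_integral_cong) (simp add: h_def norm_mult power_mult_distrib ennreal_mult mult.commute)
    also have "\<dots> = ennreal ((cmod (?f xi))\<^sup>2) * (\<integral>\<^sup>+u. ennreal ((cmod (?g (xi + 1 *\<^sub>R u)))\<^sup>2) \<partial>lborel)"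
      by (rule nn_integral_cmult) measurable
    also have "(\<integral>\<^sup>+u. ennreal ((cmod (?g (xi + 1 *\<^sub>R u)))\<^sup>2) \<partial>lborel) = ennreal ((norm g)\<^sup>2)"
      using nn_integral_lborel_affine[of "%u. ennreal ((cmod (?g u))\<^sup>2)" 1 xi] nn_integral_rep[of g] by simp
    finally show "(\<integral>\<^sup>+u. ennreal ((cmod (h u xi))\<^sup>2) \<partial>lborel) = ennreal ((cmod (?f xi))\<^sup>2) * ennreal ((norm g)\<^sup>2)" .
  qed
  also have "\<dots> = ennreal ((norm ph)\<^sup>2) * ennreal ((norm g)\<^sup>2)"
    by (subst nn_integral_multc) (simp_all add: nn_integral_rep)
  also have "ennreal ?C * (ennreal ((norm ph)\<^sup>2) * ennreal ((norm g)\<^sup>2)) = ennreal ((?C * (norm g)\<^sup>2) * (norm ph)\<^sup>2)"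
    using C by (simp only: ennreal_mult[symmetric] zero_le_power2 mult_nonneg_nonneg) (simp add: ac_simps)
  finally show ?thesis .
qed

section \<open>Recovering a function from its Weyl transform\<close>

lemma omega_linear: "omega (p + p') q = omega p q + omega p' q" "omega p (q + q') = omega p q + omega p q'"
  "omega (- p) q = - omega p q" "omega p (- q) = - omega p q"
  by (simp_all add: omega_def inner_add_left inner_add_right)

text \<open>Exchanging the two operators costs the character \<open>cis (l * omega v a)\<close>.
  This is the only dependence on \<open>a\<close>, and it makes a frame integral a Fourier
  integral.\<close>

lemma weyl_conjugate: "cinner (weyl l v @@ weyl l a @@ ph) (weyl l a @@ ps) = cis (l * omega v a) * cinner (weyl l v @@ ph) ps"
proof -
  have anti: "omega a v = - omega v a" by (simp add: omega_def inner_commute)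
  have 1: "weyl l v * weyl l a = cop (cis (l / 2 * omega v a)) * weyl l (v + a)"
    and 2: "weyl l a * weyl l v = cop (cis (- (l / 2 * omega v a))) * weyl l (v + a)"
    unfolding weyl_times anti by (simp_all add: add.commute)
  have "l * omega v a + - (l / 2 * omega v a) = l / 2 * omega v a" by simp
  then have "weyl l v * weyl l a = cop (cis (l * omega v a)) * (weyl l a * weyl l v)"
    unfolding 1 2 mult.assoc[symmetric] cop_mult cis_mult by simp
  then have "weyl l v @@ weyl l a @@ ph = cis (l * omega v a) *\<^sub>C (weyl l a @@ weyl l v @@ ph)"
    by (metis app_times app_cop)
  moreover have "cinner (weyl l a @@ x) (weyl l a @@ y) = cinner x y" for x y
  proof -
    have "adj (weyl l a) * weyl l a = 1" unfolding adj_weyl weyl_times omega_self by (intro bop_eqI) (simp add: weyl_zero)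
    then show ?thesis by (metis adj_left app_one app_times adj_right)
  qed
  ultimately show ?thesis by (simp add: cinner_simps)
qed

text \<open>The rotation that turns the symplectic form into the Euclidean inner product.\<close>

definition symp :: "(real^'n) \<times> (real^'n) => (real^'n) \<times> (real^'n)" where
  "symp v = (snd v, - fst v)"

lemma inner_symp: "inner a (symp v) = omega v a"
  by (cases a) (simp add: symp_def omega_def inner_commute)

lemma norm_symp: "norm (symp v) = norm v"
  by (cases v) (simp add: symp_def norm_Pair add.commute)

lemma symp_measurable [measurable]: "symp \<in> borel_measurable borel"
  unfolding symp_def by (intro borel_measurable_continuous_onI continuous_intros)

text \<open>A trace formula, with the frame \<open>weyl l a @@ g\<close> in place of an orthonormal basis: the integral
  is a multiple of the trace of \<open>weyl l p * T\<close>, and it recovers the function from its transform.\<close>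

lemma weyl_fourier_recovery:
  fixes F :: "(real^'n) \<times> (real^'n) => complex" and g :: "(real^'n) L2"
  assumes l: "0 < l" and F: "integrable lborel F" "continuous_on UNIV F" "!!p. cmod (F p) <= K"
    and T: "!!ph ps. cinner (T @@ ph) ps = (\<integral>q. F q * cinner (weyl l q @@ ph) ps \<partial>lborel)"
    and int: "integrable lborel (%a. cinner (weyl l p @@ T @@ weyl l a @@ g) (weyl l a @@ g))"
  shows "(\<integral>a. cinner (weyl l p @@ T @@ weyl l a @@ g) (weyl l a @@ g) \<partial>lborel) =
    of_real ((2 * pi / l) ^ DIM((real^'n) \<times> (real^'n)) * (norm g)\<^sup>2) * F (- p)"
proof -
  let ?D = "DIM((real^'n) \<times> (real^'n))"
  let ?t = "%a. cinner (weyl l p @@ T @@ weyl l a @@ g) (weyl l a @@ g)"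
  \<comment> \<open>The substitution v = p + q merges the two Weyl operators. As a function of a,
    the integrand of the trace is then the Fourier transform of this function, and its value at 0 is
    F (- p) times the squared norm of \<open>g\<close>.\<close>
  define h where "h v = F (v - p) * cis (l / 2 * omega p v) * cinner (weyl l v @@ g) g" for v
  have Fc: "continuous_on UNIV (%v. F (v - p))" by (rule continuous_on_compose2[OF F(2)]) (auto intro!: continuous_intros)
  have hc: "continuous_on UNIV h"
    unfolding h_def omega_def by (intro continuous_intros Fc)
  have hm [measurable]: "h \<in> borel_measurable borel" using hc by (rule borel_measurable_continuous_onI)
  have cg: "cmod (cinner (weyl l v @@ g) g) <= (norm g)\<^sup>2" for v
    using cmod_cinner_le[of "weyl l v @@ g" g] by (simp add: norm_weyl power2_eq_square)
  have hF: "cmod (h v) <= cmod (F (v - p)) * (norm g)\<^sup>2" for v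
    unfolding h_def norm_mult using mult_left_mono[OF cg norm_ge_zero] by simp
  have hK: "cmod (h v) <= K * (norm g)\<^sup>2" for v
    using order.trans[OF hF mult_right_mono[OF F(3)]] by simp
  have "integrable (distr lborel borel ((+) (- p))) F" using F(1) by (simp only: lborel_distr_plus)
  then have "integrable lborel (%v. F (- p + v))"
    by (subst (asm) integrable_distr_eq) (use borel_measurable_continuous_onI[OF F(2)] in auto)
  then have "integrable lborel (%v. cmod (F (v - p)) * (norm g)\<^sup>2)" by (simp add: integrable_norm)
  then have hi: "integrable lborel h" by (rule Bochner_Integration.integrable_bound) (use hF in auto)
  have t: "?t a = (\<integral>v. h v * cis (a \<bullet> (l *\<^sub>R symp v)) \<partial>lborel)" for a
  proof -
    let ?u = "weyl l a @@ g"
    have w: "cinner (weyl l p @@ weyl l q @@ ?u) ?u = cis (l / 2 * omega p q) * (cis (l * omega (p + q) a) * cinner (weyl l (p + q) @@ g) g)" for q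
    proof -
      have "weyl l p @@ weyl l q @@ ?u = cis (l / 2 * omega p q) *\<^sub>C (weyl l (p + q) @@ ?u)"
        using weyl_times[of l p q] by (metis app_times app_cop)
      then show ?thesis by (simp add: cinner_simps weyl_conjugate)
    qed
    have mm: "(%q. F q * cinner (weyl l p @@ weyl l q @@ ?u) ?u) \<in> borel_measurable borel"
      by (intro borel_measurable_continuous_onI continuous_intros F(2) continuous_on_weyl)
    have "?t a = cinner (T @@ ?u) (adj (weyl l p) @@ ?u)" by (rule adj_right)
    also have "\<dots> = (\<integral>q. F q * cinner (weyl l p @@ weyl l q @@ ?u) ?u \<partial>lborel)"
      unfolding T adj_right[of "weyl l p"] ..
    also have "\<dots> = (\<integral>v. F (- p + 1 *\<^sub>R v) * cinner (weyl l p @@ weyl l (- p + 1 *\<^sub>R v) @@ ?u) ?u \<partial>lborel)"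
      using integral_lborel_affine[OF mm, of 1 "- p"] by simp
    also have "\<dots> = (\<integral>v. h v * cis (a \<bullet> (l *\<^sub>R symp v)) \<partial>lborel)"
    proof (rule Bochner_Integration.integral_cong[OF refl])
      fix v
      have "omega p (- p + 1 *\<^sub>R v) = omega p v" by (simp only: omega_linear omega_self) simp
      then show "F (- p + 1 *\<^sub>R v) * cinner (weyl l p @@ weyl l (- p + 1 *\<^sub>R v) @@ ?u) ?u = h v * cis (a \<bullet> (l *\<^sub>R symp v))"
        unfolding w by (simp add: h_def inner_symp ac_simps)
    qed
    finally show ?thesis .
  qed
  define d :: "nat => real" where "d k = 1 / (real k + 1)" for k
  have d: "0 < d k" for k by (simp add: d_def)
  have dl: "d \<longlonglongrightarrow> 0" unfolding d_def using LIMSEQ_inverse_real_of_nat by (simp add: inverse_eq_divide add.commute)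
  \<comment> \<open>The factor l^2 in the width cancels against the scaling of the phase, so that
    the dual Gaussian has variance d k.\<close>
  let ?w = "%k (a :: (real^'n) \<times> (real^'n)). exp (- (l\<^sup>2 * d k / 2) * (norm a)\<^sup>2)"
  have A: "(\<integral>a. ?w k a *\<^sub>R ?t a \<partial>lborel) = of_real ((sqrt (2 * pi) / l) ^ ?D) *
      ((1 / sqrt (d k)) ^ ?D *\<^sub>R (\<integral>v. exp (- (norm v)\<^sup>2 / (2 * d k)) *\<^sub>R h v \<partial>lborel))" for k
  proof -
    have e: "0 < l\<^sup>2 * d k" using l d[of k] by simp
    have ex: "exp (- (norm (l *\<^sub>R symp v))\<^sup>2 / (2 * (l\<^sup>2 * d k))) = exp (- (norm v)\<^sup>2 / (2 * d k))" for v :: "(real^'n) \<times> (real^'n)"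
      using l by (simp add: norm_symp power_mult_distrib)
    have s: "sqrt (2 * pi / (l\<^sup>2 * d k)) = (sqrt (2 * pi) / l) * (1 / sqrt (d k))"
      using l by (simp add: real_sqrt_divide real_sqrt_mult)
    have "(\<integral>a. ?w k a *\<^sub>R ?t a \<partial>lborel) = of_real (sqrt (2 * pi / (l\<^sup>2 * d k)) ^ ?D) *
        (\<integral>v. exp (- (norm (l *\<^sub>R symp v))\<^sup>2 / (2 * (l\<^sup>2 * d k))) *\<^sub>R h v \<partial>lborel)"
      unfolding t by (rule gauss_fourier_pairing[OF hi _ e]) measurable
    then show ?thesis unfolding ex s power_mult_distrib by (simp only: scaleR_conv_of_real of_real_mult mult.assoc)
  qed
  have "(%k. (1 / sqrt (d k)) ^ ?D *\<^sub>R (\<integral>v. exp (- (norm v)\<^sup>2 / (2 * d k)) *\<^sub>R h v \<partial>lborel)) \<longlonglongrightarrow> of_real (sqrt (2 * pi) ^ ?D) * h 0"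
    by (rule gauss_approximate_identity[OF hm hK _ d dl]) (use hc continuous_on_eq_continuous_at[OF open_UNIV, of h] in blast)
  then have "(%k. \<integral>a. ?w k a *\<^sub>R ?t a \<partial>lborel) \<longlonglongrightarrow> of_real ((sqrt (2 * pi) / l) ^ ?D) * (of_real (sqrt (2 * pi) ^ ?D) * h 0)"
    unfolding A by (rule tendsto_mult[OF tendsto_const])
  moreover have "(%k. \<integral>a. ?w k a *\<^sub>R ?t a \<partial>lborel) \<longlonglongrightarrow> (\<integral>a. ?t a \<partial>lborel)"
  proof (rule integral_dominated_convergence)
    have [measurable]: "?t \<in> borel_measurable borel" using borel_measurable_integrable[OF int] by simp
    show "?t \<in> borel_measurable lborel" "(%a. ?w k a *\<^sub>R ?t a) \<in> borel_measurable lborel" for k by measurable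
    show "integrable lborel (%a. cmod (?t a))" using int by (rule integrable_norm)
    show "AE a in lborel. norm (?w k a *\<^sub>R ?t a) <= cmod (?t a)" for k
      using d[of k] by (intro AE_I2) (simp add: mult_left_le_one_le)
    show "AE a in lborel. (%k. ?w k a *\<^sub>R ?t a) \<longlonglongrightarrow> ?t a"
    proof (rule AE_I2)
      fix a
      have "(%k. ?w k a *\<^sub>R ?t a) \<longlonglongrightarrow> exp (- (l\<^sup>2 * 0 / 2) * (norm a)\<^sup>2) *\<^sub>R ?t a" by (intro tendsto_intros dl) simp
      then show "(%k. ?w k a *\<^sub>R ?t a) \<longlonglongrightarrow> ?t a" by simp
    qed
  qed
  ultimately have "(\<integral>a. ?t a \<partial>lborel) = of_real ((sqrt (2 * pi) / l) ^ ?D) * (of_real (sqrt (2 * pi) ^ ?D) * h 0)"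
    using LIMSEQ_unique by blast
  also have "\<dots> = of_real ((sqrt (2 * pi) / l) ^ ?D * sqrt (2 * pi) ^ ?D) * h 0" by (simp only: of_real_mult mult.assoc)
  also have "(sqrt (2 * pi) / l) ^ ?D * sqrt (2 * pi) ^ ?D = (2 * pi / l) ^ ?D"
    unfolding power_mult_distrib[symmetric] by simp
  also have "h 0 = F (- p) * of_real ((norm g)\<^sup>2)"
    by (simp only: h_def weyl_zero app_one cinner_self) (simp add: omega_def)
  finally show ?thesis by (simp add: ac_simps)
qed

section \<open>Entire extensions\<close>

text \<open>Montel's theorem gives a locally uniformly convergent subsequence, whose limit must be
  the pointwise one.\<close>

lemma holomorphic_pointwise_limit:
  fixes f :: "nat => complex => complex"
  assumes S: "open S" and hol: "!!n. f n holomorphic_on S"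
    and bd: "!!K. compact K ==> K \<subseteq> S ==> EX B. ALL n. ALL z:K. cmod (f n z) <= B"
    and lim: "!!z. z \<in> S ==> (%n. f n z) \<longlonglongrightarrow> G z"
  shows "G holomorphic_on S"
proof -
  have loc: "EX B. ALL h:range f. ALL z:K. norm (h z) <= B" if K: "compact K" "K \<subseteq> S" for K
    using bd[OF K] by blast
  obtain g r where g: "g holomorphic_on S" "strict_mono (r :: nat => nat)" "!!x. x \<in> S ==> ((%n. f (r n) x) \<longlongrightarrow> g x) sequentially"
    by (rule Montel[of S "range f" f, OF S _ loc]) (use hol in auto)
  have "g z = G z" if z: "z \<in> S" for z
    using LIMSEQ_unique[OF LIMSEQ_subseq_LIMSEQ[OF lim[OF z] g(2)]] g(3)[OF z] by (simp add: comp_def)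
  then show ?thesis using g(1) holomorphic_transform by blast
qed

lemma entire_pointwise_limit:
  fixes f :: "nat => complex => complex"
  assumes hol: "!!n. f n holomorphic_on UNIV" and bd: "!!r. EX B. ALL n z. cmod z <= r --> cmod (f n z) <= B"
    and lim: "!!z. (%n. f n z) \<longlonglongrightarrow> G z"
  shows "G holomorphic_on UNIV"
proof (rule holomorphic_pointwise_limit[where f = f])
  show "open (UNIV :: complex set)" by simp
  show "f n holomorphic_on UNIV" for n by (rule hol)
  show "(%n. f n z) \<longlonglongrightarrow> G z" for z by (rule lim)
  fix K :: "complex set" assume "compact K"
  then obtain r where r: "!!z. z \<in> K ==> cmod z <= r" using compact_imp_bounded[of K] unfolding bounded_iff by metis
  obtain B where "!!n z. cmod z <= r ==> cmod (f n z) <= B" using bd[of r] by metis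
  then show "EX B. ALL n. ALL z:K. cmod (f n z) <= B" using r by metis
qed

context pvm
begin

text \<open>The spectral cut-off at \<open>k\<close> makes the exponential bounded for complex z,
  and its Taylor sums converge in operator norm. In the application \<Lambda> is a weighted frame
  integral of X T.\<close>

lemma holomorphic_functional_calculus:
  fixes \<Lambda> :: "'a bop => complex"
  assumes add: "!!X Y. \<Lambda> (X + Y) = \<Lambda> X + \<Lambda> Y" and cop: "!!c X. \<Lambda> (cop c * X) = c * \<Lambda> X"
    and bd: "!!X. cmod (\<Lambda> X) <= C * norm X" and C: "0 <= C"
  shows "(%z. \<Lambda> (fc (%s. of_real (indicator {- real k..real k} s) * exp (\<i> * z * of_real s)))) holomorphic_on UNIV"
proof -
  let ?I = "%s. complex_of_real (indicator {- real k..real k} s)"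
  define h where "h m z s = ?I s * (\<Sum>j<m. (\<i> * z * of_real s) ^ j / fact j)" for m z s
  define H where "H z s = ?I s * exp (\<i> * z * of_real s)" for z s
  have Ib: "cmod (?I s * x) <= exp (cmod z * real k)" if "cmod x <= exp (cmod z * \<bar>s\<bar>)" for s x z
  proof (cases "s \<in> {- real k..real k}")
    case True
    then have "cmod z * \<bar>s\<bar> <= cmod z * real k" by (intro mult_left_mono) auto
    then have "exp (cmod z * \<bar>s\<bar>) <= exp (cmod z * real k)" by simp
    then show ?thesis using True order.trans[OF that] by simp
  qed simp
  have le: "cmod (h m z s) <= exp (cmod z * real k)" for m z s unfolding h_def
  proof (rule Ib)
    have "cmod (\<Sum>j<m. (\<i> * z * of_real s) ^ j / fact j) <= (\<Sum>j<m. (cmod z * \<bar>s\<bar>) ^ j / fact j)"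
      by (rule order.trans[OF norm_sum]) (simp add: norm_divide norm_power norm_mult)
    also have "\<dots> <= exp (cmod z * \<bar>s\<bar>)"
      unfolding exp_def using sum_le_suminf[OF summable_exp_generic[of "cmod z * \<bar>s\<bar>"], of "{..<m}"]
      by (simp add: divide_inverse mult.commute scaleR_conv_of_real)
    finally show "cmod (\<Sum>j<m. (\<i> * z * of_real s) ^ j / fact j) <= exp (cmod z * \<bar>s\<bar>)" .
  qed
  have Hle: "cmod (H z s) <= exp (cmod z * real k)" for z s unfolding H_def
  proof (rule Ib)
    have "cmod (exp (\<i> * z * of_real s)) <= exp (cmod (\<i> * z * of_real s))" by (rule norm_exp)
    then show "cmod (exp (\<i> * z * of_real s)) <= exp (cmod z * \<bar>s\<bar>)" by (simp add: norm_mult)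
  qed
  have hb: "bounded_borel (h m z)" for m z by (rule bounded_borelI[OF _ le]) (simp add: h_def)
  have Hb: "bounded_borel (H z)" for z by (rule bounded_borelI[OF _ Hle]) (simp add: H_def)
  have "(%z. \<Lambda> (fc (H z))) holomorphic_on UNIV"
  proof (rule entire_pointwise_limit[where f = "%m z. \<Lambda> (fc (h m z))"])
    fix m
    show "(%z. \<Lambda> (fc (h m z))) holomorphic_on UNIV"
    proof (induction m)
      case 0
      have "h 0 z = (%s. 0 * of_real (indicator {} s))" for z by (rule ext) (simp add: h_def)
      then have "fc (h 0 z) = cop 0 * E {}" for z by (simp only: fc_cmult[OF bounded_borel_indicator] fc_indicator sets.empty_sets)
      then show ?case by simp
    next
      case (Suc m)
      \<comment> \<open>The Taylor term of degree m is the scalar (i z)^m / m! times the fixed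
        operator \<open>fc v\<close>, so \<Lambda> of a Taylor sum is a polynomial in z.\<close>
      define v where "v s = ?I s * (of_real s) ^ m" for s
      have v: "cmod (v s) <= real k ^ m" for s
        by (cases "s \<in> {- real k..real k}") (auto simp: v_def norm_power intro!: power_mono)
      have vb: "bounded_borel v" by (rule bounded_borelI[OF _ v]) (simp add: v_def)
      have "h (Suc m) z = (%s. h m z s + (\<i> * z) ^ m / fact m * v s)" for z
        by (auto simp: h_def v_def distrib_left power_mult_distrib)
      then have e: "fc (h (Suc m) z) = fc (h m z) + cop ((\<i> * z) ^ m / fact m) * fc v" for z
        by (simp only: fc_add[OF hb bounded_borel_cmult[OF vb]] fc_cmult[OF vb])
      show ?case unfolding e add cop by (intro holomorphic_intros Suc) simp
    qed
  next
    fix r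
    have "cmod (\<Lambda> (fc (h n z))) <= C * exp (r * real k)" if "cmod z <= r" for n z
    proof -
      have "norm (fc (h n z)) <= exp (cmod z * real k)" by (rule fc_norm_le[OF hb le])
      also have "\<dots> <= exp (r * real k)" using that by (simp add: mult_right_mono)
      finally show ?thesis using order.trans[OF bd mult_left_mono[OF _ C]] by blast
    qed
    then show "EX B. ALL n z. cmod z <= r --> cmod (\<Lambda> (fc (h n z))) <= B" by blast
  next
    fix z
    have "(%m. fc (h m z)) \<longlonglongrightarrow> fc (H z)"
    proof (rule LIM_zero_cancel, rule Lim_null_comparison)
      let ?e = "%m. exp (cmod z * real k) - (\<Sum>j<m. (cmod z * real k) ^ j / fact j)"
      have tail: "exp x - (\<Sum>j<m. x ^ j / fact j) = (\<Sum>j. x ^ (j + m) / fact (j + m))" for m and x :: "'z :: {banach,real_normed_field}"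
        unfolding exp_def using suminf_minus_initial_segment[OF summable_exp_generic[of x], of m]
        by (simp add: divide_inverse mult.commute scaleR_conv_of_real)
      have sm: "summable (%j. x ^ (j + m) / fact (j + m))" for m and x :: real
        using summable_ignore_initial_segment[OF summable_exp_generic[of x], of m] by (simp add: divide_inverse mult.commute)
      have "cmod (h m z s - H z s) <= ?e m" for m s
      proof (cases "s \<in> {- real k..real k}")
        case True
        have pw: "(cmod z * \<bar>s\<bar>) ^ j <= (cmod z * real k) ^ j" for j using True by (intro power_mono mult_left_mono) auto
        have "h m z s - H z s = - (\<Sum>j. (\<i> * z * of_real s) ^ (j + m) / fact (j + m))"
          using True unfolding tail[symmetric] by (simp add: h_def H_def)
        then have "cmod (h m z s - H z s) = cmod (\<Sum>j. (\<i> * z * of_real s) ^ (j + m) / fact (j + m))" by simp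
        also have "\<dots> <= (\<Sum>j. (cmod z * real k) ^ (j + m) / fact (j + m))"
          by (rule norm_suminf_le[OF _ sm]) (simp add: norm_divide norm_power norm_mult divide_right_mono pw)
        finally show ?thesis unfolding tail .
      next
        case False
        have "0 <= (\<Sum>j. (cmod z * real k) ^ (j + m) / fact (j + m))" by (intro suminf_nonneg sm) simp
        then show ?thesis unfolding tail using False by (simp add: h_def H_def)
      qed
      then have "norm (fc (h m z) - fc (H z)) <= ?e m" for m
        unfolding fc_diff[OF hb Hb, symmetric] by (intro fc_norm_le bounded_borel_diff hb Hb)
      then show "\<forall>\<^sub>F m in sequentially. norm (fc (h m z) - fc (H z)) <= ?e m" by simp
      have "(%m. \<Sum>j<m. (cmod z * real k) ^ j / fact j) \<longlonglongrightarrow> exp (cmod z * real k)"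
        unfolding exp_def using summable_LIMSEQ[OF summable_exp_generic[of "cmod z * real k"]] by (simp add: divide_inverse mult.commute)
      then show "?e \<longlonglongrightarrow> 0" using tendsto_diff[OF tendsto_const[of "exp (cmod z * real k)"]] by fastforce
    qed
    then have n: "(%m. C * norm (fc (h m z) - fc (H z))) \<longlonglongrightarrow> 0"
      using tendsto_mult[OF tendsto_const[of C] tendsto_norm_zero[OF LIM_zero]] by fastforce
    have df: "\<Lambda> X - \<Lambda> Y = \<Lambda> (X - Y)" for X Y using add[of "X - Y" Y] by simp
    show "(%m. \<Lambda> (fc (h m z))) \<longlonglongrightarrow> \<Lambda> (fc (H z))"
      by (rule LIM_zero_cancel, rule Lim_null_comparison[OF always_eventually n]) (simp add: df bd)
  qed
  then show ?thesis unfolding H_def .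
qed

text \<open>\<open>S y\<close> stands for exp (- y A) T and is described only through bounded
  functions of \<open>A\<close>, so no domains appear. Two regularisations keep everything
  holomorphic: a spectral cut-off \<open>k\<close> and the integrable weights \<open>w n\<close>.
  Both are removed by pointwise limits under a bound on discs that is uniform in \<open>k\<close>
  and \<open>n\<close>.\<close>

theorem entire_extension:
  fixes T :: "'a bop" and S :: "real => 'a bop" and g :: "'i => 'a L2"
  assumes S: "!!y k. bounded_borel k ==> bounded_borel (%s. k s * of_real (exp (- (y * s)))) ==>
      fc k * S y = fc (%s. k s * of_real (exp (- (y * s)))) * T"
    and frame: "!!ph. (\<integral>\<^sup>+a. ennreal ((cmod (cinner ph (g a)))\<^sup>2) \<partial>M) <= ennreal (c * (norm ph)\<^sup>2)"
    and meas: "!!ph. (%a. cinner ph (g a)) \<in> borel_measurable M"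
    and meas2: "!!T. (%a. cinner (T @@ g a) (g a)) \<in> borel_measurable M" and c: "0 <= c"
    and N: "!!y. trace_norm (graph_of (%x. S y @@ x)) <= ennreal (N y)" "!!y. 0 <= N y"
    and g: "!!a. norm (g a) <= K"
    and w: "!!n. integrable M (w n)" "!!n a. 0 <= w n a" "!!n a. w n a <= 1" "!!a. (%n::nat. w n a) \<longlonglongrightarrow> (1::real)"
  shows "EX G. G holomorphic_on UNIV & (ALL x y. cmod (G (Complex x y)) <= c * N y) &
    (ALL r. integrable M (%a. cinner (fc (%s. cis (r * s)) @@ T @@ g a) (g a)) &
      G (of_real r) = (\<integral>a. cinner (fc (%s. cis (r * s)) @@ T @@ g a) (g a) \<partial>M))"
proof -
  have K: "cmod (cinner (X @@ g a) (g a)) <= norm X * K\<^sup>2" for X a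
  proof -
    have "cmod (cinner (X @@ g a) (g a)) <= norm (X @@ g a) * norm (g a)" by (rule cmod_cinner_le)
    also have "\<dots> <= (norm X * norm (g a)) * norm (g a)" by (intro mult_right_mono app_norm) simp
    also have "\<dots> <= (norm X * K) * K"
      using g[of a] order.trans[OF norm_ge_zero g[of a]] by (intro mult_mono mult_left_mono) auto
    finally show ?thesis by (simp add: power2_eq_square mult.assoc)
  qed
  \<comment> \<open>This is exp (i z A) T, split into its unitary factor and the operator
    \<open>S\<close> at height Im z.\<close>
  define R where "R z = fc (%s. cis (Re z * s)) * S (Im z)" for z
  define G where "G z = (\<integral>a. cinner (R z @@ g a) (g a) \<partial>M)" for z
  have bound: "(\<integral>\<^sup>+a. ennreal (cmod (cinner ((fc b * S y) @@ g a) (g a))) \<partial>M) <= ennreal (c * N y)"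
    if b: "bounded_borel b" "!!s. cmod (b s) <= 1" for b y
  proof -
    have "(\<integral>\<^sup>+a. ennreal (cmod (cinner ((fc b * S y) @@ g a) (g a))) \<partial>M) <= ennreal (c * norm (fc b) * N y)"
      unfolding app_times by (rule frame_trace_bound[OF frame meas meas2 c N])
    also have "\<dots> <= ennreal (c * 1 * N y)"
      using fc_norm_le[OF b] c N(2)[of y] by (intro ennreal_leI mult_right_mono mult_left_mono) auto
    finally show ?thesis by simp
  qed
  have boundR: "(\<integral>\<^sup>+a. ennreal (cmod (cinner (R z @@ g a) (g a))) \<partial>M) <= ennreal (c * N (Im z))" for z
    unfolding R_def by (rule bound[OF bounded_borel_cis]) simp
  have intR: "integrable M (%a. cinner (R z @@ g a) (g a))" for z
    using boundR[of z] by (intro integrableI_bounded meas2) (auto intro: le_less_trans)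
  have GN: "cmod (G z) <= c * N (Im z)" for z
  proof -
    have "ennreal (cmod (G z)) <= ennreal (c * N (Im z))"
      unfolding G_def by (rule order.trans[OF integral_norm_bound_ennreal[OF intR] boundR])
    then show ?thesis using c N(2) by (subst (asm) ennreal_le_iff) auto
  qed
  define I :: "nat => real => complex" where "I k s = of_real (indicator {- real k..real k} s)" for k s
  define h where "h k z s = I k s * exp (\<i> * z * of_real s)" for k z s
  have Ib: "bounded_borel (I k)" for k unfolding I_def by (rule bounded_borel_indicator) simp
  have hz: "h k z s = (I k s * cis (Re z * s)) * of_real (exp (- (Im z * s)))" for k z s
  proof -
    have "exp (\<i> * z * of_real s) = cis (Re z * s) * of_real (exp (- (Im z * s)))"
      unfolding exp_eq_polar[of "\<i> * z * of_real s"] by simp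
    then show ?thesis by (simp add: h_def mult.assoc)
  qed
  have hle: "cmod (h k z s) <= exp (\<bar>Im z\<bar> * real k)" for k z s
  proof (cases "s \<in> {- real k..real k}")
    case True
    then have "- (Im z * s) <= \<bar>Im z\<bar> * real k"
      using abs_le_D2[of "Im z * s"] mult_left_mono[of "\<bar>s\<bar>" "real k" "\<bar>Im z\<bar>"] by (auto simp: abs_mult)
    then show ?thesis using True by (simp add: hz I_def norm_mult)
  qed (simp add: h_def I_def)
  have hm [measurable]: "h k z \<in> borel_measurable borel" for k z unfolding h_def I_def by measurable
  have hb: "bounded_borel (h k z)" for k z by (rule bounded_borelI[OF hm hle])
  have hR: "fc (h k z) * T = fc (I k) * R z" for k z
  proof -
    have b: "bounded_borel (%s. I k s * cis (Re z * s))" by (intro bounded_borel_mult Ib bounded_borel_cis)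
    have "fc (I k) * R z = fc (%s. I k s * cis (Re z * s)) * S (Im z)"
      unfolding R_def mult.assoc[symmetric] fc_mult[OF Ib bounded_borel_cis] ..
    also have "\<dots> = fc (h k z) * T"
      using S[OF b, of "Im z"] hb[of k z] unfolding hz[abs_def] by simp
    finally show ?thesis ..
  qed
  have hlim: "(%k. (fc (h k z) * T) @@ x) \<longlonglongrightarrow> R z @@ x" for z x
  proof -
    have "(%k. fc (I k) @@ (R z @@ x)) \<longlonglongrightarrow> fc (%s. 1) @@ (R z @@ x)"
    proof (rule fc_dominated_convergence[OF Ib bounded_borel_const])
      show "cmod (I n s) <= 1" for n s by (simp add: I_def indicator_def)
      fix s
      obtain m :: nat where m: "\<bar>s\<bar> <= real m" using real_arch_simple by blast
      then have "\<forall>\<^sub>F n in sequentially. I n s = 1" unfolding eventually_sequentially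
        by (intro exI[of _ m]) (auto simp: I_def indicator_def)
      then show "(%n. I n s) \<longlonglongrightarrow> 1" by (rule tendsto_eventually)
    qed
    then show ?thesis unfolding hR app_times fc_one app_one .
  qed
  \<comment> \<open>The integrable weight makes the frame integral a bounded functional of every
    bounded X; without it only the trace norm bound gives convergence.\<close>
  define \<Lambda> where "\<Lambda> n X = (\<integral>a. w n a *\<^sub>R cinner ((X * T) @@ g a) (g a) \<partial>M)" for n X
  have wi: "integrable M (%a. w n a *\<^sub>R cinner (X @@ g a) (g a))" for n X
  proof (rule Bochner_Integration.integrable_bound[OF integrable_mult_left[OF w(1)[of n], of "norm X * K\<^sup>2"]])
    show "(%a. w n a *\<^sub>R cinner (X @@ g a) (g a)) \<in> borel_measurable M"
      using borel_measurable_integrable[OF w(1)] meas2 by (intro borel_measurable_scaleR)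
    show "AE a in M. norm (w n a *\<^sub>R cinner (X @@ g a) (g a)) <= norm (w n a * (norm X * K\<^sup>2))"
      using w(2) K by (intro AE_I2) (simp add: mult_left_mono)
  qed
  have hol1: "(%z. \<Lambda> n (fc (h k z))) holomorphic_on UNIV" for n k unfolding h_def I_def
  proof (rule holomorphic_functional_calculus[where C = "(\<integral>a. w n a \<partial>M) * (norm T * K\<^sup>2)"])
    show "\<Lambda> n (X + Y) = \<Lambda> n X + \<Lambda> n Y" for X Y
      unfolding \<Lambda>_def Bochner_Integration.integral_add[OF wi wi, symmetric]
      by (simp add: distrib_right cinner_simps scaleR_add_right)
    show "\<Lambda> n (cop c * X) = c * \<Lambda> n X" for c X
      unfolding \<Lambda>_def integral_mult_right_zero[symmetric] by (simp add: cinner_simps)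
    have W: "0 <= (\<integral>a. w n a \<partial>M)" by (intro Bochner_Integration.integral_nonneg w)
    then show "0 <= (\<integral>a. w n a \<partial>M) * (norm T * K\<^sup>2)" by simp
    fix X
    have "cmod (\<Lambda> n X) <= (\<integral>a. w n a * (norm (X * T) * K\<^sup>2) \<partial>M)" unfolding \<Lambda>_def
      by (rule order.trans[OF integral_norm_bound integral_mono[OF integrable_norm[OF wi] integrable_mult_left[OF w(1)]]])
         (use w(2) K in \<open>simp add: mult_left_mono del: app_times\<close>)
    also have "\<dots> = (\<integral>a. w n a \<partial>M) * (norm (X * T) * K\<^sup>2)" by simp
    also have "\<dots> <= (\<integral>a. w n a \<partial>M) * ((norm X * norm T) * K\<^sup>2)"
      by (intro mult_left_mono mult_right_mono norm_mult_ineq W) simp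
    finally show "cmod (\<Lambda> n X) <= (\<integral>a. w n a \<partial>M) * (norm T * K\<^sup>2) * norm X" by (simp add: ac_simps)
  qed
  have unif: "cmod (\<Lambda> n (fc (h k z))) <= c * N r + c * N (- r)" if r: "cmod z <= r" for n k z r
  proof -
    \<comment> \<open>Since \<open>N\<close> is an arbitrary function of y, a disc cannot be bounded
      height by height. On |Im z| <= r the exponential is dominated by the sum of those at r and -
      r, so the cut-off operator is a contraction \<open>fc b\<close> applied to \<open>S r\<close>
      and \<open>S (- r)\<close>.\<close>
    define d where "d s = exp (- (r * s)) + exp (- ((- r) * s))" for s
    have d0: "0 < d s" for s unfolding d_def by (intro add_pos_pos exp_gt_zero)
    define b where "b s = h k z s / of_real (d s)" for s
    have bd: "b s * of_real (d s) = h k z s" for s using d0[of s] by (simp add: b_def)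
    have bm: "b \<in> borel_measurable borel" unfolding b_def d_def by measurable
    have b1: "cmod (b s) <= 1" for s
    proof -
      have y: "\<bar>Im z\<bar> <= r" using abs_Im_le_cmod[of z] r by simp
      have "exp (- (Im z * s)) <= d s"
      proof (cases "0 <= s")
        case True
        then have "(- Im z) * s <= r * s" using y by (intro mult_right_mono) auto
        then have "exp (- (Im z * s)) <= exp (- ((- r) * s))" by simp
        then show ?thesis using exp_gt_zero[of "- (r * s)"] unfolding d_def by linarith
      next
        case False
        then have "r * s <= Im z * s" using y by (intro mult_right_mono_neg) auto
        then have "exp (- (Im z * s)) <= exp (- (r * s))" by simp
        then show ?thesis using exp_gt_zero[of "- ((- r) * s)"] unfolding d_def by linarith
      qed
      moreover have "cmod (h k z s) <= exp (- (Im z * s))" by (simp add: hz I_def norm_mult indicator_def)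
      ultimately show ?thesis using d0[of s] by (simp add: b_def norm_divide)
    qed
    have bb: "bounded_borel b" by (rule bounded_borelI[OF bm b1])
    have be: "bounded_borel (%s. b s * of_real (exp (- (y * s))))" if y: "y = r | y = - r" for y
    proof (rule bounded_borelI)
      show "(%s. b s * of_real (exp (- (y * s)))) \<in> borel_measurable borel" using bm by measurable
      fix s
      have "exp (- (y * s)) <= d s" using y unfolding d_def by auto
      then have "cmod (b s * of_real (exp (- (y * s)))) <= cmod (b s * of_real (d s))"
        using d0[of s] unfolding norm_mult by (intro mult_left_mono) auto
      also have "\<dots> <= exp (\<bar>Im z\<bar> * real k)" unfolding bd by (rule hle)
      finally show "cmod (b s * of_real (exp (- (y * s)))) <= exp (\<bar>Im z\<bar> * real k)" .
    qed
    have "h k z = (%s. b s * of_real (exp (- (r * s))) + b s * of_real (exp (- ((- r) * s))))"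
      unfolding distrib_left[symmetric] of_real_add[symmetric] d_def[symmetric] bd ..
    then have "fc (h k z) = fc (%s. b s * of_real (exp (- (r * s)))) + fc (%s. b s * of_real (exp (- ((- r) * s))))"
      by (simp only: fc_add[OF be[of r, OF disjI1[OF refl]] be[of "- r", OF disjI2[OF refl]]])
    then have X: "fc (h k z) * T = fc b * S r + fc b * S (- r)"
      by (simp only: S[OF bb be[of r, OF disjI1[OF refl]]] S[OF bb be[of "- r", OF disjI2[OF refl]]] distrib_right)
    have "ennreal (cmod (\<Lambda> n (fc (h k z)))) <= (\<integral>\<^sup>+a. ennreal (norm (w n a *\<^sub>R cinner ((fc (h k z) * T) @@ g a) (g a))) \<partial>M)"
      unfolding \<Lambda>_def by (rule integral_norm_bound_ennreal[OF wi])
    also have "\<dots> <= (\<integral>\<^sup>+a. ennreal (cmod (cinner ((fc b * S r) @@ g a) (g a))) + ennreal (cmod (cinner ((fc b * S (- r)) @@ g a) (g a))) \<partial>M)"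
    proof (rule nn_integral_mono)
      fix a
      have "norm (w n a *\<^sub>R cinner ((fc (h k z) * T) @@ g a) (g a)) <= cmod (cinner ((fc (h k z) * T) @@ g a) (g a))"
        using w(2,3)[of n a] by (simp add: mult_left_le_one_le)
      also have "\<dots> <= cmod (cinner ((fc b * S r) @@ g a) (g a)) + cmod (cinner ((fc b * S (- r)) @@ g a) (g a))"
        unfolding X app_add_left cinner_add_left by (rule norm_triangle_ineq)
      finally show "ennreal (norm (w n a *\<^sub>R cinner ((fc (h k z) * T) @@ g a) (g a))) <=
          ennreal (cmod (cinner ((fc b * S r) @@ g a) (g a))) + ennreal (cmod (cinner ((fc b * S (- r)) @@ g a) (g a)))"
        by (simp only: ennreal_plus[symmetric] norm_ge_zero ennreal_leI)
    qed
    also have "\<dots> = (\<integral>\<^sup>+a. ennreal (cmod (cinner ((fc b * S r) @@ g a) (g a))) \<partial>M) + (\<integral>\<^sup>+a. ennreal (cmod (cinner ((fc b * S (- r)) @@ g a) (g a))) \<partial>M)"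
      by (intro nn_integral_add measurable_compose[OF meas2]) measurable
    also have "\<dots> <= ennreal (c * N r) + ennreal (c * N (- r))" by (intro add_mono bound bb b1)
    finally show ?thesis using c N(2) by (subst (asm) ennreal_plus[symmetric]) (auto simp: ennreal_le_iff simp del: ennreal_plus)
  qed
  define H where "H n z = (\<integral>a. w n a *\<^sub>R cinner (R z @@ g a) (g a) \<partial>M)" for n z
  have limk: "(%k. \<Lambda> n (fc (h k z))) \<longlonglongrightarrow> H n z" for n z
  proof -
    have nk: "norm (fc (h k z) * T) <= norm (R z)" for k
    proof -
      have "norm (fc (I k)) <= 1" by (rule fc_norm_le[OF Ib]) (simp add: I_def indicator_def)
      then show ?thesis unfolding hR
        using order.trans[OF norm_mult_ineq mult_right_mono[of "norm (fc (I k))" 1 "norm (R z)"]] by simp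
    qed
    show ?thesis unfolding \<Lambda>_def H_def
    proof (rule integral_dominated_convergence)
      show "integrable M (%a. w n a * (norm (R z) * K\<^sup>2))" by (rule integrable_mult_left[OF w(1)])
      show "(%a. w n a *\<^sub>R cinner (R z @@ g a) (g a)) \<in> borel_measurable M"
        "(%a. w n a *\<^sub>R cinner ((fc (h k z) * T) @@ g a) (g a)) \<in> borel_measurable M" for k
        using borel_measurable_integrable[OF wi] by blast+
      show "AE a in M. (%k. w n a *\<^sub>R cinner ((fc (h k z) * T) @@ g a) (g a)) \<longlonglongrightarrow> w n a *\<^sub>R cinner (R z @@ g a) (g a)"
        by (intro AE_I2 tendsto_scaleR tendsto_const tendsto_cinner hlim)
      show "AE a in M. norm (w n a *\<^sub>R cinner ((fc (h k z) * T) @@ g a) (g a)) <= w n a * (norm (R z) * K\<^sup>2)" for k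
      proof (rule AE_I2)
        fix a
        have "cmod (cinner ((fc (h k z) * T) @@ g a) (g a)) <= norm (R z) * K\<^sup>2"
          by (rule order.trans[OF K mult_right_mono[OF nk]]) simp
        then show "norm (w n a *\<^sub>R cinner ((fc (h k z) * T) @@ g a) (g a)) <= w n a * (norm (R z) * K\<^sup>2)"
          using w(2)[of n a] by (simp add: mult_left_mono del: app_times)
      qed
    qed
  qed
  have bdH: "cmod (H n z) <= c * N r + c * N (- r)" if "cmod z <= r" for n z r
    by (rule tendsto_upperbound[OF tendsto_norm[OF limk] always_eventually trivial_limit_sequentially]) (use unif[OF that] in blast)
  have Hhol: "H n holomorphic_on UNIV" for n
    by (rule entire_pointwise_limit[OF hol1 _ limk]) (use unif in blast)
  have limn: "(%n. H n z) \<longlonglongrightarrow> G z" for z unfolding H_def G_def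
  proof (rule integral_dominated_convergence)
    show "integrable M (%a. cmod (cinner (R z @@ g a) (g a)))" by (rule integrable_norm[OF intR])
    show "(%a. cinner (R z @@ g a) (g a)) \<in> borel_measurable M" by (rule meas2)
    show "(%a. w n a *\<^sub>R cinner (R z @@ g a) (g a)) \<in> borel_measurable M" for n
      using borel_measurable_integrable[OF wi] by blast
    show "AE a in M. norm (w n a *\<^sub>R cinner (R z @@ g a) (g a)) <= cmod (cinner (R z @@ g a) (g a))" for n
      using w(2,3) by (intro AE_I2) (simp add: mult_left_le_one_le)
    show "AE a in M. (%n. w n a *\<^sub>R cinner (R z @@ g a) (g a)) \<longlonglongrightarrow> cinner (R z @@ g a) (g a)"
      using tendsto_scaleR[OF w(4) tendsto_const] by (intro AE_I2) force
  qed
  have Gh: "G holomorphic_on UNIV"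
    by (rule entire_pointwise_limit[OF Hhol _ limn]) (use bdH in blast)
  have "S 0 = T" using S[OF bounded_borel_const[of 1], of 0] bounded_borel_const[of 1] by (simp add: fc_one)
  then have Rr: "R (of_real r) @@ x = fc (%s. cis (r * s)) @@ T @@ x" for r x by (simp add: R_def)
  show ?thesis
  proof (intro exI[of _ G] conjI allI Gh)
    show "cmod (G (Complex x y)) <= c * N y" for x y using GN[of "Complex x y"] by simp
    show "integrable M (%a. cinner (fc (%s. cis (r * s)) @@ T @@ g a) (g a))" for r
      using intR[of "of_real r"] unfolding Rr .
    show "G (of_real r) = (\<integral>a. cinner (fc (%s. cis (r * s)) @@ T @@ g a) (g a) \<partial>M)" for r
      unfolding G_def Rr ..
  qed
qed

end

text \<open>\<open>rep_complex\<close> uses for each point y q the generator of that direction,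
  while the extension lives on the spectral measure of q alone. The hypothesis says that the scalar
  measures have the same characteristic functions after rescaling; they are compared by Levy's
  uniqueness theorem, for unit vectors so that they are probability measures.\<close>

lemma pvm_fc_scale:
  assumes P: "pvm P" and Q: "pvm Q" and eq: "!!r. pvm.fc Q (%s. cis (r * s)) = pvm.fc P (%s. cis (r * (y * s)))"
    and h: "bounded_borel h"
  shows "pvm.fc Q h = pvm.fc P (%s. h (y * s))"
proof -
  interpret P: pvm P by fact
  interpret Q: pvm Q by fact
  have [measurable]: "h \<in> borel_measurable borel" using h by (simp add: bounded_borel_def)
  have hb: "bounded_borel (%s. h (y * s))" using h by (auto simp: bounded_borel_def)
  have unit: "cinner (Q.fc h @@ u) u = cinner (P.fc (%s. h (y * s)) @@ u) u" if u: "norm u = 1" for u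
  proof -
    let ?D = "distr (P.\<mu> u) borel (%s. y * s)"
    interpret p: prob_space "P.\<mu> u" using P.E_UNIV u by (intro prob_spaceI) (simp add: P.emeasure_mu)
    interpret q: prob_space "Q.\<mu> u" using Q.E_UNIV u by (intro prob_spaceI) (simp add: Q.emeasure_mu)
    have m: "(%s. y * s) \<in> P.\<mu> u \<rightarrow>\<^sub>M borel" by measurable
    have dist: "real_distribution (Q.\<mu> u)" "real_distribution ?D"
      using p.prob_space_distr[OF m] q.prob_space_axioms by (auto simp: real_distribution_def real_distribution_axioms_def)
    have "char (Q.\<mu> u) t = char ?D t" for t
    proof -
      have "char (Q.\<mu> u) t = (\<integral>s. cis (t * s) \<partial>Q.\<mu> u)" by (simp add: char_def cis_conv_exp)
      also have "\<dots> = (\<integral>s. cis (t * (y * s)) \<partial>P.\<mu> u)"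
        using Q.fc_diag[OF bounded_borel_cis, of t u] P.fc_diag[OF bounded_borel_cis, of "t * y" u] eq[of t] by (simp add: mult.assoc)
      also have "\<dots> = char ?D t" unfolding char_def by (subst integral_distr[OF m]) (simp_all add: cis_conv_exp)
      finally show ?thesis .
    qed
    then have "Q.\<mu> u = ?D" by (intro Levy_uniqueness dist ext)
    then have "(\<integral>s. h s \<partial>Q.\<mu> u) = (\<integral>s. h (y * s) \<partial>P.\<mu> u)" by (simp add: integral_distr[OF m])
    then show ?thesis by (simp add: Q.fc_diag[OF h] P.fc_diag[OF hb])
  qed
  show ?thesis
  proof (rule bop_eq_diag)
    fix x
    show "cinner (Q.fc h @@ x) x = cinner (P.fc (%s. h (y * s)) @@ x) x"
    proof (cases "x = 0")
      case False
      define u where "u = (1 / norm x) *\<^sub>R x"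
      have u: "norm u = 1" "x = norm x *\<^sub>R u" using False by (auto simp: u_def)
      show ?thesis by (subst (1 2 3 4) u(2)) (simp add: app_scaleR cinner_simps unit[OF u(1)])
    qed simp
  qed
qed

lemma rep_complex_imaginary:
  fixes q :: "(real^'n) \<times> (real^'n)"
  shows "rep_complex l (cvec 0 q) = spectral_calculus (generator l q) (%s. of_real (exp (- s)))"
proof -
  have re: "re_vec (cvec 0 q) = (0, 0)" and im: "im_vec (cvec 0 q) = q"
    by (cases q; simp add: re_vec_def im_vec_def cvec_def vec_eq_iff)+
  have "graph_of (schroedinger (norm l) (0, 0 :: real^'n)) = graph_of (%x. x)"
    by (simp add: graph_of_def schroedinger_zero[unfolded zero_prod_def])
  then have c: "op_comp (graph_of (schroedinger (norm l) (0, 0 :: real^'n))) X = X" for X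
    by (auto simp: op_comp_def graph_of_def)
  show ?thesis unfolding rep_complex_def re im by (cases q) (simp add: c op_scale_def)
qed

text \<open>Membership in the graph of exp (- A) for the direction y q is transferred to bounded
  functions and rescaled to the direction q, which gives the relation required of \<open>S\<close>.
  The frame formula identifies the real values.\<close>

theorem fourier_entire_extension:
  fixes l :: "real^'m" and q :: "(real^'n) \<times> (real^'n)" and F :: "(real^'n) \<times> (real^'n) => complex"
  assumes l: "l ~= 0" and F: "integrable lborel F" "continuous_on UNIV F" "!!p. cmod (F p) <= K"
    and T: "!!ph ps. cinner (T @@ ph) ps = (\<integral>p. F p * cinner (weyl (norm l) p @@ ph) ps \<partial>lborel)"
    and tr: "!!y::real. trace_class (op_comp (rep_complex l (cvec 0 (y *\<^sub>R q))) (graph_of (%x. T @@ x)))"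
  shows "EX G C. G holomorphic_on UNIV & (ALL r. G (of_real r) = F (- (r *\<^sub>R q))) & 0 <= C &
    (ALL x y. ennreal (cmod (G (Complex x y))) <=
       ennreal C * trace_norm (op_comp (rep_complex l (cvec 0 (y *\<^sub>R q))) (graph_of (%x. T @@ x))))"
proof -
  let ?l = "norm l" and ?D = "DIM((real^'n) \<times> (real^'n))"
  have l0: "0 < ?l" using l by simp
  let ?P = "%q. spectral_measure (generator l q)"
  have pv: "pvm (?P q)" for q :: "(real^'n) \<times> (real^'n)" by (rule spectral_theorem(1)[OF generator(1)])
  interpret P: pvm "?P q" by (rule pv)
  have fcw: "pvm.fc (?P q) (%s. cis (r * s)) = weyl ?l (r *\<^sub>R q)" for r and q :: "(real^'n) \<times> (real^'n)"
  proof -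
    interpret Q: pvm "?P q" by (rule pv)
    have "graph_of (schroedinger ?l (r *\<^sub>R q)) = graph_of (%x. Q.fc (%s. cis (r * s)) @@ x)"
      unfolding generator(2) spectral_calculus_def by (rule Q.spectral_integral_bounded[OF bounded_borel_cis])
    then show ?thesis unfolding graph_of_inject by (intro bop_eqI) (simp add: weyl_app)
  qed
  let ?R = "%y. op_comp (rep_complex l (cvec 0 (y *\<^sub>R q))) (graph_of (%x. T @@ x))"
  have "EX S. ?R y = graph_of (%x. S @@ x)" for y
    using tr[of y] bounded_oper_bop unfolding trace_class_def by blast
  then obtain S where S: "!!y. ?R y = graph_of (%x. S y @@ x)" by metis
  have mem: "(T @@ ph, S y @@ ph) \<in> spectral_integral (?P (y *\<^sub>R q)) (%s. of_real (exp (- s)))" for y ph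
  proof -
    have "(ph, S y @@ ph) \<in> ?R y" unfolding S by (auto simp: graph_of_def)
    then show ?thesis unfolding rep_complex_imaginary spectral_calculus_def op_comp_def graph_of_def by auto
  qed
  have fcS: "pvm.fc (?P (y *\<^sub>R q)) k * S y = pvm.fc (?P (y *\<^sub>R q)) (%s. k s * of_real (exp (- s))) * T"
    if k: "bounded_borel k" "bounded_borel (%s. k s * of_real (exp (- s)))" for y k
    by (rule bop_eqI) (simp add: pvm.spectral_integral_fc[OF pv _ mem k])
  have scale: "pvm.fc (?P (y *\<^sub>R q)) h = P.fc (%s. h (y * s))" if "bounded_borel h" for y h
    by (rule pvm_fc_scale[OF pv pv _ that]) (simp add: fcw mult.assoc[symmetric])
  have SP: "P.fc k * S y = P.fc (%s. k s * of_real (exp (- (y * s)))) * T"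
    if k: "bounded_borel k" "bounded_borel (%s. k s * of_real (exp (- (y * s))))" for y k
  proof (cases "y = 0")
    case True
    \<comment> \<open>For y = 0 rescaled functions are constants, namely the value at 0. The
      indicator serves as a function with value 1 at 0 whose product with the exponential is
      bounded, and the relation becomes \<open>S y = T\<close>.\<close>
    let ?I = "%s. complex_of_real (indicator {0..1} s)"
    have I: "bounded_borel ?I" by (rule bounded_borel_indicator) simp
    have "bounded_borel (%s. ?I s * of_real (exp (- s)))"
      by (rule bounded_borelI[of _ 1]) (auto simp: norm_mult indicator_def)
    from fcS[OF I this, of y] have "S y = T"
      unfolding scale[OF I] scale[OF \<open>bounded_borel (%s. ?I s * of_real (exp (- s)))\<close>] using True by (simp add: P.fc_one)
    then show ?thesis using True by simp
  next
    case False
    \<comment> \<open>Division by y undoes the rescaling, so the relation for the direction y q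
      becomes the one for \<open>k\<close>.\<close>
    let ?k = "%s. k (s / y)"
    have b1: "bounded_borel ?k" using k(1) by (auto simp: bounded_borel_def)
    let ?j = "%s. k s * of_real (exp (- (y * s)))"
    obtain B where j: "?j \<in> borel_measurable borel" and B: "!!s. cmod (?j s) <= B" using k(2) unfolding bounded_borel_def by blast
    have "bounded_borel (%s. ?j (s / y))" by (rule bounded_borelI[OF measurable_compose[OF _ j] B]) measurable
    then have b2: "bounded_borel (%s. ?k s * of_real (exp (- s)))" using False by simp
    show ?thesis using fcS[OF b1 b2, of y] False unfolding scale[OF b1] scale[OF b2] by simp
  qed
  \<comment> \<open>The window of the frame, normalised to norm 1 so that it leaves the recovery
    formula.\<close>
  define g :: "(real^'n) L2" where "g = abs_L2 (%x. of_real (indicator (cbox 0 One) x))"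
  have "(norm g)\<^sup>2 = (LINT x|lborel. (cmod (of_real (indicator (cbox 0 One) (x::real^'n))))\<^sup>2)"
    unfolding g_def by (rule norm_abs_L2[OF square_integrable_indicator_cbox])
  also have "(%x::real^'n. (cmod (of_real (indicator (cbox 0 One) x)))\<^sup>2) = indicator (cbox 0 One)" by (auto simp: indicator_def)
  finally have g1: "(norm g)\<^sup>2 = 1" by (simp add: content_unit)
  define c where "c = (2 * pi / ?l) ^ CARD('n) * (norm g)\<^sup>2"
  define N where "N y = enn2real (trace_norm (?R y))" for y
  have N: "trace_norm (?R y) = ennreal (N y)" for y
    using tr[of y] unfolding N_def trace_class_def by (auto simp: ennreal_enn2real_if)
  define w where "w n a = exp (- ((1 / (real n + 1)) / 2) * (norm a)\<^sup>2)" for n and a :: "(real^'n) \<times> (real^'n)"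
  have "EX G. G holomorphic_on UNIV & (ALL x y. cmod (G (Complex x y)) <= c * N y) &
    (ALL r. integrable lborel (%a. cinner (P.fc (%s. cis (r * s)) @@ T @@ weyl ?l a @@ g) (weyl ?l a @@ g)) &
      G (of_real r) = (\<integral>a. cinner (P.fc (%s. cis (r * s)) @@ T @@ weyl ?l a @@ g) (weyl ?l a @@ g) \<partial>lborel))"
  proof (rule P.entire_extension[where S = S and w = w and K = "norm g"])
    show "(\<integral>\<^sup>+a. ennreal ((cmod (cinner ph (weyl ?l a @@ g)))\<^sup>2) \<partial>lborel) <= ennreal (c * (norm ph)\<^sup>2)" for ph
      unfolding c_def by (rule weyl_frame[OF l0])
    show "0 <= c" using l0 by (simp add: c_def)
    show "trace_norm (graph_of (%x. S y @@ x)) <= ennreal (N y)" for y unfolding N[symmetric] S ..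
    show "0 <= N y" for y by (simp add: N_def)
    show "norm (weyl ?l a @@ g) <= norm g" for a by (simp add: norm_weyl)
    show "integrable lborel (w n)" for n unfolding w_def by (rule gauss_integral) simp
    show "0 <= w n a" "w n a <= 1" for n a by (simp_all add: w_def)
    show "(%n. w n a) \<longlonglongrightarrow> 1" for a
    proof -
      have "(%n. 1 / (real n + 1)) \<longlonglongrightarrow> 0" using LIMSEQ_inverse_real_of_nat by (simp add: inverse_eq_divide add.commute)
      then have "(%n. w n a) \<longlonglongrightarrow> exp (- (0 / 2) * (norm a)\<^sup>2)" unfolding w_def by (intro tendsto_intros) simp_all
      then show ?thesis by simp
    qed
  qed (use SP in \<open>simp_all\<close>)
  then obtain G where G: "G holomorphic_on UNIV" "!!x y. cmod (G (Complex x y)) <= c * N y"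
    "!!r. integrable lborel (%a. cinner (P.fc (%s. cis (r * s)) @@ T @@ weyl ?l a @@ g) (weyl ?l a @@ g))"
    "!!r. G (of_real r) = (\<integral>a. cinner (P.fc (%s. cis (r * s)) @@ T @@ weyl ?l a @@ g) (weyl ?l a @@ g) \<partial>lborel)" by blast
  \<comment> \<open>The frame integral returns \<open>F\<close> with this factor, whose exponent is
    twice that of the frame bound \<open>c\<close>; dividing by it normalises the extension.\<close>
  define C0 where "C0 = (2 * pi / ?l) ^ ?D"
  have C0: "0 < C0" unfolding C0_def using l0 by simp
  have GF: "G (of_real r) = of_real C0 * F (- (r *\<^sub>R q))" for r
    using weyl_fourier_recovery[OF l0 F T G(3)[of r, unfolded fcw]] unfolding G(4) fcw C0_def g1 by simp
  have c0: "0 <= c" using l0 by (simp add: c_def)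
  show ?thesis
  proof (intro exI[of _ "%z. G z / of_real C0"] exI[of _ "c / C0"] conjI allI)
    show "(%z. G z / of_real C0) holomorphic_on UNIV" using G(1) C0 by (intro holomorphic_intros) auto
    show "G (of_real r) / of_real C0 = F (- (r *\<^sub>R q))" for r using C0 by (simp add: GF)
    show "0 <= c / C0" using c0 C0 by simp
    fix x y
    have "cmod (G (Complex x y) / of_real C0) <= c / C0 * N y"
      using G(2)[of x y] C0 by (simp add: norm_divide divide_right_mono)
    then show "ennreal (cmod (G (Complex x y) / of_real C0)) <= ennreal (c / C0) * trace_norm (?R y)"
      unfolding N using c0 C0 by (subst ennreal_mult[symmetric]) (auto simp: N_def intro!: ennreal_leI)
  qed
qed

section \<open>Beurling's theorem on the line\<close>

lemma AE_zero_continuous: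
  fixes f :: "'a::euclidean_space => complex"
  assumes A: "open A" and f: "continuous_on A f" and z: "AE x in lborel. x \<in> A --> f x = 0" and x: "x \<in> A"
  shows "f x = 0"
proof (rule ccontr)
  assume nz: "f x ~= 0"
  define U where "U = {x \<in> A. f x ~= 0}"
  have Ueq: "U = A \<inter> f -` (- {0})" by (auto simp: U_def)
  have U: "open U" unfolding Ueq by (rule continuous_open_preimage[OF f A]) (simp add: open_Compl)
  have "AE x in lborel. x \<notin> U" using z by eventually_elim (auto simp: U_def)
  then have "U \<in> null_sets lborel" using U by (subst AE_iff_null_sets) auto
  then have "negligible U" unfolding negligible_iff_null_sets by (rule null_sets_completionI)
  then show False using open_not_negligible[OF U] nz x by (auto simp: U_def)
qed

text \<open>The inversion \<open>w \<mapsto> 1 / w\<close> maps the strip \<open>\<bar>Im w\<bar> < 1\<close> to the exterior of two discs. The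
  intersection of the two regions has two components, each containing a half line.\<close>

definition strip :: "complex set" where "strip = {w. \<bar>Im w\<bar> < 1}"

definition costrip :: "complex set" where "costrip = {w. \<bar>Im w\<bar> < (cmod w)\<^sup>2}"

lemma open_strip: "open strip" and open_costrip: "open costrip"
  unfolding strip_def costrip_def by (intro open_Collect_less continuous_intros)+

lemma convex_strip: "convex strip"
proof -
  have eq: "strip = {w. inner \<i> w < 1} \<inter> {w. inner \<i> w > - 1}" by (auto simp: strip_def abs_less_iff)
  show ?thesis unfolding eq by (intro convex_Int convex_halfspace_lt convex_halfspace_gt)
qed

lemma strip_union: "strip \<union> costrip = UNIV - {\<i>, - \<i>}"
proof (intro set_eqI iffI)
  fix w assume w: "w \<in> UNIV - {\<i>, - \<i>}"
  show "w \<in> strip \<union> costrip"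
  proof (rule ccontr)
    assume "w \<notin> strip \<union> costrip"
    then have 1: "1 <= \<bar>Im w\<bar>" and 2: "(Re w)\<^sup>2 + (Im w)\<^sup>2 <= \<bar>Im w\<bar>" by (auto simp: strip_def costrip_def cmod_power2)
    have "\<bar>Im w\<bar> * 1 <= \<bar>Im w\<bar> * \<bar>Im w\<bar>" using 1 by (intro mult_left_mono) auto
    then have 3: "\<bar>Im w\<bar> <= (Im w)\<^sup>2" by (simp add: power2_eq_square)
    then have "(Re w)\<^sup>2 <= 0" using 2 by linarith
    then have r: "Re w = 0" by simp
    have "\<bar>Im w\<bar> * \<bar>Im w\<bar> <= \<bar>Im w\<bar> * 1" using 2 r by (simp add: power2_eq_square)
    then have "\<bar>Im w\<bar> <= 1" using 1 by (subst (asm) mult_le_cancel_left_pos) auto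
    then have "Im w = 1 | Im w = - 1" using 1 by linarith
    then show False using w r by (auto simp: complex_eq_iff)
  qed
qed (auto simp: strip_def costrip_def)

lemma costrip_nz: "w \<in> costrip ==> w ~= 0"
  by (auto simp: costrip_def)

lemma costrip_inverse: "w \<in> costrip ==> inverse w \<in> strip"
proof -
  assume w: "w \<in> costrip"
  have "Im (inverse w) = - Im w / (cmod w)\<^sup>2" by (simp add: cmod_power2)
  then have eq: "\<bar>Im (inverse w)\<bar> = \<bar>Im w\<bar> / (cmod w)\<^sup>2" by (simp only: abs_divide abs_minus_cancel abs_power2)
  have "0 < (cmod w)\<^sup>2" using costrip_nz[OF w] by simp
  then show ?thesis using w unfolding strip_def costrip_def mem_Collect_eq eq by (simp only: divide_less_eq_1_pos)
qed

lemma islimpt_of_real: "complex_of_real a islimpt of_real ` {a<..}"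
  unfolding islimpt_approachable
proof (intro allI impI)
  fix e :: real assume "0 < e"
  then show "EX x':of_real ` {a<..}. x' ~= of_real a & dist x' (complex_of_real a) < e"
    by (intro bexI[of _ "of_real (a + e / 2)"]) (auto simp: dist_of_real dist_real_def simp del: of_real_add)
qed

text \<open>The right half of the overlap is connected, since each of its points can be moved right
  by 1 inside it into a convex set; there the identity theorem applies along a half line. The map w
  to - w carries the left half onto it, and no point of the overlap is on the imaginary
  axis.\<close>

lemma holomorphic_zero_on_overlap:
  assumes f: "f holomorphic_on (strip \<inter> costrip)" and z: "!!x::real. x ~= 0 ==> f (of_real x) = 0"
    and w: "w \<in> strip \<inter> costrip"
  shows "f w = 0"
proof -
  define A where "A = {w. 0 < Re w} \<inter> (strip \<inter> costrip)"
  define R where "R = {w. 1 <= Re w} \<inter> strip"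
  have RA: "R \<subseteq> A"
  proof
    fix w assume w: "w \<in> R"
    have "1 * 1 <= Re w * Re w" using w by (intro mult_mono) (auto simp: R_def)
    then have "1 <= (cmod w)\<^sup>2" using zero_le_power2[of "Im w"] unfolding cmod_power2 unfolding power2_eq_square by linarith
    then show "w \<in> A" using w by (auto simp: R_def A_def strip_def costrip_def simp del: one_le_power)
  qed
  have R1: "1 \<in> R" by (simp add: R_def strip_def)
  \<comment> \<open>Moving right keeps the imaginary part and increases the modulus, so neither
    defining inequality is lost.\<close>
  have seg: "closed_segment p (p + 1) \<subseteq> A" if p: "p \<in> A" for p
  proof
    fix q assume "q \<in> closed_segment p (p + 1)"
    then obtain u where u: "0 <= u" "u <= 1" "q = (1 - u) *\<^sub>R p + u *\<^sub>R (p + 1)" by (auto simp: closed_segment_def)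
    have q: "Re q = Re p + u" "Im q = Im p" unfolding u(3) by (simp_all add: algebra_simps)
    have le: "(Re p)\<^sup>2 <= (Re p + u)\<^sup>2" using p u by (intro power_mono) (auto simp: A_def)
    have "\<bar>Im p\<bar> < (Re p)\<^sup>2 + (Im p)\<^sup>2" using p by (auto simp: A_def costrip_def cmod_power2)
    then have "\<bar>Im q\<bar> < (cmod q)\<^sup>2" unfolding cmod_power2 q using le by linarith
    then show "q \<in> A" using p u(1) q by (auto simp: A_def strip_def costrip_def)
  qed
  have "A = \<Union> ((%p. closed_segment p (p + 1) \<union> R) ` A)" (is "_ = \<Union> ?C") using seg RA by blast
  moreover have "connected (\<Union> ?C)"
  proof (rule connected_Union)
    fix s assume "s \<in> ?C"
    then obtain p where p: "p \<in> A" "s = closed_segment p (p + 1) \<union> R" by blast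
    have "p + 1 \<in> closed_segment p (p + 1) \<inter> R" using p(1) by (auto simp: A_def R_def strip_def)
    moreover have "convex R" unfolding R_def
      using convex_halfspace_ge[of 1 "1::complex"] by (intro convex_Int convex_strip) (simp add: inner_complex_def)
    ultimately show "connected s" unfolding p(2) by (intro connected_Un convex_connected convex_closed_segment) auto
  next
    have "1 \<in> \<Inter> ?C" using R1 by blast
    then show "\<Inter> ?C ~= {}" by blast
  qed
  ultimately have cA: "connected A" by simp
  have oA: "open A" unfolding A_def by (intro open_Int open_strip open_costrip open_Collect_less continuous_intros)
  let ?U = "complex_of_real ` {1<..}"
  have lim: "1 islimpt ?U" using islimpt_of_real[of 1] by simp
  have U: "?U \<subseteq> A" using RA by (auto simp: R_def strip_def)
  have main: "k w = 0" if k: "k holomorphic_on A" "!!x::real. x ~= 0 ==> k (of_real x) = 0" and w: "w \<in> A" for k w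
    by (rule analytic_continuation[OF k(1) oA cA U _ lim _ w]) (use k(2) R1 RA in auto)
  have Re: "Re w ~= 0"
  proof
    assume r: "Re w = 0"
    have "\<bar>Im w\<bar> < (Re w)\<^sup>2 + (Im w)\<^sup>2" using w by (auto simp: costrip_def cmod_power2)
    then have i: "\<bar>Im w\<bar> < 1" "\<bar>Im w\<bar> < \<bar>Im w\<bar> * \<bar>Im w\<bar>" using w r by (auto simp: strip_def power2_eq_square)
    have "\<bar>Im w\<bar> * \<bar>Im w\<bar> <= \<bar>Im w\<bar> * 1" using i(1) by (intro mult_left_mono) auto
    then show False using i(2) by linarith
  qed
  show ?thesis
  proof (cases "0 < Re w")
    case True
    have "f holomorphic_on A" by (rule holomorphic_on_subset[OF f]) (auto simp: A_def)
    moreover have "w \<in> A" using w True by (auto simp: A_def)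
    ultimately show ?thesis using main[of f w] z by blast
  next
    case False
    have "(%w. f (- w)) holomorphic_on A"
      by (rule holomorphic_on_compose_gen[OF _ f, unfolded comp_def]) (auto intro!: holomorphic_intros simp: A_def strip_def costrip_def)
    moreover have "- w \<in> A" using False Re w by (auto simp: A_def strip_def costrip_def)
    moreover have "f (- of_real x) = 0" if "x ~= 0" for x using z[of "- x"] that by simp
    ultimately show ?thesis using main[of "%w. f (- w)" "- w"] by (metis minus_minus)
  qed
qed

lemma cmod_le_sq_of_gt_one: "1 < cmod w ==> w \<in> costrip"
proof -
  assume w: "1 < cmod w"
  then have "cmod w * 1 < cmod w * cmod w" by (intro mult_strict_left_mono) auto
  then show ?thesis using abs_Im_le_cmod[of w] by (simp add: costrip_def power2_eq_square)
qed

text \<open>The gluing argument: a bounded function on the strip with this reflection property extends to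
  the whole plane and vanishes at infinity.\<close>

lemma bounded_strip_reflection_zero:
  assumes f: "\<Psi> holomorphic_on strip" and b: "!!w. w \<in> strip ==> cmod (\<Psi> w) <= B"
    and refl: "!!x::real. x ~= 0 ==> cnj (\<Psi> (of_real (1 / x))) = of_real (x\<^sup>2) * \<Psi> (of_real x)"
    and w: "w \<in> strip"
  shows "\<Psi> w = 0"
proof -
  \<comment> \<open>The two conjugations cancel, so this is holomorphic where 1 / w lies in the
    strip. The factor w^-2 makes it agree with \<Psi> on the nonzero reals and decay at
    infinity.\<close>
  define \<Phi> where "\<Phi> w = cnj (\<Psi> (cnj (inverse w))) / w\<^sup>2" for w
  have cs: "cnj ` strip = strip" by (force simp: strip_def image_iff intro: exI[of _ "cnj _"])
  have "cnj \<circ> \<Psi> \<circ> cnj holomorphic_on strip" using holomorphic_on_compose_cnj_cnj[OF _ open_strip] f cs by simp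
  then have "(%w. (cnj \<circ> \<Psi> \<circ> cnj) (inverse w)) holomorphic_on costrip"
    by (rule holomorphic_on_compose_gen[unfolded comp_def, rotated])
       (auto intro!: holomorphic_intros costrip_inverse dest: costrip_nz)
  then have \<Phi>: "\<Phi> holomorphic_on costrip" unfolding \<Phi>_def by (auto intro!: holomorphic_intros dest: costrip_nz)
  have \<Phi>b: "cmod (\<Phi> w) <= B / (cmod w)\<^sup>2" if "w \<in> costrip" for w
  proof -
    have "cnj (inverse w) \<in> strip" using costrip_inverse[OF that] by (simp add: strip_def)
    from b[OF this] show ?thesis unfolding \<Phi>_def by (simp add: norm_divide norm_power divide_right_mono)
  qed
  have eq: "\<Psi> w - \<Phi> w = 0" if "w \<in> strip \<inter> costrip" for w
  proof (rule holomorphic_zero_on_overlap[OF _ _ that])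
    show "(%w. \<Psi> w - \<Phi> w) holomorphic_on strip \<inter> costrip"
      by (intro holomorphic_on_diff holomorphic_on_subset[OF f] holomorphic_on_subset[OF \<Phi>]) auto
    fix x :: real assume "x ~= 0"
    then show "\<Psi> (of_real x) - \<Phi> (of_real x) = 0"
      using refl[of x] by (simp add: \<Phi>_def inverse_eq_divide)
  qed
  define \<Omega> where "\<Omega> w = (if w \<in> strip then \<Psi> w else \<Phi> w)" for w
  have \<Omega>c: "\<Omega> w = \<Phi> w" if "w \<in> costrip" for w using eq[of w] that by (auto simp: \<Omega>_def)
  have "\<Omega> holomorphic_on strip \<union> costrip"
  proof (rule holomorphic_on_Un[OF _ _ open_strip open_costrip])
    show "\<Omega> holomorphic_on strip" by (rule holomorphic_transform[OF f]) (simp add: \<Omega>_def)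
    show "\<Omega> holomorphic_on costrip" by (rule holomorphic_transform[OF \<Phi>]) (simp add: \<Omega>c)
  qed
  then have hol: "\<Omega> holomorphic_on UNIV - {\<i>, - \<i>}" unfolding strip_union .
  have B0: "0 <= B" using order.trans[OF norm_ge_zero b[OF w]] .
  have bd: "cmod (\<Omega> w) <= B" if "w \<notin> {\<i>, - \<i>}" for w
  proof (cases "w \<in> strip")
    case True then show ?thesis using b by (simp add: \<Omega>_def)
  next
    case False
    then have "w \<in> costrip" using strip_union that by blast
    moreover have "1 <= cmod w" using False abs_Im_le_cmod[of w] by (simp add: strip_def)
    then have "1 <= (cmod w)\<^sup>2" by simp
    then have "B / (cmod w)\<^sup>2 <= B" using B0 by (simp add: divide_le_eq mult_le_cancel_left1)
    ultimately show ?thesis using \<Phi>b[of w] \<Omega>c[of w] by simp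
  qed
  \<comment> \<open>The two regions leave out only i and - i, where the bound \<open>B\<close> makes
    both singularities removable.\<close>
  have o: "open (UNIV - {z})" for z :: complex by (simp add: open_delete)
  have "UNIV - {- \<i>} - {\<i>} = UNIV - {\<i>, - \<i>}" by auto
  then have hol': "\<Omega> holomorphic_on UNIV - {- \<i>} - {\<i>}" using hol by (simp only:)
  have int: "\<i> \<in> interior (UNIV - {- \<i>})" unfolding interior_open[OF o] by (simp add: complex_eq_iff)
  have "\<forall>\<^sub>F z in at \<i>. z \<in> UNIV - {- \<i>}"
    by (rule eventually_at_in_open'[OF o]) (simp add: complex_eq_iff)
  then have "\<forall>\<^sub>F z in at \<i>. cmod (\<Omega> z) <= B"
    using eventually_neq_at_within[of \<i> \<i> UNIV] by eventually_elim (rule bd, simp)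
  then obtain g where g: "g holomorphic_on (UNIV - {- \<i>})" "!!z. z \<notin> {\<i>, - \<i>} ==> g z = \<Omega> z"
    using holomorphic_on_extend_bounded[OF hol' int] by auto
  have "\<forall>\<^sub>F z in at (- \<i>). z \<in> UNIV - {\<i>}"
    by (rule eventually_at_in_open'[OF o]) (simp add: complex_eq_iff)
  then have "\<forall>\<^sub>F z in at (- \<i>). cmod (g z) <= B"
    using eventually_neq_at_within[of "- \<i>" "- \<i>" UNIV] by eventually_elim (subst g(2), simp, rule bd, simp)
  then obtain h where h: "h holomorphic_on UNIV" "!!z. z \<notin> {\<i>, - \<i>} ==> h z = \<Omega> z"
    using holomorphic_on_extend_bounded[OF g(1)] g(2) by auto
  have "(h \<longlongrightarrow> 0) at_infinity"
  proof (rule Lim_null_comparison)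
    show "\<forall>\<^sub>F z in at_infinity. norm (h z) <= B / (cmod z)\<^sup>2" unfolding eventually_at_infinity
    proof (intro exI[of _ 2] allI impI)
      fix z :: complex assume z: "2 <= cmod z"
      then have "z \<in> costrip" "z \<notin> {\<i>, - \<i>}" by (auto intro: cmod_le_sq_of_gt_one)
      then show "norm (h z) <= B / (cmod z)\<^sup>2" using h(2) \<Omega>c \<Phi>b by simp
    qed
    have "filterlim (%z::complex. (cmod z)\<^sup>2) at_top at_infinity"
      by (rule filterlim_pow_at_top) (auto intro: filterlim_norm_at_top)
    then show "((%z::complex. B / (cmod z)\<^sup>2) \<longlongrightarrow> 0) at_infinity" by (rule tendsto_divide_0[OF tendsto_const filterlim_at_top_imp_at_infinity])
  qed
  then have "h w = 0" by (rule Liouville_weak_0[OF h(1)])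
  moreover have "w \<notin> {\<i>, - \<i>}" using w by (auto simp: strip_def)
  ultimately show ?thesis using h(2) w by (simp add: \<Omega>_def)
qed

text \<open>For w in the strip the point w x has imaginary part at most |x|, so monotonicity of
  \<open>N\<close> makes the Beurling integrand a majorant independent of w. For real w the
  substitution t to x t relates the values at x and 1 / x, and the square satisfies the reflection
  property exactly. At w = 1 the integral is that of |G|^2 over the real line.\<close>

theorem beurling_entire:
  fixes G :: "complex => complex" and N :: "real => real"
  assumes G: "G holomorphic_on UNIV" and N: "!!x y. cmod (G (Complex x y)) <= N \<bar>y\<bar>"
    and mono: "!!s t. 0 <= s ==> s <= t ==> N s <= N t"
    and int: "integrable lborel (%x. cmod (G (of_real x)) * N \<bar>x\<bar>)"
  shows "G (of_real x) = 0"
proof -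
  define H where "H z = cnj (G (cnj z))" for z
  define g where "g x = G (of_real x)" for x :: real
  have H: "H holomorphic_on UNIV"
    using holomorphic_on_compose_cnj_cnj[of G UNIV] holomorphic_on_subset[OF G] by (simp add: comp_def H_def[abs_def])
  have gc: "continuous_on UNIV g" unfolding g_def
    by (intro continuous_on_compose2[OF holomorphic_on_imp_continuous_on[OF G]] continuous_intros) auto
  have Hc: "continuous_on UNIV (%x. H (w * of_real x))" for w
    by (intro continuous_on_compose2[OF holomorphic_on_imp_continuous_on[OF H]] continuous_intros) auto
  have [measurable]: "g \<in> borel_measurable borel" "(%x. H (w * of_real x)) \<in> borel_measurable borel" for w
    using gc Hc by (auto intro: borel_measurable_continuous_onI)
  have HN: "cmod (g x * H (w * of_real x)) <= cmod (g x) * N \<bar>x\<bar>" if w: "w \<in> strip" for w x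
  proof -
    have "cnj w * of_real x = Complex (Re w * x) (- (Im w * x))" by (simp add: complex_eq_iff)
    then have "cmod (H (w * of_real x)) = cmod (G (Complex (Re w * x) (- (Im w * x))))" by (simp add: H_def)
    also have "\<dots> <= N \<bar>- (Im w * x)\<bar>" by (rule N)
    also have "\<dots> <= N \<bar>x\<bar>" using w by (intro mono) (auto simp: strip_def abs_mult mult_left_le_one_le)
    finally show ?thesis by (simp add: norm_mult mult_left_mono)
  qed
  have int': "integrable lborel (%x. cmod (g x) * N \<bar>x\<bar>)" using int by (simp add: g_def)
  define B where "B = (\<integral>x. cmod (g x) * N \<bar>x\<bar> \<partial>lborel)"
  define \<Phi> where "\<Phi> w = (\<integral>x. g x * H (w * of_real x) \<partial>lborel)" for w
  have fi: "integrable lborel (%x. g x * H (w * of_real x))" if "w \<in> strip" for w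
    by (rule Bochner_Integration.integrable_bound[OF int']) (use HN[OF that] order.trans[OF _ abs_ge_self] in auto)
  have si: "set_integrable lborel {- real n..real n} (%x. g x * H (w * of_real x))" if "w \<in> strip" for w n
    unfolding set_integrable_def by (rule integrable_mult_indicator) (use fi[OF that] in auto)
  \<comment> \<open>On a compact interval differentiation under the integral is available; the bound
    \<open>B\<close> is uniform in n, so holomorphy passes to the limit.\<close>
  define \<Phi>n where "\<Phi>n n w = integral (cbox (- real n) (real n)) (%x. g x * H (w * of_real x))" for n w
  have \<Phi>n: "\<Phi>n n w = (\<integral>x. indicator {- real n..real n} x *\<^sub>R (g x * H (w * of_real x)) \<partial>lborel)" if "w \<in> strip" for n w
    unfolding \<Phi>n_def using set_borel_integral_eq_integral(2)[OF si[OF that, of n]] by (simp add: set_lebesgue_integral_def)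
  have bd: "cmod (\<integral>x. F x \<partial>lborel) <= B" if "!!x. cmod (F x) <= cmod (g x) * N \<bar>x\<bar>" "F \<in> borel_measurable lborel" for F :: "real => complex"
  proof -
    have "integrable lborel F" by (rule Bochner_Integration.integrable_bound[OF int' that(2)]) (use that(1) order.trans[OF _ abs_ge_self] in auto)
    then show ?thesis unfolding B_def by (intro order.trans[OF integral_norm_bound integral_mono] integrable_norm int' that(1))
  qed
  have \<Phi>B: "cmod (\<Phi> w) <= B" if "w \<in> strip" for w
    unfolding \<Phi>_def by (rule bd[OF HN[OF that]]) measurable
  have "\<Phi> holomorphic_on strip"
  proof (rule holomorphic_pointwise_limit[where f = \<Phi>n])
    show "open strip" by (rule open_strip)
    fix n
    have dH: "deriv H holomorphic_on UNIV" by (rule holomorphic_deriv[OF H]) simp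
    show "\<Phi>n n holomorphic_on strip" unfolding \<Phi>n_def
    proof (rule leibniz_rule_holomorphic[where fx = "%w t. g t * (deriv H (w * of_real t) * of_real t)"])
      show "((%w. g t * H (w * of_real t)) has_field_derivative g t * (deriv H (w * of_real t) * of_real t)) (at w within strip)" for w t
      proof -
        have "(H has_field_derivative deriv H (w * of_real t)) (at (w * of_real t))"
          using holomorphic_derivI[OF H open_UNIV] by blast
        then have "((%w. H (w * of_real t)) has_field_derivative deriv H (w * of_real t) * of_real t) (at w)"
          by (rule DERIV_chain2) (auto intro!: derivative_eq_intros)
        then show ?thesis by (rule has_field_derivative_at_within[OF DERIV_cmult])
      qed
      show "(%x. g x * H (w * of_real x)) integrable_on cbox (- real n) (real n)" if "w \<in> strip" for w
        using set_borel_integral_eq_integral(1)[OF si[OF that, of n]] by simp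
      have "continuous_on (strip \<times> cbox (- real n) (real n)) (%p. g (snd p) * (deriv H (fst p * of_real (snd p)) * of_real (snd p)))"
        by (intro continuous_intros continuous_on_compose2[OF gc] continuous_on_compose2[OF holomorphic_on_imp_continuous_on[OF dH]]) auto
      then show "continuous_on (strip \<times> cbox (- real n) (real n)) (%(w, t). g t * (deriv H (w * of_real t) * of_real t))"
        by (simp add: case_prod_beta)
      show "convex strip" by (rule convex_strip)
    qed
  next
    fix K assume K: "K \<subseteq> strip"
    have "cmod (\<Phi>n n w) <= B" if "w \<in> strip" for n w unfolding \<Phi>n[OF that]
      by (rule bd) (use HN[OF that] order.trans[OF norm_ge_zero HN[OF that]] in \<open>auto simp: indicator_def\<close>)
    then show "EX B. ALL n. ALL z:K. cmod (\<Phi>n n z) <= B" using K by blast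
  next
    fix w assume w: "w \<in> strip"
    show "(%n. \<Phi>n n w) \<longlonglongrightarrow> \<Phi> w" unfolding \<Phi>n[OF w] \<Phi>_def
    proof (rule integral_dominated_convergence[OF _ _ int'])
      show "AE x in lborel. norm (indicator {- real n..real n} x *\<^sub>R (g x * H (w * of_real x))) <= cmod (g x) * N \<bar>x\<bar>" for n
        using HN[OF w] order.trans[OF norm_ge_zero HN[OF w]] by (intro AE_I2) (auto simp: indicator_def)
      show "AE x in lborel. (%n. indicator {- real n..real n} x *\<^sub>R (g x * H (w * of_real x))) \<longlonglongrightarrow> g x * H (w * of_real x)"
      proof (rule AE_I2, rule tendsto_eventually)
        fix x :: real
        obtain m :: nat where "\<bar>x\<bar> <= real m" using real_arch_simple by blast
        then show "\<forall>\<^sub>F n in sequentially. indicator {- real n..real n} x *\<^sub>R (g x * H (w * of_real x)) = g x * H (w * of_real x)"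
          unfolding eventually_sequentially by (intro exI[of _ m]) (auto simp: indicator_def)
      qed
    qed measurable
  qed
  then have hol: "(%w. (\<Phi> w)\<^sup>2) holomorphic_on strip" by (intro holomorphic_intros)
  have refl: "cnj (\<Phi> (of_real (1 / x))) = of_real \<bar>x\<bar> * \<Phi> (of_real x)" if x: "x ~= 0" for x :: real
  proof -
    have H': "H (of_real t) = cnj (g t)" for t by (simp add: H_def g_def)
    have "cnj (\<Phi> (of_real (1 / x))) = (\<integral>t. cnj (g t * H (of_real (1 / x) * of_real t)) \<partial>lborel)"
      unfolding \<Phi>_def by (rule Bochner_Integration.integral_cnj[symmetric])
    also have "\<dots> = (\<integral>t. cnj (g t) * g (t / x) \<partial>lborel)" unfolding of_real_mult[symmetric] H' by simp
    also have "\<dots> = \<bar>x\<bar> *\<^sub>R (\<integral>t. cnj (g (0 + x * t)) * g ((0 + x * t) / x) \<partial>lborel)"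
      by (rule lborel_integral_real_affine[OF x])
    also have "\<dots> = of_real \<bar>x\<bar> * \<Phi> (of_real x)"
      unfolding \<Phi>_def of_real_mult[symmetric] H' using x by (simp add: scaleR_conv_of_real mult.commute)
    finally show ?thesis .
  qed
  have "(\<Phi> 1)\<^sup>2 = 0"
  proof (rule bounded_strip_reflection_zero[OF hol])
    show "cmod ((\<Phi> w)\<^sup>2) <= B\<^sup>2" if "w \<in> strip" for w
      unfolding norm_power by (intro power_mono \<Phi>B that) simp
    show "cnj ((\<Phi> (of_real (1 / x)))\<^sup>2) = of_real (x\<^sup>2) * (\<Phi> (of_real x))\<^sup>2" if "x ~= 0" for x :: real
      unfolding complex_cnj_power refl[OF that] power_mult_distrib of_real_power[symmetric] power2_abs ..
    show "1 \<in> strip" by (simp add: strip_def)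
  qed
  then have "\<Phi> 1 = 0" by simp
  have 1: "1 \<in> strip" by (simp add: strip_def)
  have sq: "g x * H (1 * of_real x) = of_real ((cmod (g x))\<^sup>2)" for x
    using complex_norm_square[of "g x"] by (simp add: H_def g_def)
  have "integrable lborel (%x. complex_of_real ((cmod (g x))\<^sup>2))" using fi[OF 1] unfolding sq .
  then have i: "integrable lborel (%x. (cmod (g x))\<^sup>2)" unfolding complex_of_real_integrable_eq .
  have "(\<integral>x. (cmod (g x))\<^sup>2 \<partial>lborel) = 0"
    using \<open>\<Phi> 1 = 0\<close> unfolding \<Phi>_def sq integral_complex_of_real of_real_eq_0_iff .
  then have "AE x in lborel. (cmod (g x))\<^sup>2 = 0" using integral_nonneg_eq_0_iff_AE[OF i] by simp
  then have "AE x in lborel. x \<in> UNIV --> g x = 0" by simp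
  then show ?thesis using AE_zero_continuous[OF open_UNIV gc] by (simp add: g_def)
qed

lemma borel_measurable_mono_ennreal:
  fixes f :: "real => ennreal"
  assumes "mono f" shows "f \<in> borel_measurable borel"
proof (rule borel_measurableI_ge)
  fix y
  have "is_interval {x. y <= f x}" unfolding is_interval_1 using monoD[OF assms] by (blast intro: order.trans)
  then show "{x \<in> space borel. y <= f x} \<in> sets borel" using real_interval_borel_measurable by simp
qed

text \<open>Here the majorant may be infinite; in that case the function vanishes on a half line.\<close>

theorem beurling_entire_ennreal:
  fixes G :: "complex => complex" and N :: "real => ennreal"
  assumes G: "G holomorphic_on UNIV" and N: "!!x y. ennreal (cmod (G (Complex x y))) <= N \<bar>y\<bar>"
    and mono: "mono N"
    and fin: "(\<integral>\<^sup>+x. indicator {1..} x * ((ennreal (cmod (G (of_real x))) + ennreal (cmod (G (of_real (- x))))) * N x) \<partial>lborel) < \<infinity>"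
  shows "G (of_real x) = 0"
proof -
  have Nm [measurable]: "N \<in> borel_measurable borel" by (rule borel_measurable_mono_ennreal[OF mono])
  define g where "g x = G (of_real x)" for x :: real
  have gc: "continuous_on UNIV g" unfolding g_def
    by (intro continuous_on_compose2[OF holomorphic_on_imp_continuous_on[OF G]] continuous_intros) auto
  then have [measurable]: "g \<in> borel_measurable borel" by (rule borel_measurable_continuous_onI)
  let ?h = "%x. indicator {1..} x * ((ennreal (cmod (g x)) + ennreal (cmod (g (- x)))) * N x)"
  have fin': "(\<integral>\<^sup>+x. ?h x \<partial>lborel) < \<infinity>" using fin by (simp add: g_def)
  show ?thesis
  proof (cases "EX t. N t = \<infinity>")
    case True
    then obtain t where t: "N t = \<infinity>" by blast
    define s where "s = max 1 t"
    have inf: "N y = \<infinity>" if "s < y" for y using monoD[OF mono, of t y] that t by (simp add: s_def top_unique)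
    have "AE x in lborel. ?h x ~= \<infinity>" by (rule nn_integral_noteq_infinite) (use fin' in auto)
    then have "AE x in lborel. x \<in> {s<..} --> g x = 0"
    proof eventually_elim
      case (elim x)
      show ?case
      proof
        assume x: "x \<in> {s<..}"
        then have "?h x = (ennreal (cmod (g x)) + ennreal (cmod (g (- x)))) * \<top>" using inf[of x] by (simp add: s_def)
        then have "ennreal (cmod (g x)) + ennreal (cmod (g (- x))) = 0" using elim by (metis ennreal_mult_top infinity_ennreal_def)
        then show "g x = 0" by simp
      qed
    qed
    then have z: "g y = 0" if "s < y" for y
      using AE_zero_continuous[OF open_greaterThan continuous_on_subset[OF gc]] that by blast
    show ?thesis
      by (rule analytic_continuation[where U = "of_real ` {s<..}", OF G open_UNIV connected_UNIV _ _ islimpt_of_real])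
         (use z in \<open>auto simp: g_def\<close>)
  next
    case False
    define M where "M t = enn2real (N t)" for t
    have M: "N t = ennreal (M t)" for t using False unfolding M_def by (simp add: ennreal_enn2real_if)
    have M0: "0 <= M t" for t by (simp add: M_def)
    have GM: "cmod (G (Complex x y)) <= M \<bar>y\<bar>" for x y using N[of x y] M0 unfolding M by (simp add: ennreal_le_iff)
    have Mm: "M s <= M t" if "s <= t" for s t using monoD[OF mono that] M0 unfolding M by (simp add: ennreal_le_iff)
    have [measurable]: "M \<in> borel_measurable borel" unfolding M_def by measurable
    have gM: "cmod (g x) <= M t" if "0 <= t" for x t using GM[of x 0] Mm[OF that] by (simp add: g_def complex_of_real_def)
    let ?k = "%x. ennreal (cmod (g x) * M \<bar>x\<bar>)"
    have "(\<integral>\<^sup>+x. ?k x \<partial>lborel) <= (\<integral>\<^sup>+x. indicator {0..} x * ?k x + indicator {..0} x * ?k x \<partial>lborel)"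
      by (rule nn_integral_mono) (auto simp: indicator_def)
    also have "\<dots> = (\<integral>\<^sup>+x. indicator {0..} x * ?k x \<partial>lborel) + (\<integral>\<^sup>+x. indicator {..0} x * ?k x \<partial>lborel)"
      by (rule nn_integral_add) measurable
    also have "(\<integral>\<^sup>+x. indicator {..0} x * ?k x \<partial>lborel) = (\<integral>\<^sup>+x. indicator {0..} x * ?k (- x) \<partial>lborel)"
      by (subst nn_integral_real_affine[of _ "-1" 0]) (auto intro!: nn_integral_cong simp: indicator_def)
    also have "(\<integral>\<^sup>+x. indicator {0..} x * ?k x \<partial>lborel) + (\<integral>\<^sup>+x. indicator {0..} x * ?k (- x) \<partial>lborel) =
        (\<integral>\<^sup>+x. indicator {0..} x * ?k x + indicator {0..} x * ?k (- x) \<partial>lborel)"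
      by (rule nn_integral_add[symmetric]) measurable
    also have "\<dots> <= (\<integral>\<^sup>+x. ennreal (2 * (M 1 * M 1)) * indicator {0..1} x + ?h x \<partial>lborel)"
    proof (rule nn_integral_mono)
      fix x :: real
      consider "x < 0" | "0 <= x" "x < 1" | "1 <= x" by linarith
      then show "indicator {0..} x * ?k x + indicator {0..} x * ?k (- x) <= ennreal (2 * (M 1 * M 1)) * indicator {0..1} x + ?h x"
      proof cases
        \<comment> \<open>The hypothesis says nothing on the unit interval, but there both the
          function and the weight are at most \<open>M 1\<close>.\<close>
        case 2
        have "cmod (g y) * M \<bar>x\<bar> <= M 1 * M 1" for y using 2 M0 gM[of 1 y] Mm[of "\<bar>x\<bar>" 1] by (intro mult_mono) auto
        from add_mono[OF this[of x] this[of "- x"]] have "ennreal (cmod (g x) * M \<bar>x\<bar> + cmod (g (- x)) * M \<bar>x\<bar>) <= ennreal (2 * (M 1 * M 1))"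
          by (intro ennreal_leI) simp
        then show ?thesis using 2 M0 by (simp add: ennreal_plus[symmetric] del: ennreal_plus)
      next
        case 3
        then show ?thesis unfolding M using M0 by (simp add: distrib_right ennreal_mult add_increasing)
      qed simp
    qed
    also have "\<dots> = ennreal (2 * (M 1 * M 1)) * emeasure lborel {0..1::real} + (\<integral>\<^sup>+x. ?h x \<partial>lborel)"
      by (subst nn_integral_add) (simp_all add: nn_integral_cmult_indicator)
    also have "\<dots> < \<infinity>" using fin' by (simp add: ennreal_mult_less_top)
    finally have i: "integrable lborel (%x. cmod (g x) * M \<bar>x\<bar>)"
      using M0 by (intro integrableI_nonneg) auto
    show ?thesis by (rule beurling_entire[OF G GM Mm i[unfolded g_def]])
  qed
qed

section \<open>Coordinates and decay\<close>

text \<open>The square of 1 + |x| dominates 1 + x_b^2 for every coordinate, so twice the dimension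
  is enough decay to compare with a product of integrable one-variable functions.\<close>

lemma integrable_decay:
  fixes h :: "'a::euclidean_space => complex"
  assumes [measurable]: "h \<in> borel_measurable borel" and K: "!!x. (1 + norm x) ^ (2 * DIM('a)) * cmod (h x) <= K"
  shows "integrable lborel h"
proof -
  let ?r = "%x::real. complex_of_real (inverse (1 + x\<^sup>2))"
  have "integrable lborel (%x::real. inverse (1 + x\<^sup>2))"
    using integrable_inverse_1_plus_square by (simp add: set_integrable_def)
  then have "integrable lborel ?r" by (rule integrable_of_real)
  then have i: "integrable lborel (%x::'a. (\<Prod>b\<in>Basis. ?r (x \<bullet> b)) * of_real K)"
    by (intro integrable_mult_left lborel_prod_integral)
  show ?thesis
  proof (rule Bochner_Integration.integrable_bound[OF i])
    show "AE x in lborel. norm (h x) <= norm ((\<Prod>b\<in>Basis. ?r (x \<bullet> b)) * of_real K)"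
    proof (rule AE_I2)
      fix x :: 'a
      have "(\<Prod>b\<in>Basis. 1 + (x \<bullet> b)\<^sup>2) <= (\<Prod>b\<in>(Basis::'a set). (1 + norm x)\<^sup>2)"
      proof (rule prod_mono)
        fix b :: 'a assume "b \<in> Basis"
        then have "\<bar>x \<bullet> b\<bar>\<^sup>2 <= (norm x)\<^sup>2" by (intro power_mono Basis_le_norm) auto
        then show "0 <= 1 + (x \<bullet> b)\<^sup>2 & 1 + (x \<bullet> b)\<^sup>2 <= (1 + norm x)\<^sup>2" by (simp add: power2_sum add_increasing2)
      qed
      also have "\<dots> = (1 + norm x) ^ (2 * DIM('a))" by (simp add: power_mult)
      finally have le: "(\<Prod>b\<in>Basis. 1 + (x \<bullet> b)\<^sup>2) * cmod (h x) <= K"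
        using order.trans[OF mult_right_mono K[of x]] by simp
      have p: "0 < (\<Prod>b\<in>Basis. 1 + (x \<bullet> b)\<^sup>2)" by (intro prod_pos) (simp add: add_pos_nonneg)
      have K0: "0 <= K" using order.trans[OF _ le] p by simp
      have "cmod (h x) <= K / (\<Prod>b\<in>Basis. 1 + (x \<bullet> b)\<^sup>2)" using le p by (simp add: pos_le_divide_eq mult.commute)
      also have "\<dots> = norm ((\<Prod>b\<in>Basis. ?r (x \<bullet> b)) * of_real K)"
        using K0 prod_nonneg[of Basis "%b. inverse (1 + (x \<bullet> b)\<^sup>2)"]
        by (simp add: norm_mult abs_of_nonneg of_real_prod[symmetric] prod_inversef[symmetric] divide_inverse mult.commute del: of_real_prod of_real_inverse)
      finally show "norm (h x) <= norm ((\<Prod>b\<in>Basis. ?r (x \<bullet> b)) * of_real K)" .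
    qed
  qed measurable
qed

lemma schwartz_bound:
  assumes "schwartz f" shows "EX K. ALL x. (1 + norm x) ^ k * cmod (f x) <= K"
proof -
  have "bounded (range (%x. (1 + norm x) ^ k *\<^sub>R partials [] f x))"
    using assms unfolding schwartz_def by (metis empty_set empty_subsetI)
  then obtain K where "!!x. norm ((1 + norm x) ^ k *\<^sub>R f x) <= K" unfolding bounded_iff by auto
  then show ?thesis by (intro exI[of _ K]) simp
qed

lemma schwartz_continuous: "schwartz f ==> continuous_on UNIV f"
proof -
  assume "schwartz f"
  then have "partials [] f differentiable (at x)" for x unfolding schwartz_def by (metis empty_set empty_subsetI)
  then show ?thesis by (auto simp: continuous_on_eq_continuous_at intro: differentiable_imp_continuous_within)
qed

lemma inner_vec_of: "inner (vec_of b x) (vec_of b' y) = (\<Sum>i\<in>UNIV. \<Sum>j\<in>UNIV. x $ i * (y $ j * inner (b i) (b' j)))"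
  unfolding vec_of_def inner_sum_left by (simp add: inner_sum_right sum_distrib_left mult.left_commute)

lemma norm_vec_of_sum:
  fixes v :: "'g::euclidean_space"
  assumes b: "!!i j. inner (b i) (b j) = (if i = j then 1 else 0)" and v: "!!i. inner v (b i) = 0"
  shows "(norm (v + vec_of b x))\<^sup>2 = (norm v)\<^sup>2 + (norm x)\<^sup>2"
proof -
  have "inner (vec_of b x) (vec_of b x) = inner x x"
    unfolding inner_vec_of b by (simp add: inner_vec_def if_distrib[of "(*) _"] cong: if_cong)
  moreover have "inner v (vec_of b x) = 0" unfolding vec_of_def inner_sum_right by (simp add: v)
  ultimately show ?thesis by (simp add: power2_norm_eq_inner inner_add_left inner_add_right inner_commute)
qed

lemma vec_of_linear: "vec_of b (x + y) = vec_of b x + vec_of b y" "vec_of b (r *\<^sub>R x) = r *\<^sub>R vec_of b x" "vec_of b 0 = 0"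
  by (simp_all add: vec_of_def scaleR_add_left sum.distrib scaleR_sum_right)

lemma continuous_on_vec_of [continuous_intros]: "continuous_on S f ==> continuous_on S (%x. vec_of b (f x))"
  unfolding vec_of_def by (intro continuous_intros)

lemma subspace_range_vec_of: "subspace (range (vec_of b))"
  unfolding subspace_def by (auto simp: vec_of_linear(3)[symmetric, of b] vec_of_linear(1,2)[symmetric])

lemma range_vec_of: "range (vec_of b) = span (range b)"
proof
  show "range (vec_of b) \<subseteq> span (range b)" unfolding vec_of_def by (intro image_subsetI span_sum span_scale span_base rangeI)
  have "b i \<in> range (vec_of b)" for i
    by (rule image_eqI[of _ _ "axis i 1"]) (simp_all add: vec_of_def axis_def if_distrib[of "%r. r *\<^sub>R _"] cong: if_cong)
  then show "span (range b) \<subseteq> range (vec_of b)" by (intro span_minimal subspace_range_vec_of) auto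
qed

lemma hor_vec_surj:
  assumes "orthonormal_basis_of (case_sum E E') S" and "v \<in> S"
  shows "EX p. v = hor_vec E E' p"
proof -
  have r: "range (case_sum E E') = range E \<union> range E'" by (subst UNIV_sum) (simp add: image_Un image_image)
  have "v \<in> span (range E \<union> range E')" using assms by (simp add: orthonormal_basis_of_def r)
  then obtain a c where "v = a + c" "a \<in> span (range E)" "c \<in> span (range E')" unfolding span_Un by blast
  then show ?thesis unfolding range_vec_of[symmetric] hor_vec_def by auto
qed

text \<open>\<open>N_coords\<close> takes nested triples, whereas the central transform is a
  function on pairs; Tonelli shows that regrouping preserves Lebesgue measure.\<close>

lemma lborel_assoc:
  "distr lborel borel (%q. (fst (fst q), snd (fst q), snd q)) = (lborel :: ('a::euclidean_space \<times> 'b::euclidean_space \<times> 'c::euclidean_space) measure)"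
  (is "distr lborel borel ?a = _")
proof (rule measure_eqI)
  have m [measurable]: "?a \<in> borel_measurable borel" by (intro borel_measurable_continuous_onI continuous_intros)
  fix A assume "A \<in> sets (distr (lborel :: (('a \<times> 'b) \<times> 'c) measure) borel ?a)"
  then have A [measurable]: "A \<in> sets borel" by simp
  let ?I = "indicator A :: _ => ennreal"
  have mI: "(%q. ?I (?a q)) \<in> borel_measurable (lborel \<Otimes>\<^sub>M lborel)" by (simp add: lborel_prod)
  have "emeasure (distr lborel borel ?a) A = (\<integral>\<^sup>+q. ?I q \<partial>distr lborel borel ?a)" by simp
  also have "\<dots> = (\<integral>\<^sup>+q. ?I (?a q) \<partial>lborel)" by (rule nn_integral_distr) (use m in simp_all)
  also have "\<dots> = (\<integral>\<^sup>+p. (\<integral>\<^sup>+t. ?I (?a (p, t)) \<partial>lborel) \<partial>lborel)"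
    by (subst lborel_prod[symmetric], subst lborel.nn_integral_fst[symmetric]) (simp_all add: lborel_prod)
  also have "\<dots> = (\<integral>\<^sup>+x. (\<integral>\<^sup>+u. (\<integral>\<^sup>+t. ?I (?a ((x, u), t)) \<partial>lborel) \<partial>lborel) \<partial>lborel)"
    by (subst lborel_prod[symmetric], subst lborel.nn_integral_fst[symmetric])
       (use lborel.borel_measurable_nn_integral_fst[OF mI] in \<open>simp_all add: lborel_prod\<close>)
  also have "\<dots> = (\<integral>\<^sup>+x. (\<integral>\<^sup>+p. ?I (x, p) \<partial>lborel) \<partial>lborel)"
  proof (rule nn_integral_cong)
    fix x
    have "(\<integral>\<^sup>+u. (\<integral>\<^sup>+t. ?I (x, u, t) \<partial>lborel) \<partial>lborel) = (\<integral>\<^sup>+p. ?I (x, p) \<partial>(lborel \<Otimes>\<^sub>M lborel))"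
      by (rule lborel.nn_integral_fst) (simp add: lborel_prod)
    then show "(\<integral>\<^sup>+u. (\<integral>\<^sup>+t. ?I (?a ((x, u), t)) \<partial>lborel) \<partial>lborel) = (\<integral>\<^sup>+p. ?I (x, p) \<partial>lborel)"
      by (simp add: lborel_prod)
  qed
  also have "\<dots> = (\<integral>\<^sup>+p. ?I p \<partial>(lborel \<Otimes>\<^sub>M lborel))" by (rule lborel.nn_integral_fst) (simp add: lborel_prod)
  also have "\<dots> = (\<integral>\<^sup>+p. ?I p \<partial>lborel)" by (simp only: lborel_prod)
  also have "\<dots> = emeasure lborel A" by simp
  finally show "emeasure (distr lborel borel ?a) A = emeasure lborel A" .
qed simp

lemma integral_assoc:
  fixes h :: "'a::euclidean_space \<times> 'b::euclidean_space \<times> 'c::euclidean_space => complex"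
  assumes h: "integrable lborel h"
  shows "integrable lborel (%p. \<integral>t. h (fst p, snd p, t) \<partial>lborel)"
    and "(\<integral>q. h q \<partial>lborel) = (\<integral>p. (\<integral>t. h (fst p, snd p, t) \<partial>lborel) \<partial>lborel)"
proof -
  let ?a = "%q::('a \<times> 'b) \<times> 'c. (fst (fst q), snd (fst q), snd q)"
  have m: "?a \<in> lborel \<rightarrow>\<^sub>M borel" by (simp, intro borel_measurable_continuous_onI continuous_intros)
  have hm: "h \<in> borel_measurable borel" using borel_measurable_integrable[OF h] by simp
  have "integrable lborel (%q. h (?a q))"
    using h unfolding lborel_assoc[symmetric] integrable_distr_eq[OF m hm] .
  then have i: "integrable (lborel \<Otimes>\<^sub>M lborel) (%(p, t). h (fst p, snd p, t))" by (simp add: lborel_prod split_beta')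
  show "integrable lborel (%p. \<integral>t. h (fst p, snd p, t) \<partial>lborel)" using lborel_pair.integrable_fst[OF i] .
  have "(\<integral>q. h q \<partial>lborel) = (\<integral>q. h (?a q) \<partial>lborel)" by (subst lborel_assoc[symmetric], rule integral_distr[OF m hm])
  then show "(\<integral>q. h q \<partial>lborel) = (\<integral>p. (\<integral>t. h (fst p, snd p, t) \<partial>lborel) \<partial>lborel)"
    using lborel_pair.integral_fst[OF i] by (simp add: lborel_prod split_beta')
qed

section \<open>The vanishing of the central Fourier transform\<close>

text \<open>By Tonelli and scaling, the integral over w of H (r w) is r^(-D) times that of H, where
  D is the dimension, and r^(-D) <= r^(-2) is integrable over r >= 1. Starting at 1 avoids the
  singularity at 0; both signs of r are kept so that the whole line through w is seen.\<close>

lemma dilation_finite: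
  fixes H :: "'a::euclidean_space => ennreal"
  assumes [measurable]: "H \<in> borel_measurable borel" and fin: "(\<integral>\<^sup>+q. H q \<partial>lborel) < \<infinity>" and D: "2 <= DIM('a)"
  shows "AE w in lborel. (\<integral>\<^sup>+r. indicator {1..} r * (H (r *\<^sub>R w) + H ((- r) *\<^sub>R w)) \<partial>lborel) < \<infinity>"
proof -
  let ?I = "\<integral>\<^sup>+q. H q \<partial>lborel"
  have s: "(\<integral>\<^sup>+w. H (c *\<^sub>R w) \<partial>lborel) = ennreal (1 / \<bar>c\<bar> ^ DIM('a)) * ?I" if c: "c ~= 0" for c
  proof -
    have "?I = ennreal (\<bar>c\<bar> ^ DIM('a)) * (\<integral>\<^sup>+w. H (c *\<^sub>R w) \<partial>lborel)"
      using nn_integral_lborel_affine[of H c 0] c by simp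
    then have "ennreal (1 / \<bar>c\<bar> ^ DIM('a)) * ?I = ennreal (1 / \<bar>c\<bar> ^ DIM('a) * \<bar>c\<bar> ^ DIM('a)) * (\<integral>\<^sup>+w. H (c *\<^sub>R w) \<partial>lborel)"
      by (subst ennreal_mult) (simp_all add: mult.assoc)
    then show ?thesis using c by simp
  qed
  have tail: "(\<integral>\<^sup>+r. ennreal (1 / r\<^sup>2) * indicator {1..} r \<partial>lborel) < \<infinity>"
  proof -
    have "((%r::real. - 1 / r) \<longlongrightarrow> 0) at_top" by (rule tendsto_divide_0[OF tendsto_const filterlim_at_top_imp_at_infinity[OF filterlim_ident]])
    then have "(\<integral>\<^sup>+r. ennreal (1 / r\<^sup>2) * indicator {1..} r \<partial>lborel) = ennreal (0 - (- 1 / 1))"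
      by (rule nn_integral_FTC_atLeast[rotated -1]) (auto intro!: derivative_eq_intros simp: power2_eq_square)
    then show ?thesis by simp
  qed
  let ?J = "%r w. indicator {1..} r * (H (r *\<^sub>R w) + H ((- r) *\<^sub>R w))"
  have "(\<integral>\<^sup>+w. (\<integral>\<^sup>+r. ?J r w \<partial>lborel) \<partial>lborel) = (\<integral>\<^sup>+r. (\<integral>\<^sup>+w. ?J r w \<partial>lborel) \<partial>lborel)"
    by (rule lborel_pair.Fubini') measurable
  also have "\<dots> <= (\<integral>\<^sup>+r. 2 * ?I * (ennreal (1 / r\<^sup>2) * indicator {1..} r) \<partial>lborel)"
  proof (rule nn_integral_mono)
    fix r :: real
    show "(\<integral>\<^sup>+w. ?J r w \<partial>lborel) <= 2 * ?I * (ennreal (1 / r\<^sup>2) * indicator {1..} r)"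
    proof (cases "1 <= r")
      case True
      have "r\<^sup>2 <= r ^ DIM('a)" using True D by (intro power_increasing)
      then have le: "1 / r ^ DIM('a) <= 1 / r\<^sup>2" using True by (intro divide_left_mono) auto
      have "(\<integral>\<^sup>+w. ?J r w \<partial>lborel) = (\<integral>\<^sup>+w. H (r *\<^sub>R w) \<partial>lborel) + (\<integral>\<^sup>+w. H ((- r) *\<^sub>R w) \<partial>lborel)"
        using True by (simp add: nn_integral_add)
      also have "\<dots> = 2 * ?I * ennreal (1 / r ^ DIM('a))"
        using True s[of r] s[of "- r"] by simp (metis mult.assoc mult.commute mult_2)
      also have "\<dots> <= 2 * ?I * ennreal (1 / r\<^sup>2)" by (intro mult_left_mono ennreal_leI le) simp
      finally show ?thesis using True by simp
    qed simp
  qed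
  also have "\<dots> = 2 * ?I * (\<integral>\<^sup>+r. ennreal (1 / r\<^sup>2) * indicator {1..} r \<partial>lborel)" by (rule nn_integral_cmult) measurable
  also have "\<dots> < \<infinity>" using fin tail by (simp add: ennreal_mult_less_top)
  finally have "(\<integral>\<^sup>+w. (\<integral>\<^sup>+r. ?J r w \<partial>lborel) \<partial>lborel) ~= \<infinity>" by simp
  then have "AE w in lborel. (\<integral>\<^sup>+r. ?J r w \<partial>lborel) ~= \<infinity>" by (intro nn_integral_noteq_infinite) measurable
  then show ?thesis by (simp add: less_top)
qed

text \<open>Almost every w has a finite Beurling integral along its line, where the extension of
  \<open>F\<close> must vanish; continuity of \<open>F\<close> then removes the exceptional
  set.\<close>

theorem central_fourier_zero:
  fixes e :: "'m::finite => 'g::euclidean_space" and E E' :: "'n::finite => 'g" and l :: "real^'m"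
  assumes f: "schwartz f" and centre: "orthonormal_basis_of e Z" and hor: "orthonormal_basis_of (case_sum E E') (Z\<^sup>\<bottom>)"
    and l: "l ~= 0" and tr: "!!p. trace_class (op_comp (rep_complex l p) (group_fourier e E E' f l))"
    and Beurling: "(\<integral>\<^sup>+q. ennreal (cmod (central_fourier e E E' f l q)) *
             (SUP q'\<in>{q'. norm q' <= norm q}. trace_norm (op_comp (rep_complex l (cvec 0 q')) (group_fourier e E E' f l)))
        \<partial>lborel) < \<infinity>"
  shows "central_fourier e E E' f l p = 0"
proof -
  define N where "N = N_coords e E E'"
  define F where "F = central_fourier e E E' f l"
  have F: "F p = (\<integral>t. f (N (fst p, snd p, t)) * cis (inner l t) \<partial>lborel)" for p
    by (simp add: F_def central_fourier_def case_prod_beta N_def)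
  have fc: "continuous_on UNIV f" by (rule schwartz_continuous[OF f])
  have eo: "inner (e i) (e j) = (if i = j then 1 else 0)" for i j using centre by (simp add: orthonormal_basis_of_def)
  have ho: "inner (case_sum E E' i) (case_sum E E' j) = (if i = j then 1 else 0)" for i j
    using hor unfolding orthonormal_basis_of_def by blast
  have EE: "inner (E i) (E j) = (if i = j then 1 else 0)" "inner (E' i) (E' j) = (if i = j then 1 else 0)" "inner (E i) (E' j) = 0" for i j
    using ho[of "Inl i" "Inl j"] ho[of "Inr i" "Inr j"] ho[of "Inl i" "Inr j"] by simp_all
  have "case_sum E E' i \<in> Z\<^sup>\<bottom>" for i using hor unfolding orthonormal_basis_of_def by (metis rangeI span_base)
  moreover have "e j \<in> Z" for j using centre unfolding orthonormal_basis_of_def by (metis rangeI span_base)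
  ultimately have "inner (case_sum E E' i) (e j) = 0" for i j unfolding orthogonal_comp_def orthogonal_def by (auto simp: inner_commute)
  from this[of "Inl _"] this[of "Inr _"] have Ee: "inner (E i) (e j) = 0" "inner (E' i) (e j) = 0" for i j by simp_all
  have nN: "norm (N q) = norm q" for q
  proof -
    obtain x u t where q: "q = (x, u, t)" by (cases q) auto
    have v: "inner (vec_of E x) (E' j) = 0" for j unfolding vec_of_def inner_sum_left by (simp add: EE)
    have v': "inner (vec_of E x + vec_of E' u) (e j) = 0" for j
      unfolding vec_of_def inner_add_left inner_sum_left by (simp add: Ee)
    have "(norm (N q))\<^sup>2 = (norm (vec_of E x))\<^sup>2 + (norm u)\<^sup>2 + (norm t)\<^sup>2"
      unfolding q N_def N_coords_def hor_vec_def prod.case norm_vec_of_sum[of e, OF eo v'] norm_vec_of_sum[of E', OF EE(2) v] ..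
    moreover have "(norm (vec_of E x))\<^sup>2 = (norm x)\<^sup>2" using norm_vec_of_sum[of E 0 x] EE(1) by simp
    ultimately have "(norm (N q))\<^sup>2 = (norm q)\<^sup>2" unfolding q norm_Pair by simp
    then show ?thesis by (simp add: power2_eq_iff_nonneg)
  qed
  have Nc: "continuous_on S (%x. N (f x))" if "continuous_on S f" for f and S :: "'z::topological_space set"
    unfolding N_def N_coords_def hor_vec_def case_prod_beta by (intro continuous_intros that)
  have fN: "continuous_on S (%x. f (N (h x)))" if "continuous_on S h" for h and S :: "'z::topological_space set"
    by (rule continuous_on_compose2[OF fc Nc[OF that]]) simp
  have dec: "integrable lborel (%q. f (N q))"
  proof -
    obtain K where "!!x. (1 + norm x) ^ (2 * DIM((real^'n) \<times> (real^'n) \<times> (real^'m))) * cmod (f x) <= K" using schwartz_bound[OF f] by blast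
    from this[of "N _"] show ?thesis unfolding nN
      by (intro integrable_decay borel_measurable_continuous_onI fN continuous_intros) auto
  qed
  have [measurable]: "(%q. f (N q)) \<in> borel_measurable borel" by (intro borel_measurable_continuous_onI fN continuous_intros)
  have ic: "integrable lborel (%q. f (N q) * (cis (inner l (snd (snd q))) * X (fst q, fst (snd q))))"
    if X: "!!p. cmod (X p) <= B" "continuous_on UNIV X" for X :: "(real^'n) \<times> (real^'n) => complex" and B
  proof (rule Bochner_Integration.integrable_bound[OF integrable_mult_right[OF dec, of "of_real B"]])
    have B0: "0 <= B" using order.trans[OF norm_ge_zero X(1)] .
    show "AE q in lborel. norm (f (N q) * (cis (inner l (snd (snd q))) * X (fst q, fst (snd q)))) <= norm (of_real B * f (N q))"
      using mult_left_mono[OF X(1) norm_ge_zero] B0 by (intro AE_I2) (simp add: norm_mult mult.commute)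
    have "continuous_on UNIV (%q::(real^'n) \<times> (real^'n) \<times> (real^'m). X (fst q, fst (snd q)))"
      by (intro continuous_on_compose2[OF X(2)] continuous_intros) auto
    then show "(%q. f (N q) * (cis (inner l (snd (snd q))) * X (fst q, fst (snd q)))) \<in> borel_measurable lborel"
      by (simp, intro borel_measurable_continuous_onI continuous_intros fN)
  qed
  have Fi: "integrable lborel F"
    using integral_assoc(1)[OF ic[of "%_. 1" 1]] unfolding F[abs_def] by simp
  obtain Kt where Kt: "!!x. (1 + norm x) ^ (2 * DIM(real^'m)) * cmod (f x) <= Kt" using schwartz_bound[OF f] by blast
  \<comment> \<open>The coordinate map is an isometry, so decay of \<open>f\<close> gives a majorant
    in t that does not depend on the horizontal point; boundedness and continuity of
    \<open>F\<close> follow by domination.\<close>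
  define b where "b t = Kt / (1 + norm t) ^ (2 * DIM(real^'m))" for t :: "real^'m"
  have K0: "0 <= Kt" by (rule order.trans[OF _ Kt[of 0]]) simp
  have pos: "0 < (1 + norm t) ^ (2 * DIM(real^'m))" for t :: "real^'m" by (simp add: add_pos_nonneg)
  have fb: "cmod (f (N (x, u, t))) <= b t" for x u t
  proof -
    have "norm t <= norm (N (x, u, t))" unfolding nN using norm_snd_le[of "(u, t)" x] norm_snd_le[of t u] by (meson order.trans norm_snd_le)
    then have "(1 + norm t) ^ (2 * DIM(real^'m)) * cmod (f (N (x, u, t))) <= Kt"
      by (intro order.trans[OF mult_right_mono[OF power_mono] Kt[of "N (x, u, t)"]]) auto
    then show ?thesis unfolding b_def using pos[of t] by (simp only: pos_le_divide_eq mult.commute)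
  qed
  have "integrable lborel (%t. complex_of_real (b t))"
  proof (rule integrable_decay)
    show "(%t. complex_of_real (b t)) \<in> borel_measurable borel" unfolding b_def by measurable
    show "(1 + norm t) ^ (2 * DIM(real^'m)) * cmod (complex_of_real (b t)) <= Kt" for t
      unfolding b_def norm_of_real using pos[of t] K0 by (simp add: abs_of_nonneg)
  qed
  then have bi: "integrable lborel b" unfolding complex_of_real_integrable_eq .
  have tm [measurable]: "(%t. f (N (x, u, t))) \<in> borel_measurable borel" for x u
    by (intro borel_measurable_continuous_onI fN continuous_intros)
  have FB: "cmod (F p) <= (\<integral>t. b t \<partial>lborel)" for p
  proof -
    have "integrable lborel (%t. f (N (fst p, snd p, t)) * cis (inner l t))"
      by (rule Bochner_Integration.integrable_bound[OF bi]) (use fb order.trans[OF fb abs_ge_self] in \<open>auto simp: norm_mult\<close>)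
    then show ?thesis unfolding F
      by (intro order.trans[OF integral_norm_bound integral_mono] integrable_norm bi) (simp_all add: norm_mult fb)
  qed
  have Fc: "continuous_on UNIV F" unfolding continuous_on_sequentially comp_def
  proof (intro allI impI ballI, elim conjE)
    fix p :: "nat => (real^'n) \<times> (real^'n)" and p0 assume p: "p \<longlonglongrightarrow> p0"
    show "(%k. F (p k)) \<longlonglongrightarrow> F p0" unfolding F
    proof (rule integral_dominated_convergence[OF _ _ bi])
      show "AE t in lborel. (%k. f (N (fst (p k), snd (p k), t)) * cis (inner l t)) \<longlonglongrightarrow> f (N (fst p0, snd p0, t)) * cis (inner l t)"
      proof (intro AE_I2 tendsto_mult tendsto_const)
        fix t
        have "continuous_on UNIV (%p. f (N (fst p, snd p, t)))" by (intro fN continuous_intros)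
        then show "(%k. f (N (fst (p k), snd (p k), t))) \<longlonglongrightarrow> f (N (fst p0, snd p0, t))"
          by (rule continuous_on_tendsto_compose[OF _ p]) auto
      qed
      show "AE t in lborel. norm (f (N (fst (p k), snd (p k), t)) * cis (inner l t)) <= b t" for k
        by (intro AE_I2) (simp add: norm_mult fb)
    qed measurable
  qed
  have [measurable]: "F \<in> borel_measurable borel" using Fc by (rule borel_measurable_continuous_onI)
  have "EX T. ALL x y. cinner (T @@ x) y = (\<integral>p. cinner ((cop (F p) * weyl (norm l) p) @@ x) y \<partial>lborel)"
  proof (rule weak_integral_exists)
    show "integrable lborel (%p. cmod (F p))" using Fi by (rule integrable_norm)
    show "norm (cop (F p) * weyl (norm l) p) <= cmod (F p)" for p
      unfolding norm_cop_mult using norm_weyl_le[of "norm l" p] by (simp add: mult_left_le)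
    show "(%p. cinner ((cop (F p) * weyl (norm l) p) @@ x) y) \<in> borel_measurable lborel" for x y
      by (simp add: cinner_simps)
  qed
  then obtain T where T: "!!x y. cinner (T @@ x) y = (\<integral>p. F p * cinner (weyl (norm l) p @@ x) y \<partial>lborel)"
    by (auto simp: cinner_simps)
  \<comment> \<open>Integrating the central variable first turns the group transform into the Weyl
    transform of \<open>F\<close>.\<close>
  have gT: "group_fourier e E E' f l = graph_of (%x. T @@ x)"
  proof -
    have eq: "(LINT q|lborel. f (N_coords e E E' q) * cinner (rep l q ph) ps) = cinner (T @@ ph) ps" for ph ps :: "(real^'n) L2"
    proof -
      let ?X = "%p. cinner (weyl (norm l) p @@ ph) ps"
      have b: "cmod (?X p) <= norm ph * norm ps" for p using cmod_cinner_le[of "weyl (norm l) p @@ ph" ps] by (simp add: norm_weyl)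
      have "(LINT q|lborel. f (N_coords e E E' q) * cinner (rep l q ph) ps) =
          (\<integral>q. f (N q) * (cis (inner l (snd (snd q))) * ?X (fst q, fst (snd q))) \<partial>lborel)"
        by (simp add: N_def rep_def case_prod_beta cinner_simps weyl_app)
      also have "\<dots> = (\<integral>p. (\<integral>t. (f (N (fst p, snd p, t)) * cis (inner l t)) * ?X p \<partial>lborel) \<partial>lborel)"
        using integral_assoc(2)[OF ic[of ?X, OF b]] by (simp add: continuous_intros continuous_on_weyl mult.assoc)
      also have "\<dots> = cinner (T @@ ph) ps" unfolding T F by simp
      finally show ?thesis .
    qed
    have "(THE th. ALL ps. cinner th ps = cinner (T @@ ph) ps) = T @@ ph" for ph by (rule the_equality) (auto intro: cinner_ext)
    then show ?thesis unfolding group_fourier_def eq by simp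
  qed
  \<comment> \<open>As a function of the radius the supremum is monotone, hence Borel, and its
    values may be infinite.\<close>
  define M where "M \<rho> = (SUP q'\<in>{q' :: (real^'n) \<times> (real^'n). norm q' <= \<rho>}. trace_norm (op_comp (rep_complex l (cvec 0 q')) (graph_of (%x. T @@ x))))" for \<rho>
  have Mm: "mono M" unfolding M_def by (intro monoI SUP_subset_mono) auto
  have [measurable]: "M \<in> borel_measurable borel" by (rule borel_measurable_mono_ennreal[OF Mm])
  define H where "H q = ennreal (cmod (F q)) * M (norm q)" for q
  have "(\<integral>\<^sup>+q. H q \<partial>lborel) < \<infinity>" using Beurling unfolding H_def M_def F_def gT .
  then have ae: "AE w in lborel. (\<integral>\<^sup>+r. indicator {1..} r * (H (r *\<^sub>R w) + H ((- r) *\<^sub>R w)) \<partial>lborel) < \<infinity>"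
  proof (intro dilation_finite)
    have "1 <= CARD('n)" by (simp add: Suc_leI)
    then have "2 <= CARD('n) + CARD('n)" by linarith
    then show "2 <= DIM((real^'n) \<times> (real^'n))" by simp
  qed (simp_all add: H_def[abs_def])
  have "AE w in lborel. w \<in> UNIV --> F w = 0" using ae
  proof eventually_elim
    case (elim w)
    obtain G C where G: "G holomorphic_on UNIV" "!!r. G (of_real r) = F (- (r *\<^sub>R w))" "0 <= C"
      "!!x y. ennreal (cmod (G (Complex x y))) <= ennreal C * trace_norm (op_comp (rep_complex l (cvec 0 (y *\<^sub>R w))) (graph_of (%x. T @@ x)))"
      using fourier_entire_extension[OF l Fi Fc FB T tr[unfolded gT]] by blast
    \<comment> \<open>The extension takes the value F (- r w) at r, so F w is its value at
      -1.\<close>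
    have "G (of_real (- 1)) = 0"
    proof (rule beurling_entire_ennreal[OF G(1), where N = "%t. ennreal C * M (t * norm w)"])
      show "mono (%t. ennreal C * M (t * norm w))"
        by (intro monoI mult_left_mono monoD[OF Mm] mult_right_mono) auto
      fix x y
      have le: "trace_norm (op_comp (rep_complex l (cvec 0 (y *\<^sub>R w))) (graph_of (%x. T @@ x))) <= M (\<bar>y\<bar> * norm w)"
        unfolding M_def by (rule SUP_upper) simp
      show "ennreal (cmod (G (Complex x y))) <= ennreal C * M (\<bar>y\<bar> * norm w)"
        by (rule order.trans[OF G(4) mult_left_mono[OF le]]) simp
    next
      have "(\<integral>\<^sup>+x. indicator {1..} x * ((ennreal (cmod (G (of_real x))) + ennreal (cmod (G (of_real (- x))))) * (ennreal C * M (x * norm w))) \<partial>lborel)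
        = (\<integral>\<^sup>+r. ennreal C * (indicator {1..} r * (H (r *\<^sub>R w) + H ((- r) *\<^sub>R w))) \<partial>lborel)"
        unfolding G(2) H_def by (intro nn_integral_cong) (auto simp: indicator_def algebra_simps)
      also have "\<dots> = ennreal C * (\<integral>\<^sup>+r. indicator {1..} r * (H (r *\<^sub>R w) + H ((- r) *\<^sub>R w)) \<partial>lborel)"
        unfolding H_def by (rule nn_integral_cmult) measurable
      also have "\<dots> < \<infinity>" using elim by (simp add: ennreal_mult_less_top)
      finally show "(\<integral>\<^sup>+x. indicator {1..} x * ((ennreal (cmod (G (of_real x))) + ennreal (cmod (G (of_real (- x))))) * (ennreal C * M (x * norm w))) \<partial>lborel) < \<infinity>" .
    qed
    then show ?case using G(2)[of "- 1"] by simp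
  qed
  then show ?thesis using AE_zero_continuous[OF open_UNIV Fc] unfolding F_def by blast
qed

theorem theorem1p4:
  fixes brk :: "'g::euclidean_space \<Rightarrow> 'g \<Rightarrow> 'g"
    and e :: "'m::finite \<Rightarrow> 'g"
    and E E' :: "real^'m \<Rightarrow> 'n::finite \<Rightarrow> 'g"
    and \<mu> :: "('g \<Rightarrow>\<^sub>L 'g) measure"
    and f :: "'g \<Rightarrow> complex"
  assumes h_type: "h_type_algebra brk"
    and centre: "orthonormal_basis_of e (lie_centre brk)"
    and m: "CARD('m) \<in> {2, 3}"
    and n: "dim (horizontal brk) = 2 * CARD('n)"
    and adapted: "\<forall>l. l \<noteq> 0 \<longrightarrow> adapted_basis brk e l (E l) (E' l)"
    and haar: "haar_measure (U_group brk) \<mu>"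
    and f: "schwartz f"
    and range: "\<forall>l p. l \<noteq> 0 \<longrightarrow>
      Range (group_fourier e (E l) (E' l) f l) \<subseteq> Domain (rep_complex l p)"
    and trace: "\<forall>l p. l \<noteq> 0 \<longrightarrow>
      trace_class (op_comp (rep_complex l p) (group_fourier e (E l) (E' l) f l))"
    and HS: "\<forall>l p. l \<noteq> 0 \<longrightarrow>
      (\<integral>\<^sup>+\<sigma>. hs_norm_sq (op_comp (rep_complex l (act (E l) (E' l) \<sigma> p))
                            (group_fourier e (E l) (E' l) f l)) \<partial>\<mu>) < \<infinity>"
    and Beurling: "AE l in lborel. l \<noteq> 0 \<longrightarrow>
      (\<integral>\<^sup>+q. ennreal (cmod (central_fourier e (E l) (E' l) f l q)) *
             (SUP q'\<in>{q'. norm q' \<le> norm q}.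
                trace_norm (op_comp (rep_complex l (cvec 0 q')) (group_fourier e (E l) (E' l) f l)))
        \<partial>lborel) < \<infinity>"
  shows "f = (\<lambda>_. 0)"
proof
  fix X :: 'g
  let ?Z = "lie_centre brk"
  have eo: "inner (e i) (e j) = (if i = j then 1 else 0)" for i j using centre by (simp add: orthonormal_basis_of_def)
  have Ze: "?Z = range (vec_of e)" unfolding range_vec_of using centre by (simp add: orthonormal_basis_of_def)
  \<comment> \<open>The central coordinates of \<open>X\<close>. The horizontal part
    \<open>v\<close> that remains is a fixed vector of the algebra, whereas the adapted coordinates
    change with the frequency.\<close>
  define t0 :: "real^'m" where "t0 = (\<chi> i. inner X (e i))"
  define v where "v = X - vec_of e t0"
  have ve: "inner v (e i) = 0" for i
    unfolding v_def inner_diff_left vec_of_def inner_sum_left by (simp add: t0_def eo if_distrib[of "(*) _"] cong: if_cong)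
  have "inner v (vec_of e t) = 0" for t unfolding vec_of_def inner_sum_right by (simp add: ve)
  then have vh: "v \<in> horizontal brk" unfolding Ze orthogonal_comp_def orthogonal_def by (auto simp: inner_commute)
  \<comment> \<open>The restriction of \<open>f\<close> to the central fibre through
    \<open>v\<close>. Its Fourier transform at l is the central transform at the adapted coordinates
    of \<open>v\<close>, so the results for separate frequencies combine on one function.\<close>
  define h where "h t = f (v + vec_of e t)" for t
  have nt: "norm t <= norm (v + vec_of e t)" for t
    by (rule power2_le_imp_le) (simp_all add: norm_vec_of_sum[OF eo ve])
  have hc: "continuous_on UNIV h"
    unfolding h_def by (intro continuous_on_compose2[OF schwartz_continuous[OF f]] continuous_intros) auto
  have hK: "EX K. ALL t. (1 + norm t) ^ k * cmod (h t) <= K" for k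
  proof -
    obtain K where K: "!!x. (1 + norm x) ^ k * cmod (f x) <= K" using schwartz_bound[OF f] by blast
    have "(1 + norm t) ^ k * cmod (h t) <= K" for t
      unfolding h_def by (rule order.trans[OF mult_right_mono[OF power_mono] K]) (use nt in auto)
    then show ?thesis by blast
  qed
  obtain K where K: "!!t. (1 + norm t) ^ (2 * DIM(real^'m)) * cmod (h t) <= K" using hK by blast
  obtain K' where K': "!!t. (1 + norm t) ^ 0 * cmod (h t) <= K'" using hK by blast
  have hi: "integrable lborel h" by (rule integrable_decay[OF borel_measurable_continuous_onI[OF hc] K])
  have "AE l in lborel. l ~= (0 :: real^'m)" using AE_lborel_singleton[of 0] by simp
  then have "AE l in lborel. (\<integral>t. h t * cis (l \<bullet> t) \<partial>lborel) = 0" using Beurling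
  proof eventually_elim
    case (elim l)
    then have l: "l ~= 0" by simp
    have hor: "orthonormal_basis_of (case_sum (E l) (E' l)) (horizontal brk)" using adapted l unfolding adapted_basis_def by blast
    obtain p where p: "v = hor_vec (E l) (E' l) p" using hor_vec_surj[OF hor vh] by blast
    have "central_fourier e (E l) (E' l) f l p = 0"
      by (rule central_fourier_zero[OF f centre hor l]) (use trace l elim in auto)
    then show ?case by (simp add: central_fourier_def case_prod_beta N_coords_def h_def p)
  qed
  then have "h t0 = 0" using K' by (intro fourier_uniqueness[OF hi _ hc]) auto
  then show "f X = 0" by (simp add: h_def v_def)
qed
end
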